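(* Let $N>1$ be such that $X_0(N)$ has genus zero, with Hauptmodul $x_N$ and function $h_N$ as in the context. Suppose $f_{N^2}$ is an element of the function field of $X_0(N^2)$ whose divisor is $$\operatorname{div}(f_{N^2})=\psi(N)\cdot\sum_{d\mid N}\ \sum_{a}\Bigl[\bigl([\tfrac ad]_{N^2}\bigr)-\bigl([\tfrac11]_{N^2}\bigr)\Bigr],$$ where the inner sum runs over the $\varphi(\gcd(d,N^2/d))$ cusps of $X_0(N^2)$ of the form $[\frac ad]_{N^2}$ (this divisor equals $\psi(N)\cdot[(\phi_N')^*([\frac11]_N/N)-\phi_N^*([\frac11]_N)]$). Then, in a neighborhood of the cusp $[\frac1{N^2}]_{N^2}$ (i.e.\ of $\tau=i\infty$), $$h_N\bigl(x_N(\tau)\bigr)\ \sim\ \Bigl[f_{N^2}(\tau)\big/f_{N^2}\bigl([\tfrac1{N^2}]_{N^2}\bigr)\Bigr]^{-1/12}\,h_N\bigl(x_N(N\tau)\bigr).$$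
   Context: $\Gamma_0(M)$ is the Hecke congruence subgroup of the modular group, $X_0(M)=\Gamma_0(M)\backslash\mathfrak{H}^*$; cusps of $X_0(M)$ are $\Gamma_0(M)$-classes $[\frac ad]_M$ of points of $\mathbb{P}^1(\mathbb{Q})$, each with a representative $a/d$, $d\mid M$, $\gcd(a,d)=1$, $d$ being an invariant of the class; $[\frac11]_M\ni0$, $[\frac1M]_M\ni i\infty$. $\psi(N)=N\prod_{p\mid N}(1+1/p)$. $\phi_N:X_0(N^2)\to X_0(N)$ is the covering from $\Gamma_0(N^2)<\Gamma_0(N)$, and $\phi_N':X_0(N^2)\to X_0(N)'$ the covering from $\Gamma_0(N^2)<\Gamma_0(N)'$, where $\Gamma_0(N)'$ is the conjugate of $\Gamma_0(N)$ by $\tau\mapsto N\tau$; on functions, $x_N\circ\phi_N$ is $\tau\mapsto x_N(\tau)$ and $x_N\circ\phi_N'$ is $\tau\mapsto x_N(N\tau)$. When $X_0(N)$ has genus zero, $x_N$ is a Hauptmodul with a simple zero at $\tau=i\infty$ and a simple pole at $\tau=0$, normalized so that $j=P_N(x_N)/Q_N(x_N)$ ($j$ the Klein invariant) with $P_N,Q_N$ coprime monic, $\deg P_N=\psi(N)$, $x_N\mid Q_N$; and $h_N(x_N)=[P_N(x_N)/P_N(0)]^{-1/12}{}_2F_1(\tfrac1{12},\tfrac5{12};1;1728Q_N(x_N)/P_N(x_N))$ near $x_N=0$. For functions $\mathfrak{h}^{(1)},\mathfrak{h}^{(2)}$ analytic near the cusp $[\frac1{N^2}]_{N^2}$ of $X_0(N^2)$,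 $\mathfrak{h}^{(1)}\sim\mathfrak{h}^{(2)}$ means: they are the unique analytic solutions normalized to $1$ at that cusp of $L_1\mathfrak{h}=0$, $L_2\mathfrak{h}=0$ respectively, where $L_1,L_2$ are second-order Fuchsian differential operators on $X_0(N^2)$ (with coefficients in its function field) such that (i) for each $L_i$, every ratio of independent local solutions is of the form $(a\tau+b)/(c\tau+d)$ with $ad\ne bc$, its singular points are exactly the fixed points of $\Gamma_0(N^2)$ (cusps and elliptic points), and its exponent difference is $1/k$ at each elliptic fixed point of order $k$ and $0$ at each cusp; and (ii) $L_1$ and $L_2$ have the same exponents at every point. *)

theory Defs
  imports "HOL-Complex_Analysis.Complex_Analysis"
begin

section \<open>The group \<open>\<Gamma>\<^sub>0(M)\<close> and the curve \<open>X\<^sub>0(M)\<close>\<close>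

text \<open>The quadruple \<open>(a, b, c, d)\<close> stands for the matrix with rows \<open>(a, b)\<close> and \<open>(c, d)\<close>.\<close>

type_synonym mat2 = "int \<times> int \<times> int \<times> int"

definition Gamma0 :: "nat \<Rightarrow> mat2 set" where
  "Gamma0 M = {(a, b, c, d). a * d - b * c = 1 \<and> int M dvd c}"

definition upper_half :: "complex set" where
  "upper_half = {\<tau>. Im \<tau> > 0}"

fun moebius_act :: "mat2 \<Rightarrow> complex \<Rightarrow> complex" where
  "moebius_act (a, b, c, d) \<tau> = (of_int a * \<tau> + of_int b) / (of_int c * \<tau> + of_int d)"

text \<open>
  Points of the extended upper half-plane. \<open>Cusp a c\<close>, with \<open>a\<close>, \<open>c\<close> coprime, is the point
  \<open>a/c\<close> of the rational projective line; \<open>Cusp 1 0\<close> is \<open>i\<infinity>\<close>. A rational point is thus given by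
  either of the two primitive vectors \<open>(a, c)\<close>, \<open>(-a, -c)\<close>; since \<open>-I\<close> lies in \<open>\<Gamma>\<^sub>0(M)\<close>, the
  two are always in the same \<open>\<Gamma>\<^sub>0(M)\<close>-orbit, so the orbits below are exactly the points of \<open>X\<^sub>0(M)\<close>.
\<close>

datatype hpoint = Inner complex | Cusp int int

definition ext_upper_half :: "hpoint set" where
  "ext_upper_half = Inner ` upper_half \<union> {Cusp a c |a c. coprime a c}"

fun act :: "mat2 \<Rightarrow> hpoint \<Rightarrow> hpoint" where
  "act \<gamma> (Inner \<tau>) = Inner (moebius_act \<gamma> \<tau>)"
| "act (a, b, c, d) (Cusp p q) = Cusp (a * p + b * q) (c * p + d * q)"

definition X0_class :: "nat \<Rightarrow> hpoint \<Rightarrow> hpoint set" where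
  "X0_class M p = {act \<gamma> p |\<gamma>. \<gamma> \<in> Gamma0 M}"

definition cusps_with_denom :: "nat \<Rightarrow> nat \<Rightarrow> hpoint set set" where
  "cusps_with_denom M d = {X0_class M (Cusp a (int d)) |a. coprime a (int d)}"

text \<open>The order of the stabilizer of \<open>\<tau>\<close> in \<open>\<Gamma>\<^sub>0(M)/{\<plusminus>I}\<close>.\<close>

definition stab_order :: "nat \<Rightarrow> complex \<Rightarrow> nat" where
  "stab_order M \<tau> = card {\<gamma> \<in> Gamma0 M. moebius_act \<gamma> \<tau> = \<tau>} div 2"

fun fixed_point :: "nat \<Rightarrow> hpoint \<Rightarrow> bool" where
  "fixed_point M (Inner \<tau>) \<longleftrightarrow> stab_order M \<tau> > 1"
| "fixed_point M (Cusp a c) \<longleftrightarrow> True"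

text \<open>
  The matrix below is \<open>\<sigma> T\<^sup>w \<sigma>\<^sup>-\<^sup>1\<close>, where \<open>\<sigma>\<close> in \<open>SL\<^sub>2(\<int>)\<close> has first column \<open>(a, c)\<close>
  and \<open>T\<close> is the translation by \<open>1\<close>.
\<close>

definition cusp_width :: "nat \<Rightarrow> int \<Rightarrow> int \<Rightarrow> nat" where
  "cusp_width M a c = (LEAST w. w > 0 \<and>
     (1 - a * c * int w, a\<^sup>2 * int w, - (c\<^sup>2 * int w), 1 + a * c * int w) \<in> Gamma0 M)"

text \<open>
  A local parameter of \<open>X\<^sub>0(M)\<close>, written as a function of \<open>\<tau>\<close>. At a cusp it is
  \<open>exp (2\<pi>i \<sigma>\<^sup>-\<^sup>1\<tau> / w)\<close> with \<open>\<sigma>\<close>, \<open>w\<close> as above; another choice of \<open>(b, d)\<close> multiplies it by a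
  root of unity, and for \<open>Cusp 1 0\<close> it is \<open>exp (2\<pi>i\<tau>)\<close>.
\<close>

fun local_param :: "nat \<Rightarrow> hpoint \<Rightarrow> complex \<Rightarrow> complex" where
  "local_param M (Inner \<tau>\<^sub>0) \<tau> = ((\<tau> - \<tau>\<^sub>0) / (\<tau> - cnj \<tau>\<^sub>0)) ^ stab_order M \<tau>\<^sub>0"
| "local_param M (Cusp a c) \<tau> =
     (let (b, d) = (SOME (b, d). a * d - b * c = 1)
      in exp (2 * pi * \<i> * moebius_act (d, - b, - c, a) \<tau> / of_nat (cusp_width M a c)))"


section \<open>Functions, divisors and differentials on \<open>X\<^sub>0(M)\<close>\<close>

definition expands_at :: "nat \<Rightarrow> (complex \<Rightarrow> complex) \<Rightarrow> hpoint \<Rightarrow> (complex \<Rightarrow> complex) \<Rightarrow> bool" where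
  "expands_at M f p F \<longleftrightarrow>
     (\<exists>r>0. \<forall>\<tau>\<in>upper_half. 0 < norm (local_param M p \<tau>) \<and> norm (local_param M p \<tau>) < r \<longrightarrow>
        f \<tau> = F (local_param M p \<tau>))"

definition function_field :: "nat \<Rightarrow> (complex \<Rightarrow> complex) set" where
  "function_field M = {f. f nicely_meromorphic_on upper_half \<and>
     (\<forall>\<gamma>\<in>Gamma0 M. \<forall>\<tau>\<in>upper_half. f (moebius_act \<gamma> \<tau>) = f \<tau>) \<and>
     (\<forall>a c. coprime a c \<longrightarrow> (\<exists>F. F meromorphic_on {0} \<and> expands_at M f (Cusp a c) F))}"

text \<open>
  An element of the function field as a function of the local parameter at \<open>p\<close>. It is uniquely
  determined on some punctured neighbourhood of \<open>0\<close>, and only its behaviour there is used.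
\<close>

definition expansion :: "nat \<Rightarrow> hpoint \<Rightarrow> (complex \<Rightarrow> complex) \<Rightarrow> complex \<Rightarrow> complex" where
  "expansion M p f = (SOME F. F meromorphic_on {0} \<and> expands_at M f p F)"

definition ord_at :: "nat \<Rightarrow> (complex \<Rightarrow> complex) \<Rightarrow> hpoint \<Rightarrow> int" where
  "ord_at M f p = zorder (expansion M p f) 0"

definition value_at :: "nat \<Rightarrow> (complex \<Rightarrow> complex) \<Rightarrow> hpoint \<Rightarrow> complex" where
  "value_at M f p = Lim (at 0) (expansion M p f)"

definition has_divisor :: "nat \<Rightarrow> (complex \<Rightarrow> complex) \<Rightarrow> (hpoint set \<Rightarrow> int) \<Rightarrow> bool" where
  "has_divisor M f D \<longleftrightarrow>
     (\<exists>\<tau>\<in>upper_half. f \<tau> \<noteq> 0) \<and> (\<forall>p\<in>ext_upper_half. ord_at M f p = D (X0_class M p))"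

definition point_divisor :: "hpoint set \<Rightarrow> hpoint set \<Rightarrow> int" where
  "point_divisor C P = (if P = C then 1 else 0)"

text \<open>The holomorphic differentials \<open>\<omega>(\<tau>) d\<tau>\<close> on \<open>X\<^sub>0(M)\<close>.\<close>

definition holomorphic_differentials :: "nat \<Rightarrow> (complex \<Rightarrow> complex) set" where
  "holomorphic_differentials M = {\<omega>. \<omega> holomorphic_on upper_half \<and>
     (\<forall>(a, b, c, d)\<in>Gamma0 M. \<forall>\<tau>\<in>upper_half.
        \<omega> (moebius_act (a, b, c, d) \<tau>) = (of_int c * \<tau> + of_int d)\<^sup>2 * \<omega> \<tau>) \<and>
     (\<forall>p\<in>ext_upper_half. \<exists>G. G analytic_on {0} \<and>
        expands_at M (\<lambda>\<tau>. \<omega> \<tau> / deriv (local_param M p) \<tau>) p G)}"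

text \<open>The dimension of the space of holomorphic differentials.\<close>

definition genus_X0 :: "nat \<Rightarrow> enat" where
  "genus_X0 M = (SUP n \<in> {n. \<exists>\<omega> :: nat \<Rightarrow> complex \<Rightarrow> complex.
     (\<forall>i<n. \<omega> i \<in> holomorphic_differentials M) \<and>
     (\<forall>k :: nat \<Rightarrow> complex. (\<forall>\<tau>\<in>upper_half. (\<Sum>i<n. k i * \<omega> i \<tau>) = 0) \<longrightarrow> (\<forall>i<n. k i = 0))}. enat n)"

text \<open>A Hauptmodul generates the function field over \<open>\<complex>\<close>.\<close>

definition is_hauptmodul :: "nat \<Rightarrow> (complex \<Rightarrow> complex) \<Rightarrow> bool" where
  "is_hauptmodul M x \<longleftrightarrow> x \<in> function_field M \<and>
     (\<forall>f\<in>function_field M. \<exists>p q :: complex poly. q \<noteq> 0 \<and>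
        (\<forall>\<tau>\<in>upper_half. \<not> is_pole f \<tau> \<and> \<not> is_pole x \<tau> \<longrightarrow> f \<tau> * poly q (x \<tau>) = poly p (x \<tau>)))"


section \<open>The Klein invariant, \<open>\<psi>\<close> and \<open>h\<^sub>N\<close>\<close>

definition eisenstein_G :: "nat \<Rightarrow> complex \<Rightarrow> complex" where
  "eisenstein_G k \<tau> =
     (\<Sum>\<^sub>\<infinity>(m, n) \<in> UNIV - {(0, 0)}. 1 / (of_int m + of_int n * \<tau>) ^ k)"

definition klein_j :: "complex \<Rightarrow> complex" where
  "klein_j \<tau> = (let g2 = 60 * eisenstein_G 4 \<tau>; g3 = 140 * eisenstein_G 6 \<tau>
                in 1728 * g2 ^ 3 / (g2 ^ 3 - 27 * g3 ^ 2))"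

definition dedekind_psi :: "nat \<Rightarrow> nat" where
  "dedekind_psi N = N div (\<Prod>p\<in>prime_factors N. p) * (\<Prod>p\<in>prime_factors N. p + 1)"

lemma dedekind_psi_eq:
  assumes "N > 0"
  shows "real (dedekind_psi N) = real N * (\<Prod>p\<in>prime_factors N. 1 + 1 / real p)"
proof -
  have "(\<Prod>p\<in>prime_factors N. p) dvd (\<Prod>p\<in>prime_factors N. p ^ multiplicity p N)"
    by (intro prod_dvd_prod dvd_power) (auto simp: prime_factors_multiplicity)
  also have "\<dots> = N"
    using prime_factorization_nat[OF assms] by simp
  finally have dvd: "(\<Prod>p\<in>prime_factors N. p) dvd N" .
  have "(\<Prod>p\<in>prime_factors N. 1 + 1 / real p) = (\<Prod>p\<in>prime_factors N. (real p + 1) / real p)"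
    by (intro prod.cong refl) (auto simp: field_simps dest: in_prime_factors_imp_prime prime_gt_0_nat)
  then show ?thesis
    using dvd by (simp add: dedekind_psi_def real_of_nat_div prod_dividef add.commute)
qed

definition hyp2F1 :: "complex \<Rightarrow> complex \<Rightarrow> complex \<Rightarrow> complex \<Rightarrow> complex" where
  "hyp2F1 a b c z = eval_fps (fps_hypergeo [a, b] [c] 1) z"

text \<open>Meaningful near \<open>x = 0\<close>, where the principal branch of the root is the one close to \<open>1\<close>.\<close>

definition h_fun :: "complex poly \<Rightarrow> complex poly \<Rightarrow> complex \<Rightarrow> complex" where
  "h_fun P Q x = (poly P x / poly P 0) powr (- 1 / 12) *
     hyp2F1 (1 / 12) (5 / 12) 1 (1728 * poly Q x / poly P x)"


section \<open>Second-order differential operators on \<open>X\<^sub>0(M)\<close>\<close>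

text \<open>
  \<open>DiffOp x A B\<close> is the operator \<open>D\<^sub>x\<^sup>2 + A D\<^sub>x + B\<close> with \<open>D\<^sub>x = d/dx\<close>. If \<open>x\<close>, \<open>A\<close>, \<open>B\<close> are
  functions of a coordinate \<open>z\<close>, it is, up to the factor \<open>(dx/dz)\<^sup>2\<close>, equal to
  \<open>D\<^sub>z\<^sup>2 + (A x' - x''/x') D\<^sub>z + B x'\<^sup>2\<close>.
\<close>

datatype diff_op = DiffOp (dvar: "complex \<Rightarrow> complex")
  (dcoeff1: "complex \<Rightarrow> complex") (dcoeff0: "complex \<Rightarrow> complex")

definition zcoeff1 :: "diff_op \<Rightarrow> complex \<Rightarrow> complex" where
  "zcoeff1 L z = dcoeff1 L z * deriv (dvar L) z - deriv (deriv (dvar L)) z / deriv (dvar L) z"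

definition zcoeff0 :: "diff_op \<Rightarrow> complex \<Rightarrow> complex" where
  "zcoeff0 L z = dcoeff0 L z * (deriv (dvar L) z)\<^sup>2"

definition solves_at :: "diff_op \<Rightarrow> (complex \<Rightarrow> complex) \<Rightarrow> complex \<Rightarrow> bool" where
  "solves_at L u z \<longleftrightarrow> deriv (deriv u) z + zcoeff1 L z * deriv u z + zcoeff0 L z * u z = 0"

definition diff_op_on :: "nat \<Rightarrow> diff_op \<Rightarrow> bool" where
  "diff_op_on M L \<longleftrightarrow> dvar L \<in> function_field M \<and> \<not> dvar L constant_on upper_half \<and>
     dcoeff1 L \<in> function_field M \<and> dcoeff0 L \<in> function_field M"

text \<open>The operator in terms of the local parameter at \<open>p\<close>.\<close>

definition localize :: "nat \<Rightarrow> hpoint \<Rightarrow> diff_op \<Rightarrow> diff_op" where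
  "localize M p L =
     DiffOp (expansion M p (dvar L)) (expansion M p (dcoeff1 L)) (expansion M p (dcoeff0 L))"

text \<open>All the local coefficients are meromorphic at \<open>0\<close>, so having no pole means being analytic.\<close>

definition singular_point :: "nat \<Rightarrow> diff_op \<Rightarrow> hpoint \<Rightarrow> bool" where
  "singular_point M L p \<longleftrightarrow>
     is_pole (zcoeff1 (localize M p L)) 0 \<or> is_pole (zcoeff0 (localize M p L)) 0"

definition fuchsian :: "nat \<Rightarrow> diff_op \<Rightarrow> bool" where
  "fuchsian M L \<longleftrightarrow> (\<forall>p\<in>ext_upper_half.
     \<not> is_pole (\<lambda>z. z * zcoeff1 (localize M p L) z) 0 \<and>
     \<not> is_pole (\<lambda>z. z\<^sup>2 * zcoeff0 (localize M p L) z) 0)"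

definition indicial_poly :: "nat \<Rightarrow> diff_op \<Rightarrow> hpoint \<Rightarrow> complex poly" where
  "indicial_poly M L p =
     [:0, 1:] * [:- 1, 1:]
     + smult (Lim (at 0) (\<lambda>z. z * zcoeff1 (localize M p L) z)) [:0, 1:]
     + [:Lim (at 0) (\<lambda>z. z\<^sup>2 * zcoeff0 (localize M p L) z):]"

definition exponents :: "nat \<Rightarrow> diff_op \<Rightarrow> hpoint \<Rightarrow> complex multiset" where
  "exponents M L p = proots (indicial_poly M L p)"

definition exponent_difference :: "nat \<Rightarrow> diff_op \<Rightarrow> hpoint \<Rightarrow> complex \<Rightarrow> bool" where
  "exponent_difference M L p \<delta> \<longleftrightarrow> (\<exists>\<rho>. exponents M L p = {#\<rho>, \<rho> + \<delta>#})"

definition solution_on :: "diff_op \<Rightarrow> complex set \<Rightarrow> (complex \<Rightarrow> complex) \<Rightarrow> bool" where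
  "solution_on L U u \<longleftrightarrow> u holomorphic_on U \<and> (\<forall>\<tau>\<in>U. solves_at L u \<tau>)"

definition independent_on ::
  "complex set \<Rightarrow> (complex \<Rightarrow> complex) \<Rightarrow> (complex \<Rightarrow> complex) \<Rightarrow> bool" where
  "independent_on U u v \<longleftrightarrow>
     (\<forall>\<alpha> \<beta>. (\<forall>\<tau>\<in>U. \<alpha> * u \<tau> + \<beta> * v \<tau> = 0) \<longrightarrow> \<alpha> = 0 \<and> \<beta> = 0)"

text \<open>
  Local solutions as functions of \<open>\<tau>\<close>. The regions \<open>U\<close> only avoid a discrete set of points, and the
  ratios persist under analytic continuation.
\<close>

definition moebius_ratios :: "diff_op \<Rightarrow> bool" where
  "moebius_ratios L \<longleftrightarrow> (\<forall>U u v.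
     open U \<and> connected U \<and> U \<noteq> {} \<and> U \<subseteq> upper_half \<and>
     dvar L analytic_on U \<and> dcoeff1 L analytic_on U \<and> dcoeff0 L analytic_on U \<and>
     (\<forall>\<tau>\<in>U. deriv (dvar L) \<tau> \<noteq> 0) \<and>
     solution_on L U u \<and> solution_on L U v \<and> independent_on U u v \<longrightarrow>
     (\<exists>a b c d :: complex. a * d \<noteq> b * c \<and>
        (\<forall>\<tau>\<in>U. v \<tau> \<noteq> 0 \<longrightarrow> u \<tau> / v \<tau> = (a * \<tau> + b) / (c * \<tau> + d))))"

definition uniformizing :: "nat \<Rightarrow> diff_op \<Rightarrow> bool" where
  "uniformizing M L \<longleftrightarrow> diff_op_on M L \<and> fuchsian M L \<and> moebius_ratios L \<and>
     (\<forall>p\<in>ext_upper_half. singular_point M L p \<longleftrightarrow> fixed_point M p) \<and>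
     (\<forall>\<tau>\<in>upper_half. stab_order M \<tau> > 1 \<longrightarrow>
        exponent_difference M L (Inner \<tau>) (1 / of_nat (stab_order M \<tau>))) \<and>
     (\<forall>a c. coprime a c \<longrightarrow> exponent_difference M L (Cusp a c) 0)"

text \<open>Analytic solutions near \<open>i\<infinity>\<close> with value \<open>1\<close> there, in terms of the local parameter.\<close>

definition normalized_solution :: "nat \<Rightarrow> diff_op \<Rightarrow> (complex \<Rightarrow> complex) \<Rightarrow> bool" where
  "normalized_solution M L u \<longleftrightarrow> u analytic_on {0} \<and> u 0 = 1 \<and>
     (\<forall>\<^sub>F z in at 0. solves_at (localize M (Cusp 1 0) L) u z)"

definition unique_normalized_solution :: "nat \<Rightarrow> diff_op \<Rightarrow> (complex \<Rightarrow> complex) \<Rightarrow> bool" where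
  "unique_normalized_solution M L h \<longleftrightarrow> (\<exists>u. expands_at M h (Cusp 1 0) u \<and>
     normalized_solution M L u \<and>
     (\<forall>v. normalized_solution M L v \<longrightarrow> (\<forall>\<^sub>F z in nhds 0. v z = u z)))"

definition cusp_equiv ::
  "nat \<Rightarrow> (complex \<Rightarrow> complex) \<Rightarrow> (complex \<Rightarrow> complex) \<Rightarrow> bool" where
  "cusp_equiv M h1 h2 \<longleftrightarrow> (\<exists>L1 L2. uniformizing M L1 \<and> uniformizing M L2 \<and>
     unique_normalized_solution M L1 h1 \<and> unique_normalized_solution M L2 h2 \<and>
     (\<forall>p\<in>ext_upper_half. exponents M L1 p = exponents M L2 p))"

end

theory Submission
  imports Defs "HOL-Number_Theory.Totient"
begin

text \<open>
  Put \<open>K\<^sub>1(\<tau>) = \<Delta>(\<tau>) / Q\<^sub>N(x\<^sub>N(\<tau>))\<close> and \<open>K\<^sub>2(\<tau>) = K\<^sub>1(N\<tau>) / f(\<tau>)\<close>. Both are forms of weight 12 on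
  \<open>\<Gamma>\<^sub>0(N\<^sup>2)\<close> without zeros in the upper half-plane. By the classical identity
  \<open>\<^sub>2F\<^sub>1(1/12, 5/12; 1; 1728/j)\<^sup>4 = E\<^sub>4\<close>, the two functions of the theorem are, near \<open>i\<infinity>\<close> and up to
  constants, the twelfth roots \<open>h\<close> of \<open>K\<^sub>1\<close> and \<open>K\<^sub>2\<close>. The operator with solution space spanned by
  \<open>h\<close> and \<open>\<tau>h\<close> has coefficients in the function field, because they only involve the logarithmic
  derivative of \<open>K\<close>, and \<open>h\<close> transforms with weight one up to a root of unity. Its exponents are
  \<open>0, 1/k\<close> at a point of the upper half-plane with stabilizer of order \<open>k\<close>, and the order of \<open>K\<close>
  divided by 12, taken twice, at a cusp. It remains to compare orders at the cusps: \<open>K\<^sub>1\<close> has order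
  \<open>N \<psi>(N)\<close> at \<open>[1/1]\<close> and 0 at all other cusps of \<open>X\<^sub>0(N\<^sup>2)\<close>, and the divisor of \<open>f\<close> is exactly what
  makes the orders of \<open>K\<^sub>2\<close> the same.
\<close>

section \<open>Eisenstein series and their Fourier expansions\<close>

text \<open>Working with \<open>K\<close> instead of its twelfth root avoids branches and multiplier
  systems. The choice of \<open>K1\<close> is forced: \<open>h^12 = P(0) / P(x) * E4^3\<close> and
  \<open>E4^3 = j * Delta\<close>, so \<open>P(x)\<close> cancels and
  \<open>P(0) * Delta / Q(x)\<close> remains. Both operators use the variable \<open>j\<close>,
  whose invariance under the whole modular group allows every cusp to be moved to infinity. The
  orders come from \<open>j = P(x) / Q(x)\<close>: where \<open>x\<close> is finite at a cusp,
  \<open>Q(x)\<close> has order equal to the pole order of \<open>j\<close>, which is also the order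
  of \<open>Delta\<close>, and the two cancel; at the class of 0 the width \<open>N\<close> and the
  simple pole of \<open>x\<close> give \<open>deg P - deg Q = N\<close>, hence order
  \<open>deg P = psi(N)\<close> for \<open>K1\<close> in level \<open>N\<close>, and
  \<open>N\<close> times that in level \<open>N^2\<close>. \<open>K1(N * tau)\<close> has order
  \<open>psi(N)\<close> exactly at the cusps whose denominator divides \<open>N\<close>;
  \<open>f\<close> cancels these, and its multiplicity at [1/1] fits because the totients of the
  divisors of \<open>N\<close> add up to \<open>N\<close>. Two analytic inputs rest on Ramanujan's
  equations: \<open>Delta\<close> has no zeros, and the fourth power of the hypergeometric series is
  \<open>E4\<close>.\<close>

definition to_q :: "complex \<Rightarrow> complex" where
  "to_q \<tau> = exp (2 * pi * \<i> * \<tau>)"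

text \<open>
  Up to the factor \<open>(-1)\<^sup>n\<^sup>+\<^sup>1 n!\<close>, this is the sum of \<open>1 / (z + m)\<^sup>n\<^sup>+\<^sup>1\<close> over all integers \<open>m\<close>.
\<close>

definition bilat :: "nat \<Rightarrow> complex \<Rightarrow> complex" where
  "bilat n z = Polygamma n z - (-1) ^ n * Polygamma n (1 - z)"

text \<open>Logarithmic differentiation of the reflection formula for \<open>rGamma\<close> gives
  \<open>- pi * cot (pi * z)\<close>, and the cotangent is a Moebius function of
  \<open>to_q z\<close>.\<close>

lemma bilat_0:
  assumes "z \<notin> \<int>"
  shows "bilat 0 z = pi * \<i> * ((1 + to_q z) / (1 - to_q z))"
proof -
  have n1: "z \<notin> \<int>\<^sub>\<le>\<^sub>0" and n2: "1 - z \<notin> \<int>\<^sub>\<le>\<^sub>0"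
    using assms by (auto elim!: nonpos_Ints_cases simp: algebra_simps) 
      (metis Ints_1 Ints_diff Ints_of_int diff_diff_eq2 add_diff_cancel_left' assms)
  have s: "((\<lambda>z. rGamma z * rGamma (1 - z)) has_field_derivative
      (-rGamma z * Digamma z) * rGamma (1 - z) + (- rGamma (1 - z) * Digamma (1 - z) * (-1)) * rGamma z) (at z)"
    using n1 n2 by (auto intro!: derivative_eq_intros has_field_derivative_rGamma_no_nonpos_int
        DERIV_chain2[OF has_field_derivative_rGamma_no_nonpos_int] simp: algebra_simps)
  have t: "((\<lambda>z. rGamma z * rGamma (1 - z)) has_field_derivative cos (of_real pi * z)) (at z)"
    unfolding rGamma_reflection_complex by (auto intro!: derivative_eq_intros)
  have e: "- (rGamma z * rGamma (1 - z)) * bilat 0 z = cos (of_real pi * z)"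
    using DERIV_unique[OF s t] by (simp add: bilat_def algebra_simps)
  then have e': "- sin (of_real pi * z) / pi * bilat 0 z = cos (of_real pi * z)"
    by (simp add: rGamma_reflection_complex)
  have sn: "sin (of_real pi * z) \<noteq> 0"
    using assms unfolding sin_eq_0 by (metis Ints_of_int mult_left_cancel of_real_eq_0_iff of_real_mult of_real_of_int_eq pi_neq_zero mult.commute)
  define w where "w = exp (\<i> * (of_real pi * z))"
  have w0: "w \<noteq> 0" by (simp add: w_def)
  have q: "to_q z = w * w" unfolding to_q_def w_def by (simp flip: exp_add add: algebra_simps)
  have s': "sin (of_real pi * z) = (w - 1 / w) / (2 * \<i>)"
    by (simp add: sin_exp_eq w_def exp_minus inverse_eq_divide field_simps)
  have c': "cos (of_real pi * z) = (w + 1 / w) / 2"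
    by (simp add: cos_exp_eq w_def exp_minus inverse_eq_divide field_simps)
  have w1: "1 - w * w \<noteq> 0" using sn unfolding s' using w0 by (auto simp: field_simps)
  have "bilat 0 z = - pi * cos (of_real pi * z) / sin (of_real pi * z)"
    using arg_cong[OF e', of "\<lambda>t. - pi * t"] sn by (simp add: field_simps)
  also have "\<dots> = pi * \<i> * ((1 + to_q z) / (1 - to_q z))"
    unfolding s' c' q using w0 w1 by (simp add: divide_simps) (simp add: algebra_simps)
  finally show ?thesis .
qed

text \<open>The sign \<open>(-1) ^ n\<close> in \<open>bilat\<close> compensates the inner
  derivative of \<open>1 - z\<close>, so each \<open>bilat\<close> is the derivative of the
  preceding one, and closed forms are propagated by differentiation.\<close>

lemma bilat_Suc:
  assumes "\<And>z. z \<notin> \<int> \<Longrightarrow> bilat n z = f z"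
    and "\<And>z. z \<notin> \<int> \<Longrightarrow> (f has_field_derivative f' z) (at z)" and "z \<notin> \<int>"
  shows "bilat (Suc n) z = f' z"
proof -
  have n1: "z \<notin> \<int>\<^sub>\<le>\<^sub>0" and n2: "1 - z \<notin> \<int>\<^sub>\<le>\<^sub>0"
    using assms(3) by (auto elim!: nonpos_Ints_cases simp: algebra_simps) 
      (metis Ints_1 Ints_diff Ints_of_int diff_diff_eq2 add_diff_cancel_left' assms(3))
  have "(bilat n has_field_derivative bilat (Suc n) z) (at z)"
    unfolding bilat_def using n1 n2 by (auto intro!: derivative_eq_intros)
  moreover have "(bilat n has_field_derivative f' z) (at z)"
  proof (rule has_field_derivative_transform_within_open[OF assms(2)[OF assms(3)]])
    show "open (- (\<int> :: complex set))" using closed_Ints by blast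
  qed (use assms in auto)
  ultimately show ?thesis by (rule DERIV_unique)
qed

lemma to_q_eq_1_iff: "to_q z = 1 \<longleftrightarrow> z \<in> \<int>"
proof
  assume "to_q z = 1"
  then obtain n :: int where "Im z = 0" "Re z = of_int n"
    unfolding to_q_def exp_eq_1 by auto
  then have "z = of_int n" by (auto intro: complex_eqI)
  then show "z \<in> \<int>" by simp
next
  assume "z \<in> \<int>"
  then show "to_q z = 1" by (auto simp: to_q_def Ints_def exp_eq_1)
qed

lemma to_q_deriv: "(to_q has_field_derivative 2 * pi * \<i> * to_q z) (at z within A)"
  unfolding to_q_def by (auto intro!: derivative_eq_intros)

lemmas to_q_deriv' [derivative_intros] = DERIV_chain2[OF to_q_deriv]

text \<open>Differentiation acts on functions of \<open>q\<close> as \<open>2 * pi * \<i>\<close>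
  times \<open>q d/dq\<close>; starting from \<open>bilat_0\<close> this produces the Eulerian
  polynomials as numerators. The indices 3 and 5 belong to the weights 4 and 6.\<close>

lemma bilat_3:
  assumes "z \<notin> \<int>"
  shows "bilat 3 z = 16 * pi ^ 4 * (to_q z * ((1 + 4 * to_q z + to_q z ^ 2) / (1 - to_q z) ^ 4))"
    and "bilat 5 z = - 64 * pi ^ 6 * (to_q z * ((1 + 26 * to_q z + 66 * to_q z ^ 2 + 26 * to_q z ^ 3 + to_q z ^ 4) / (1 - to_q z) ^ 6))"
proof -
  have q1: "1 - to_q z \<noteq> 0" if "z \<notin> \<int>" for z using that to_q_eq_1_iff[of z] by auto
  have 1: "bilat (Suc 0) z = pi * \<i> * (2 * pi * \<i>) * (2 * to_q z / (1 - to_q z) ^ 2)" if "z \<notin> \<int>" for z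
    by (rule bilat_Suc[OF bilat_0 _ that], assumption)
      (use q1 in \<open>auto intro!: derivative_eq_intros simp: divide_simps, auto simp: algebra_simps power2_eq_square\<close>)
  have 2: "bilat 2 z = pi * \<i> * (2 * pi * \<i>) ^ 2 * (2 * to_q z * (1 + to_q z) / (1 - to_q z) ^ 3)" if "z \<notin> \<int>" for z
    unfolding numeral_2_eq_2
    by (rule bilat_Suc[OF 1 _ that], assumption)
      (use q1 in \<open>auto intro!: derivative_eq_intros simp: divide_simps, auto simp: algebra_simps power2_eq_square power3_eq_cube eval_nat_numeral\<close>)
  have 3: "bilat 3 z = pi * \<i> * (2 * pi * \<i>) ^ 3 * (2 * to_q z * (1 + 4 * to_q z + to_q z ^ 2) / (1 - to_q z) ^ 4)" if "z \<notin> \<int>" for z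
    unfolding numeral_3_eq_3 unfolding numeral_2_eq_2[symmetric]
    by (rule bilat_Suc[OF 2 _ that], assumption)
      (use q1 in \<open>auto intro!: derivative_eq_intros simp: divide_simps, auto simp: algebra_simps power2_eq_square power3_eq_cube eval_nat_numeral\<close>)
  have 4: "bilat (Suc 3) z = pi * \<i> * (2 * pi * \<i>) ^ 4 * (2 * to_q z * (1 + 11 * to_q z + 11 * to_q z ^ 2 + to_q z ^ 3) / (1 - to_q z) ^ 5)" if "z \<notin> \<int>" for z
    by (rule bilat_Suc[OF 3 _ that], assumption)
      (use q1 in \<open>auto intro!: derivative_eq_intros simp: divide_simps, auto simp: algebra_simps power2_eq_square power3_eq_cube eval_nat_numeral\<close>)
  have 5: "bilat (Suc (Suc 3)) z = pi * \<i> * (2 * pi * \<i>) ^ 5 * (2 * to_q z * (1 + 26 * to_q z + 66 * to_q z ^ 2 + 26 * to_q z ^ 3 + to_q z ^ 4) / (1 - to_q z) ^ 6)" if "z \<notin> \<int>" for z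
    by (rule bilat_Suc[OF 4 _ that], assumption)
      (use q1 in \<open>auto intro!: derivative_eq_intros simp: divide_simps, auto simp: algebra_simps power2_eq_square power3_eq_cube eval_nat_numeral\<close>)
  have i: "\<i> ^ 3 = - \<i>" "\<i> ^ 5 = \<i>" by (auto simp: eval_nat_numeral)
  have c3: "pi * \<i> * (2 * pi * \<i>) ^ 3 = 8 * complex_of_real pi ^ 4"
    by (simp add: power_mult_distrib i power_numeral_reduce mult_ac)
  have c5: "pi * \<i> * (2 * pi * \<i>) ^ 5 = - 32 * complex_of_real pi ^ 6"
    by (simp add: power_mult_distrib i power_numeral_reduce mult_ac)
  show "bilat 3 z = 16 * pi ^ 4 * (to_q z * ((1 + 4 * to_q z + to_q z ^ 2) / (1 - to_q z) ^ 4))"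
    using 3[OF assms] unfolding c3 by simp
  show "bilat 5 z = - 64 * pi ^ 6 * (to_q z * ((1 + 26 * to_q z + 66 * to_q z ^ 2 + 26 * to_q z ^ 3 + to_q z ^ 4) / (1 - to_q z) ^ 6))"
    using 5[OF assms] unfolding c5 by (simp add: numeral_eq_Suc)
qed

section \<open>Convergence and Fourier expansion of the lattice sums\<close>

lemma summable_on_int_square: "(\<lambda>m::int. 1 / (1 + real_of_int m ^ 2)) summable_on UNIV"
proof -
  have "summable (\<lambda>n. norm (1 / (1 + real n ^ 2)))"
  proof (rule summable_comparison_test')
    show "summable (\<lambda>n. 2 * (1 / (real (Suc n)) ^ 2))"
      by (intro summable_mult) (use inverse_squares_sums in \<open>simp add: sums_iff\<close>)
    show "norm (norm (1 / (1 + real n ^ 2))) \<le> 2 * (1 / (real (Suc n)) ^ 2)" if "n \<ge> 0" for n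
    proof -
      have "(real (Suc n)) ^ 2 \<le> 2 * (1 + real n ^ 2)"
        using sum_squares_ge_zero[of "real n - 1" 0] by (simp add: power2_eq_square algebra_simps)
      moreover have "\<not> 1 + (real n)\<^sup>2 < 0" by (simp add: not_less)
      ultimately show ?thesis by (simp add: divide_simps add_nonneg_eq_0_iff)
    qed
  qed
  then have s: "(\<lambda>n::nat. 1 / (1 + real n ^ 2)) summable_on UNIV"
    by (rule norm_summable_imp_summable_on)
  have 1: "(\<lambda>m::int. 1 / (1 + real_of_int m ^ 2)) summable_on (int ` UNIV)"
    by (subst summable_on_reindex) (use s in \<open>auto simp: o_def\<close>)
  have 2: "(\<lambda>m::int. 1 / (1 + real_of_int m ^ 2)) summable_on ((\<lambda>n. - int n) ` UNIV)"
    by (subst summable_on_reindex) (use s in \<open>auto simp: o_def inj_on_def\<close>)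
  have "(UNIV :: int set) = int ` UNIV \<union> (\<lambda>n. - int n) ` UNIV"
    by (auto) (metis int_cases2 rangeI)
  with summable_on_union[OF 1 2] show ?thesis by simp
qed

text \<open>The squared norm is a positive definite quadratic form in \<open>(m, n)\<close> because
  \<open>\<tau>\<close> is not real; the constant comes from expressing \<open>m\<close> through the
  real part \<open>m + n * Re \<tau>\<close>.\<close>

lemma lattice_norm_bound:
  assumes "Im \<tau> > 0"
  obtains c where "c > 0" "\<And>m n. real_of_int m ^ 2 + real_of_int n ^ 2 \<le> c * norm (of_int m + of_int n * \<tau>) ^ 2"
proof
  define x y where "x = Re \<tau>" "y = Im \<tau>"
  show "2 + (2 * (Re \<tau>)\<^sup>2 + 1) / (Im \<tau>)\<^sup>2 > 0" by (simp add: add_pos_nonneg)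
  fix m n :: int
  define a b where "a = real_of_int m" "b = real_of_int n"
  have y: "y > 0" using assms by (simp add: x_y_def)
  have n: "norm (of_int m + of_int n * \<tau>) ^ 2 = (a + b * x) ^ 2 + b ^ 2 * y ^ 2"
    by (simp add: cmod_power2 a_b_def x_y_def power_mult_distrib)
  \<comment> \<open>The difference of the two sides is \<open>(a + 2 * b * x) ^ 2\<close>.\<close>
  have "a ^ 2 + b ^ 2 \<le> 2 * (a + b * x) ^ 2 + (2 * x ^ 2 + 1) * b ^ 2"
    using zero_le_power2[of "a + 2 * (b * x)"] by (simp add: power2_eq_square algebra_simps)
  also have "\<dots> \<le> (2 + (2 * x\<^sup>2 + 1) / y\<^sup>2) * ((a + b * x) ^ 2 + b ^ 2 * y ^ 2)"
  proof -
    have "(2 * x ^ 2 + 1) * b ^ 2 = (2 * x\<^sup>2 + 1) / y\<^sup>2 * (b ^ 2 * y ^ 2)"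
      using y by simp
    also have "\<dots> \<le> (2 * x\<^sup>2 + 1) / y\<^sup>2 * ((a + b * x) ^ 2 + b ^ 2 * y ^ 2)"
      by (intro mult_left_mono) auto
    finally have "(2 * x ^ 2 + 1) * b ^ 2 \<le> (2 * x\<^sup>2 + 1) / y\<^sup>2 * ((a + b * x) ^ 2 + b ^ 2 * y ^ 2)" .
    moreover have "2 * (a + b * x) ^ 2 \<le> 2 * ((a + b * x) ^ 2 + b ^ 2 * y ^ 2)" by simp
    ultimately show ?thesis unfolding distrib_right[of 2] by (rule add_mono[rotated])
  qed
  finally show "real_of_int m ^ 2 + real_of_int n ^ 2 \<le> (2 + (2 * (Re \<tau>)\<^sup>2 + 1) / (Im \<tau>)\<^sup>2) * norm (of_int m + of_int n * \<tau>) ^ 2"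
    unfolding n by (simp add: a_b_def x_y_def)
qed

text \<open>For \<open>k \<ge> 4\<close> the terms are dominated by a constant times
  \<open>1 / ((1 + m^2) * (1 + n^2))\<close>, whose double sum factors into two convergent single
  sums.\<close>

lemma eisenstein_abs_summable:
  assumes "Im \<tau> > 0" "k \<ge> 4"
  shows "(\<lambda>x. norm (case x of (m, n) \<Rightarrow> 1 / (of_int m + of_int n * \<tau>) ^ k)) summable_on (UNIV - {(0 :: int, 0 :: int)})"
proof -
  obtain c where c: "c > 0" "\<And>m n. real_of_int m ^ 2 + real_of_int n ^ 2 \<le> c * norm (of_int m + of_int n * \<tau>) ^ 2"
    using lattice_norm_bound[OF assms(1)] by blast
  define h where "h = (\<lambda>m::int. 1 / (1 + real_of_int m ^ 2))"
  have h0: "h m \<ge> 0" for m unfolding h_def by simp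
  have hs: "h summable_on UNIV" unfolding h_def by (rule summable_on_int_square)
  have "(\<lambda>x. norm (case x of (m, n) \<Rightarrow> h m * h n)) summable_on (UNIV \<times> UNIV)"
    unfolding Infinite_Sum.abs_summable_on_Sigma_iff using h0 hs
    by (auto simp: abs_mult infsum_cmult_right' infsum_nonneg intro!: summable_on_cmult_right summable_on_cmult_left)
  then have hs2: "(\<lambda>x. norm (case x of (m, n) \<Rightarrow> h m * h n)) summable_on (UNIV - {(0, 0)})"
    by (rule summable_on_subset_banach) auto
  define C where "C = 3 * c ^ 2 * (sqrt c) ^ (k - 4)"
  have hs3: "(\<lambda>x. norm (case x of (m, n) \<Rightarrow> C * (h m * h n))) summable_on (UNIV - {(0, 0)})"
    using summable_on_cmult_right[OF hs2, of "\<bar>C\<bar>"] by (simp add: case_prod_unfold abs_mult)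
  show ?thesis
  proof (rule Infinite_Sum.abs_summable_on_comparison_test[OF hs3])
    fix x :: "int \<times> int" assume "x \<in> UNIV - {(0, 0)}"
    then obtain m n where x: "x = (m, n)" and mn: "\<not> (m = 0 \<and> n = 0)" by (cases x) auto
    define a b where "a = real_of_int m ^ 2" "b = real_of_int n ^ 2"
    define w where "w = norm (of_int m + of_int n * \<tau>)"
    have "a \<ge> 0" "b \<ge> 0" by (auto simp: a_b_def)
    have ab: "a + b \<ge> 1"
    proof -
      have "m ^ 2 + n ^ 2 > 0" using mn by (simp add: sum_power2_gt_zero_iff)
      then have "m ^ 2 + n ^ 2 \<ge> 1" by linarith
      then have "real_of_int (m ^ 2 + n ^ 2) \<ge> 1" by linarith
      then show ?thesis by (simp add: a_b_def)
    qed
    have w2: "a + b \<le> c * w ^ 2" using c(2)[of m n] by (simp add: a_b_def w_def)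
    have w0: "w > 0" using ab w2 by (auto simp: w_def intro: ccontr)
    have "1 \<le> c * w ^ 2" using ab w2 by linarith
    then have "sqrt 1 \<le> sqrt (c * w ^ 2)" by (rule real_sqrt_le_mono)
    then have sw: "1 \<le> sqrt c * w" using w0 by (simp add: real_sqrt_mult)
    have "(1 + a) * (1 + b) \<le> 3 * (a + b) ^ 2"
    proof -
      have "a + b \<le> (a + b) ^ 2" using ab by (simp add: self_le_power)
      moreover have "1 \<le> (a + b) ^ 2" using ab by (simp add: self_le_power)
      moreover have "a * b \<le> (a + b) ^ 2" using \<open>a \<ge> 0\<close> \<open>b \<ge> 0\<close>
        by (simp add: power2_eq_square algebra_simps)
      ultimately show ?thesis by (simp add: algebra_simps)
    qed
    also have "\<dots> \<le> 3 * (c * w ^ 2) ^ 2" using w2 ab by (intro mult_left_mono power_mono) auto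
    also have "\<dots> \<le> 3 * (c * w ^ 2) ^ 2 * (sqrt c * w) ^ (k - 4)"
      using one_le_power[OF sw, of "k - 4"] by (simp add: mult_le_cancel_left1)
    also have "\<dots> = C * w ^ k"
    proof -
      have "w ^ k = (w ^ 2) ^ 2 * w ^ (k - 4)" using assms(2) by (simp flip: power_mult power_add)
      then show ?thesis by (simp add: C_def power_mult_distrib)
    qed
    finally have le: "(1 + a) * (1 + b) \<le> C * w ^ k" .
    have "\<not> (1 + (real_of_int m)\<^sup>2) * (1 + (real_of_int n)\<^sup>2) < 0" by (simp add: not_less)
    with le have "1 / w ^ k \<le> C * (h m * h n)"
      using w0 \<open>a \<ge> 0\<close> \<open>b \<ge> 0\<close> unfolding h_def by (simp add: a_b_def divide_simps add_nonneg_eq_0_iff mult_ac)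
    then show "norm (case x of (m, n) \<Rightarrow> 1 / (of_int m + of_int n * \<tau>) ^ k) \<le> norm (case x of (m, n) \<Rightarrow> C * (h m * h n))"
      by (simp add: norm_divide norm_power w_def x)
  qed
qed

text \<open>The integers \<open>m \<ge> 0\<close> and \<open>m \<le> - 1\<close> give the Polygamma
  series at \<open>z\<close> and at \<open>1 - z\<close>. As \<open>n\<close> is odd the exponent is
  even, so the sign in the second half disappears.\<close>

lemma infsum_bilateral:
  assumes "z \<notin> \<int>" "odd n" "(\<lambda>m::int. 1 / (of_int m + z) ^ Suc n) summable_on UNIV"
  shows "infsum (\<lambda>m::int. 1 / (of_int m + z) ^ Suc n) UNIV = bilat n z / fact n"
proof -
  let ?f = "\<lambda>m::int. 1 / (of_int m + z) ^ Suc n"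
  have n: "n > 0" using assms(2) by (cases n) auto
  have z0: "z \<noteq> 0" "1 - z \<noteq> 0" using assms(1) by auto
  have U: "(UNIV :: int set) = range int \<union> range (\<lambda>k. - 1 - int k)"
  proof (intro equalityI subsetI UNIV_I)
    fix m :: int
    show "m \<in> range int \<union> range (\<lambda>k. - 1 - int k)"
    proof (cases "m \<ge> 0")
      case True
      then have "m = int (nat m)" by simp
      then show ?thesis by blast
    next
      case False
      then have "m = - 1 - int (nat (- 1 - m))" by simp
      then show ?thesis by blast
    qed
  qed
  have s1: "?f summable_on range int" and s2: "?f summable_on range (\<lambda>k. - 1 - int k)"
    using summable_on_subset_banach[OF assms(3)] by auto
  have "infsum ?f UNIV = infsum ?f (range int) + infsum ?f (range (\<lambda>k. - 1 - int k))"
    unfolding U by (rule infsum_Un_disjoint[OF s1 s2]) auto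
  also have "infsum ?f (range int) = Polygamma n z / fact n"
  proof -
    have i: "inj int" by simp
    have "((?f \<circ> int) has_sum infsum ?f (range int)) UNIV"
      using has_sum_infsum[OF s1] unfolding has_sum_reindex[OF i] .
    from sums_unique2[OF has_sum_imp_sums[OF this]] Polygamma_LIMSEQ[OF z0(1) n]
    show ?thesis using assms(2) by (simp add: o_def inverse_eq_divide add.commute)
  qed
  also have "infsum ?f (range (\<lambda>k. - 1 - int k)) = Polygamma n (1 - z) / fact n"
  proof -
    have i: "inj (\<lambda>k. - 1 - int k)" by (auto simp: inj_on_def)
    have "((?f \<circ> (\<lambda>k. - 1 - int k)) has_sum infsum ?f (range (\<lambda>k. - 1 - int k))) UNIV"
      using has_sum_infsum[OF s2] unfolding has_sum_reindex[OF i] .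
    note * = has_sum_imp_sums[OF this]
    have "(?f \<circ> (\<lambda>k. - 1 - int k)) = (\<lambda>k. inverse ((1 - z + of_nat k) ^ Suc n))"
    proof
      fix k
      have "of_int (- 1 - int k) + z = - (1 - z + of_nat k)" by simp
      then have "(of_int (- 1 - int k) + z) ^ Suc n = (1 - z + of_nat k) ^ Suc n"
        using assms(2) by (metis even_Suc power_minus_even)
      then show "(?f \<circ> (\<lambda>k. - 1 - int k)) k = inverse ((1 - z + of_nat k) ^ Suc n)"
        by (simp only: o_def inverse_eq_divide)
    qed
    with * sums_unique2[OF _ Polygamma_LIMSEQ[OF z0(2) n]]
    show ?thesis using assms(2) by (simp add: even_Suc)
  qed
  finally show ?thesis using assms(2) by (simp add: bilat_def add_divide_distrib)
qed

text \<open>Splitting by parity: the even terms contribute \<open>1 / 2 ^ k\<close> times the whole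
  sum. The odd part is a Polygamma value at 1/2, which the closed form of \<open>bilat\<close>
  evaluates because \<open>z = 1 - z\<close> there.\<close>

lemma sums_zeta_from_odd:
  assumes "k > 1" "(\<lambda>n. 1 / (2 * of_nat n + 1 :: complex) ^ k) sums s"
    "summable (\<lambda>n. 1 / (of_nat n + 1 :: complex) ^ k)"
  shows "(2 ^ k - 1) * (\<Sum>n. 1 / (of_nat n + 1 :: complex) ^ k) = 2 ^ k * s"
proof -
  define t where "t = (\<Sum>n. 1 / (of_nat n + 1 :: complex) ^ k)"
  have t: "(\<lambda>n. 1 / (of_nat n + 1 :: complex) ^ k) sums t"
    using assms(3) unfolding t_def by (rule summable_sums)
  have "(\<lambda>n. \<Sum>i = n * 2..<n * 2 + 2. 1 / (of_nat i + 1 :: complex) ^ k) sums t"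
    by (rule sums_group[OF t]) simp
  moreover have "(\<Sum>i = n * 2..<n * 2 + 2. 1 / (of_nat i + 1 :: complex) ^ k)
    = 1 / (2 * of_nat n + 1) ^ k + (1 / 2 ^ k) * (1 / (of_nat n + 1) ^ k)" for n
  proof -
    have "{n * 2..<n * 2 + 2} = {2 * n, 2 * n + 1}" by auto
    moreover have "(of_nat (2 * n + 1) + 1 :: complex) ^ k = 2 ^ k * (of_nat n + 1) ^ k"
      by (simp flip: power_mult_distrib add: algebra_simps)
    ultimately show ?thesis by simp
  qed
  ultimately have "(\<lambda>n. 1 / (2 * of_nat n + 1 :: complex) ^ k + (1 / 2 ^ k) * (1 / (of_nat n + 1) ^ k)) sums t"
    by simp
  moreover have "(\<lambda>n. 1 / (2 * of_nat n + 1 :: complex) ^ k + (1 / 2 ^ k) * (1 / (of_nat n + 1) ^ k)) sums (s + 1 / 2 ^ k * t)"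
    by (intro sums_add sums_mult assms t)
  ultimately have "t = s + 1 / 2 ^ k * t" by (rule sums_unique2)
  then show ?thesis unfolding t_def[symmetric] by (simp add: field_simps)
qed

lemma half_odd_sums:
  assumes "n > 0"
  shows "(\<lambda>k. 1 / (2 * of_nat k + 1 :: complex) ^ Suc n) sums ((-1) ^ Suc n * Polygamma n (1/2) / fact n / 2 ^ Suc n)"
proof -
  have "(\<lambda>k. inverse ((1/2 + of_nat k :: complex) ^ Suc n) / 2 ^ Suc n) sums ((-1) ^ Suc n * Polygamma n (1/2) / fact n / 2 ^ Suc n)"
    by (intro sums_divide Polygamma_LIMSEQ) (use assms in auto)
  moreover have "inverse ((1/2 + of_nat k :: complex) ^ Suc n) / 2 ^ Suc n = 1 / (2 * of_nat k + 1) ^ Suc n" for k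
  proof -
    have "(2 * of_nat k + 1 :: complex) ^ Suc n = 2 ^ Suc n * (1/2 + of_nat k) ^ Suc n"
      by (simp only: power_mult_distrib[symmetric]) (simp add: algebra_simps)
    then show ?thesis by (simp only: inverse_eq_divide) (simp add: field_simps)
  qed
  ultimately show ?thesis by simp
qed

lemma summable_zeta: "k > 1 \<Longrightarrow> summable (\<lambda>n. 1 / (of_nat n + 1 :: complex) ^ k)"
  using Polygamma_LIMSEQ[of "1 :: complex" "k - 1"]
  by (auto simp: sums_iff inverse_eq_divide add.commute)

lemma half_not_Int: "(1 / 2 :: complex) \<notin> \<int>"
  using fraction_not_in_Ints[where 'a = complex, of 2 1] by simp

lemma to_q_half: "to_q (1 / 2) = - 1"
  by (simp add: to_q_def)

lemma zeta_4: "(\<Sum>n. 1 / (of_nat n + 1 :: complex) ^ 4) = pi ^ 4 / 90"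
proof -
  have "2 * Polygamma 3 (1 / 2 :: complex) = 2 * pi ^ 4"
    using bilat_3(1)[OF half_not_Int] by (simp add: bilat_def to_q_half)
  then have P: "Polygamma 3 (1 / 2 :: complex) = pi ^ 4" by simp
  have "fact 3 = (6 :: complex)" by (simp add: fact_numeral)
  with half_odd_sums[of 3] P have "(\<lambda>k. 1 / (2 * of_nat k + 1 :: complex) ^ 4) sums (pi ^ 4 / 96)"
    by simp
  from sums_zeta_from_odd[OF _ this summable_zeta] show ?thesis by (simp add: field_simps)
qed

lemma zeta_6: "(\<Sum>n. 1 / (of_nat n + 1 :: complex) ^ 6) = pi ^ 6 / 945"
proof -
  have "2 * Polygamma 5 (1 / 2 :: complex) = 16 * pi ^ 6"
    using bilat_3(2)[OF half_not_Int] by (simp add: bilat_def to_q_half)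
  then have P: "Polygamma 5 (1 / 2 :: complex) = 8 * pi ^ 6" by simp
  have "fact 5 = (120 :: complex)" by (simp add: fact_numeral)
  with half_odd_sums[of 5] P have "(\<lambda>k. 1 / (2 * of_nat k + 1 :: complex) ^ 6) sums (pi ^ 6 / 960)"
    by simp
  from sums_zeta_from_odd[OF _ this summable_zeta] show ?thesis by (simp add: field_simps)
qed

text \<open>Lattice points are grouped by their second coordinate. Coordinate 0 gives twice a zeta
  value, opposite coordinates agree because the exponent is even, and each positive coordinate gives
  a bilateral sum.\<close>

lemma eisenstein_G_expand:
  assumes \<tau>: "Im \<tau> > 0" and n: "odd n" "n \<ge> 3"
  shows "eisenstein_G (Suc n) \<tau> =
     2 * (\<Sum>j. 1 / (of_nat j + 1) ^ Suc n) + 2 * (\<Sum>j. bilat n (of_nat (Suc j) * \<tau>) / fact n)"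
proof -
  define f where "f = (\<lambda>(m, n'). 1 / (of_int m + of_int n' * \<tau>) ^ Suc n)"
  have abs: "(\<lambda>x. norm (f x)) summable_on (UNIV - {(0, 0)})"
    unfolding f_def by (rule eisenstein_abs_summable) (use assms in auto)
  then have s: "f summable_on (UNIV - {(0, 0)})" by (rule Infinite_Sum.abs_summable_summable)
  \<comment> \<open>Rows are indexed from 0, so index \<open>j\<close> stands for the second
    coordinate \<open>Suc j\<close>.\<close>
  define A B C where "A = (\<lambda>m. (m, 0 :: int)) ` (UNIV - {0 :: int})"
    and "B = (\<lambda>(j, m). (m, int (Suc j))) ` (UNIV \<times> (UNIV :: int set))"
    and "C = (\<lambda>(j, m). (- m, - int (Suc j))) ` (UNIV \<times> (UNIV :: int set))"
  have ABC: "UNIV - {(0, 0)} = A \<union> (B \<union> C)"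
  proof (intro equalityI subsetI)
    fix x :: "int \<times> int" assume x: "x \<in> UNIV - {(0, 0)}"
    obtain m k where mk: "x = (m, k)" by (cases x)
    consider "k = 0" | "k > 0" | "k < 0" by linarith
    then show "x \<in> A \<union> (B \<union> C)"
    proof cases
      case 1 then show ?thesis using x mk by (auto simp: A_def B_def C_def)
    next
      case 2
      then have "x = (\<lambda>(j, m). (m, int (Suc j))) (nat (k - 1), m)" using mk by simp
      then show ?thesis unfolding A_def B_def C_def by blast
    next
      case 3
      then have "x = (\<lambda>(j, m). (- m, - int (Suc j))) (nat (- k - 1), - m)" using mk by simp
      then show ?thesis unfolding A_def B_def C_def by blast
    qed
  qed (auto simp: A_def B_def C_def)
  have sA: "f summable_on A" and sB: "f summable_on B" and sC: "f summable_on C" and sBC: "f summable_on (B \<union> C)"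
    using s unfolding ABC by (auto intro: summable_on_subset_banach)
  have "eisenstein_G (Suc n) \<tau> = infsum f (A \<union> (B \<union> C))"
    unfolding eisenstein_G_def ABC[symmetric] f_def ..
  also have "\<dots> = infsum f A + (infsum f B + infsum f C)"
  proof -
    have "A \<inter> (B \<union> C) = {}" "B \<inter> C = {}" by (auto simp: A_def B_def C_def)
    then show ?thesis using infsum_Un_disjoint[OF sA sBC] infsum_Un_disjoint[OF sB sC] by simp
  qed
  also have "infsum f A = 2 * (\<Sum>j. 1 / (of_nat j + 1) ^ Suc n)"
  proof -
    define g where "g = (\<lambda>m::int. 1 / (of_int m :: complex) ^ Suc n)"
    have i: "inj_on (\<lambda>m. (m, 0 :: int)) (UNIV - {0 :: int})" by (auto simp: inj_on_def)
    have fg: "f \<circ> (\<lambda>m. (m, 0 :: int)) = g" by (auto simp: f_def g_def)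
    have sg: "g summable_on (UNIV - {0})"
      using sA unfolding A_def B_def C_def summable_on_reindex[OF i] fg .
    have U: "UNIV - {0} = range (\<lambda>j. int j + 1) \<union> range (\<lambda>j. - int j - 1)"
    proof (intro equalityI subsetI)
      fix m :: int assume "m \<in> UNIV - {0}"
      then have "m \<ge> 1 \<or> m \<le> - 1" by auto
      then have "m = int (nat (m - 1)) + 1 \<or> m = - int (nat (- m - 1)) - 1" by auto
      then show "m \<in> range (\<lambda>j. int j + 1) \<union> range (\<lambda>j. - int j - 1)" by blast
    qed auto
    have s1: "g summable_on range (\<lambda>j. int j + 1)" and s2: "g summable_on range (\<lambda>j. - int j - 1)"
      using sg unfolding U by (auto intro: summable_on_subset_banach)
    have i1: "inj (\<lambda>j. int j + 1)" and i2: "inj (\<lambda>j. - int j - 1)" by (auto simp: inj_on_def)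
    have "infsum f A = infsum g (UNIV - {0})"
      unfolding A_def B_def C_def infsum_reindex[OF i] fg ..
    also have "\<dots> = infsum g (range (\<lambda>j. int j + 1)) + infsum g (range (\<lambda>j. - int j - 1))"
      unfolding U by (rule infsum_Un_disjoint[OF s1 s2]) auto
    also have "infsum g (range (\<lambda>j. int j + 1)) = (\<Sum>j. 1 / (of_nat j + 1) ^ Suc n)"
      using has_sum_infsum[OF s1, unfolded has_sum_reindex[OF i1], THEN has_sum_imp_sums]
      by (simp add: sums_iff o_def g_def)
    also have "infsum g (range (\<lambda>j. - int j - 1)) = (\<Sum>j. 1 / (of_nat j + 1) ^ Suc n)"
    proof -
      have "g \<circ> (\<lambda>j. - int j - 1) = (\<lambda>j. 1 / (of_nat j + 1) ^ Suc n)"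
      proof
        fix j
        have "of_int (- int j - 1) = - (of_nat j + 1 :: complex)" by simp
        then have "(of_int (- int j - 1)) ^ Suc n = (of_nat j + 1 :: complex) ^ Suc n"
          using n by (metis even_Suc power_minus_even)
        then show "(g \<circ> (\<lambda>j. - int j - 1)) j = 1 / (of_nat j + 1) ^ Suc n"
          by (simp only: o_def g_def)
      qed
      then show ?thesis
        using has_sum_infsum[OF s2, unfolded has_sum_reindex[OF i2], THEN has_sum_imp_sums]
        by (simp only: sums_iff)
    qed
    finally show ?thesis by simp
  qed
  also have "infsum f C = infsum f B"
  proof -
    have i1: "inj_on (\<lambda>(j, m). (m, int (Suc j))) (UNIV \<times> (UNIV :: int set))"
      and i2: "inj_on (\<lambda>(j, m). (- m, - int (Suc j))) (UNIV \<times> (UNIV :: int set))"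
      by (auto simp: inj_on_def)
    have "f (- m, - k) = f (m, k)" for m k
    proof -
      have "of_int (- m) + of_int (- k) * \<tau> = - (of_int m + of_int k * \<tau>)" by simp
      then have "(of_int (- m) + of_int (- k) * \<tau>) ^ Suc n = (of_int m + of_int k * \<tau>) ^ Suc n"
        using n by (metis even_Suc power_minus_even)
      then show ?thesis by (simp only: f_def case_prod_conv)
    qed
    then have "f \<circ> (\<lambda>(j, m). (- m, - int (Suc j))) = f \<circ> (\<lambda>(j, m). (m, int (Suc j)))"
      by (auto simp: fun_eq_iff simp del: of_nat_Suc)
    then show ?thesis unfolding A_def B_def C_def infsum_reindex[OF i1] infsum_reindex[OF i2] by simp
  qed
  also have "infsum f B = (\<Sum>j. bilat n (of_nat (Suc j) * \<tau>) / fact n)"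
  proof -
    have i1: "inj_on (\<lambda>(j, m). (m, int (Suc j))) (UNIV \<times> (UNIV :: int set))"
      by (auto simp: inj_on_def)
    define g where "g = (\<lambda>(j, m). 1 / (of_int m + of_nat (Suc j) * \<tau>) ^ Suc n)"
    have fg: "f \<circ> (\<lambda>(j, m). (m, int (Suc j))) = g"
      by (auto simp: fun_eq_iff f_def g_def)
    have sg: "g summable_on (UNIV \<times> UNIV)"
      using sB unfolding A_def B_def C_def summable_on_reindex[OF i1] fg .
    have sr: "(\<lambda>m. g (j, m)) summable_on UNIV" for j
    proof -
      have "g summable_on (Pair j ` UNIV)" by (rule summable_on_subset_banach[OF sg]) auto
      then show ?thesis by (subst (asm) summable_on_reindex) (auto simp: inj_on_def o_def)
    qed
    have row: "((\<lambda>m. g (j, m)) has_sum (bilat n (of_nat (Suc j) * \<tau>) / fact n)) UNIV" for j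
    proof -
      have "of_nat (Suc j) * \<tau> \<notin> \<int>"
      proof
        assume "of_nat (Suc j) * \<tau> \<in> \<int>"
        then obtain k where "of_nat (Suc j) * \<tau> = of_int k" by (auto elim: Ints_cases)
        then have "Im (of_nat (Suc j) * \<tau>) = 0" by (metis Im_complex_of_real of_real_of_int_eq)
        moreover have "Im (of_nat (Suc j) * \<tau>) = real (Suc j) * Im \<tau>" by (simp del: of_nat_Suc)
        ultimately show False using \<tau> by (simp del: of_nat_Suc)
      qed
      from infsum_bilateral[OF this n(1)] sr[of j] have "infsum (\<lambda>m. g (j, m)) UNIV = bilat n (of_nat (Suc j) * \<tau>) / fact n"
        by (simp add: g_def)
      then show ?thesis using has_sum_infsum[OF sr[of j]] by simp
    qed
    have "((\<lambda>j. bilat n (of_nat (Suc j) * \<tau>) / fact n) has_sum infsum g (UNIV \<times> UNIV)) UNIV"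
      using has_sum_SigmaD[OF has_sum_infsum[OF sg] row] .
    from has_sum_imp_sums[OF this]
    have "infsum g (UNIV \<times> UNIV) = (\<Sum>j. bilat n (of_nat (Suc j) * \<tau>) / fact n)"
      by (simp add: sums_iff)
    then show ?thesis unfolding A_def B_def C_def infsum_reindex[OF i1] fg .
  qed
  finally show ?thesis by simp
qed

text \<open>Multiplication by the automorphy factor turns the lattice of the transformed point into
  that of \<open>\<tau>\<close>, with the pairs permuted by an invertible integral matrix.
  Reindexing and scaling of \<open>infsum\<close> are valid without summability, so \<open>k\<close>
  is arbitrary.\<close>

lemma eisenstein_G_modular:
  assumes "a * d - b * c = 1" "Im \<tau> > 0"
  shows "eisenstein_G k (moebius_act (a, b, c, d) \<tau>) = (of_int c * \<tau> + of_int d) ^ k * eisenstein_G k \<tau>"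
proof -
  define w where "w = of_int c * \<tau> + of_int d"
  have w0: "w \<noteq> 0"
  proof
    assume "w = 0"
    then have "Im w = 0" "Re w = 0" by auto
    then have "c = 0" "d = 0" using assms(2) by (auto simp: w_def)
    then show False using assms(1) by simp
  qed
    have e1: "a * (d * m + b * n) - b * (c * m + a * n) = m" for m n
    proof -
      have "a * (d * m + b * n) - b * (c * m + a * n) = (a * d - b * c) * m" by (simp add: algebra_simps)
      then show ?thesis using assms(1) by simp
    qed
    have e2: "- c * (d * m + b * n) + d * (c * m + a * n) = n" for m n
    proof -
      have "- c * (d * m + b * n) + d * (c * m + a * n) = (a * d - b * c) * n" by (simp add: algebra_simps)
      then show ?thesis using assms(1) by simp
    qed
    have e3: "d * (a * m - b * n) + b * (- c * m + d * n) = m" for m n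
    proof -
      have "d * (a * m - b * n) + b * (- c * m + d * n) = (a * d - b * c) * m" by (simp add: algebra_simps)
      then show ?thesis using assms(1) by simp
    qed
    have e4: "c * (a * m - b * n) + a * (- c * m + d * n) = n" for m n
    proof -
      have "c * (a * m - b * n) + a * (- c * m + d * n) = (a * d - b * c) * n" by (simp add: algebra_simps)
      then show ?thesis using assms(1) by simp
    qed
  have bij: "bij_betw (\<lambda>(m, n). (d * m + b * n, c * m + a * n)) (UNIV - {(0, 0)}) (UNIV - {(0, 0)})"
  proof (rule bij_betwI[where g = "\<lambda>(m, n). (a * m - b * n, - c * m + d * n)"])
    show "(\<lambda>(m, n). (d * m + b * n, c * m + a * n)) \<in> UNIV - {(0, 0)} \<rightarrow> UNIV - {(0, 0)}"
      using e1 e2 by (auto, (metis diff_zero mult_zero_right add.right_neutral)+)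
    show "(\<lambda>(m, n). (a * m - b * n, - c * m + d * n)) \<in> UNIV - {(0, 0)} \<rightarrow> UNIV - {(0, 0)}"
    proof (rule Pi_I)
      fix x :: "int \<times> int" assume x: "x \<in> UNIV - {(0, 0)}"
      obtain m n where mn: "x = (m, n)" by (cases x)
      have "\<not> (a * m - b * n = 0 \<and> - c * m + d * n = 0)"
      proof
        assume h: "a * m - b * n = 0 \<and> - c * m + d * n = 0"
        have "m = 0" "n = 0" using e3[of m n] e4[of m n] unfolding conjunct1[OF h] conjunct2[OF h] by auto
        then show False using x mn by auto
      qed
      then show "(case x of (m, n) \<Rightarrow> (a * m - b * n, - c * m + d * n)) \<in> UNIV - {(0, 0)}"
        using mn by auto
    qed
  qed (use e1 e2 e3 e4 in \<open>auto simp del: mult_minus_left\<close>)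
  have "eisenstein_G k \<tau> = (\<Sum>\<^sub>\<infinity>x \<in> UNIV - {(0, 0)}. case (case x of (m, n) \<Rightarrow> (d * m + b * n, c * m + a * n)) of (m, n) \<Rightarrow> 1 / (of_int m + of_int n * \<tau>) ^ k)"
    unfolding eisenstein_G_def by (rule infsum_reindex_bij_betw[OF bij, symmetric])
  also have "\<dots> = (\<Sum>\<^sub>\<infinity>(m, n) \<in> UNIV - {(0, 0)}. (1 / w ^ k) * (1 / (of_int m + of_int n * moebius_act (a, b, c, d) \<tau>) ^ k))"
  proof (rule infsum_cong)
    fix x :: "int \<times> int"
    obtain m n where x: "x = (m, n)" by (cases x)
    have "of_int (d * m + b * n) + of_int (c * m + a * n) * \<tau> = w * (of_int m + of_int n * moebius_act (a, b, c, d) \<tau>)"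
    proof -
      have "w * (of_int m + of_int n * moebius_act (a, b, c, d) \<tau>) = w * of_int m + of_int n * (of_int a * \<tau> + of_int b)"
      proof -
        have "w * (x + y * (u / w)) = w * x + y * u" for x y u using w0 by (simp add: field_simps)
        moreover have "moebius_act (a, b, c, d) \<tau> = (of_int a * \<tau> + of_int b) / w" by (simp add: w_def)
        ultimately show ?thesis by (simp only:)
      qed
      then show ?thesis by (simp add: w_def algebra_simps)
    qed
    then show "(case (case x of (m, n) \<Rightarrow> (d * m + b * n, c * m + a * n)) of (m, n) \<Rightarrow> 1 / (of_int m + of_int n * \<tau>) ^ k) =
       (case x of (m, n) \<Rightarrow> (1 / w ^ k) * (1 / (of_int m + of_int n * moebius_act (a, b, c, d) \<tau>) ^ k))"
      by (simp only: case_prod_conv x) (simp add: power_mult_distrib)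
  qed
  also have "\<dots> = 1 / w ^ k * eisenstein_G k (moebius_act (a, b, c, d) \<tau>)"
    unfolding eisenstein_G_def by (simp only: case_prod_unfold infsum_cmult_right')
  finally show ?thesis using w0 by (simp add: w_def)
qed

text \<open>On \<open>norm q \<le> r < 1\<close> all \<open>q ^ Suc n\<close> stay in the same disc,
  where \<open>l\<close> is bounded, so a geometric series is a majorant. The prefactor has exponent
  \<open>n\<close> and not \<open>Suc n\<close>: one factor \<open>q\<close> of the Lambert series
  is split off, so that later divisions by \<open>q\<close> are purely algebraic.\<close>

lemma lambert_series:
  assumes l: "l holomorphic_on ball 0 1"
  shows "(\<lambda>q. \<Sum>n. q ^ n * l (q ^ Suc n)) holomorphic_on ball (0 :: complex) 1"
    and "q \<in> ball 0 1 \<Longrightarrow> summable (\<lambda>n. q ^ n * l (q ^ Suc n))"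
proof -
  have bd: "\<exists>B. \<forall>n. \<forall>q \<in> cball 0 r. norm (q ^ n * l (q ^ Suc n)) \<le> B * r ^ n" if r: "0 \<le> r" "r < 1" for r
  proof -
    have "compact (l ` cball 0 r)"
      by (intro compact_continuous_image holomorphic_on_imp_continuous_on holomorphic_on_subset[OF l]) (use r in auto)
    then obtain B where B: "\<And>q. q \<in> cball 0 r \<Longrightarrow> norm (l q) \<le> B"
      unfolding bounded_iff[THEN iffD1, THEN ex_forward] using compact_imp_bounded bounded_iff by (metis imageI)
    have "norm (q ^ n * l (q ^ Suc n)) \<le> B * r ^ n" if q: "q \<in> cball 0 r" for n q
    proof -
      have nq: "norm q \<le> r" using q by simp
      have "norm (q ^ Suc n) \<le> norm q ^ 1" unfolding norm_power
        by (rule power_decreasing) (use nq r in auto)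
      then have "norm (l (q ^ Suc n)) \<le> B" using nq by (intro B) auto
      moreover have "norm (q ^ n) \<le> r ^ n" using nq by (simp add: norm_power power_mono)
      ultimately have "norm (q ^ n) * norm (l (q ^ Suc n)) \<le> r ^ n * B"
        by (intro mult_mono) (use r in auto)
      then show ?thesis by (simp only: norm_mult mult.commute)
    qed
    then show ?thesis by blast
  qed
  have sm: "summable (\<lambda>n. B * r ^ n)" if "0 \<le> r" "r < 1" for B r :: real
    using that by (intro summable_mult summable_geometric) auto
  show "summable (\<lambda>n. q ^ n * l (q ^ Suc n))" if "q \<in> ball 0 1" for q
  proof -
    from bd[of "norm q"] that obtain B where "\<forall>n. \<forall>x \<in> cball 0 (norm q). norm (x ^ n * l (x ^ Suc n)) \<le> B * norm q ^ n"
      by auto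
    then have "\<And>n. norm (q ^ n * l (q ^ Suc n)) \<le> B * norm q ^ n" by auto
    then show ?thesis by (intro summable_comparison_test'[OF sm[of "norm q" B], of 0]) (use that in auto)
  qed
  show "(\<lambda>q. \<Sum>n. q ^ n * l (q ^ Suc n)) holomorphic_on ball (0 :: complex) 1"
  proof (rule holomorphic_uniform_sequence[where f = "\<lambda>n q. \<Sum>i<n. q ^ i * l (q ^ Suc i)"])
    fix n
    have m: "q ^ Suc i \<in> ball 0 1" if "q \<in> ball 0 1" for q :: complex and i
      using that by (simp add: norm_power power_less_one_iff del: power_Suc)
    have "(\<lambda>q. l (q ^ Suc i)) holomorphic_on ball 0 1" for i
    proof -
      have "(\<lambda>q::complex. q ^ Suc i) holomorphic_on ball 0 1" by (intro holomorphic_intros)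
      moreover have "(\<lambda>q::complex. q ^ Suc i) ` ball 0 1 \<subseteq> ball 0 1" using m by blast
      ultimately show ?thesis
        using holomorphic_on_compose_gen[of "\<lambda>q. q ^ Suc i" "ball 0 1" l "ball 0 1"] l by (simp only: o_def)
    qed
    then show "(\<lambda>q. \<Sum>i<n. q ^ i * l (q ^ Suc i)) holomorphic_on ball 0 1"
      by (intro holomorphic_intros)
  next
    fix x :: complex assume x: "x \<in> ball 0 1"
    define r where "r = (norm x + 1) / 2"
    have r: "0 \<le> r" "r < 1" "norm x < r" using x by (auto simp: r_def)
    obtain B where B: "\<And>n q. q \<in> cball 0 r \<Longrightarrow> norm (q ^ n * l (q ^ Suc n)) \<le> B * r ^ n"
      using bd r by blast
    have sub: "cball x (r - norm x) \<subseteq> cball 0 r"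
    proof
      fix y assume "y \<in> cball x (r - norm x)"
      then show "y \<in> cball 0 r" using norm_triangle_ineq2[of y x] by (auto simp: dist_norm norm_minus_commute)
    qed
    have "uniform_limit (cball 0 r) (\<lambda>n q. \<Sum>i<n. q ^ i * l (q ^ Suc i)) (\<lambda>q. \<Sum>n. q ^ n * l (q ^ Suc n)) sequentially"
      by (rule Weierstrass_m_test[OF B sm]) (use r in auto)
    then have "uniform_limit (cball x (r - norm x)) (\<lambda>n q. \<Sum>i<n. q ^ i * l (q ^ Suc i)) (\<lambda>q. \<Sum>n. q ^ n * l (q ^ Suc n)) sequentially"
      by (rule uniform_limit_on_subset[OF _ sub])
    then show "\<exists>d>0. cball x d \<subseteq> ball 0 1 \<and> uniform_limit (cball x d) (\<lambda>n q. \<Sum>i<n. q ^ i * l (q ^ Suc i)) (\<lambda>q. \<Sum>n. q ^ n * l (q ^ Suc n)) sequentially"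
      using r sub by (intro exI[of _ "r - norm x"]) (auto simp: subset_iff)
  qed auto
qed

lemma to_q_norm: "norm (to_q \<tau>) = exp (- (2 * pi * Im \<tau>))"
  by (simp add: to_q_def)

lemma to_q_in_ball: "Im \<tau> > 0 \<Longrightarrow> to_q \<tau> \<in> ball 0 1"
  by (simp add: to_q_norm)

lemma to_q_nonzero [simp]: "to_q \<tau> \<noteq> 0"
  by (simp add: to_q_def)

lemma to_q_add_int: "to_q (\<tau> + of_int k) = to_q \<tau>"
proof -
  have "to_q (\<tau> + of_int k) = to_q \<tau> * to_q (of_int k)"
    by (simp add: to_q_def distrib_left exp_add)
  also have "to_q (of_int k) = 1" using to_q_eq_1_iff by auto
  finally show ?thesis by simp
qed

lemma to_q_mult_nat: "to_q (of_nat n * \<tau>) = to_q \<tau> ^ n"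
  by (simp add: to_q_def exp_of_nat_mult[symmetric] mult_ac)

lemma to_q_surj:
  assumes "q \<noteq> 0" "norm q < 1"
  obtains \<tau> where "Im \<tau> > 0" "to_q \<tau> = q"
proof
  show "to_q (Ln q / (2 * pi * \<i>)) = q" using assms by (simp add: to_q_def)
  have "Im (Ln q / (2 * pi * \<i>)) = - Re (Ln q) / (2 * pi)"
    by (simp add: Im_divide power2_eq_square)
  also have "\<dots> > 0" using assms by (simp add: divide_neg_pos ln_less_zero)
  finally show "Im (Ln q / (2 * pi * \<i>)) > 0" .
qed

lemma Im_minus_inverse: "Im (- 1 / \<tau>) = Im \<tau> / norm \<tau> ^ 2"
  by (simp add: Im_divide cmod_power2)

text \<open>
  A quantitative substitute for the valence formula: \<open>\<bar>f(\<tau>)\<bar> (Im \<tau>)\<^sup>l\<close> is invariant under the modular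
  group and decays at \<open>i\<infinity>\<close>, so it attains its maximum at a point with imaginary part at least
  \<open>17/20 < \<surd>3/2\<close>; a vanishing order \<open>n \<ge> l/5\<close> contradicts the maximum principle in \<open>q\<close>.
\<close>

lemma modular_form_vanishes:
  assumes F: "F holomorphic_on ball 0 1"
    and f: "\<And>\<tau>. Im \<tau> > 0 \<Longrightarrow> f \<tau> = to_q \<tau> ^ n * F (to_q \<tau>)"
    and S: "\<And>\<tau>. Im \<tau> > 0 \<Longrightarrow> f (- 1 / \<tau>) = \<tau> ^ (2 * l) * f \<tau>"
    and n: "n > 0" and l: "l \<le> 5 * n" and q: "q \<in> ball 0 1"
  shows "F q = 0"
proof (rule ccontr)
  assume Fq: "F q \<noteq> 0"
  define \<phi> where "\<phi> = (\<lambda>\<tau>. norm (f \<tau>) * Im \<tau> ^ l)"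
  have \<phi>T: "\<phi> (\<tau> + of_int k) = \<phi> \<tau>" if "Im \<tau> > 0" for \<tau> k
    using that by (simp add: \<phi>_def f to_q_add_int)
  have \<phi>S: "\<phi> (- 1 / \<tau>) = \<phi> \<tau>" if "Im \<tau> > 0" for \<tau>
  proof -
    have "\<tau> \<noteq> 0" using that by auto
    then show ?thesis
      unfolding \<phi>_def S[OF that] Im_minus_inverse
      by (simp add: norm_mult norm_power power_divide power_mult)
  qed
  have shift: "\<exists>\<tau>'. Im \<tau>' = Im \<tau> \<and> \<bar>Re \<tau>'\<bar> \<le> 1 / 2 \<and> \<phi> \<tau>' = \<phi> \<tau>" if "Im \<tau> > 0" for \<tau>
  proof (intro exI conjI)
    show "Im (\<tau> + of_int (- round (Re \<tau>))) = Im \<tau>" by simp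
    show "\<bar>Re (\<tau> + of_int (- round (Re \<tau>)))\<bar> \<le> 1 / 2"
      using of_int_round_abs_le[of "Re \<tau>"] by (simp add: abs_minus_commute)
    show "\<phi> (\<tau> + of_int (- round (Re \<tau>))) = \<phi> \<tau>" by (rule \<phi>T[OF that])
  qed
  \<comment> \<open>\<open>c = (1/2)^2 + (17/20)^2\<close> bounds \<open>norm \<tau> ^ 2\<close>
    when the real part is reduced and the imaginary part is below 17/20. Inversion then enlarges the
    imaginary part by at least the factor \<open>1 / c > 1\<close>, so finitely many steps reach
    17/20; this takes the place of a fundamental domain.\<close>
  define c :: real where "c = 389 / 400"
  have red0: "\<exists>\<tau>'. Im \<tau>' \<ge> 17 / 20 \<and> \<bar>Re \<tau>'\<bar> \<le> 1 / 2 \<and> \<phi> \<tau>' = \<phi> \<tau>"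
    if "Im \<tau> > 0" "Im \<tau> \<ge> 17 / 20 * c ^ j" for \<tau> j
    using that
  proof (induction j arbitrary: \<tau>)
    case 0
    obtain \<tau>' where "Im \<tau>' = Im \<tau> \<and> \<bar>Re \<tau>'\<bar> \<le> 1 / 2 \<and> \<phi> \<tau>' = \<phi> \<tau>" using shift[of \<tau>] 0 by blast
    then show ?case using 0 by (intro exI[of _ \<tau>']) auto
  next
    case (Suc j)
    show ?case
    proof (cases "Im \<tau> \<ge> 17 / 20")
      case True
      obtain \<tau>' where "Im \<tau>' = Im \<tau> \<and> \<bar>Re \<tau>'\<bar> \<le> 1 / 2 \<and> \<phi> \<tau>' = \<phi> \<tau>" using shift[of \<tau>] Suc.prems by blast
      then show ?thesis using True by (intro exI[of _ \<tau>']) auto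
    next
      case False
      obtain \<tau>' where \<tau>': "Im \<tau>' = Im \<tau>" "\<bar>Re \<tau>'\<bar> \<le> 1 / 2" "\<phi> \<tau>' = \<phi> \<tau>"
        using shift[of \<tau>] Suc.prems by auto
      have "\<bar>Re \<tau>'\<bar> ^ 2 \<le> (1 / 2) ^ 2" "Im \<tau>' ^ 2 \<le> (17 / 20) ^ 2"
        using \<tau>' False Suc.prems by (intro power_mono; simp)+
      then have nc: "norm \<tau>' ^ 2 \<le> c" unfolding cmod_power2 c_def by (simp add: power_divide)
      have np: "norm \<tau>' ^ 2 > 0" using \<tau>' Suc.prems by auto
      have i0: "Im (- 1 / \<tau>') > 0" unfolding Im_minus_inverse using np \<tau>' Suc.prems by simp
      have "17 / 20 * c ^ j * norm \<tau>' ^ 2 \<le> 17 / 20 * c ^ j * c"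
        by (rule mult_left_mono[OF nc]) (simp add: c_def)
      also have "\<dots> \<le> Im \<tau>'" using Suc.prems \<tau>' by (simp add: mult_ac)
      finally have "17 / 20 * c ^ j \<le> Im (- 1 / \<tau>')"
        unfolding Im_minus_inverse using np by (simp add: pos_le_divide_eq)
      from Suc.IH[OF i0 this] show ?thesis using \<phi>S[of \<tau>'] \<tau>' Suc.prems by auto
    qed
  qed
  have red: "\<exists>\<tau>'. Im \<tau>' \<ge> 17 / 20 \<and> \<bar>Re \<tau>'\<bar> \<le> 1 / 2 \<and> \<phi> \<tau>' = \<phi> \<tau>" if pos: "Im \<tau> > 0" for \<tau>
  proof -
    obtain j where "c ^ j < Im \<tau> / (17 / 20)"
      using real_arch_pow_inv[of "Im \<tau> / (17 / 20)" c] pos by (auto simp: c_def)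
    then show ?thesis by (intro red0[OF pos, of j]) (simp add: field_simps)
  qed
  have Fc: "continuous_on (ball 0 1) F" using F by (rule holomorphic_on_imp_continuous_on)
  obtain q1 where q1: "q1 \<noteq> 0" "norm q1 < 1" "F q1 \<noteq> 0"
  proof (cases "q = 0")
    case False
    then show ?thesis using that[of q] Fq q by auto
  next
    case True
    have "isCont F 0" using Fc by (simp add: continuous_on_eq_continuous_at)
    then have "eventually (\<lambda>z. F z \<noteq> 0) (at 0)"
      using Fq True by (auto intro: tendsto_imp_eventually_ne simp: isCont_def)
    moreover have "eventually (\<lambda>z::complex. norm z < 1) (at 0)"
      by (rule eventually_at_in_open'[of "ball 0 1", THEN eventually_mono]) auto
    moreover have "eventually (\<lambda>z::complex. z \<noteq> 0) (at 0)" by (simp add: eventually_at_filter)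
    ultimately have "eventually (\<lambda>z. F z \<noteq> 0 \<and> norm z < 1 \<and> z \<noteq> 0) (at 0)" by eventually_elim auto
    then obtain z where "F z \<noteq> 0 \<and> norm z < 1 \<and> z \<noteq> 0"
      using eventually_happens'[of "at (0 :: complex)"] by (metis (mono_tags, lifting) at_neq_bot)
    then show ?thesis using that by blast
  qed
  obtain \<tau>1' where "Im \<tau>1' > 0" "to_q \<tau>1' = q1" using to_q_surj q1 by blast
  then obtain \<tau>1 where \<tau>1: "Im \<tau>1 \<ge> 17 / 20" "\<bar>Re \<tau>1\<bar> \<le> 1 / 2" and "\<phi> \<tau>1 = \<phi> \<tau>1'"
    using red by blast
  then have \<phi>1: "\<phi> \<tau>1 > 0" using \<open>Im \<tau>1' > 0\<close> \<open>to_q \<tau>1' = q1\<close> q1 by (simp add: \<phi>_def f)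
  define \<rho> where "\<rho> = exp (- (2 * pi * (17 / 20)))"
  have \<rho>: "\<rho> < 1" by (simp add: \<rho>_def)
  have "compact (F ` cball 0 \<rho>)"
    by (intro compact_continuous_image continuous_on_subset[OF Fc]) (use \<rho> in auto)
  then obtain B where B: "B > 0" "\<And>z. z \<in> cball 0 \<rho> \<Longrightarrow> norm (F z) \<le> B"
    using compact_imp_bounded bounded_pos by (metis imageI)
  have \<phi>B: "\<phi> \<tau> \<le> B * (Im \<tau> ^ l / exp (Im \<tau>))" if "Im \<tau> \<ge> 17 / 20" for \<tau>
  proof -
    have "norm (to_q \<tau>) \<le> \<rho>" using that by (simp add: to_q_norm \<rho>_def)
    then have 1: "norm (F (to_q \<tau>)) \<le> B" by (intro B) auto
    have "exp (- (2 * pi * Im \<tau>)) \<le> exp (- Im \<tau>)"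
      using that pi_gt3 by (simp add: mult_le_cancel_right1)
    then have 2: "norm (to_q \<tau> ^ n) \<le> exp (- Im \<tau>)"
    proof -
      have "norm (to_q \<tau> ^ n) \<le> norm (to_q \<tau>) ^ 1" unfolding norm_power
        by (rule power_decreasing) (use n that in \<open>auto simp: to_q_norm\<close>)
      also have "\<dots> \<le> exp (- Im \<tau>)" using \<open>exp (- (2 * pi * Im \<tau>)) \<le> exp (- Im \<tau>)\<close> by (simp add: to_q_norm)
      finally show ?thesis .
    qed
    have "norm (f \<tau>) \<le> exp (- Im \<tau>) * B"
      unfolding f[OF order.strict_trans2[OF _ that], simplified] norm_mult
      by (intro mult_mono 1 2) auto
    then have "\<phi> \<tau> \<le> exp (- Im \<tau>) * B * Im \<tau> ^ l"
      unfolding \<phi>_def using that by (intro mult_right_mono) auto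
    then show ?thesis by (simp add: exp_minus field_simps)
  qed
  have "((\<lambda>y. B * (y ^ l / exp y)) \<longlongrightarrow> B * 0) at_top"
    by (intro tendsto_intros tendsto_power_div_exp_0)
  then have "eventually (\<lambda>y. B * (y ^ l / exp y) < \<phi> \<tau>1) at_top"
    using \<phi>1 by (intro order_tendstoD(2)[where y = "B * 0"]) auto
  then obtain Y where Y: "\<And>y. y \<ge> Y \<Longrightarrow> B * (y ^ l / exp y) < \<phi> \<tau>1"
    by (auto simp: eventually_at_top_linorder)
  \<comment> \<open>Above height \<open>Y\<close> the decay keeps \<open>\<phi>\<close> below its
    value at \<open>\<tau>1\<close>, so the maximum over this compact rectangle is a global
    one.\<close>
  define R where "R = cbox (Complex (- 1 / 2) (17 / 20)) (Complex (1 / 2) Y)"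
  have inR: "\<tau> \<in> R \<longleftrightarrow> - 1 / 2 \<le> Re \<tau> \<and> Re \<tau> \<le> 1 / 2 \<and> 17 / 20 \<le> Im \<tau> \<and> Im \<tau> \<le> Y" for \<tau>
    by (auto simp: R_def in_cbox_complex_iff)
  have \<tau>1Y: "Im \<tau>1 \<le> Y"
  proof (rule ccontr)
    assume "\<not> Im \<tau>1 \<le> Y"
    then have "B * (Im \<tau>1 ^ l / exp (Im \<tau>1)) < \<phi> \<tau>1" by (intro Y) auto
    with \<phi>B[OF \<tau>1(1)] show False by linarith
  qed
  have "\<tau>1 \<in> R" using \<tau>1 \<tau>1Y by (auto simp: inR abs_le_iff)
  have cont: "continuous_on R \<phi>"
  proof -
    have "continuous_on R (\<lambda>\<tau>. norm (to_q \<tau> ^ n * F (to_q \<tau>)) * Im \<tau> ^ l)"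
    proof (intro continuous_intros)
      show "continuous_on R to_q" unfolding to_q_def by (intro continuous_intros)
      then show "continuous_on R (\<lambda>\<tau>. F (to_q \<tau>))"
        by (rule continuous_on_compose2[OF Fc]) (use inR to_q_in_ball in force)
    qed
    then show ?thesis by (rule continuous_on_eq) (auto simp: \<phi>_def inR f)
  qed
  obtain \<tau>0 where \<tau>0: "\<tau>0 \<in> R" "\<And>\<tau>. \<tau> \<in> R \<Longrightarrow> \<phi> \<tau> \<le> \<phi> \<tau>0"
    using continuous_attains_sup[OF _ _ cont] \<open>\<tau>1 \<in> R\<close> by (metis R_def compact_cbox empty_iff)
  have max: "\<phi> \<tau> \<le> \<phi> \<tau>0" if pos: "Im \<tau> > 0" for \<tau>
  proof -
    obtain \<tau>' where \<tau>': "Im \<tau>' \<ge> 17 / 20" "\<bar>Re \<tau>'\<bar> \<le> 1 / 2" "\<phi> \<tau>' = \<phi> \<tau>" using red[OF pos] by blast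
    show ?thesis
    proof (cases "Im \<tau>' \<le> Y")
      case True
      then have "\<tau>' \<in> R" using \<tau>' by (auto simp: inR abs_le_iff)
      then show ?thesis using \<tau>0(2)[of \<tau>'] \<tau>' by simp
    next
      case False
      then have "\<phi> \<tau>' < \<phi> \<tau>1" using Y[of "Im \<tau>'"] \<phi>B[OF \<tau>'(1)] by auto
      then show ?thesis using \<tau>0(2)[OF \<open>\<tau>1 \<in> R\<close>] \<tau>' by auto
    qed
  qed
  have \<phi>0: "\<phi> \<tau>0 > 0" using \<phi>1 \<tau>0(2)[OF \<open>\<tau>1 \<in> R\<close>] by linarith
  define y0 where "y0 = Im \<tau>0"
  \<comment> \<open>5/6 lies just below 17/20, so the maximum point is inside the comparison circle,
    and it makes \<open>5 * (1 / y1) = 6 < 2 * pi\<close> in the final estimate.\<close>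
  define y1 :: real where "y1 = 5 / 6"
  define q0 where "q0 = to_q \<tau>0"
  have y0: "y0 \<ge> 17 / 20" using \<tau>0(1) by (simp add: inR y0_def)
  define r where "r = exp (- (2 * pi * y1))"
  have r: "0 < r" "r < 1" by (auto simp: r_def y1_def)
  \<comment> \<open>On the circle of radius \<open>r\<close> the imaginary part is
    \<open>y1\<close>, so there \<open>F\<close> is controlled by the maximum of
    \<open>\<phi>\<close>; the maximum principle carries this bound to \<open>q0\<close>.\<close>
  have "norm (F q0) \<le> \<phi> \<tau>0 / (y1 ^ l * r ^ n)"
  proof (rule maximum_modulus_frontier[where S = "cball 0 r" and f = F])
    show "F holomorphic_on interior (cball 0 r)" by (rule holomorphic_on_subset[OF F]) (use r in auto)
    show "continuous_on (closure (cball 0 r)) F" by (rule continuous_on_subset[OF Fc]) (use r in auto)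
    show "q0 \<in> cball 0 r" using y0 by (simp add: q0_def to_q_norm r_def y1_def y0_def)
    fix z :: complex assume "z \<in> frontier (cball 0 r)"
    then have z: "norm z = r" using r by (simp add: frontier_cball)
    have "z \<noteq> 0" "norm z < 1" using z r by auto
    then obtain \<tau> where \<tau>: "Im \<tau> > 0" "to_q \<tau> = z" using to_q_surj by blast
    have "exp (- (2 * pi * Im \<tau>)) = exp (- (2 * pi * y1))" using z \<tau> by (simp add: to_q_norm[symmetric] r_def)
    then have "Im \<tau> = y1" by simp
    then have "norm z ^ n * norm (F z) * y1 ^ l \<le> \<phi> \<tau>0" using max[OF \<tau>(1)] \<tau> by (simp add: \<phi>_def f norm_mult norm_power)
    then show "norm (F z) \<le> \<phi> \<tau>0 / (y1 ^ l * r ^ n)" using z r by (simp add: field_simps y1_def)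
  qed auto
  moreover have "norm (F q0) = \<phi> \<tau>0 / (y0 ^ l * exp (- (2 * pi * y0)) ^ n)"
  proof -
    have "\<phi> \<tau>0 = exp (- (2 * pi * y0)) ^ n * norm (F q0) * y0 ^ l"
      using y0 by (simp add: \<phi>_def f y0_def norm_mult norm_power to_q_norm q0_def)
    then show ?thesis using y0 by simp
  qed
  ultimately have "1 / (y0 ^ l * exp (- (2 * pi * y0)) ^ n) \<le> 1 / (y1 ^ l * r ^ n)"
    using mult_le_cancel_left_pos[OF \<phi>0, of "1 / (y0 ^ l * exp (- (2 * pi * y0)) ^ n)" "1 / (y1 ^ l * r ^ n)"] by simp
  then have le: "y1 ^ l * r ^ n \<le> y0 ^ l * exp (- (2 * pi * y0)) ^ n"
    using y0 r by (simp add: field_simps y1_def)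
  have y01: "y0 > 0" "y1 > 0" "y0 > y1" using y0 by (auto simp: y1_def)
  have "ln (y1 ^ l * r ^ n) \<le> ln (y0 ^ l * exp (- (2 * pi * y0)) ^ n)"
    by (subst ln_le_cancel_iff) (use le y01 r in auto)
  then have "real l * ln y1 - real n * (2 * pi * y1) \<le> real l * ln y0 - real n * (2 * pi * y0)"
    using y01 r by (simp add: ln_mult ln_realpow r_def)
  then have "real n * (2 * pi * (y0 - y1)) \<le> real l * (ln y0 - ln y1)" by (simp add: algebra_simps)
  also have "ln y0 - ln y1 = ln (y0 / y1)" using y01 by (simp add: ln_div)
  also have "real l * ln (y0 / y1) \<le> real l * (y0 / y1 - 1)"
    using y01 by (intro mult_left_mono ln_le_minus_one) auto
  also have "\<dots> \<le> real (5 * n) * (y0 / y1 - 1)"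
    using l y01 by (intro mult_right_mono) auto
  also have "y0 / y1 - 1 = (y0 - y1) * (6 / 5)" by (simp add: y1_def)
  finally have "(real n * (y0 - y1)) * (2 * pi) \<le> (real n * (y0 - y1)) * 6" by (simp add: algebra_simps)
  then have "2 * pi \<le> 6" using n y01 by (subst (asm) mult_le_cancel_left_pos) auto
  then show False using pi_gt3 by simp
qed

section \<open>The discriminant and the Klein invariant\<close>

text \<open>
  The factors are Eulerian polynomials, so that \<open>e4\<close> and \<open>e6\<close> are the Lambert series
  \<open>E\<^sub>4 = 1 + 240 \<Sum> n\<^sup>3 q\<^sup>n / (1 - q\<^sup>n)\<close> and \<open>E\<^sub>6 = 1 - 504 \<Sum> n\<^sup>5 q\<^sup>n / (1 - q\<^sup>n)\<close>. In \<open>d1\<close> the factor \<open>q\<close>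
  has been cancelled from \<open>(E\<^sub>4\<^sup>3 - E\<^sub>6\<^sup>2) / 1728\<close>.
\<close>

definition m4 :: "complex \<Rightarrow> complex" where
  "m4 q = (\<Sum>n. q ^ n * ((\<lambda>q. (1 + 4 * q + q ^ 2) / (1 - q) ^ 4) (q ^ Suc n)))"

definition m6 :: "complex \<Rightarrow> complex" where
  "m6 q = (\<Sum>n. q ^ n * ((\<lambda>q. (1 + 26 * q + 66 * q ^ 2 + 26 * q ^ 3 + q ^ 4) / (1 - q) ^ 6) (q ^ Suc n)))"

definition e4 :: "complex \<Rightarrow> complex" where "e4 q = 1 + 240 * q * m4 q"
definition e6 :: "complex \<Rightarrow> complex" where "e6 q = 1 - 504 * q * m6 q"

definition d1 :: "complex \<Rightarrow> complex" where
  "d1 q = (720 * m4 q + 1008 * m6 q + q * (172800 * m4 q ^ 2 - 254016 * m6 q ^ 2) + 13824000 * q ^ 2 * m4 q ^ 3) / 1728"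

definition delta :: "complex \<Rightarrow> complex" where "delta q = q * d1 q"

lemma delta_eq: "delta q = (e4 q ^ 3 - e6 q ^ 2) / 1728"
  unfolding delta_def d1_def e4_def e6_def by (simp add: field_simps power2_eq_square power3_eq_cube)

lemma m4_holo: "m4 holomorphic_on ball 0 1" and m6_holo: "m6 holomorphic_on ball 0 1"
  unfolding m4_def m6_def by (intro lambert_series(1) holomorphic_intros; auto)+

lemma m4_0 [simp]: "m4 0 = 1" and m6_0 [simp]: "m6 0 = 1"
proof -
  have "(\<Sum>n. (0 :: complex) ^ n * c n) = c 0" for c
    using powser_zero[of c] by (simp add: mult.commute)
  from this[of "\<lambda>n. 1"] show "m4 0 = 1" "m6 0 = 1" unfolding m4_def m6_def by simp_all
qed

lemma e4_holo [holomorphic_intros]: "e4 holomorphic_on ball 0 1"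
  and e6_holo [holomorphic_intros]: "e6 holomorphic_on ball 0 1"
  and d1_holo [holomorphic_intros]: "d1 holomorphic_on ball 0 1"
  unfolding e4_def e6_def d1_def by (intro holomorphic_intros m4_holo m6_holo; simp)+

lemma delta_holo: "delta holomorphic_on ball 0 1"
  unfolding delta_def by (intro holomorphic_intros)

lemma d1_0 [simp]: "d1 0 = 1" and e4_0 [simp]: "e4 0 = 1" and e6_0 [simp]: "e6 0 = 1"
  by (simp_all add: d1_def e4_def e6_def)

lemma to_q_nat_mult_notin: "Im \<tau> > 0 \<Longrightarrow> of_nat (Suc j) * \<tau> \<notin> \<int>"
proof
  assume t: "Im \<tau> > 0" and "of_nat (Suc j) * \<tau> \<in> \<int>"
  then obtain k where "of_nat (Suc j) * \<tau> = of_int k" by (auto elim: Ints_cases)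
  then have "Im (of_nat (Suc j) * \<tau>) = 0" by (metis Im_complex_of_real of_real_of_int_eq)
  moreover have "Im (of_nat (Suc j) * \<tau>) = real (Suc j) * Im \<tau>" by (simp del: of_nat_Suc)
  ultimately show False using t by (simp del: of_nat_Suc)
qed

lemma G4_eq: 
  assumes "Im \<tau> > 0"
  shows "eisenstein_G 4 \<tau> = pi ^ 4 / 45 * e4 (to_q \<tau>)"
proof -
  let ?l = "\<lambda>q :: complex. (1 + 4 * q + q ^ 2) / (1 - q) ^ 4"
  let ?q = "to_q \<tau>"
  have q: "?q \<in> ball 0 1" by (rule to_q_in_ball[OF assms])
  have s: "summable (\<lambda>n. ?q ^ n * ?l (?q ^ Suc n))"
    by (intro lambert_series(2)[OF _ q] holomorphic_intros) auto
  have "bilat 3 (of_nat (Suc j) * \<tau>) / fact 3 = (16 * pi ^ 4 / 6 * ?q) * (?q ^ j * ?l (?q ^ Suc j))" for j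
    unfolding bilat_3(1)[OF to_q_nat_mult_notin[OF assms]] to_q_mult_nat
    by (simp add: fact_numeral)
  then have "(\<Sum>j. bilat 3 (of_nat (Suc j) * \<tau>) / fact 3) = (16 * pi ^ 4 / 6 * ?q) * m4 ?q"
    unfolding m4_def by (simp only: suminf_mult[OF s])
  then have "eisenstein_G (Suc 3) \<tau> = 2 * (pi ^ 4 / 90) + 2 * ((16 * pi ^ 4 / 6 * ?q) * m4 ?q)"
    using eisenstein_G_expand[of \<tau> 3] assms zeta_4 by (simp del: of_nat_Suc add: field_simps)
  then show ?thesis by (simp add: e4_def algebra_simps)
qed

lemma G6_eq: 
  assumes "Im \<tau> > 0"
  shows "eisenstein_G 6 \<tau> = 2 * pi ^ 6 / 945 * e6 (to_q \<tau>)"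
proof -
  let ?l = "\<lambda>q :: complex. (1 + 26 * q + 66 * q ^ 2 + 26 * q ^ 3 + q ^ 4) / (1 - q) ^ 6"
  let ?q = "to_q \<tau>"
  have q: "?q \<in> ball 0 1" by (rule to_q_in_ball[OF assms])
  have s: "summable (\<lambda>n. ?q ^ n * ?l (?q ^ Suc n))"
    by (intro lambert_series(2)[OF _ q] holomorphic_intros) auto
  have "bilat 5 (of_nat (Suc j) * \<tau>) / fact 5 = (- 64 * pi ^ 6 / 120 * ?q) * (?q ^ j * ?l (?q ^ Suc j))" for j
    unfolding bilat_3(2)[OF to_q_nat_mult_notin[OF assms]] to_q_mult_nat
    by (simp add: fact_numeral)
  then have "(\<Sum>j. bilat 5 (of_nat (Suc j) * \<tau>) / fact 5) = (- 64 * pi ^ 6 / 120 * ?q) * m6 ?q"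
    unfolding m6_def by (simp only: suminf_mult[OF s])
  then have "eisenstein_G (Suc 5) \<tau> = 2 * (pi ^ 6 / 945) + 2 * ((- 64 * pi ^ 6 / 120 * ?q) * m6 ?q)"
    using eisenstein_G_expand[of \<tau> 5] assms by (simp only:) (simp add: zeta_6)
  then show ?thesis by (simp add: e6_def algebra_simps)
qed

lemma moebius_Im:
  assumes "a * d - b * c = 1" "Im \<tau> > 0"
  shows "of_int c * \<tau> + of_int d \<noteq> 0" and "Im (moebius_act (a, b, c, d) \<tau>) > 0"
proof -
  define w where "w = of_int c * \<tau> + of_int d"
  show w0: "of_int c * \<tau> + of_int d \<noteq> 0"
  proof
    assume "of_int c * \<tau> + of_int d = 0"
    then have "Im (of_int c * \<tau> + of_int d) = 0" "Re (of_int c * \<tau> + of_int d) = 0" by auto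
    then have "c = 0" "d = 0" using assms(2) by auto
    then show False using assms(1) by simp
  qed
  have "Im (moebius_act (a, b, c, d) \<tau>) = of_int (a * d - b * c) * Im \<tau> / norm w ^ 2"
  proof -
    have "Im (of_int a * \<tau> + of_int b) * Re w - Re (of_int a * \<tau> + of_int b) * Im w = of_int (a * d - b * c) * Im \<tau>"
      by (simp add: w_def algebra_simps)
    then show ?thesis unfolding moebius_act.simps w_def[symmetric] Im_divide cmod_power2 by simp
  qed
  also have "\<dots> = Im \<tau> / norm w ^ 2" using assms(1) by simp
  finally show "Im (moebius_act (a, b, c, d) \<tau>) > 0"
    using assms(2) w0 by (simp add: w_def)
qed

lemma e4_modular:
  assumes "a * d - b * c = 1" "Im \<tau> > 0"
  shows "e4 (to_q (moebius_act (a, b, c, d) \<tau>)) = (of_int c * \<tau> + of_int d) ^ 4 * e4 (to_q \<tau>)"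
    and "e6 (to_q (moebius_act (a, b, c, d) \<tau>)) = (of_int c * \<tau> + of_int d) ^ 6 * e6 (to_q \<tau>)"
    and "delta (to_q (moebius_act (a, b, c, d) \<tau>)) = (of_int c * \<tau> + of_int d) ^ 12 * delta (to_q \<tau>)"
proof -
  show 4: "e4 (to_q (moebius_act (a, b, c, d) \<tau>)) = (of_int c * \<tau> + of_int d) ^ 4 * e4 (to_q \<tau>)"
    using eisenstein_G_modular[OF assms, of 4] G4_eq[OF assms(2)] G4_eq[OF moebius_Im(2)[OF assms]] by simp
  show 6: "e6 (to_q (moebius_act (a, b, c, d) \<tau>)) = (of_int c * \<tau> + of_int d) ^ 6 * e6 (to_q \<tau>)"
    using eisenstein_G_modular[OF assms, of 6] G6_eq[OF assms(2)] G6_eq[OF moebius_Im(2)[OF assms]] by simp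
  show "delta (to_q (moebius_act (a, b, c, d) \<tau>)) = (of_int c * \<tau> + of_int d) ^ 12 * delta (to_q \<tau>)"
    unfolding delta_eq 4 6 by (simp add: power_mult_distrib right_diff_distrib flip: power_mult)
qed

text \<open>\<open>g2 ^ 3\<close> and \<open>27 * g3 ^ 2\<close> both carry the factor
  \<open>64 * pi ^ 12 / 27\<close>, which cancels in the quotient; 1728 is absorbed by
  \<open>delta_eq\<close>.\<close>

lemma klein_j_eq:
  assumes "Im \<tau> > 0"
  shows "klein_j \<tau> = e4 (to_q \<tau>) ^ 3 / delta (to_q \<tau>)"
proof -
  have "klein_j \<tau> = 1728 * (64 * pi ^ 12 / 27 * e4 (to_q \<tau>) ^ 3) / (64 * pi ^ 12 / 27 * (1728 * delta (to_q \<tau>)))"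
  proof -
    have 1: "(60 * eisenstein_G 4 \<tau>) ^ 3 = 64 * pi ^ 12 / 27 * e4 (to_q \<tau>) ^ 3"
      unfolding G4_eq[OF assms] by (simp add: power_mult_distrib power_divide flip: power_mult)
    have 2: "27 * (140 * eisenstein_G 6 \<tau>) ^ 2 = 64 * pi ^ 12 / 27 * e6 (to_q \<tau>) ^ 2"
      unfolding G6_eq[OF assms] by (simp add: power_mult_distrib power_divide flip: power_mult)
    have "1728 * delta (to_q \<tau>) = e4 (to_q \<tau>) ^ 3 - e6 (to_q \<tau>) ^ 2" by (simp add: delta_eq)
    then show ?thesis unfolding klein_j_def Let_def 1 2 by (simp only: right_diff_distrib)
  qed
  also have "\<dots> = e4 (to_q \<tau>) ^ 3 / delta (to_q \<tau>)" by simp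
  finally show ?thesis .
qed

section \<open>Derivatives of modular forms and Ramanujan's equations\<close>

definition tpi :: complex where "tpi = 2 * pi * \<i>"
text \<open>With \<open>\<theta> = q d/dq\<close> one has \<open>d/d\<tau> = tpi * \<theta>\<close>.
  The inverse constant is the coefficient of the correction terms by which \<open>\<theta>\<close>
  fails to preserve modularity.\<close>

definition c2pi :: complex where "c2pi = 1 / tpi"

lemma c2pi: "c2pi * tpi = 1" by (simp add: c2pi_def tpi_def)

text \<open>The transformation law \<open>R\<close> is differentiated and solved for
  \<open>\<theta> h\<close> at the transformed point; \<open>\<tau> ^ 2\<close> is the inverse of
  the derivative of the inversion.\<close>

lemma theta_S:
  assumes h: "h holomorphic_on ball 0 1"
    and R: "\<And>\<tau>. Im \<tau> > 0 \<Longrightarrow> h (to_q (- 1 / \<tau>)) = R \<tau>"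
    and R': "(R has_field_derivative R') (at \<tau>)" and \<tau>: "Im \<tau> > 0"
  shows "to_q (- 1 / \<tau>) * deriv h (to_q (- 1 / \<tau>)) = c2pi * (\<tau> ^ 2 * R')"
proof -
  have t0: "\<tau> \<noteq> 0" using \<tau> by auto
  have i: "Im (- 1 / \<tau>) > 0" unfolding Im_minus_inverse using \<tau> t0 by simp
  have "(h has_field_derivative deriv h (to_q (- 1 / \<tau>))) (at (to_q (- 1 / \<tau>)))"
    by (rule holomorphic_derivI[OF h]) (use to_q_in_ball[OF i] in auto)
  moreover have "((\<lambda>\<tau>. to_q (- 1 / \<tau>)) has_field_derivative 2 * pi * \<i> * to_q (- 1 / \<tau>) * (1 / \<tau> ^ 2)) (at \<tau>)"
    using t0 by (auto intro!: derivative_eq_intros simp: power2_eq_square)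
  ultimately have "((\<lambda>\<tau>. h (to_q (- 1 / \<tau>))) has_field_derivative deriv h (to_q (- 1 / \<tau>)) * (2 * pi * \<i> * to_q (- 1 / \<tau>) * (1 / \<tau> ^ 2))) (at \<tau>)"
    by (rule DERIV_chain2)
  moreover have "((\<lambda>\<tau>. h (to_q (- 1 / \<tau>))) has_field_derivative R') (at \<tau>)"
    by (rule has_field_derivative_transform_within_open[OF R' open_halfspace_Im_gt[of 0]]) (use R \<tau> in auto)
  ultimately have "deriv h (to_q (- 1 / \<tau>)) * (2 * pi * \<i> * to_q (- 1 / \<tau>) * (1 / \<tau> ^ 2)) = R'"
    by (rule DERIV_unique)
  then show ?thesis using t0 by (auto simp: c2pi_def tpi_def field_simps)
qed

lemma deriv_to_q:
  assumes "h holomorphic_on ball 0 1" "Im \<tau> > 0"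
  shows "((\<lambda>\<tau>. h (to_q \<tau>)) has_field_derivative tpi * (to_q \<tau> * deriv h (to_q \<tau>))) (at \<tau>)"
proof -
  have "(h has_field_derivative deriv h (to_q \<tau>)) (at (to_q \<tau>))"
    by (rule holomorphic_derivI[OF assms(1)]) (use to_q_in_ball[OF assms(2)] in auto)
  from DERIV_chain2[OF this to_q_deriv] show ?thesis by (simp add: mult_ac tpi_def)
qed

text \<open>
  With \<open>\<theta> = q d/dq\<close>, these are \<open>\<theta>\<Delta> / q\<close> and \<open>\<theta>\<^sup>2\<Delta> / q\<close>; the quotient \<open>d2 / d1\<close> is \<open>E\<^sub>2\<close>.
\<close>

definition d2 :: "complex \<Rightarrow> complex" where "d2 q = d1 q + q * deriv d1 q"
definition d3 :: "complex \<Rightarrow> complex" where "d3 q = d1 q + 3 * q * deriv d1 q + q ^ 2 * deriv (deriv d1) q"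

lemma d1'_holo: "deriv d1 holomorphic_on ball 0 1" "deriv (deriv d1) holomorphic_on ball 0 1"
  by (intro holomorphic_deriv d1_holo open_ball)+

lemma d2_holo: "d2 holomorphic_on ball 0 1"
  unfolding d2_def by (intro holomorphic_intros d1'_holo)

lemma delta_deriv: "q \<in> ball 0 1 \<Longrightarrow> (delta has_field_derivative d2 q) (at q)"
  unfolding delta_def d2_def
  by (auto intro!: derivative_eq_intros holomorphic_derivI[OF d1_holo])

lemma theta_delta_deriv: "q \<in> ball 0 1 \<Longrightarrow> ((\<lambda>q. q * d2 q) has_field_derivative d3 q) (at q)"
  unfolding d2_def d3_def
  by (auto intro!: derivative_eq_intros holomorphic_derivI[OF d1_holo] holomorphic_derivI[OF d1'_holo(1)] simp: algebra_simps power2_eq_square)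

lemma S_rules:
  assumes "Im \<tau> > 0"
  shows "e4 (to_q (- 1 / \<tau>)) = \<tau> ^ 4 * e4 (to_q \<tau>)" "e6 (to_q (- 1 / \<tau>)) = \<tau> ^ 6 * e6 (to_q \<tau>)"
    "delta (to_q (- 1 / \<tau>)) = \<tau> ^ 12 * delta (to_q \<tau>)"
  using e4_modular[of 0 0 "-1" 1 \<tau>] assms by simp_all

lemma deriv_power_mult:
  assumes "(g has_field_derivative g') (at z)"
  shows "((\<lambda>z :: complex. z ^ n * g z) has_field_derivative of_nat n * z ^ (n - 1) * g z + z ^ n * g') (at z)"
  using assms by (auto intro!: derivative_eq_intros)

text \<open>One derivative takes weight \<open>n + 1\<close> to \<open>n + 3\<close> with a
  correction of coefficient \<open>(n + 1) * c\<close>. For the second derivative of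
  \<open>\<Delta>\<close> the law of weight 14 is differentiated again, whence
  \<open>26 = 14 + 12\<close> and \<open>156 = 12 * 13\<close>. Function values are free variables,
  so that only ring arithmetic is involved.\<close>

lemma theta_S_algebra:
  fixes c t z g h k :: complex
  assumes "c * t = 1"
  shows "c * (z ^ 2 * (of_nat (Suc n) * z ^ n * k + z ^ Suc n * (t * g)))
      = z ^ (n + 3) * g + of_nat (Suc n) * c * z ^ (n + 2) * k"
    and "c * (z ^ 2 * (14 * z ^ 13 * g + z ^ 14 * (t * h) + (156 * c * z ^ 12 * k + 12 * c * z ^ 13 * (t * g))))
      = z ^ 16 * h + 26 * c * z ^ 15 * g + 156 * c ^ 2 * z ^ 14 * k"
proof -
  have "c * (z ^ 2 * (of_nat (Suc n) * z ^ n * k + z ^ Suc n * (t * g)))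
     = (c * t) * (z ^ 2 * z ^ Suc n) * g + of_nat (Suc n) * c * (z ^ 2 * z ^ n) * k"
    by (simp only: distrib_left mult_ac add_ac)
  then show "c * (z ^ 2 * (of_nat (Suc n) * z ^ n * k + z ^ Suc n * (t * g)))
      = z ^ (n + 3) * g + of_nat (Suc n) * c * z ^ (n + 2) * k"
    unfolding assms power_add[symmetric] by (simp only: mult_1 add.commute) (simp add: numeral_eq_Suc)
  have "c * (z ^ 2 * (14 * z ^ 13 * g + z ^ 14 * (t * h) + (156 * c * z ^ 12 * k + 12 * c * z ^ 13 * (t * g))))
     = (c * t) * (z ^ 2 * z ^ 14) * h + 14 * c * (z ^ 2 * z ^ 13) * g + 12 * c * (c * t) * (z ^ 2 * z ^ 13) * g
      + 156 * (c * c) * (z ^ 2 * z ^ 12) * k"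
    by (simp only: distrib_left mult_ac add_ac)
  then show "c * (z ^ 2 * (14 * z ^ 13 * g + z ^ 14 * (t * h) + (156 * c * z ^ 12 * k + 12 * c * z ^ 13 * (t * g))))
      = z ^ 16 * h + 26 * c * z ^ 15 * g + 156 * c ^ 2 * z ^ 14 * k"
    unfolding assms power_add[symmetric] by (simp add: power2_eq_square)
qed

lemma S_theta_e4:
  assumes \<tau>: "Im \<tau> > 0"
  shows "to_q (- 1 / \<tau>) * deriv e4 (to_q (- 1 / \<tau>)) = \<tau> ^ 6 * (to_q \<tau> * deriv e4 (to_q \<tau>)) + 4 * c2pi * \<tau> ^ 5 * e4 (to_q \<tau>)"
proof -
  have "((\<lambda>\<tau>. \<tau> ^ 4 * e4 (to_q \<tau>)) has_field_derivative
     4 * \<tau> ^ 3 * e4 (to_q \<tau>) + \<tau> ^ 4 * (tpi * (to_q \<tau> * deriv e4 (to_q \<tau>)))) (at \<tau>)"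
    using deriv_power_mult[OF deriv_to_q[OF e4_holo \<tau>], of 4] by simp
  from theta_S[OF e4_holo S_rules(1) this \<tau>] show ?thesis
    using theta_S_algebra(1)[OF c2pi, of \<tau> 3] by simp
qed

lemma S_theta_delta:
  assumes \<tau>: "Im \<tau> > 0"
  shows "to_q (- 1 / \<tau>) * d2 (to_q (- 1 / \<tau>)) = \<tau> ^ 14 * (to_q \<tau> * d2 (to_q \<tau>)) + 12 * c2pi * \<tau> ^ 13 * delta (to_q \<tau>)"
proof -
  have i: "Im (- 1 / \<tau>) > 0" unfolding Im_minus_inverse using \<tau> by (intro divide_pos_pos) auto
  have dd: "deriv delta (to_q \<tau>) = d2 (to_q \<tau>)" if "Im \<tau> > 0" for \<tau>
    by (intro DERIV_imp_deriv delta_deriv to_q_in_ball that)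
  have "((\<lambda>\<tau>. \<tau> ^ 12 * delta (to_q \<tau>)) has_field_derivative
     12 * \<tau> ^ 11 * delta (to_q \<tau>) + \<tau> ^ 12 * (tpi * (to_q \<tau> * d2 (to_q \<tau>)))) (at \<tau>)"
    using deriv_power_mult[OF deriv_to_q[OF delta_holo \<tau>], of 12] by (simp add: dd[OF \<tau>])
  from theta_S[OF delta_holo S_rules(3) this \<tau>, unfolded dd[OF i]] show ?thesis
    using theta_S_algebra(1)[OF c2pi, of \<tau> 11] by simp
qed

lemma S_theta2_delta:
  assumes \<tau>: "Im \<tau> > 0"
  shows "to_q (- 1 / \<tau>) * d3 (to_q (- 1 / \<tau>)) = \<tau> ^ 16 * (to_q \<tau> * d3 (to_q \<tau>)) + 26 * c2pi * \<tau> ^ 15 * (to_q \<tau> * d2 (to_q \<tau>))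
     + 156 * c2pi ^ 2 * \<tau> ^ 14 * delta (to_q \<tau>)"
proof -
  let ?h = "\<lambda>q. q * d2 q"
  have hh: "?h holomorphic_on ball 0 1" by (intro holomorphic_intros d2_holo)
  have i: "Im (- 1 / \<tau>) > 0" unfolding Im_minus_inverse using \<tau> by (intro divide_pos_pos) auto
  have dd: "deriv delta (to_q \<tau>) = d2 (to_q \<tau>)" if "Im \<tau> > 0" for \<tau>
    by (intro DERIV_imp_deriv delta_deriv to_q_in_ball that)
  have dd': "deriv ?h (to_q \<tau>) = d3 (to_q \<tau>)" if "Im \<tau> > 0" for \<tau>
    by (intro DERIV_imp_deriv theta_delta_deriv to_q_in_ball that)
  have "((\<lambda>\<tau>. \<tau> ^ 14 * (to_q \<tau> * d2 (to_q \<tau>)) + 12 * c2pi * \<tau> ^ 13 * delta (to_q \<tau>)) has_field_derivative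
     14 * \<tau> ^ 13 * (to_q \<tau> * d2 (to_q \<tau>)) + \<tau> ^ 14 * (tpi * (to_q \<tau> * d3 (to_q \<tau>)))
     + (156 * c2pi * \<tau> ^ 12 * delta (to_q \<tau>) + 12 * c2pi * \<tau> ^ 13 * (tpi * (to_q \<tau> * d2 (to_q \<tau>))))) (at \<tau>)"
  proof -
    have "((\<lambda>\<tau>. \<tau> ^ 14 * g \<tau> + 12 * c2pi * \<tau> ^ 13 * k \<tau>) has_field_derivative
      14 * \<tau> ^ 13 * g \<tau> + \<tau> ^ 14 * g' + (156 * c2pi * \<tau> ^ 12 * k \<tau> + 12 * c2pi * \<tau> ^ 13 * k')) (at \<tau>)"
      if "(g has_field_derivative g') (at \<tau>)" "(k has_field_derivative k') (at \<tau>)" for g k g' k'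
      using that by (auto intro!: derivative_eq_intros)
    from this[OF deriv_to_q[OF hh \<tau>] deriv_to_q[OF delta_holo \<tau>]] show ?thesis
      unfolding dd[OF \<tau>] dd'[OF \<tau>] .
  qed
  from theta_S[OF hh S_theta_delta this \<tau>, unfolded dd'[OF i]] show ?thesis
    unfolding theta_S_algebra(2)[OF c2pi] .
qed

text \<open>
  Ramanujan's differential equations for \<open>E\<^sub>4\<close> and \<open>E\<^sub>2 = \<theta>\<Delta> / \<Delta>\<close>, cleared of denominators because
  \<open>\<Delta> \<noteq> 0\<close> is itself deduced from the second one.
\<close>

lemma ramanujan_e4:
  assumes q: "q \<in> ball 0 1"
  shows "3 * q * d1 q * deriv e4 q = e4 q * d2 q - d1 q * e6 q"
proof -
  \<comment> \<open>\<open>F\<close> is \<open>W / q ^ 2\<close>. \<open>W\<close> has weight 18: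
    the corrections of \<open>\<theta> E4\<close> and \<open>\<theta> \<Delta>\<close> cancel
    because \<open>3 * 4 = 12\<close>. Its terms of order \<open>q\<close> cancel too, so the
    vanishing criterion applies with \<open>9 \<le> 5 * 2\<close>.\<close>
  define F where "F = (\<lambda>q. 3 * d1 q * deriv e4 q - e4 q * deriv d1 q - d1 q * (504 * m6 q + 240 * m4 q))"
  define W where "W = (\<lambda>q. 3 * delta q * (q * deriv e4 q) - e4 q * (q * d2 q) + delta q * e6 q)"
  have WF: "W q = q ^ 2 * F q" for q
    unfolding W_def F_def delta_def d2_def by (simp add: e4_def e6_def power2_eq_square algebra_simps)
  have Fh: "F holomorphic_on ball 0 1"
    unfolding F_def by (intro holomorphic_intros m4_holo m6_holo d1'_holo holomorphic_deriv e4_holo open_ball)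
  have "F q = 0"
  proof (rule modular_form_vanishes[OF Fh _ _ _ _ q, where n = 2 and l = 9 and f = "\<lambda>\<tau>. W (to_q \<tau>)"])
    fix \<tau> :: complex assume \<tau>: "Im \<tau> > 0"
    show "W (to_q (- 1 / \<tau>)) = \<tau> ^ (2 * 9) * W (to_q \<tau>)"
    proof -
      have 1: "3 * (T * \<delta>) * (\<tau> ^ 6 * \<theta> + 4 * c2pi * \<tau> ^ 5 * e) - (\<tau> ^ 4 * e) * (T * \<tau> ^ 2 * \<theta>' + 12 * c2pi * (T * \<tau>) * \<delta>) + (T * \<delta>) * (\<tau> ^ 6 * e')
          = T * \<tau> ^ 6 * (3 * \<delta> * \<theta> - e * \<theta>' + \<delta> * e')" for T \<delta> \<theta> e e' \<theta>'
        by algebra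
      have 2: "\<tau> ^ 14 = \<tau> ^ 12 * \<tau> ^ 2" "\<tau> ^ 13 = \<tau> ^ 12 * \<tau>" "\<tau> ^ (2 * 9) = \<tau> ^ 12 * \<tau> ^ 6"
        by (simp_all add: eval_nat_numeral)
      show ?thesis
        unfolding W_def S_rules[OF \<tau>] S_theta_e4[OF \<tau>] S_theta_delta[OF \<tau>] 2 by (rule 1)
    qed
  qed (auto simp: WF)
  then show ?thesis unfolding F_def d2_def by (simp add: e4_def e6_def algebra_simps)
qed

lemma ramanujan_e2:
  assumes q: "q \<in> ball 0 1"
  shows "12 * d1 q * d3 q - 13 * d2 q ^ 2 + d1 q ^ 2 * e4 q = 0"
proof -
  \<comment> \<open>With the coefficients 12 and 13 the corrections cancel
    (\<open>12 * 26 = 2 * 13 * 12\<close>, \<open>12 * 156 = 13 * 144\<close>), so \<open>W\<close>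
    has weight 28. Order \<open>q ^ 2\<close> cancels by \<open>12 - 13 + 1 = 0\<close>, and
    \<open>14 \<le> 5 * 3\<close>.\<close>
  define F where "F = (\<lambda>q. 12 * d1 q * (3 * deriv d1 q + q * deriv (deriv d1) q) - 26 * d1 q * deriv d1 q
     - 13 * q * deriv d1 q ^ 2 + 240 * d1 q ^ 2 * m4 q)"
  define W where "W = (\<lambda>q. 12 * delta q * (q * d3 q) - 13 * (q * d2 q) ^ 2 + delta q ^ 2 * e4 q)"
  have WF: "W q = q ^ 3 * F q" for q
    unfolding W_def F_def delta_def d2_def d3_def by (simp add: e4_def power2_eq_square power3_eq_cube algebra_simps)
  have Fh: "F holomorphic_on ball 0 1"
    unfolding F_def by (intro holomorphic_intros m4_holo m6_holo d1'_holo open_ball)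
  have "F q = 0"
  proof (rule modular_form_vanishes[OF Fh _ _ _ _ q, where n = 3 and l = 14 and f = "\<lambda>\<tau>. W (to_q \<tau>)"])
    fix \<tau> :: complex assume \<tau>: "Im \<tau> > 0"
    show "W (to_q (- 1 / \<tau>)) = \<tau> ^ (2 * 14) * W (to_q \<tau>)"
    proof -
      have 1: "12 * (T * \<delta>) * (T * \<tau> ^ 4 * \<theta>2 + 26 * c2pi * (T * \<tau> ^ 3) * \<theta> + 156 * c2pi ^ 2 * (T * \<tau> ^ 2) * \<delta>)
          - 13 * (T * \<tau> ^ 2 * \<theta> + 12 * c2pi * (T * \<tau>) * \<delta>) ^ 2 + (T * \<delta>) ^ 2 * (\<tau> ^ 4 * e)
          = T * T * \<tau> ^ 4 * (12 * \<delta> * \<theta>2 - 13 * \<theta> ^ 2 + \<delta> ^ 2 * e)" for T \<delta> \<theta> e \<theta>2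
        by algebra
      have 2: "\<tau> ^ 14 = \<tau> ^ 12 * \<tau> ^ 2" "\<tau> ^ 13 = \<tau> ^ 12 * \<tau>" "\<tau> ^ 15 = \<tau> ^ 12 * \<tau> ^ 3" "\<tau> ^ 16 = \<tau> ^ 12 * \<tau> ^ 4"
         "\<tau> ^ (2 * 14) = \<tau> ^ 12 * \<tau> ^ 12 * \<tau> ^ 4"
        by (simp_all add: eval_nat_numeral)
      show ?thesis
        unfolding W_def S_rules[OF \<tau>] S_theta2_delta[OF \<tau>] S_theta_delta[OF \<tau>] 2 by (rule 1)
    qed
  qed (auto simp: WF)
  then have "q * F q = 0" by simp
  then show ?thesis unfolding F_def d2_def d3_def by (simp add: e4_def power2_eq_square algebra_simps)
qed

text \<open>
  At a zero of order \<open>n\<close>, the leading terms of the equation for \<open>E\<^sub>2\<close> would give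
  \<open>12 n (n - 1) = 13 n\<^sup>2\<close>.
\<close>

lemma d1_nonzero:
  assumes q: "q \<in> ball 0 1"
  shows "d1 q \<noteq> 0"
proof
  assume z: "d1 q = 0"
  have q0: "q \<noteq> 0" using z by auto
  have nc: "\<not> d1 constant_on ball 0 1"
  proof
    assume "d1 constant_on ball 0 1"
    then have "d1 q = d1 0" using q unfolding constant_on_def by (metis centre_in_ball zero_less_one)
    then show False using z by simp
  qed
  obtain g r n where n: "0 < n" and r: "0 < r" "ball q r \<subseteq> ball 0 1" and g: "g holomorphic_on ball q r"
    and fac: "\<And>w. w \<in> ball q r \<Longrightarrow> d1 w = (w - q) ^ n * g w" and g0: "\<And>w. w \<in> ball q r \<Longrightarrow> g w \<noteq> 0"
    by (rule holomorphic_factor_zero_nonconstant[OF d1_holo open_ball connected_ball q z nc]) (rule that, assumption+)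
  \<comment> \<open>The regular part of the logarithmic derivative of \<open>d1\<close>, whose polar
    part is \<open>n / (w - q)\<close>.\<close>
  define k where "k = (\<lambda>w. deriv g w / g w)"
  have kh: "k holomorphic_on ball q r" unfolding k_def
    by (intro holomorphic_intros holomorphic_deriv g g0 open_ball)
  define k' where "k' = deriv k"
  have k'h: "k' holomorphic_on ball q r" unfolding k'_def by (intro holomorphic_deriv kh open_ball)
  have L: "deriv d1 w = d1 w * (of_nat n / (w - q) + k w)" if w: "w \<in> ball q r" "w \<noteq> q" for w
  proof -
    have "((\<lambda>w. (w - q) ^ n * g w) has_field_derivative of_nat n * (w - q) ^ (n - 1) * g w + (w - q) ^ n * deriv g w) (at w)"
      using holomorphic_derivI[OF g open_ball w(1), of UNIV] by (auto intro!: derivative_eq_intros)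
    then have "(d1 has_field_derivative of_nat n * (w - q) ^ (n - 1) * g w + (w - q) ^ n * deriv g w) (at w)"
      by (rule has_field_derivative_transform_within_open[OF _ open_ball w(1)]) (simp add: fac)
    then have "deriv d1 w = of_nat n * (w - q) ^ (n - 1) * g w + (w - q) ^ n * deriv g w"
      by (rule DERIV_imp_deriv)
    also have "\<dots> = d1 w * (of_nat n / (w - q) + k w)"
      unfolding fac[OF w(1)] k_def using w g0[OF w(1)] n by (cases n) (auto simp: field_simps)
    finally show ?thesis .
  qed
  have L': "deriv (deriv d1) w = d1 w * ((of_nat n / (w - q) + k w) ^ 2 - of_nat n / (w - q) ^ 2 + k' w)" if w: "w \<in> ball q r" "w \<noteq> q" for w
  proof -
    have w1: "w \<in> ball 0 1" using w r by auto
    have "((\<lambda>w. d1 w * (of_nat n / (w - q) + k w)) has_field_derivative deriv d1 w * (of_nat n / (w - q) + k w) + d1 w * (- of_nat n / (w - q) ^ 2 + k' w)) (at w)"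
      unfolding k'_def using holomorphic_derivI[OF d1_holo open_ball w1, of UNIV] holomorphic_derivI[OF kh open_ball w(1), of UNIV] w
      by (auto intro!: derivative_eq_intros simp: power2_eq_square)
    then have "(deriv d1 has_field_derivative deriv d1 w * (of_nat n / (w - q) + k w) + d1 w * (- of_nat n / (w - q) ^ 2 + k' w)) (at w)"
      by (rule has_field_derivative_transform_within_open[of _ _ _ "ball q r - {q}"]) (use w L in auto)
    from DERIV_imp_deriv[OF this] show ?thesis unfolding L[OF w] minus_divide_left[symmetric] by algebra
  qed
  \<comment> \<open>The equation for \<open>E2\<close> divided by \<open>d1 w ^ 2\<close> and
    multiplied by \<open>(w - q) ^ 2\<close>. In this form it is regular at \<open>q\<close>, and at
    \<open>w = q\<close> only the leading terms remain.\<close>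
  define E where "E = (\<lambda>w. 12 * ((w - q) ^ 2 + 3 * w * (w - q) * (of_nat n + (w - q) * k w)
      + w ^ 2 * ((of_nat n + (w - q) * k w) ^ 2 - of_nat n + (w - q) ^ 2 * k' w))
      - 13 * ((w - q) + w * (of_nat n + (w - q) * k w)) ^ 2 + (w - q) ^ 2 * e4 w)"
  have E0: "E w = 0" if w: "w \<in> ball q r" "w \<noteq> q" for w
  proof -
    define p where "p = w - q"
    have p0: "p \<noteq> 0" using w by (simp add: p_def)
    have d: "d1 w \<noteq> 0" using fac[OF w(1)] g0[OF w(1)] w by auto
    define l where "l = of_nat n / p + k w"
    have pl: "of_nat n + p * k w = p * l" using p0 by (simp add: l_def field_simps)
    have pl2: "of_nat n = p ^ 2 * (of_nat n / p ^ 2)" using p0 by simp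
    have "w \<in> ball 0 1" using w r by auto
    note R = ramanujan_e2[OF this, unfolded d2_def d3_def L[OF w] L'[OF w], folded p_def, folded l_def]
    define u where "u = complex_of_nat n / p ^ 2"
    have "d1 w ^ 2 * (12 * (1 + 3 * w * l + w ^ 2 * (l ^ 2 - u + k' w)) - 13 * (1 + w * l) ^ 2 + e4 w) = 0"
      using R unfolding u_def by algebra
    then have "12 * (1 + 3 * w * l + w ^ 2 * (l ^ 2 - u + k' w)) - 13 * (1 + w * l) ^ 2 + e4 w = 0" using d by simp
    moreover have "of_nat n = p ^ 2 * u" using p0 by (simp add: u_def)
    ultimately show ?thesis unfolding E_def p_def[symmetric] pl by algebra
  qed
  have cont: "isCont E q"
  proof -
    have "E holomorphic_on ball q r" unfolding E_def
      by (intro holomorphic_intros kh k'h holomorphic_on_subset[OF e4_holo] r)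
    then show ?thesis using r by (meson centre_in_ball continuous_on_eq_continuous_at holomorphic_on_imp_continuous_on open_ball)
  qed
  have "eventually (\<lambda>w. E w = 0) (at q)"
    using E0 r unfolding eventually_at by (intro exI[of _ r]) (auto simp: dist_commute)
  then have "E \<midarrow>q\<rightarrow> 0" by (rule tendsto_eventually)
  with cont have "E q = 0" unfolding isCont_def by (rule tendsto_unique[rotated]) simp
  then have "q ^ 2 * (12 * (of_nat n ^ 2 - of_nat n) - 13 * of_nat n ^ 2) = 0"
    unfolding E_def by (simp add: algebra_simps)
  then have "12 * (complex_of_nat n ^ 2 - of_nat n) - 13 * of_nat n ^ 2 = 0" using q0 by simp
  then have "of_nat n * (of_nat n + 12 :: complex) = 0" by algebra
  then have "of_nat (n * (n + 12)) = (0 :: complex)" by simp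
  then have "n * (n + 12) = 0" unfolding of_nat_eq_0_iff .
  then show False using n by simp
qed

section \<open>The discriminant and \<open>j\<close> on the upper half-plane\<close>

lemma upper_half_iff: "\<tau> \<in> upper_half \<longleftrightarrow> Im \<tau> > 0"
  by (simp add: upper_half_def)

lemma open_upper_half: "open upper_half" and connected_upper_half: "connected upper_half"
  and convex_upper_half: "convex upper_half"
  unfolding upper_half_def
  by (auto intro: open_halfspace_Im_gt convex_halfspace_Im_gt convex_connected)

definition Delta :: "complex \<Rightarrow> complex" where "Delta \<tau> = delta (to_q \<tau>)"

lemma Delta_nonzero: "Im \<tau> > 0 \<Longrightarrow> Delta \<tau> \<noteq> 0"
  unfolding Delta_def delta_def using d1_nonzero[OF to_q_in_ball] by simp

lemma to_q_holo: "to_q holomorphic_on A"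
  unfolding to_q_def by (intro holomorphic_intros)

lemma comp_to_q_holo: "h holomorphic_on ball 0 1 \<Longrightarrow> (\<lambda>\<tau>. h (to_q \<tau>)) holomorphic_on upper_half"
  using holomorphic_on_compose_gen[OF to_q_holo, of h "ball 0 1" upper_half] to_q_in_ball
  by (auto simp: o_def upper_half_iff image_subset_iff)

lemma Delta_holo: "Delta holomorphic_on upper_half"
  unfolding Delta_def by (rule comp_to_q_holo[OF delta_holo])

lemma Delta_modular:
  assumes "a * d - b * c = 1" "Im \<tau> > 0"
  shows "Delta (moebius_act (a, b, c, d) \<tau>) = (of_int c * \<tau> + of_int d) ^ 12 * Delta \<tau>"
  unfolding Delta_def by (rule e4_modular(3)[OF assms])

lemma klein_j_invariant:
  assumes "a * d - b * c = 1" "Im \<tau> > 0"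
  shows "klein_j (moebius_act (a, b, c, d) \<tau>) = klein_j \<tau>"
  using moebius_Im[OF assms] assms e4_modular[OF assms]
  by (simp add: klein_j_eq power_mult_distrib del: moebius_act.simps flip: power_mult)

lemma klein_j_holo: "klein_j holomorphic_on upper_half"
proof -
  have "(\<lambda>\<tau>. e4 (to_q \<tau>) ^ 3 / Delta \<tau>) holomorphic_on upper_half"
    by (intro holomorphic_intros comp_to_q_holo Delta_holo e4_holo) (simp add: upper_half_iff Delta_nonzero)
  then show ?thesis by (rule holomorphic_transform) (simp add: upper_half_iff klein_j_eq Delta_def)
qed

definition j_q :: "complex \<Rightarrow> complex" where "j_q q = e4 q ^ 3 / delta q"

lemma klein_j_q: "Im \<tau> > 0 \<Longrightarrow> klein_j \<tau> = j_q (to_q \<tau>)"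
  by (simp add: klein_j_eq j_q_def)

lemma analytic_at_0: "h holomorphic_on ball 0 1 \<Longrightarrow> h analytic_on {0 :: complex}"
  by (rule analytic_on_subset[of _ "ball 0 1"]) (auto simp: analytic_on_open)

lemma zorder_delta: "zorder delta 0 = 1"
  by (rule zorder_eqI[of "ball 0 1" _ d1]) (auto simp: delta_def d1_holo)

lemma zorder_j_q: "zorder j_q 0 = - 1"
proof (rule zorder_eqI[of "ball 0 1" _ "\<lambda>q. e4 q ^ 3 / d1 q"])
  show "(\<lambda>q. e4 q ^ 3 / d1 q) holomorphic_on ball 0 1"
    by (intro holomorphic_intros d1_nonzero)
qed (auto simp: j_q_def delta_def power_int_minus field_simps)

lemma j_q_meromorphic: "j_q meromorphic_on {0}"
  unfolding j_q_def using delta_holo e4_holo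
  by (intro meromorphic_intros analytic_on_imp_meromorphic_on analytic_at_0)

section \<open>The hypergeometric function\<close>

abbreviation hyp_fps :: "complex fps" where "hyp_fps \<equiv> fps_hypergeo [1 / 12, 5 / 12] [1] 1"

lemma hyp_fps_rec: "of_nat (Suc n) ^ 2 * hyp_fps $ Suc n = (1 / 12 + of_nat n) * (5 / 12 + of_nat n) * hyp_fps $ n"
proof -
  have "hyp_fps $ Suc n = (1 / 12 + of_nat n) * (5 / 12 + of_nat n) / of_nat (Suc n) ^ 2 * hyp_fps $ n"
    unfolding fps_hypergeo_rec by (simp add: power2_eq_square add.commute)
  moreover have "of_nat (Suc n) \<noteq> (0 :: complex)" by (simp only: of_nat_neq_0 not_False_eq_True)
  ultimately show ?thesis by (simp add: field_simps del: fps_hypergeo_nth of_nat_Suc)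
qed

text \<open>The ratio of consecutive coefficients is
  \<open>(1/12 + n) * (5/12 + n) / (n + 1) ^ 2\<close>, which is at most 1.\<close>

lemma hyp_fps_bound: "norm (hyp_fps $ n) \<le> 1"
proof (induction n)
  case 0
  then show ?case by (subst fps_hypergeo_0) simp
next
  case (Suc n)
  have "real (Suc n) ^ 2 * norm (hyp_fps $ Suc n) = norm (of_nat (Suc n) ^ 2 * hyp_fps $ Suc n)"
    by (simp only: norm_mult norm_power norm_of_nat)
  also have "\<dots> = norm ((1 / 12 + of_nat n) * (5 / 12 + of_nat n) :: complex) * norm (hyp_fps $ n)"
    unfolding hyp_fps_rec norm_mult ..
  also have "\<dots> \<le> norm ((1 / 12 + of_nat n) * (5 / 12 + of_nat n) :: complex)"
    using Suc by (simp only: mult_left_le norm_ge_zero)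
  also have "\<dots> \<le> real (Suc n) * real (Suc n)"
  proof -
    have "norm (1 / 12 + of_nat n :: complex) \<le> real (Suc n)"
      by (rule order.trans[OF norm_triangle_ineq]) simp
    moreover have "norm (5 / 12 + of_nat n :: complex) \<le> real (Suc n)"
      by (rule order.trans[OF norm_triangle_ineq]) simp
    ultimately show ?thesis unfolding norm_mult by (intro mult_mono) auto
  qed
  finally show ?case by (simp add: power2_eq_square del: fps_hypergeo_nth of_nat_Suc)
qed

lemma hyp_fps_radius: "fps_conv_radius hyp_fps \<ge> 1"
  unfolding fps_conv_radius_def
proof (rule conv_radius_geI_ex)
  fix r :: real assume r: "0 < r" "ereal r < 1"
  have "summable (\<lambda>n. hyp_fps $ n * of_real r ^ n)"
  proof (rule summable_comparison_test'[where N = 0])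
    show "summable (\<lambda>n. r ^ n)" using r by (intro summable_geometric) auto
    show "norm (hyp_fps $ n * of_real r ^ n) \<le> r ^ n" for n
      using mult_right_mono[OF hyp_fps_bound, of "r ^ n" n] r
      by (simp add: norm_mult norm_power del: fps_hypergeo_nth)
  qed
  then show "\<exists>z::complex. norm z = r \<and> summable (\<lambda>n. hyp_fps $ n * z ^ n)"
    using r by (intro exI[of _ "of_real r"]) (simp del: fps_hypergeo_nth)
qed

text \<open>Gauss's equation with \<open>a = 1/12\<close>, \<open>b = 5/12\<close>,
  \<open>c = 1\<close>: the constants are \<open>a + b + 1 = 3/2\<close> and
  \<open>a * b = 5/144\<close>.\<close>

lemma hyp_fps_ode:
  "fps_X * (1 - fps_X) * fps_deriv (fps_deriv hyp_fps) + (1 - fps_const (3 / 2) * fps_X) * fps_deriv hyp_fps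
     = fps_const (5 / 144) * hyp_fps"
proof (rule fps_ext)
  fix n
  define a where "a = (\<lambda>n. hyp_fps $ n)"
  have rec: "of_nat (Suc n) ^ 2 * a (Suc n) = (1 / 12 + of_nat n) * (5 / 12 + of_nat n) * a n" for n
    unfolding a_def by (rule hyp_fps_rec)
  have eq: "fps_X * (1 - fps_X) * fps_deriv (fps_deriv hyp_fps) + (1 - fps_const (3 / 2) * fps_X) * fps_deriv hyp_fps
     = fps_X * fps_deriv (fps_deriv hyp_fps) - fps_X * (fps_X * fps_deriv (fps_deriv hyp_fps)) + fps_deriv hyp_fps - fps_const (3 / 2) * (fps_X * fps_deriv hyp_fps)"
    by (simp add: algebra_simps)
  have "(fps_X * (1 - fps_X) * fps_deriv (fps_deriv hyp_fps) + (1 - fps_const (3 / 2) * fps_X) * fps_deriv hyp_fps) $ n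
     = of_nat (Suc n) ^ 2 * a (Suc n) - (of_nat n * (of_nat n - 1) + 3 / 2 * of_nat n) * a n"
    unfolding eq
    by (cases n; cases "n - 1")
      (simp_all add: a_def power2_eq_square algebra_simps del: fps_hypergeo_nth)
  also have "\<dots> = 5 / 144 * a n" unfolding rec by (simp add: algebra_simps)
  finally show "(fps_X * (1 - fps_X) * fps_deriv (fps_deriv hyp_fps) + (1 - fps_const (3 / 2) * fps_X) * fps_deriv hyp_fps) $ n
      = (fps_const (5 / 144) * hyp_fps) $ n" by (simp add: a_def del: fps_hypergeo_nth)
qed

lemma eval_fps_has_derivative:
  assumes "fps_conv_radius f \<ge> 1" "norm (z :: complex) < 1"
  shows "(eval_fps f has_field_derivative eval_fps (fps_deriv f) z) (at z)"
proof -
  have "ereal (norm z) < fps_conv_radius f" using assms by (metis ereal_less(3) order.strict_trans2)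
  then show ?thesis by (intro has_field_derivative_eval_fps) (auto simp: eball_def)
qed

definition hypF :: "complex \<Rightarrow> complex" where "hypF = eval_fps hyp_fps"
definition hypF' :: "complex \<Rightarrow> complex" where "hypF' = eval_fps (fps_deriv hyp_fps)"
definition hypF'' :: "complex \<Rightarrow> complex" where "hypF'' = eval_fps (fps_deriv (fps_deriv hyp_fps))"

lemma hyp2F1_eq: "hyp2F1 (1 / 12) (5 / 12) 1 = hypF"
  by (simp add: hyp2F1_def hypF_def fun_eq_iff)

lemma hyp_fps_radius': "fps_conv_radius (fps_deriv hyp_fps) \<ge> 1" "fps_conv_radius (fps_deriv (fps_deriv hyp_fps)) \<ge> 1"
  using hyp_fps_radius fps_conv_radius_deriv[of hyp_fps] fps_conv_radius_deriv[of "fps_deriv hyp_fps"]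
  by (auto intro: order.trans)

lemma hypF_deriv: "norm t < 1 \<Longrightarrow> (hypF has_field_derivative hypF' t) (at t)"
  and hypF'_deriv: "norm t < 1 \<Longrightarrow> (hypF' has_field_derivative hypF'' t) (at t)"
  unfolding hypF_def hypF'_def hypF''_def
  by (auto intro!: eval_fps_has_derivative hyp_fps_radius hyp_fps_radius')

lemma hypF_ode:
  assumes "norm t < 1"
  shows "t * (1 - t) * hypF'' t + (1 - 3 / 2 * t) * hypF' t = 5 / 144 * hypF t"
proof -
  have lt: "ereal (norm t) < fps_conv_radius f" if "fps_conv_radius f \<ge> 1" for f :: "complex fps"
    using assms that by (metis ereal_less(3) order.strict_trans2)
  have r: "fps_conv_radius (f * g) \<ge> 1" if "fps_conv_radius f \<ge> 1" "fps_conv_radius g \<ge> 1" for f g :: "complex fps"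
    using that fps_conv_radius_mult[of f g] by (meson min.boundedI order.trans)
  have r': "fps_conv_radius (f - g) \<ge> 1" if "fps_conv_radius f \<ge> 1" "fps_conv_radius g \<ge> 1" for f g :: "complex fps"
    using that fps_conv_radius_diff[of f g] by (meson min.boundedI order.trans)
  have "eval_fps (fps_X * (1 - fps_X) * fps_deriv (fps_deriv hyp_fps) + (1 - fps_const (3 / 2) * fps_X) * fps_deriv hyp_fps) t
     = t * (1 - t) * hypF'' t + (1 - 3 / 2 * t) * hypF' t"
    unfolding hypF'_def hypF''_def
    by (simp add: eval_fps_add eval_fps_mult eval_fps_diff lt r r' hyp_fps_radius hyp_fps_radius')
  moreover have "eval_fps (fps_const (5 / 144) * hyp_fps) t = 5 / 144 * hypF t"
    unfolding hypF_def by (simp add: eval_fps_mult lt hyp_fps_radius)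
  ultimately show ?thesis unfolding hyp_fps_ode by simp
qed

lemma hypF_0: "hypF 0 = 1"
  unfolding hypF_def by (simp only: eval_fps_at_0 fps_hypergeo_0)

lemma hypF_holo: "hypF holomorphic_on ball 0 1" "hypF' holomorphic_on ball 0 1"
  unfolding holomorphic_on_open[OF open_ball] using hypF_deriv hypF'_deriv by (metis mem_ball_0)+

definition jinv_q :: "complex \<Rightarrow> complex" where "jinv_q q = 1728 * delta q / e4 q ^ 3"

text \<open>
  By Ramanujan's equations, \<open>E\<^sub>4\<^sup>1\<^sup>/\<^sup>4\<close> satisfies the hypergeometric equation in \<open>1728/j\<close>, whose
  analytic solutions at 0 form a line.
\<close>

lemma hypF_e4:
  obtains r where "0 < r" "r < 1" "\<And>q. norm q < r \<Longrightarrow> e4 q \<noteq> 0 \<and> norm (jinv_q q) < 1 \<and> hypF (jinv_q q) ^ 4 = e4 q"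
proof -
  have ce: "isCont e4 0" "isCont e6 0" "isCont delta 0"
    using e4_holo e6_holo delta_holo
    by (auto simp: continuous_on_eq_continuous_at dest!: holomorphic_on_imp_continuous_on)
  then have t4: "(e4 \<longlongrightarrow> e4 0) (nhds 0)" and t6: "(e6 \<longlongrightarrow> e6 0) (nhds 0)" and td: "(delta \<longlongrightarrow> delta 0) (nhds 0)"
    unfolding isCont_def by (simp_all only: tendsto_at_iff_tendsto_nhds)
  have tj: "(jinv_q \<longlongrightarrow> jinv_q 0) (nhds 0)" unfolding jinv_q_def by (intro tendsto_intros t4 td) simp
  from tendsto_Re[OF t4] t6 tendsto_norm[OF tj]
  have "eventually (\<lambda>q. Re (e4 q) > 0) (nhds 0)" "eventually (\<lambda>q. e6 q \<noteq> 0) (nhds 0)"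
    "eventually (\<lambda>q. norm (jinv_q q) < 1) (nhds 0)"
    by (auto intro: order_tendstoD tendsto_imp_eventually_ne simp: jinv_q_def delta_def)
  then have "eventually (\<lambda>q. Re (e4 q) > 0 \<and> e6 q \<noteq> 0 \<and> norm (jinv_q q) < 1) (nhds 0)"
    by eventually_elim auto
  then obtain r0 where r0: "r0 > 0" "\<And>q. dist q 0 < r0 \<Longrightarrow> Re (e4 q) > 0 \<and> e6 q \<noteq> 0 \<and> norm (jinv_q q) < 1"
    unfolding eventually_nhds_metric by blast
  define r where "r = min r0 (1 / 2)"
  have r: "0 < r" "r < 1" using r0 by (auto simp: r_def)
  have good: "q \<in> ball 0 1" "Re (e4 q) > 0" "e4 q \<noteq> 0" "e6 q \<noteq> 0" "norm (jinv_q q) < 1" "d1 q \<noteq> 0" if "q \<in> ball 0 r" for q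
    using that r0(2)[of q] d1_nonzero[of q] by (auto simp: r_def)
  have sub: "ball 0 r \<subseteq> ball (0 :: complex) 1" using r by auto
  \<comment> \<open>The fourth root of \<open>E4\<close> with value 1 at \<open>q = 0\<close>; the
    radius keeps \<open>Re (e4 q)\<close> positive, away from the cut of the logarithm.\<close>
  define y where "y = (\<lambda>q. exp (Ln (e4 q) / 4))"
  define E2 where "E2 = (\<lambda>q. d2 q / d1 q)"
  \<comment> \<open>\<open>E6 / E4\<close> is the logarithmic derivative of \<open>1728 / j\<close>
    with respect to \<open>q d/dq\<close>, and its square is
    \<open>E4 * (1 - 1728 / j)\<close>.\<close>
  define \<epsilon> where "\<epsilon> = (\<lambda>q. e6 q / e4 q)"
  have t\<epsilon>: "\<epsilon> q ^ 2 = e4 q * (1 - jinv_q q)" if "q \<in> ball 0 r" for q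
  proof -
    have "1728 * delta q = e4 q ^ 3 - e6 q ^ 2" by (simp add: delta_eq)
    then show ?thesis unfolding \<epsilon>_def jinv_q_def using good(3)[OF that]
      by (simp add: field_simps power2_eq_square power3_eq_cube) algebra
  qed
  have de4: "(e4 has_field_derivative (E2 q * e4 q - e6 q) / (3 * q)) (at q)" if q: "q \<in> ball 0 r" "q \<noteq> 0" for q
  proof -
    have "deriv e4 q = (E2 q * e4 q - e6 q) / (3 * q)"
      using ramanujan_e4[OF good(1)[OF q(1)]] good(6)[OF q(1)] q(2) unfolding E2_def by (simp add: field_simps)
    then show ?thesis using holomorphic_derivI[OF e4_holo open_ball good(1)[OF q(1)], of UNIV] by simp
  qed
  have dd: "(delta has_field_derivative E2 q * delta q / q) (at q)" if q: "q \<in> ball 0 r" "q \<noteq> 0" for q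
    using delta_deriv[OF good(1)[OF q(1)]] good(6)[OF q(1)] q(2) by (simp add: E2_def delta_def)
  \<comment> \<open>The equation for \<open>E6\<close> follows by differentiating
    \<open>1728 * delta = e4 ^ 3 - e6 ^ 2\<close> and cancelling \<open>e6\<close>; this is why the
    radius also excludes zeros of \<open>e6\<close>.\<close>
  have de6: "(e6 has_field_derivative (E2 q * e6 q - e4 q ^ 2) / (2 * q)) (at q)" if q: "q \<in> ball 0 r" "q \<noteq> 0" for q
  proof -
    have d6: "(e6 has_field_derivative deriv e6 q) (at q)"
      by (rule holomorphic_derivI[OF e6_holo open_ball good(1)[OF q(1)]])
    have "((\<lambda>q. (e4 q ^ 3 - e6 q ^ 2) / 1728) has_field_derivative
       (3 * e4 q ^ 2 * ((E2 q * e4 q - e6 q) / (3 * q)) - 2 * e6 q * deriv e6 q) / 1728) (at q)"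
      using de4[OF q] d6 by (auto intro!: derivative_eq_intros)
    moreover have "delta = (\<lambda>q. (e4 q ^ 3 - e6 q ^ 2) / 1728)" using delta_eq by blast
    ultimately have "(3 * e4 q ^ 2 * ((E2 q * e4 q - e6 q) / (3 * q)) - 2 * e6 q * deriv e6 q) / 1728 = E2 q * delta q / q"
      using dd[OF q] DERIV_unique by metis
    then have "e4 q ^ 2 * (E2 q * e4 q - e6 q) - 2 * e6 q * (q * deriv e6 q) = E2 q * (e4 q ^ 3 - e6 q ^ 2)"
    proof -
      define K M where "K = (E2 q * e4 q - e6 q) / (3 * q)" and "M = E2 q * delta q / q"
      have "3 * q * K = E2 q * e4 q - e6 q" "q * M = E2 q * delta q" using q(2) by (simp_all add: K_def M_def)
      moreover have "3 * e4 q ^ 2 * K - 2 * e6 q * deriv e6 q = 1728 * M"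
        using \<open>_ / 1728 = E2 q * delta q / q\<close> unfolding K_def[symmetric] M_def[symmetric] by (simp add: field_simps)
      moreover have "1728 * delta q = e4 q ^ 3 - e6 q ^ 2" by (simp add: delta_eq)
      ultimately show ?thesis by algebra
    qed
    then have "e6 q * (2 * (q * deriv e6 q)) = e6 q * (E2 q * e6 q - e4 q ^ 2)" by algebra
    then have "2 * (q * deriv e6 q) = E2 q * e6 q - e4 q ^ 2" using good(4)[OF q(1)] by simp
    then have "deriv e6 q = (E2 q * e6 q - e4 q ^ 2) / (2 * q)" using q(2) by (simp add: field_simps)
    then show ?thesis using d6 by simp
  qed
  have dE2: "(E2 has_field_derivative (E2 q ^ 2 - e4 q) / (12 * q)) (at q)" if q: "q \<in> ball 0 r" "q \<noteq> 0" for q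
  proof -
    have 1: "(d1 has_field_derivative (d2 q - d1 q) / q) (at q)"
      using holomorphic_derivI[OF d1_holo open_ball good(1)[OF q(1)], of UNIV] q(2) by (simp add: d2_def)
    have "(d2 has_field_derivative deriv d2 q) (at q)"
      by (rule holomorphic_derivI[OF d2_holo open_ball good(1)[OF q(1)]])
    moreover have "deriv d2 q = (d3 q - d2 q) / q"
    proof -
      have "((\<lambda>q. q * d2 q) has_field_derivative d2 q + q * deriv d2 q) (at q)"
        using \<open>(d2 has_field_derivative deriv d2 q) (at q)\<close> by (auto intro!: derivative_eq_intros)
      from DERIV_unique[OF this theta_delta_deriv[OF good(1)[OF q(1)]]] show ?thesis using q(2) by (auto simp: field_simps)
    qed
    ultimately have 2: "(d2 has_field_derivative (d3 q - d2 q) / q) (at q)" by simp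
    have "(E2 has_field_derivative ((d3 q - d2 q) / q * d1 q - d2 q * ((d2 q - d1 q) / q)) / (d1 q * d1 q)) (at q)"
      unfolding E2_def by (rule DERIV_divide[OF 2 1 good(6)[OF q(1)]])
    moreover have "((d3 q - d2 q) / q * d1 q - d2 q * ((d2 q - d1 q) / q)) / (d1 q * d1 q) = (E2 q ^ 2 - e4 q) / (12 * q)"
    proof -
      have "12 * ((d3 q - d2 q) * d1 q - d2 q * (d2 q - d1 q)) = d2 q ^ 2 - e4 q * d1 q ^ 2"
        using ramanujan_e2[OF good(1)[OF q(1)]] by algebra
      then have "((d3 q - d2 q) * d1 q - d2 q * (d2 q - d1 q)) = (d2 q ^ 2 - e4 q * d1 q ^ 2) / 12" by (simp add: field_simps)
      moreover have "(d3 q - d2 q) / q * d1 q - d2 q * ((d2 q - d1 q) / q) = ((d3 q - d2 q) * d1 q - d2 q * (d2 q - d1 q)) / q"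
        using q(2) by (simp add: field_simps)
      ultimately show ?thesis unfolding E2_def using q(2) good(6)[OF q(1)] by (simp add: field_simps power2_eq_square) algebra
    qed
    ultimately show ?thesis by simp
  qed
  have d\<epsilon>: "(\<epsilon> has_field_derivative (E2 q * \<epsilon> q / 6 - e4 q / 2 + \<epsilon> q ^ 2 / 3) / q) (at q)" if q: "q \<in> ball 0 r" "q \<noteq> 0" for q
    unfolding \<epsilon>_def
    by (rule DERIV_cong[OF DERIV_divide[OF de6[OF q] de4[OF q] good(3)[OF q(1)]]])
      (use q(2) good(3)[OF q(1)] in \<open>simp add: field_simps power2_eq_square\<close>)
  have dt: "(jinv_q has_field_derivative jinv_q q * \<epsilon> q / q) (at q)" if q: "q \<in> ball 0 r" "q \<noteq> 0" for q
  proof -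
    have "(jinv_q has_field_derivative ((1728 * (E2 q * delta q / q)) * e4 q ^ 3 - 1728 * delta q * (3 * e4 q ^ 2 * ((E2 q * e4 q - e6 q) / (3 * q)))) / (e4 q ^ 3 * e4 q ^ 3)) (at q)"
      unfolding jinv_q_def using dd[OF q] de4[OF q] good(3)[OF q(1)]
      by (intro DERIV_divide) (auto intro!: derivative_eq_intros)
    moreover have "((1728 * (E2 q * delta q / q)) * e4 q ^ 3 - 1728 * delta q * (3 * e4 q ^ 2 * ((E2 q * e4 q - e6 q) / (3 * q)))) / (e4 q ^ 3 * e4 q ^ 3) = jinv_q q * \<epsilon> q / q"
      unfolding jinv_q_def \<epsilon>_def using q(2) good(3)[OF q(1)] by (simp add: field_simps power2_eq_square power3_eq_cube)
    ultimately show ?thesis by simp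
  qed
  have y0: "y q \<noteq> 0" for q by (simp add: y_def)
  have dy: "(y has_field_derivative y q * (E2 q - \<epsilon> q) / (12 * q)) (at q)" if q: "q \<in> ball 0 r" "q \<noteq> 0" for q
  proof -
    have "e4 q \<notin> \<real>\<^sub>\<le>\<^sub>0" using good(2)[OF q(1)] by (auto simp: complex_nonpos_Reals_iff)
    from DERIV_chain2[OF DERIV_exp DERIV_cdivide[OF DERIV_chain2[OF has_field_derivative_Ln[OF this] de4[OF q]], of 4]]
    have d: "(y has_field_derivative y q * (inverse (e4 q) * ((E2 q * e4 q - e6 q) / (3 * q)) / 4)) (at q)"
      unfolding y_def .
    have e: "inverse (e4 q) * ((E2 q * e4 q - e6 q) / (3 * q)) / 4 = (E2 q - \<epsilon> q) / (12 * q)"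
      unfolding \<epsilon>_def using good(3)[OF q(1)] q(2) by (simp add: field_simps)
    show ?thesis using d unfolding e by (simp only: times_divide_eq_right)
  qed
  define v where "v = (\<lambda>q. hypF (jinv_q q))"
  \<comment> \<open>\<open>Z = \<theta> v - v * \<theta> y / y\<close> is the Wronskian of
    \<open>v\<close> and \<open>y\<close> divided by \<open>y\<close>. It satisfies the same
    first-order equation as \<open>y\<close>, so \<open>Z / y\<close> is constant, and evaluation at
    \<open>q = 0\<close> shows that the constant is 0.\<close>
  define Z where "Z = (\<lambda>q. hypF' (jinv_q q) * jinv_q q * \<epsilon> q - v q * (E2 q - \<epsilon> q) / 12)"
  have dv: "(v has_field_derivative hypF' (jinv_q q) * (jinv_q q * \<epsilon> q / q)) (at q)" if q: "q \<in> ball 0 r" "q \<noteq> 0" for q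
    unfolding v_def by (rule DERIV_chain2[OF hypF_deriv[OF good(5)[OF q(1)]] dt[OF q]])
  have dv': "((\<lambda>q. hypF' (jinv_q q)) has_field_derivative hypF'' (jinv_q q) * (jinv_q q * \<epsilon> q / q)) (at q)" if q: "q \<in> ball 0 r" "q \<noteq> 0" for q
    by (rule DERIV_chain2[OF hypF'_deriv[OF good(5)[OF q(1)]] dt[OF q]])
  have dZ: "(Z has_field_derivative Z q * (E2 q - \<epsilon> q) / (12 * q)) (at q)" if q: "q \<in> ball 0 r" "q \<noteq> 0" for q
  proof -
    define F F' F'' t e E x where "F = v q" and "F' = hypF' (jinv_q q)" and "F'' = hypF'' (jinv_q q)" and "t = jinv_q q" and "e = \<epsilon> q" and "E = E2 q" and "x = e4 q"
    note defs = F_def F'_def F''_def t_def e_def E_def x_def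
    define p m n where "p = t * e / q" and "m = (E * e / 6 - x / 2 + e ^ 2 / 3) / q" and "n = (E ^ 2 - x) / (12 * q)"
    define D where "D = (F'' * p * t + p * F') * e + m * (F' * t) - (F' * p * (E - e) + (n - m) * F) / 12"
    have "(Z has_field_derivative D) (at q)"
      unfolding Z_def D_def p_def m_def n_def defs
      by (rule DERIV_diff[OF DERIV_mult[OF DERIV_mult[OF dv'[OF q] dt[OF q]] d\<epsilon>[OF q]]
            DERIV_cdivide[OF DERIV_mult[OF dv[OF q] DERIV_diff[OF dE2[OF q] d\<epsilon>[OF q]]]]])
    moreover have "D = Z q * (E2 q - \<epsilon> q) / (12 * q)"
    proof -
      have pmn: "q * p = t * e" "q * m = E * e / 6 - x / 2 + e ^ 2 / 3" "12 * q * n = E ^ 2 - x"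
        using q(2) by (simp_all add: p_def m_def n_def)
      have ode: "144 * (t * (1 - t) * F'') + (144 - 216 * t) * F' = 5 * F"
        using arg_cong[OF hypF_ode[OF good(5)[OF q(1)]], of "\<lambda>z. 144 * z"] unfolding defs v_def by (simp add: algebra_simps)
      have e2: "e ^ 2 = x * (1 - t)" unfolding defs by (rule t\<epsilon>[OF q(1)])
      have "144 * q * D = 144 * ((F'' * (q * p) * t + (q * p) * F') * e + (q * m) * (F' * t)) - 12 * (F' * (q * p) * (E - e)) - (12 * q * n) * F + 12 * (q * m) * F"
        by (simp add: D_def field_simps)
      \<comment> \<open>The second summand is a multiple of the hypergeometric equation plus a
        multiple of the relation for \<open>e ^ 2\<close>, so it vanishes.\<close>
      also have "\<dots> = (12 * F' * t * e - F * (E - e)) * (E - e)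
        + (t * x * (144 * (t * (1 - t) * F'') + (144 - 216 * t) * F' - 5 * F) + (e ^ 2 - x * (1 - t)) * (144 * F'' * t ^ 2 + 216 * F' * t + 5 * F))"
        unfolding pmn by (simp add: power2_eq_square algebra_simps)
      also have "\<dots> = (12 * F' * t * e - F * (E - e)) * (E - e)" unfolding ode e2 by simp
      finally have "D = (12 * F' * t * e - F * (E - e)) * (E - e) / (144 * q)" using q(2) by (simp add: nonzero_eq_divide_eq mult_ac)
      also have "\<dots> = Z q * (E2 q - \<epsilon> q) / (12 * q)"
      proof -
        have "12 * F' * t * e - F * (E - e) = 12 * Z q" unfolding Z_def defs by (simp add: field_simps)
        then show ?thesis unfolding defs using q(2) by simp
      qed
      finally show ?thesis .
    qed
    ultimately show ?thesis by simp
  qed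
  define W where "W = (\<lambda>q. Z q / y q)"
  have cont: "continuous_on (ball 0 r) h" if "h holomorphic_on ball 0 1" for h :: "complex \<Rightarrow> complex"
    by (rule continuous_on_subset[OF holomorphic_on_imp_continuous_on[OF that] sub])
  note cs = cont[OF e4_holo] cont[OF e6_holo] cont[OF d1_holo] cont[OF d2_holo] cont[OF delta_holo]
  have cy: "continuous_on (ball 0 r) y"
    unfolding y_def by (intro continuous_intros cs) (use good(2) in \<open>force simp: complex_nonpos_Reals_iff\<close>)+
  have ct: "continuous_on (ball 0 r) jinv_q" unfolding jinv_q_def by (intro continuous_intros cs) (use good(3) in auto)
  have cv: "continuous_on (ball 0 r) v"
    unfolding v_def by (rule continuous_on_compose2[OF holomorphic_on_imp_continuous_on[OF hypF_holo(1)] ct]) (use good(5) in auto)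
  have cv': "continuous_on (ball 0 r) (\<lambda>q. hypF' (jinv_q q))"
    by (rule continuous_on_compose2[OF holomorphic_on_imp_continuous_on[OF hypF_holo(2)] ct]) (use good(5) in auto)
  have cW: "continuous_on (ball 0 r) W"
    unfolding W_def Z_def E2_def \<epsilon>_def
    by (intro continuous_intros cs cy cv cv' ct ballI good(3) good(6) y0; (assumption | simp))
  have dW: "(W has_field_derivative 0) (at q)" if "q \<in> ball 0 r - {0}" for q
  proof -
    have q: "q \<in> ball 0 r" "q \<noteq> 0" using that by auto
    show ?thesis unfolding W_def
      by (rule DERIV_cong[OF DERIV_divide[OF dZ[OF q] dy[OF q] y0]]) (simp add: y0)
  qed
  obtain c where c: "\<And>q. q \<in> ball 0 r \<Longrightarrow> W q = c"
    by (rule DERIV_zero_connected_constant[of "ball 0 r" "{0}" W]) (use cW dW in auto)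
  have "W 0 = 0" by (simp add: W_def Z_def E2_def \<epsilon>_def jinv_q_def delta_def d2_def)
  then have W0: "W q = 0" if "q \<in> ball 0 r" for q using c[OF that] c[of 0] r by simp
  define s where "s = (\<lambda>q. v q / y q)"
  have ds: "(s has_field_derivative 0) (at q)" if "q \<in> ball 0 r - {0}" for q
  proof -
    have q: "q \<in> ball 0 r" "q \<noteq> 0" using that by auto
    have "hypF' (jinv_q q) * jinv_q q * \<epsilon> q = v q * (E2 q - \<epsilon> q) / 12" using W0[OF q(1)] y0[of q] by (simp add: W_def Z_def)
    then have e: "hypF' (jinv_q q) * (jinv_q q * \<epsilon> q / q) = v q * (E2 q - \<epsilon> q) / (12 * q)" using q(2) by (simp add: field_simps)
    show ?thesis unfolding s_def
      by (rule DERIV_cong[OF DERIV_divide[OF dv[OF q, unfolded e] dy[OF q] y0]]) (simp add: y0)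
  qed
  obtain c where c: "\<And>q. q \<in> ball 0 r \<Longrightarrow> s q = c"
  proof (rule DERIV_zero_connected_constant[of "ball 0 r" "{0}" s])
    show "continuous_on (ball 0 r) s" unfolding s_def by (intro continuous_intros cv cy) (simp add: y0)
  qed (use ds in auto)
  have "s 0 = 1" by (simp add: s_def v_def y_def jinv_q_def delta_def hypF_0)
  then have s1: "s q = 1" if "q \<in> ball 0 r" for q using c[OF that] c[of 0] r by simp
  have "hypF (jinv_q q) ^ 4 = e4 q" if "q \<in> ball 0 r" for q
  proof -
    have "hypF (jinv_q q) = y q" using s1[OF that] y0[of q] by (simp add: s_def v_def)
    moreover have "y q ^ 4 = exp (Ln (e4 q))" unfolding y_def by (simp flip: exp_of_nat_mult)
    ultimately show ?thesis using good(3)[OF that] by simp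
  qed
  then show ?thesis using that[of r] r good by auto
qed

section \<open>Operators attached to twelfth roots\<close>

text \<open>
  \<open>D\<^sub>J\<^sup>2 + opA D\<^sub>J + opB\<close> is the operator with solutions \<open>h\<close> and \<open>\<tau>h\<close>, where \<open>h\<^sup>1\<^sup>2 = K\<close>; \<open>logd K\<close> is
  the logarithmic derivative of \<open>h\<close>.
\<close>

definition logd :: "(complex \<Rightarrow> complex) \<Rightarrow> complex \<Rightarrow> complex" where
  "logd K z = deriv K z / (12 * K z)"

definition opA :: "(complex \<Rightarrow> complex) \<Rightarrow> (complex \<Rightarrow> complex) \<Rightarrow> complex \<Rightarrow> complex" where
  "opA J K s = (deriv (deriv J) s / deriv J s - 2 * logd K s) / deriv J s"

definition opB :: "(complex \<Rightarrow> complex) \<Rightarrow> (complex \<Rightarrow> complex) \<Rightarrow> complex \<Rightarrow> complex" where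
  "opB J K s = (logd K s ^ 2 - deriv (logd K) s) / deriv J s ^ 2"

lemma deriv_cong_open:
  assumes "open U" "s \<in> U" "\<And>z. z \<in> U \<Longrightarrow> f z = g z"
  shows "deriv f s = deriv g s"
  by (rule deriv_cong_ev) (use assms in \<open>auto simp: eventually_nhds\<close>)

lemma op_cong:
  assumes U: "open U" "s \<in> U" and J: "\<And>z. z \<in> U \<Longrightarrow> J z = J' z" and K: "\<And>z. z \<in> U \<Longrightarrow> K z = K' z"
  shows "opA J K s = opA J' K' s" "opB J K s = opB J' K' s"
proof -
  have dJ: "deriv J z = deriv J' z" and dK: "deriv K z = deriv K' z" if "z \<in> U" for z
    using deriv_cong_open[OF U(1) that J] deriv_cong_open[OF U(1) that K] by auto
  have "deriv (deriv J) s = deriv (deriv J') s" by (rule deriv_cong_open[OF U dJ])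
  moreover have l: "logd K z = logd K' z" if "z \<in> U" for z using dK[OF that] K[OF that] by (simp add: logd_def)
  moreover have "deriv (logd K) s = deriv (logd K') s" by (rule deriv_cong_open[OF U l])
  ultimately show "opA J K s = opA J' K' s" "opB J K s = opB J' K' s"
    unfolding opA_def opB_def using dJ[OF U(2)] l[OF U(2)] by simp_all
qed

lemma logd_holo:
  assumes "open V" "K holomorphic_on V" "\<And>z. z \<in> V \<Longrightarrow> K z \<noteq> 0"
  shows "logd K holomorphic_on V"
  unfolding logd_def using assms by (intro holomorphic_intros holomorphic_deriv) auto

text \<open>If \<open>h ^ 12 = K\<close>, then
  \<open>h (\<mu> s) / (\<gamma> * s + \<delta>)\<close> and its product with \<open>s\<close> span
  the pullbacks of \<open>h\<close> and \<open>\<tau> h\<close>, so the coefficients of the operator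
  are simply pulled back. Complex entries cover the map from the disc as well as the modular
  group.\<close>

lemma op_moebius:
  fixes \<alpha> \<beta> \<gamma> \<delta> :: complex
  defines "\<mu> \<equiv> \<lambda>s. (\<alpha> * s + \<beta>) / (\<gamma> * s + \<delta>)"
  assumes V: "open V" "J holomorphic_on V" "K holomorphic_on V" "\<And>z. z \<in> V \<Longrightarrow> K z \<noteq> 0"
    and D: "\<alpha> * \<delta> - \<beta> * \<gamma> \<noteq> 0"
    and U: "open U" "s \<in> U" "\<And>z. z \<in> U \<Longrightarrow> \<gamma> * z + \<delta> \<noteq> 0" "\<And>z. z \<in> U \<Longrightarrow> \<mu> z \<in> V"
  shows "opA (\<lambda>s. J (\<mu> s)) (\<lambda>s. K (\<mu> s) / (\<gamma> * s + \<delta>) ^ 12) s = opA J K (\<mu> s)"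
    "opB (\<lambda>s. J (\<mu> s)) (\<lambda>s. K (\<mu> s) / (\<gamma> * s + \<delta>) ^ 12) s = opB J K (\<mu> s)"
    "deriv (\<lambda>s. J (\<mu> s)) s = deriv J (\<mu> s) * ((\<alpha> * \<delta> - \<beta> * \<gamma>) / (\<gamma> * s + \<delta>) ^ 2)"
proof -
  define D where "D = \<alpha> * \<delta> - \<beta> * \<gamma>"
  define Jt where "Jt = (\<lambda>s. J (\<mu> s))"
  define Kt where "Kt = (\<lambda>s. K (\<mu> s) / (\<gamma> * s + \<delta>) ^ 12)"
  define w where "w = (\<lambda>s. \<gamma> * s + \<delta>)"
  have \<mu>w: "\<mu> = (\<lambda>s. (\<alpha> * s + \<beta>) / w s)" and Kw: "Kt = (\<lambda>s. K (\<mu> s) / w s ^ 12)"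
    by (simp_all add: \<mu>_def Kt_def w_def)
  have D0: "D \<noteq> 0" using D by (simp add: D_def)
  have w0: "w z \<noteq> 0" if "z \<in> U" for z using U(3)[OF that] by (simp add: w_def)
  have dw: "(w has_field_derivative \<gamma>) (at z)" for z unfolding w_def by (auto intro!: derivative_eq_intros)
  have d\<mu>: "(\<mu> has_field_derivative D / w z ^ 2) (at z)" if z: "z \<in> U" for z
  proof -
    have "(\<mu> has_field_derivative (\<alpha> * w z - (\<alpha> * z + \<beta>) * \<gamma>) / (w z * w z)) (at z)"
      unfolding \<mu>w
      by (rule DERIV_cong[OF DERIV_divide[OF _ dw w0[OF z]]]) (auto intro!: derivative_eq_intros)
    moreover have "\<alpha> * w z - (\<alpha> * z + \<beta>) * \<gamma> = D" by (simp add: w_def D_def algebra_simps)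
    ultimately show ?thesis by (simp add: power2_eq_square)
  qed
  have dwi: "((\<lambda>z. D / w z ^ 2) has_field_derivative - 2 * \<gamma> * D / w z ^ 3) (at z)" if z: "z \<in> U" for z
    using dw[of z] w0[OF z] by (auto intro!: derivative_eq_intros simp: power2_eq_square power3_eq_cube field_simps)
  have dJ: "(J has_field_derivative deriv J z) (at z)" "(deriv J has_field_derivative deriv (deriv J) z) (at z)"
    "(K has_field_derivative deriv K z) (at z)" "(logd K has_field_derivative deriv (logd K) z) (at z)" if "z \<in> V" for z
    using holomorphic_derivI[OF V(2,1) that] holomorphic_derivI[OF holomorphic_deriv[OF V(2,1)] V(1) that]
      holomorphic_derivI[OF V(3,1) that] holomorphic_derivI[OF logd_holo[OF V(1,3,4)] V(1) that] by auto
  have J1: "deriv Jt z = deriv J (\<mu> z) * (D / w z ^ 2)" if z: "z \<in> U" for z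
    unfolding Jt_def by (rule DERIV_imp_deriv[OF DERIV_chain2[OF dJ(1)[OF U(4)[OF z]] d\<mu>[OF z]]])
  have J2: "deriv (deriv Jt) z = deriv (deriv J) (\<mu> z) * (D / w z ^ 2) * (D / w z ^ 2) + (- 2 * \<gamma> * D / w z ^ 3) * deriv J (\<mu> z)" if z: "z \<in> U" for z
  proof -
    have "deriv (deriv Jt) z = deriv (\<lambda>z. deriv J (\<mu> z) * (D / w z ^ 2)) z"
      by (rule deriv_cong_open[OF U(1) z J1])
    also have "\<dots> = deriv (deriv J) (\<mu> z) * (D / w z ^ 2) * (D / w z ^ 2) + (- 2 * \<gamma> * D / w z ^ 3) * deriv J (\<mu> z)"
      by (rule DERIV_imp_deriv[OF DERIV_mult[OF DERIV_chain2[OF dJ(2)[OF U(4)[OF z]] d\<mu>[OF z]] dwi[OF z]]])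
    finally show ?thesis .
  qed
  have K1: "logd Kt z = logd K (\<mu> z) * (D / w z ^ 2) - \<gamma> / w z" if z: "z \<in> U" for z
  proof -
    have "((\<lambda>s. w s ^ 12) has_field_derivative 12 * w z ^ 11 * \<gamma>) (at z)"
      using dw[of z] by (auto intro!: derivative_eq_intros)
    from DERIV_divide[OF DERIV_chain2[OF dJ(3)[OF U(4)[OF z]] d\<mu>[OF z]] this]
    have dKt: "deriv Kt z = (deriv K (\<mu> z) * (D / w z ^ 2) * w z ^ 12 - K (\<mu> z) * (12 * w z ^ 11 * \<gamma>)) / (w z ^ 12 * w z ^ 12)"
      unfolding Kw using w0[OF z] by (intro DERIV_imp_deriv) simp
    have Ktz: "Kt z = K (\<mu> z) / w z ^ 12" by (simp add: Kw)
    have alg: "((k * p * W - K0 * (12 * v * \<gamma>)) / (W * W)) / (12 * (K0 / W)) = k / (12 * K0) * p - \<gamma> / u"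
      if "W = v * u" "v \<noteq> 0" "u \<noteq> 0" "K0 \<noteq> 0" for W v u K0 k p :: complex
      using that by (simp add: field_simps)
    show ?thesis
      unfolding logd_def dKt Ktz
      by (rule alg) (use w0[OF z] V(4)[OF U(4)[OF z]] in \<open>auto simp: eval_nat_numeral\<close>)
  qed
  have K2: "deriv (logd Kt) z = deriv (logd K) (\<mu> z) * (D / w z ^ 2) * (D / w z ^ 2) + (- 2 * \<gamma> * D / w z ^ 3) * logd K (\<mu> z) + \<gamma> ^ 2 / w z ^ 2" if z: "z \<in> U" for z
  proof -
    have "((\<lambda>z. \<gamma> / w z) has_field_derivative - (\<gamma> ^ 2 / w z ^ 2)) (at z)"
      using dw[of z] w0[OF z] by (auto intro!: derivative_eq_intros simp: power2_eq_square)
    note * = DERIV_diff[OF DERIV_mult[OF DERIV_chain2[OF dJ(4)[OF U(4)[OF z]] d\<mu>[OF z]] dwi[OF z]] this]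
    have "deriv (logd Kt) z = deriv (\<lambda>z. logd K (\<mu> z) * (D / w z ^ 2) - \<gamma> / w z) z"
      by (rule deriv_cong_open[OF U(1) z K1])
    then show ?thesis using DERIV_imp_deriv[OF *] by simp
  qed
  define p a b c e x where "p = D / w s ^ 2" and "a = deriv J (\<mu> s)" and "b = deriv (deriv J) (\<mu> s)" and "c = logd K (\<mu> s)" and "e = deriv (logd K) (\<mu> s)" and "x = \<gamma> / w s"
  have p0: "p \<noteq> 0" using D0 w0[OF U(2)] by (simp add: p_def)
  have px: "- 2 * \<gamma> * D / w s ^ 3 = - 2 * p * x" by (simp add: p_def x_def power2_eq_square power3_eq_cube)
  have xx: "\<gamma> ^ 2 / w s ^ 2 = x ^ 2" by (simp add: x_def power_divide)
  note eqs = J1[OF U(2)] J2[OF U(2)] K1[OF U(2)] K2[OF U(2)]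
  note eqs' = eqs[unfolded px xx, folded p_def, folded a_def b_def c_def e_def x_def]
  have "opA Jt Kt s = opA J K (\<mu> s)"
    unfolding opA_def eqs' a_def[symmetric] b_def[symmetric] c_def[symmetric]
    using p0 by (cases "a = 0") (simp_all add: field_simps)
  moreover have "opB Jt Kt s = opB J K (\<mu> s)"
  proof -
    have "(c * p - x) ^ 2 - (e * p * p + - 2 * p * x * c + x ^ 2) = (c ^ 2 - e) * p ^ 2"
      by (simp add: power2_eq_square algebra_simps)
    then show ?thesis unfolding opB_def eqs' a_def[symmetric] b_def[symmetric] c_def[symmetric] e_def[symmetric]
      using p0 by (simp add: power_mult_distrib)
  qed
  ultimately show "opA (\<lambda>s. J (\<mu> s)) (\<lambda>s. K (\<mu> s) / (\<gamma> * s + \<delta>) ^ 12) s = opA J K (\<mu> s)"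
    "opB (\<lambda>s. J (\<mu> s)) (\<lambda>s. K (\<mu> s) / (\<gamma> * s + \<delta>) ^ 12) s = opB J K (\<mu> s)"
    unfolding Jt_def Kt_def by auto
  show "deriv (\<lambda>s. J (\<mu> s)) s = deriv J (\<mu> s) * ((\<alpha> * \<delta> - \<beta> * \<gamma>) / (\<gamma> * s + \<delta>) ^ 2)"
    using J1[OF U(2)] unfolding Jt_def D_def w_def .
qed

text \<open>\<open>opA J K\<close> and \<open>opA l K\<close> belong to one solution space in two
  variables. Rewriting the operator from the variable \<open>J\<close>, which is \<open>X\<close>
  after \<open>l\<close>, to the coordinate \<open>l\<close> therefore gives the coefficients formed
  with \<open>l\<close> itself.\<close>

lemma zcoeff_change:
  assumes U: "open U" "s \<in> U" "l holomorphic_on U" and l0: "deriv l s \<noteq> 0"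
    and X: "open W" "X holomorphic_on W" "\<And>z. z \<in> U \<Longrightarrow> l z \<in> W"
    and J: "\<And>z. z \<in> U \<Longrightarrow> J z = X (l z)" and J0: "deriv J s \<noteq> 0"
    and A: "A (l s) = opA J K s" and B: "B (l s) = opB J K s"
  shows "zcoeff1 (DiffOp X A B) (l s) = opA l K s" "zcoeff0 (DiffOp X A B) (l s) = opB l K s"
proof -
  have dX: "(X has_field_derivative deriv X z) (at z)" "(deriv X has_field_derivative deriv (deriv X) z) (at z)" if "z \<in> W" for z
    using holomorphic_derivI[OF X(2,1) that] holomorphic_derivI[OF holomorphic_deriv[OF X(2,1)] X(1) that] by auto
  have dl: "(l has_field_derivative deriv l z) (at z)" "(deriv l has_field_derivative deriv (deriv l) z) (at z)" if "z \<in> U" for z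
    using holomorphic_derivI[OF U(3,1) that] holomorphic_derivI[OF holomorphic_deriv[OF U(3,1)] U(1) that] by auto
  have J1: "deriv J z = deriv X (l z) * deriv l z" if z: "z \<in> U" for z
    using deriv_cong_open[OF U(1) z J] DERIV_imp_deriv[OF DERIV_chain2[OF dX(1)[OF X(3)[OF z]] dl(1)[OF z]]] by simp
  have J2: "deriv (deriv J) s = deriv (deriv X) (l s) * deriv l s * deriv l s + deriv (deriv l) s * deriv X (l s)"
    using deriv_cong_open[OF U(1,2) J1] DERIV_imp_deriv[OF DERIV_mult[OF DERIV_chain2[OF dX(2)[OF X(3)[OF U(2)]] dl(1)[OF U(2)]] dl(2)[OF U(2)]]] by simp
  have X0: "deriv X (l s) \<noteq> 0" using J0 J1[OF U(2)] by auto
  show "zcoeff1 (DiffOp X A B) (l s) = opA l K s"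
    unfolding zcoeff1_def diff_op.sel A opA_def J1[OF U(2)] J2 using X0 l0 by (simp add: field_simps)
  show "zcoeff0 (DiffOp X A B) (l s) = opB l K s"
    unfolding zcoeff0_def diff_op.sel B opB_def J1[OF U(2)] using X0 by (simp add: power_mult_distrib)
qed

lemma moebius_comp_inv:
  assumes "a * d - b * c = (1 :: int)" "Im \<tau> > 0"
  shows "moebius_act (d, - b, - c, a) (moebius_act (a, b, c, d) \<tau>) = \<tau>"
    "moebius_act (a, b, c, d) (moebius_act (d, - b, - c, a) \<tau>) = \<tau>"
proof -
  have *: "(of_int d * ((of_int a * \<tau> + of_int b) / w) - of_int b) / (- of_int c * ((of_int a * \<tau> + of_int b) / w) + of_int a) = \<tau>"
    if e: "of_int a * of_int d - of_int b * of_int c = (1 :: complex)" and w: "w = of_int c * \<tau> + of_int d" "w \<noteq> 0"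
    for a b c d w
  proof -
    have "of_int d * ((of_int a * \<tau> + of_int b) / w) - of_int b = (of_int d * (of_int a * \<tau> + of_int b) - of_int b * w) / w"
      using w(2) by (simp add: field_simps)
    also have "of_int d * (of_int a * \<tau> + of_int b) - of_int b * w = (of_int a * of_int d - of_int b * of_int c) * \<tau>"
      unfolding w(1) by (simp add: algebra_simps)
    finally have 1: "of_int d * ((of_int a * \<tau> + of_int b) / w) - of_int b = \<tau> / w" using e by simp
    have "- of_int c * ((of_int a * \<tau> + of_int b) / w) + of_int a = (of_int a * w - of_int c * (of_int a * \<tau> + of_int b)) / w"
      using w(2) by (simp add: field_simps)
    also have "of_int a * w - of_int c * (of_int a * \<tau> + of_int b) = (of_int a * of_int d - of_int b * of_int c)"
      unfolding w(1) by (simp add: algebra_simps)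
    finally have 2: "- of_int c * ((of_int a * \<tau> + of_int b) / w) + of_int a = 1 / w" using e by simp
    show ?thesis unfolding 1 2 using w(2) by simp
  qed
  have e: "of_int a * of_int d - of_int b * of_int c = (1 :: complex)"
    using assms(1) by (metis of_int_1 of_int_diff of_int_mult)
  show "moebius_act (d, - b, - c, a) (moebius_act (a, b, c, d) \<tau>) = \<tau>"
    using *[OF e refl moebius_Im(1)[OF assms]] by simp
  have e': "of_int d * of_int a - of_int (- b) * of_int (- c) = (1 :: complex)" using e by (simp add: mult.commute)
  have "d * a - - b * - c = 1" using assms(1) by (simp add: mult.commute)
  from *[OF e' refl moebius_Im(1)[OF this assms(2)]]
  show "moebius_act (a, b, c, d) (moebius_act (d, - b, - c, a) \<tau>) = \<tau>" by simp
qed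

section \<open>Local parameters\<close>

text \<open>Uses the same \<open>SOME\<close> as \<open>local_param\<close>, so that the local
  parameter at the cusp is \<open>cusp_q\<close> of the inverse of exactly this matrix.\<close>

definition cusp_mat :: "int \<Rightarrow> int \<Rightarrow> mat2" where
  "cusp_mat a c = (case (SOME (b, d). a * d - b * c = 1) of (b, d) \<Rightarrow> (a, b, c, d))"

lemma cusp_mat:
  assumes "coprime a c"
  obtains b d where "a * d - b * c = 1" "cusp_mat a c = (a, b, c, d)"
    "(SOME (b, d). a * d - b * c = 1) = (b, d)"
proof -
  obtain x y where xy: "a * x + c * y = 1" using assms by (metis bezout_int coprime_iff_gcd_eq_1 mult.commute)
  have "\<exists>p. (case p of (b, d) \<Rightarrow> a * d - b * c = 1)"
    by (rule exI[of _ "(- y, x)"]) (use xy in \<open>simp add: algebra_simps\<close>)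
  then have "(case (SOME (b, d). a * d - b * c = 1) of (b, d) \<Rightarrow> a * d - b * c = 1)" by (rule someI_ex)
  then show ?thesis using that by (cases "SOME (b, d). a * d - b * c = 1") (auto simp: cusp_mat_def)
qed

lemma cusp_width_dvd_iff:
  assumes "(1 - a * c * int w, a\<^sup>2 * int w, - (c\<^sup>2 * int w), 1 + a * c * int w) = m"
  shows "m \<in> Gamma0 M \<longleftrightarrow> int M dvd c\<^sup>2 * int w"
proof -
  have "(1 - a * c * int w) * (1 + a * c * int w) - (a\<^sup>2 * int w) * (- (c\<^sup>2 * int w)) = 1"
    by (simp add: algebra_simps power2_eq_square)
  then show ?thesis unfolding Gamma0_def assms[symmetric] by (simp only: mem_Collect_eq case_prod_conv dvd_minus_iff) simp
qed

text \<open>The matrix in the definition of the width always has determinant 1, so the only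
  condition is \<open>M dvd c^2 * w\<close>.\<close>

lemma cusp_width_eq:
  assumes "M > 0"
  shows "cusp_width M a c = nat (int M div gcd (int M) (c\<^sup>2))"
proof -
  define g where "g = gcd (int M) (c\<^sup>2)"
  have g: "g > 0" "g dvd int M" "g dvd c\<^sup>2" using assms by (auto simp: g_def)
  obtain m k where m: "int M = g * m" and k: "c\<^sup>2 = g * k" using g by (auto elim!: dvdE)
  have "0 < g * m" unfolding m[symmetric] using assms by simp
  then have m0: "m > 0" using g(1) by (simp add: zero_less_mult_iff)
  have cop: "coprime m k"
  proof -
    have "gcd (g * m) (g * k) = g" unfolding m[symmetric] k[symmetric] by (rule g_def[symmetric])
    moreover have "gcd (g * m) (g * k) = g * gcd m k" using gcd_mult_distrib_int[of g m k] g(1) by simp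
    ultimately have "gcd m k = 1" using g(1) by simp
    then show ?thesis by (simp only: coprime_iff_gcd_eq_1)
  qed
  have iff: "int M dvd c\<^sup>2 * int w \<longleftrightarrow> m dvd int w" for w
    unfolding m k using g cop by (simp add: mult.assoc coprime_dvd_mult_right_iff)
  have "(LEAST w. w > 0 \<and> int M dvd c\<^sup>2 * int w) = nat m"
  proof (rule Least_equality)
    show "nat m > 0 \<and> int M dvd c\<^sup>2 * int (nat m)" unfolding iff using m0 by simp
    show "nat m \<le> w" if "w > 0 \<and> int M dvd c\<^sup>2 * int w" for w
      using that unfolding iff by (auto dest: zdvd_imp_le)
  qed
  moreover have "int M div gcd (int M) (c\<^sup>2) = m"
  proof -
    have "int M div gcd (int M) (c\<^sup>2) = (g * m) div g" by (simp only: g_def[symmetric] m[symmetric])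
    then show ?thesis using g(1) by simp
  qed
  ultimately show ?thesis unfolding cusp_width_def cusp_width_dvd_iff[OF refl] by (simp only:)
qed

lemma cusp_width_pos: "M > 0 \<Longrightarrow> cusp_width M a c > 0"
  by (simp add: cusp_width_eq pos_imp_zdiv_pos_iff zdvd_imp_le)

definition cusp_q :: "nat \<Rightarrow> complex \<Rightarrow> complex" where "cusp_q w \<tau> = to_q (\<tau> / of_nat w)"

lemma cusp_q_nonzero [simp]: "cusp_q w \<tau> \<noteq> 0" by (simp add: cusp_q_def)

lemma cusp_q_surj:
  assumes "z \<noteq> 0" "norm z < 1" "w > 0"
  obtains \<tau> where "Im \<tau> > 0" "cusp_q w \<tau> = z"
proof -
  obtain t where "Im t > 0" "to_q t = z" using to_q_surj assms by blast
  then show ?thesis using that[of "of_nat w * t"] assms by (simp add: cusp_q_def)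
qed

lemma cusp_q_power': "w > 0 \<Longrightarrow> cusp_q w \<tau> ^ w = to_q \<tau>"
  unfolding cusp_q_def to_q_mult_nat[symmetric] by simp

lemma local_param_cusp:
  assumes "cusp_mat a c = (a, b, c, d)" "coprime a c"
  shows "local_param M (Cusp a c) \<tau> = cusp_q (cusp_width M a c) (moebius_act (d, - b, - c, a) \<tau>)"
proof -
  obtain b' d' where "cusp_mat a c = (a, b', c, d')" "(SOME (b, d). a * d - b * c = 1) = (b', d')"
    using cusp_mat[OF assms(2)] by blast
  then show ?thesis using assms by (simp add: cusp_q_def to_q_def)
qed

text \<open>Pulling back by \<open>cusp_mat\<close> turns the local parameter into
  \<open>cusp_q\<close>. The condition that the parameter be nonzero disappears, since an
  exponential has no zeros.\<close>

lemma expands_at_cusp_iff: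
  assumes "coprime a c"
  shows "expands_at M f (Cusp a c) F \<longleftrightarrow>
    (\<exists>r>0. \<forall>\<tau>. Im \<tau> > 0 \<and> norm (cusp_q (cusp_width M a c) \<tau>) < r \<longrightarrow>
       f (moebius_act (cusp_mat a c) \<tau>) = F (cusp_q (cusp_width M a c) \<tau>))"
proof -
  obtain b d where bd: "a * d - b * c = 1" "cusp_mat a c = (a, b, c, d)" using cusp_mat[OF assms] by blast
  have bd': "d * a - - b * - c = 1" using bd(1) by (simp add: mult.commute)
  note lp = local_param_cusp[OF bd(2) assms]
  show ?thesis unfolding expands_at_def lp bd(2)
  proof (intro ex_cong1 conj_cong refl iffI allI ballI impI)
    fix r \<tau> assume h: "\<forall>\<tau>\<in>upper_half. 0 < norm (cusp_q (cusp_width M a c) (moebius_act (d, - b, - c, a) \<tau>)) \<and>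
          norm (cusp_q (cusp_width M a c) (moebius_act (d, - b, - c, a) \<tau>)) < r \<longrightarrow>
            f \<tau> = F (cusp_q (cusp_width M a c) (moebius_act (d, - b, - c, a) \<tau>))"
      and t: "Im \<tau> > 0 \<and> norm (cusp_q (cusp_width M a c) \<tau>) < r"
    have m: "moebius_act (a, b, c, d) \<tau> \<in> upper_half" unfolding upper_half_iff using moebius_Im(2)[OF bd(1)] t by blast
    have i: "moebius_act (d, - b, - c, a) (moebius_act (a, b, c, d) \<tau>) = \<tau>" using moebius_comp_inv(1)[OF bd(1)] t by blast
    show "f (moebius_act (a, b, c, d) \<tau>) = F (cusp_q (cusp_width M a c) \<tau>)"
      using h[rule_format, OF m] unfolding i using t by simp
  next
    fix r \<tau> assume h: "\<forall>\<tau>. 0 < Im \<tau> \<and> norm (cusp_q (cusp_width M a c) \<tau>) < r \<longrightarrow>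
             f (moebius_act (a, b, c, d) \<tau>) = F (cusp_q (cusp_width M a c) \<tau>)"
      and t: "\<tau> \<in> upper_half" "0 < norm (cusp_q (cusp_width M a c) (moebius_act (d, - b, - c, a) \<tau>)) \<and>
          norm (cusp_q (cusp_width M a c) (moebius_act (d, - b, - c, a) \<tau>)) < r"
    have t': "Im \<tau> > 0" using t by (simp add: upper_half_iff)
    show "f \<tau> = F (cusp_q (cusp_width M a c) (moebius_act (d, - b, - c, a) \<tau>))"
      using h[rule_format, of "moebius_act (d, - b, - c, a) \<tau>"] moebius_Im(2)[OF bd' t'] t(2) moebius_comp_inv(2)[OF bd(1) t'] by metis
  qed
qed

section \<open>The disc coordinate and the stabilizer at a point of the upper half-plane\<close>

definition inner_s :: "complex \<Rightarrow> complex \<Rightarrow> complex" where "inner_s \<tau>0 \<tau> = (\<tau> - \<tau>0) / (\<tau> - cnj \<tau>0)"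
text \<open>The inverse of the Cayley map \<open>inner_s\<close>. The denominator is spelled
  \<open>- 1 * s + 1\<close> to have the literal shape of the map in
  \<open>op_moebius\<close>.\<close>

definition inner_mu :: "complex \<Rightarrow> complex \<Rightarrow> complex" where "inner_mu \<tau>0 s = (- cnj \<tau>0 * s + \<tau>0) / (- 1 * s + 1)"

lemma inner_s_mu:
  assumes "Im \<tau>0 > 0" "s \<noteq> 1"
  shows "inner_s \<tau>0 (inner_mu \<tau>0 s) = s"
proof -
  have n: "\<tau>0 - cnj \<tau>0 \<noteq> 0" using assms by (auto simp: complex_eq_iff)
  have s: "1 - s \<noteq> 0" using assms by auto
  have mu: "inner_mu \<tau>0 s = (- cnj \<tau>0 * s + \<tau>0) / (1 - s)" by (simp add: inner_mu_def)
  have 1: "inner_mu \<tau>0 s - \<tau>0 = s * (\<tau>0 - cnj \<tau>0) / (1 - s)"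
    unfolding mu using s by (simp add: field_simps)
  have 2: "inner_mu \<tau>0 s - cnj \<tau>0 = (\<tau>0 - cnj \<tau>0) / (1 - s)"
    unfolding mu using s by (simp add: field_simps)
  show ?thesis unfolding inner_s_def 1 2 using n s by simp
qed

lemma inner_mu_s:
  assumes "Im \<tau>0 > 0" "Im \<tau> > 0"
  shows "inner_mu \<tau>0 (inner_s \<tau>0 \<tau>) = \<tau>" "norm (inner_s \<tau>0 \<tau>) < 1"
proof -
  have n: "\<tau>0 - cnj \<tau>0 \<noteq> 0" using assms by (auto simp: complex_eq_iff)
  have d: "\<tau> - cnj \<tau>0 \<noteq> 0" using assms by (auto simp: complex_eq_iff)
  have 1: "- 1 * inner_s \<tau>0 \<tau> + 1 = (\<tau>0 - cnj \<tau>0) / (\<tau> - cnj \<tau>0)"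
    unfolding inner_s_def using d by (simp add: field_simps)
  have 2: "- cnj \<tau>0 * inner_s \<tau>0 \<tau> + \<tau>0 = \<tau> * (\<tau>0 - cnj \<tau>0) / (\<tau> - cnj \<tau>0)"
    unfolding inner_s_def using d by (simp add: field_simps)
  show "inner_mu \<tau>0 (inner_s \<tau>0 \<tau>) = \<tau>" unfolding inner_mu_def 1 2 using n d by simp
  have "norm (\<tau> - \<tau>0) ^ 2 < norm (\<tau> - cnj \<tau>0) ^ 2"
  proof -
    have "norm (\<tau> - cnj \<tau>0) ^ 2 - norm (\<tau> - \<tau>0) ^ 2 = 4 * (Im \<tau> * Im \<tau>0)"
      unfolding cmod_power2 by (simp add: power2_eq_square algebra_simps)
    also have "\<dots> > 0" using assms by simp
    finally show ?thesis by simp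
  qed
  then have "norm (\<tau> - \<tau>0) < norm (\<tau> - cnj \<tau>0)" by (rule power_less_imp_less_base) simp
  then show "norm (inner_s \<tau>0 \<tau>) < 1" unfolding inner_s_def norm_divide using d by simp
qed

lemma inner_mu_Im:
  assumes "Im \<tau>0 > 0" "norm s < 1"
  shows "Im (inner_mu \<tau>0 s) > 0"
proof -
  have s: "1 - s \<noteq> 0" using assms by auto
  have mu: "inner_mu \<tau>0 s = (- cnj \<tau>0 * s + \<tau>0) / (1 - s)" by (simp add: inner_mu_def)
  have "Im (- cnj \<tau>0 * s + \<tau>0) * Re (1 - s) - Re (- cnj \<tau>0 * s + \<tau>0) * Im (1 - s) = Im \<tau>0 * (1 - norm s ^ 2)"
    unfolding cmod_power2 by (simp add: power2_eq_square algebra_simps)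
  moreover have "norm s ^ 2 < 1" using assms(2) by (simp add: power_less_one_iff)
  ultimately show ?thesis unfolding mu Im_divide using assms s
    by (intro divide_pos_pos) (auto simp: complex_eq_iff sum_power2_gt_zero_iff)
qed

lemma local_param_inner: "local_param M (Inner \<tau>0) \<tau> = inner_s \<tau>0 \<tau> ^ stab_order M \<tau>0"
  by (simp add: inner_s_def)

text \<open>The principal root jumps along the cut but tends to 0 from all directions; so limits in
  \<open>s ^ k\<close> as \<open>s\<close> tends to 0 can be read as limits in
  \<open>z\<close>.\<close>

lemma root_tends_to_0:
  assumes "k > 0"
  shows "filterlim (\<lambda>z. exp (Ln z / of_nat k)) (at 0) (at (0 :: complex))"
proof -
  have "((\<lambda>z::complex. exp (Ln z / of_nat k)) \<longlongrightarrow> 0) (at 0)"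
  proof (rule Lim_null_comparison)
    show "eventually (\<lambda>z. norm (exp (Ln z / of_nat k)) \<le> norm z powr (1 / real k)) (at (0 :: complex))"
      unfolding eventually_at_filter using assms by (intro always_eventually) (auto simp: powr_def)
    have "((\<lambda>z. norm (z :: complex) powr (1 / real k)) \<longlongrightarrow> 0 powr (1 / real k)) (at 0)"
      using assms by (intro tendsto_powr' tendsto_eq_intros) auto
    then show "((\<lambda>z. norm (z :: complex) powr (1 / real k)) \<longlongrightarrow> 0) (at 0)" by simp
  qed
  then show ?thesis by (auto simp: filterlim_at)
qed

lemma root_power: "k > 0 \<Longrightarrow> z \<noteq> 0 \<Longrightarrow> exp (Ln z / of_nat k) ^ k = (z :: complex)"
  by (simp flip: exp_of_nat_mult)

text \<open>Invariance under the \<open>k\<close>-th roots of unity makes the value at a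
  \<open>k\<close>-th root of \<open>z\<close> independent of the chosen root. Hence the
  discontinuous principal root can be replaced near each point by an analytic branch.\<close>

lemma meromorphic_of_power:
  fixes \<phi> :: "complex \<Rightarrow> complex"
  assumes mero: "\<phi> meromorphic_on {0}" and k: "k > 0" and r: "r > 0"
    and inv: "\<And>s \<zeta>. 0 < norm s \<Longrightarrow> norm s < r \<Longrightarrow> \<zeta> ^ k = 1 \<Longrightarrow> \<phi> (\<zeta> * s) = \<phi> s"
  obtains \<Phi> where "\<Phi> meromorphic_on {0}" "\<And>s. 0 < norm s \<Longrightarrow> norm s < r \<Longrightarrow> \<phi> s = \<Phi> (s ^ k)"
proof -
  define rt where "rt = (\<lambda>z. exp (Ln z / of_nat k) :: complex)"
  define \<Phi> where "\<Phi> = (\<lambda>z. \<phi> (rt z))"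
  have rt: "rt z ^ k = z" if "z \<noteq> 0" for z unfolding rt_def by (rule root_power[OF k that])
  have \<Phi>: "\<phi> s = \<Phi> (s ^ k)" if s: "0 < norm s" "norm s < r" for s
  proof -
    have s0: "s \<noteq> 0" using s by auto
    have "(rt (s ^ k) / s) ^ k = 1" using rt[of "s ^ k"] s0 by (simp add: power_divide)
    from inv[OF s this] show ?thesis using s0 by (simp add: \<Phi>_def)
  qed
  obtain r1 where r1: "r1 > 0" "\<phi> analytic_on ball 0 r1 - {0}"
    using mero unfolding meromorphic_at_iff isolated_singularity_at_def by blast
  define r2 where "r2 = min r r1"
  have r2: "r2 > 0" using r r1 by (simp add: r2_def)
  have lt: "norm s < r2" if "norm s ^ k < r2 ^ k" for s :: complex
    using that r2 by (meson less_imp_le power_less_imp_less_base)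
  have an: "\<Phi> analytic_on {z0}" if z0: "z0 \<in> ball 0 (r2 ^ k) - {0}" for z0
  proof -
    define s0 where "s0 = rt z0"
    have s0: "s0 ^ k = z0" "s0 \<noteq> 0" using rt z0 by (auto simp: s0_def rt_def)
    \<comment> \<open>The analytic branch of the \<open>k\<close>-th root near \<open>z0\<close>
      with value \<open>s0\<close> there: \<open>z / z0\<close> is close to 1, away from the
      cut.\<close>
    define h where "h = (\<lambda>z. s0 * exp (Ln (z / z0) / of_nat k))"
    have hk: "h z ^ k = z" if "z \<noteq> 0" for z
      using that z0 root_power[OF k, of "z / z0"] unfolding h_def by (simp add: power_mult_distrib s0)
    have "z0 / z0 = 1" using z0 by simp
    then have "z0 / z0 \<notin> \<real>\<^sub>\<le>\<^sub>0" by simp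
    then have ha: "h analytic_on {z0}" unfolding h_def using k z0 by (intro analytic_intros) auto
    have hz: "h z0 = s0" unfolding h_def using z0 by simp
    have "norm s0 ^ k < r2 ^ k" using z0 s0(1) by (auto simp: norm_power[symmetric])
    then have ns: "norm s0 < r2" by (rule lt)
    have "\<phi> analytic_on {s0}" by (rule analytic_on_subset[OF r1(2)]) (use ns s0 in \<open>auto simp: r2_def\<close>)
    then have "(\<lambda>z. \<phi> (h z)) analytic_on {z0}"
      using analytic_on_compose[OF ha, of \<phi>] hz by (simp add: o_def)
    moreover have "eventually (\<lambda>z. \<phi> (h z) = \<Phi> z) (nhds z0)"
    proof -
      have "eventually (\<lambda>z. z \<in> ball 0 (r2 ^ k) - {0}) (nhds z0)"
        using z0 by (intro eventually_nhds_in_open) auto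
      then show ?thesis
      proof eventually_elim
        case (elim z)
        then have z: "z \<noteq> 0" "norm z < r2 ^ k" by auto
        have "norm (h z) ^ k < r2 ^ k" using z hk[OF z(1)] by (simp flip: norm_power)
        then have "norm (h z) < r2" by (rule lt)
        moreover have "h z \<noteq> 0" using s0 by (simp add: h_def)
        ultimately show ?case using \<Phi>[of "h z"] hk[OF z(1)] by (simp add: r2_def)
      qed
    qed
    ultimately show ?thesis using analytic_at_cong[of "\<lambda>z. \<phi> (h z)" \<Phi> z0 z0] by simp
  qed
  have "\<Phi> analytic_on ball 0 (r2 ^ k) - {0}" using an by (subst analytic_on_analytic_at) blast
  then have "isolated_singularity_at \<Phi> 0"
    unfolding isolated_singularity_at_def using r2 by (intro exI[of _ "r2 ^ k"]) simp
  moreover have "not_essential \<Phi> 0"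
  proof -
    have f: "filterlim rt (at 0) (at 0)" unfolding rt_def by (rule root_tends_to_0[OF k])
    have "not_essential \<phi> 0" using mero by (simp add: meromorphic_at_iff)
    then show ?thesis
      unfolding not_essential_def is_pole_def \<Phi>_def using filterlim_compose[OF _ f] by blast
  qed
  ultimately have "\<Phi> meromorphic_on {0}" by (simp add: meromorphic_at_iff)
  then show ?thesis using that \<Phi> by blast
qed

lemma moebius_Im_eq:
  assumes "a * d - b * c = (1 :: int)"
  shows "Im (moebius_act (a, b, c, d) \<tau>) = Im \<tau> / norm (of_int c * \<tau> + of_int d) ^ 2"
proof -
  define w where "w = of_int c * \<tau> + of_int d"
  have "Im (of_int a * \<tau> + of_int b) * Re w - Re (of_int a * \<tau> + of_int b) * Im w = of_int (a * d - b * c) * Im \<tau>"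
    by (simp add: w_def algebra_simps)
  then show ?thesis unfolding moebius_act.simps w_def[symmetric] Im_divide cmod_power2 using assms by simp
qed

locale stabilizer =
  fixes M :: nat and \<tau>0 :: complex
  assumes pos: "Im \<tau>0 > 0"
begin

text \<open>
  On the stabilizer of \<open>\<tau>0\<close> the cocycle \<open>jf\<close> has absolute value 1, so \<open>chi \<gamma> = 1 / (jf \<gamma>)\<^sup>2\<close> is the derivative of
  \<open>\<gamma>\<close> at \<open>\<tau>0\<close>: in the coordinate \<open>inner_s \<tau>0\<close>, \<open>\<gamma>\<close> is the rotation by \<open>chi \<gamma>\<close>.
\<close>

definition "G = {\<gamma> \<in> Gamma0 M. moebius_act \<gamma> \<tau>0 = \<tau>0}"
definition "jf = (\<lambda>(a :: int, b :: int, c, d). of_int c * \<tau>0 + of_int d :: complex)"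
definition "chi \<gamma> = cnj (jf \<gamma>) / jf \<gamma>"

lemma G_D:
  assumes "(a, b, c, d) \<in> G"
  shows "a * d - b * c = 1" "int M dvd c" "norm (of_int c * \<tau>0 + of_int d) = 1"
    "of_int a * \<tau>0 + of_int b = \<tau>0 * (of_int c * \<tau>0 + of_int d)"
proof -
  show 1: "a * d - b * c = 1" "int M dvd c" using assms by (auto simp: G_def Gamma0_def)
  have f: "moebius_act (a, b, c, d) \<tau>0 = \<tau>0" using assms by (simp add: G_def)
  have "Im \<tau>0 / norm (of_int c * \<tau>0 + of_int d) ^ 2 = Im \<tau>0"
    using moebius_Im_eq[OF 1(1), of \<tau>0] f by simp
  then have "norm (of_int c * \<tau>0 + of_int d) ^ 2 = 1"
    using pos moebius_Im(1)[OF 1(1) pos] by (simp add: field_simps)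
  then show "norm (of_int c * \<tau>0 + of_int d) = 1" by (simp add: power2_eq_1_iff) (metis norm_ge_zero neg_0_le_iff_le not_one_le_zero)
  show "of_int a * \<tau>0 + of_int b = \<tau>0 * (of_int c * \<tau>0 + of_int d)"
    using f moebius_Im(1)[OF 1(1) pos] by (simp add: field_simps)
qed

lemma lin_inj:
  assumes "of_int c * \<tau>0 + of_int d = (of_int c' * \<tau>0 + of_int d' :: complex)"
  shows "c = c'" "d = d'"
proof -
  have "Im (of_int c * \<tau>0 + of_int d) = Im (of_int c' * \<tau>0 + of_int d')" using assms by simp
  then show "c = c'" using pos by simp
  then show "d = d'" using assms by simp
qed

text \<open>As \<open>\<tau>0\<close> is fixed, the bottom row determines the value of the top row,
  and each row can be read off from its value because \<open>\<tau>0\<close> is not real.\<close>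

lemma jf_inj: "inj_on jf G"
proof (rule inj_onI)
  fix x y assume xy: "x \<in> G" "y \<in> G" "jf x = jf y"
  obtain a b c d where x: "x = (a, b, c, d)" by (cases x)
  obtain a' b' c' d' where y: "y = (a', b', c', d')" by (cases y)
  have "c = c'" "d = d'" using lin_inj[of c d c' d'] xy(3) by (auto simp: jf_def x y)
  then have "of_int a * \<tau>0 + of_int b = (of_int a' * \<tau>0 + of_int b' :: complex)"
    using G_D(4)[of a b c d] G_D(4)[of a' b' c' d'] xy x y by simp
  from lin_inj[OF this] show "x = y" using x y \<open>c = c'\<close> \<open>d = d'\<close> by simp
qed

text \<open>The bottom rows are lattice points on the unit circle.\<close>

lemma finite_G: "finite G"
proof -
  define B where "B = \<lceil>1 / Im \<tau>0\<rceil>"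
  define C where "C = \<lceil>1 + real_of_int B * norm \<tau>0\<rceil>"
  have "jf ` G \<subseteq> (\<lambda>(c, d). of_int c * \<tau>0 + of_int d) ` ({- B..B} \<times> {- C..C})"
  proof
    fix z assume "z \<in> jf ` G"
    then obtain a b c d where g: "(a, b, c, d) \<in> G" and z: "z = of_int c * \<tau>0 + of_int d" by (auto simp: jf_def)
    have n: "norm z = 1" using G_D(3)[OF g] z by simp
    have "\<bar>of_int c * Im \<tau>0\<bar> \<le> 1" using abs_Im_le_cmod[of z] n z by simp
    then have "\<bar>real_of_int c\<bar> \<le> 1 / Im \<tau>0" using pos by (simp add: abs_mult field_simps)
    then have c: "\<bar>real_of_int c\<bar> \<le> real_of_int B" unfolding B_def by linarith
    have "\<bar>real_of_int d\<bar> = norm (of_int d :: complex)" by simp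
    also have "of_int d = z - of_int c * \<tau>0" using z by simp
    also have "norm (z - of_int c * \<tau>0) \<le> 1 + \<bar>real_of_int c\<bar> * norm \<tau>0"
      using norm_triangle_ineq4[of z "of_int c * \<tau>0"] n by (simp add: norm_mult)
    also have "\<dots> \<le> 1 + real_of_int B * norm \<tau>0" using c by (simp add: mult_right_mono)
    finally have d: "\<bar>real_of_int d\<bar> \<le> real_of_int C" unfolding C_def by linarith
    have "c \<in> {- B..B}" "d \<in> {- C..C}" using c d by auto
    then show "z \<in> (\<lambda>(c, d). of_int c * \<tau>0 + of_int d) ` ({- B..B} \<times> {- C..C})" using z by auto
  qed
  then have "finite (jf ` G)" by (rule finite_subset) auto
  then show ?thesis by (rule finite_imageD[OF _ jf_inj])
qed

lemma jf_norm: "x \<in> G \<Longrightarrow> norm (jf x) = 1"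
  using G_D(3) by (cases x) (auto simp: jf_def)

lemma chi_eq: 
  assumes "x \<in> G"
  shows "chi x = cnj (jf x ^ 2)"
proof -
  have "jf x * cnj (jf x) = 1" using jf_norm[OF assms] by (simp add: complex_norm_square[symmetric])
  moreover have "jf x \<noteq> 0" using jf_norm[OF assms] by auto
  ultimately show ?thesis unfolding chi_def by (simp add: power2_eq_square field_simps)
qed

lemma neg_G: "(a, b, c, d) \<in> G \<Longrightarrow> (- a, - b, - c, - d) \<in> G"
proof -
  assume g: "(a, b, c, d) \<in> G"
  have "moebius_act (- a, - b, - c, - d) \<tau>0 = moebius_act (a, b, c, d) \<tau>0"
  proof -
    have "of_int (- a) * \<tau>0 + of_int (- b) = - (of_int a * \<tau>0 + of_int b)"
      "of_int (- c) * \<tau>0 + of_int (- d) = - (of_int c * \<tau>0 + of_int d)" by auto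
    then show ?thesis by (simp only: moebius_act.simps minus_divide_divide)
  qed
  then show ?thesis using g by (auto simp: G_def Gamma0_def simp del: moebius_act.simps)
qed

lemma one_G: "(1, 0, 0, 1) \<in> G" by (auto simp: G_def Gamma0_def)

text \<open>On the unit circle \<open>chi\<close> is the conjugate square of \<open>jf\<close>, so
  its fibres are pairs of opposite matrices. This matches the division by 2 in
  \<open>stab_order\<close>.\<close>

lemma card_fiber:
  assumes "x \<in> G"
  shows "card {y \<in> G. chi y = chi x} = 2"
proof -
  obtain a b c d where x: "x = (a, b, c, d)" by (cases x)
  define x' where "x' = (- a, - b, - c, - d)"
  have x'G: "x' \<in> G" using neg_G assms x by (simp add: x'_def)
  have jx': "jf x' = - jf x" by (simp add: jf_def x x'_def)
  have "{y \<in> G. chi y = chi x} = {x, x'}"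
  proof (intro equalityI subsetI)
    fix y assume "y \<in> {y \<in> G. chi y = chi x}"
    then have y: "y \<in> G" "chi y = chi x" by blast+
    then have "cnj (jf y ^ 2) = cnj (jf x ^ 2)" using chi_eq[OF y(1)] chi_eq[OF assms] by simp
    then have "jf y ^ 2 = jf x ^ 2" by (simp only: complex_cnj_cancel_iff)
    then have "jf y = jf x \<or> jf y = jf x'" unfolding jx' by (simp add: power2_eq_iff)
    then show "y \<in> {x, x'}" using inj_onD[OF jf_inj _ y(1) assms] inj_onD[OF jf_inj _ y(1) x'G] by auto
  qed (use assms x'G chi_eq jx' in auto)
  moreover have "x \<noteq> x'"
  proof
    assume "x = x'"
    then have "jf x = - jf x" using jx' by simp
    then have "jf x = 0" by simp
    then show False using jf_norm[OF assms] by simp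
  qed
  ultimately show ?thesis by simp
qed

lemma card_chi: "stab_order M \<tau>0 = card (chi ` G)"
proof -
  have "card G = (\<Sum>y\<in>chi ` G. card {x \<in> G. chi x = y})"
    using sum.image_gen[OF finite_G, of "\<lambda>_. 1 :: nat" chi] by simp
  also have "\<dots> = (\<Sum>y\<in>chi ` G. 2)" by (rule sum.cong) (auto simp: card_fiber)
  finally have "card G = 2 * card (chi ` G)" by simp
  then show ?thesis unfolding stab_order_def G_def[symmetric] by simp
qed

lemma stab_order_pos: "stab_order M \<tau>0 > 0"
  unfolding card_chi card_gt_0_iff using finite_G one_G by auto

lemma mult_G:
  assumes "x \<in> G" "y \<in> G"
  obtains z where "z \<in> G" "jf z = jf x * jf y"
proof -
  obtain a b c d where x: "x = (a, b, c, d)" by (cases x)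
  obtain a' b' c' d' where y: "y = (a', b', c', d')" by (cases y)
  define z where "z = (a * a' + b * c', a * b' + b * d', c * a' + d * c', c * b' + d * d')"
  note gx = G_D[OF assms(1)[unfolded x]] and gy = G_D[OF assms(2)[unfolded y]]
  have j: "jf z = jf x * jf y"
  proof -
    have "jf z = of_int c * (of_int a' * \<tau>0 + of_int b') + of_int d * (of_int c' * \<tau>0 + of_int d')"
      by (simp add: jf_def z_def algebra_simps)
    then show ?thesis unfolding gy(4) by (simp add: jf_def x y algebra_simps)
  qed
  have "(a * a' + b * c') * (c * b' + d * d') - (a * b' + b * d') * (c * a' + d * c') = (a * d - b * c) * (a' * d' - b' * c')"
    by (simp add: algebra_simps)
  then have det: "(a * a' + b * c') * (c * b' + d * d') - (a * b' + b * d') * (c * a' + d * c') = 1" using gx(1) gy(1) by simp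
  have num: "of_int (a * a' + b * c') * \<tau>0 + of_int (a * b' + b * d') = \<tau>0 * jf z"
  proof -
    have "of_int (a * a' + b * c') * \<tau>0 + of_int (a * b' + b * d') = of_int a * (of_int a' * \<tau>0 + of_int b') + of_int b * (of_int c' * \<tau>0 + of_int d')"
      by (simp add: algebra_simps)
    also have "\<dots> = (of_int a * \<tau>0 + of_int b) * (of_int c' * \<tau>0 + of_int d')" unfolding gy(4) by (simp add: algebra_simps)
    finally show ?thesis unfolding gx(4) j by (simp add: jf_def x y)
  qed
  have z0: "jf z \<noteq> 0" using j jf_norm[OF assms(1)] jf_norm[OF assms(2)] by auto
  have "moebius_act z \<tau>0 = \<tau>0"
  proof -
    have "moebius_act z \<tau>0 = (of_int (a * a' + b * c') * \<tau>0 + of_int (a * b' + b * d')) / jf z"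
      unfolding z_def jf_def by (simp only: moebius_act.simps case_prod_conv)
    then show ?thesis unfolding num using z0 by simp
  qed
  moreover have "z \<in> Gamma0 M" using det gx(2) gy(2) by (auto simp: Gamma0_def z_def)
  ultimately show ?thesis using that j by (simp add: G_def)
qed

text \<open>Multiplication by an element \<open>\<zeta>\<close> of the image permutes this finite
  set; comparing the products of all elements gives \<open>\<zeta> ^ k = 1\<close>, where
  \<open>k\<close> is its size. There are only \<open>k\<close> such roots of unity, so all of them
  occur.\<close>

lemma chi_image: "chi ` G = {\<zeta>. \<zeta> ^ stab_order M \<tau>0 = 1}"
proof -
  define k where "k = stab_order M \<tau>0"
  define C where "C = chi ` G"
  have fC: "finite C" using finite_G by (simp add: C_def)
  have nz: "\<zeta> \<noteq> 0" if zC: "\<zeta> \<in> C" for \<zeta>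
  proof -
    obtain g where g: "g \<in> G" "\<zeta> = chi g" using zC unfolding C_def by blast
    have "jf g \<noteq> 0" using jf_norm[OF g(1)] by auto
    then show ?thesis unfolding g(2) chi_def by simp
  qed
  have "C \<subseteq> {\<zeta>. \<zeta> ^ k = 1}"
  proof
    fix \<zeta> assume z: "\<zeta> \<in> C"
    have sub: "(*) \<zeta> ` C \<subseteq> C"
    proof
      fix y assume "y \<in> (*) \<zeta> ` C"
      then obtain g h where "g \<in> G" "h \<in> G" "y = chi g * chi h" using z by (auto simp: C_def)
      moreover then obtain m where "m \<in> G" "jf m = jf g * jf h" using mult_G by blast
      ultimately have "y = chi m" by (simp add: chi_eq power_mult_distrib)
      then show "y \<in> C" using \<open>m \<in> G\<close> by (simp add: C_def)
    qed
    have inj: "inj_on ((*) \<zeta>) C" using nz[OF z] by (auto simp: inj_on_def)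
    have "(*) \<zeta> ` C = C" by (rule card_subset_eq[OF fC sub card_image[OF inj]])
    then have "\<Prod>C = prod ((*) \<zeta>) C" using prod.reindex[OF inj, of "\<lambda>x. x"] by simp
    also have "\<dots> = \<zeta> ^ card C * \<Prod>C" by (simp add: prod.distrib)
    finally have "\<zeta> ^ card C = 1" using nz fC by (simp add: prod_zero_iff)
    then show "\<zeta> \<in> {\<zeta>. \<zeta> ^ k = 1}" by (simp add: k_def card_chi C_def)
  qed
  moreover have "card C = card {\<zeta>::complex. \<zeta> ^ k = 1}"
    using card_roots_unity_eq[of k] stab_order_pos by (simp add: k_def card_chi[symmetric] C_def)
  moreover have "finite {\<zeta>::complex. \<zeta> ^ k = 1}" using finite_roots_unity[of k] stab_order_pos by (simp add: k_def)
  ultimately show ?thesis using card_subset_eq by (metis C_def k_def)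
qed

lemma chi_acts:
  assumes "x \<in> G" "Im \<tau> > 0"
  shows "inner_s \<tau>0 (moebius_act x \<tau>) = chi x * inner_s \<tau>0 \<tau>"
proof -
  obtain a b c d where x: "x = (a, b, c, d)" by (cases x)
  note g = G_D[OF assms(1)[unfolded x]]
  define j j' w where "j = of_int c * \<tau>0 + of_int d" and "j' = of_int c * cnj \<tau>0 + of_int d" and "w = of_int c * \<tau> + of_int d"
  have w0: "w \<noteq> 0" "j \<noteq> 0" unfolding w_def j_def using moebius_Im(1)[OF g(1)] assms(2) pos by auto
  have j': "j' = cnj j" by (simp add: j_def j'_def)
  then have j'0: "j' \<noteq> 0" using w0 by simp
  have e: "of_int a * of_int d - of_int b * of_int c = (1 :: complex)" using g(1) by (metis of_int_1 of_int_diff of_int_mult)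
  have t0: "\<tau>0 = (of_int a * \<tau>0 + of_int b) / j" using g(4) w0 by (simp add: j_def)
  have t0': "cnj \<tau>0 = (of_int a * cnj \<tau>0 + of_int b) / j'"
  proof -
    have "cnj (of_int a * \<tau>0 + of_int b) = cnj (\<tau>0 * j)" using g(4) by (simp add: j_def)
    then have "of_int a * cnj \<tau>0 + of_int b = cnj \<tau>0 * j'" unfolding j' by simp
    then show ?thesis using j'0 by simp
  qed
  have diff: "(of_int a * \<tau> + of_int b) / w - (of_int a * u + of_int b) / v = (\<tau> - u) / (w * v)"
    if "v = of_int c * u + of_int d" "v \<noteq> 0" for u v
  proof -
    have "(of_int a * \<tau> + of_int b) / w - (of_int a * u + of_int b) / v = ((of_int a * \<tau> + of_int b) * v - (of_int a * u + of_int b) * w) / (w * v)"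
      using w0 that(2) by (simp add: field_simps)
    also have "(of_int a * \<tau> + of_int b) * v - (of_int a * u + of_int b) * w = (of_int a * of_int d - of_int b * of_int c) * (\<tau> - u)"
      unfolding that(1) w_def by (simp add: algebra_simps)
    finally show ?thesis using e by simp
  qed
  have m: "moebius_act x \<tau> = (of_int a * \<tau> + of_int b) / w" by (simp add: x w_def)
  have 1: "moebius_act x \<tau> - \<tau>0 = (\<tau> - \<tau>0) / (w * j)"
    using diff[OF j_def w0(2)] t0 m by simp
  have 2: "moebius_act x \<tau> - cnj \<tau>0 = (\<tau> - cnj \<tau>0) / (w * j')"
    using diff[OF j'_def j'0] t0' m by simp
  have "chi x = j' / j" unfolding chi_def j' by (simp add: jf_def x j_def)
  then show ?thesis unfolding inner_s_def 1 2 using w0 j'0 by simp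
qed

lemma rotation_exists:
  assumes "\<zeta> ^ stab_order M \<tau>0 = 1"
  obtains x where "x \<in> Gamma0 M" "\<And>\<tau>. Im \<tau> > 0 \<Longrightarrow> inner_s \<tau>0 (moebius_act x \<tau>) = \<zeta> * inner_s \<tau>0 \<tau>"
  using assms chi_image chi_acts by (smt (verit) G_def image_iff mem_Collect_eq)

end

text \<open>The local parameter takes every small nonzero value, so nothing is left to choose near
  0.\<close>

lemma expands_at_unique:
  assumes p: "p \<in> ext_upper_half" and M: "M > 0" and F: "expands_at M f p F" "expands_at M f p F'"
  shows "eventually (\<lambda>z. F z = F' z) (at 0)"
proof -
  have surj: "\<exists>\<tau>\<in>upper_half. local_param M p \<tau> = z" if z: "z \<noteq> 0" "norm z < 1" for z
  proof (cases p)
    case (Inner \<tau>0)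
    then have pos: "Im \<tau>0 > 0" using p by (auto simp: ext_upper_half_def upper_half_iff)
    interpret stabilizer M \<tau>0 by unfold_locales (rule pos)
    define s where "s = exp (Ln z / of_nat (stab_order M \<tau>0))"
    have s: "s ^ stab_order M \<tau>0 = z" unfolding s_def by (rule root_power[OF stab_order_pos z(1)])
    have "norm s ^ stab_order M \<tau>0 < 1" using s z(2) by (simp flip: norm_power)
    then have "norm s < 1" using power_less_one_iff[of "norm s" "stab_order M \<tau>0"] by simp
    then have "s \<noteq> 1" "Im (inner_mu \<tau>0 s) > 0" using inner_mu_Im[OF pos] by auto
    then show ?thesis unfolding Inner local_param_inner using inner_s_mu[OF pos] s
      by (intro bexI[of _ "inner_mu \<tau>0 s"]) (auto simp: upper_half_iff)
  next
    case (Cusp a c)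
    then have co: "coprime a c" using p by (auto simp: ext_upper_half_def)
    obtain b d where bd: "a * d - b * c = 1" "cusp_mat a c = (a, b, c, d)" using cusp_mat[OF co] by blast
    obtain t where t: "Im t > 0" "cusp_q (cusp_width M a c) t = z" using cusp_q_surj[OF z cusp_width_pos[OF M]] by blast
    show ?thesis unfolding Cusp local_param_cusp[OF bd(2) co]
      using moebius_Im(2)[OF bd(1) t(1)] moebius_comp_inv(1)[OF bd(1) t(1)] t(2)
      by (intro bexI[of _ "moebius_act (a, b, c, d) t"]) (auto simp: upper_half_iff simp del: moebius_act.simps)
  qed
  obtain r where r: "r > 0" "\<And>\<tau>. \<tau> \<in> upper_half \<Longrightarrow> 0 < norm (local_param M p \<tau>) \<Longrightarrow> norm (local_param M p \<tau>) < r \<Longrightarrow> f \<tau> = F (local_param M p \<tau>)"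
    using F(1) unfolding expands_at_def by blast
  obtain r' where r': "r' > 0" "\<And>\<tau>. \<tau> \<in> upper_half \<Longrightarrow> 0 < norm (local_param M p \<tau>) \<Longrightarrow> norm (local_param M p \<tau>) < r' \<Longrightarrow> f \<tau> = F' (local_param M p \<tau>)"
    using F(2) unfolding expands_at_def by blast
  have "F z = F' z" if z: "z \<noteq> 0" "norm z < min 1 (min r r')" for z
  proof -
    obtain \<tau> where "\<tau> \<in> upper_half" "local_param M p \<tau> = z" using surj[OF z(1)] z(2) by auto
    then show ?thesis using r(2)[of \<tau>] r'(2)[of \<tau>] z by auto
  qed
  then show ?thesis unfolding eventually_at using r(1) r'(1)
    by (intro exI[of _ "min 1 (min r r')"]) (auto simp: dist_norm)
qed

lemma expansion_props:
  assumes p: "p \<in> ext_upper_half" and M: "M > 0" and F: "F meromorphic_on {0}" "expands_at M f p F"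
  shows "expansion M p f meromorphic_on {0}" "expands_at M f p (expansion M p f)"
    "eventually (\<lambda>z. expansion M p f z = F z) (at 0)"
proof -
  have "expansion M p f meromorphic_on {0} \<and> expands_at M f p (expansion M p f)"
    unfolding expansion_def by (rule someI[of "\<lambda>F. F meromorphic_on {0} \<and> expands_at M f p F" F]) (use F in auto)
  then show 1: "expansion M p f meromorphic_on {0}" "expands_at M f p (expansion M p f)" by auto
  show "eventually (\<lambda>z. expansion M p f z = F z) (at 0)" by (rule expands_at_unique[OF p M 1(2) F(2)])
qed

text \<open>In the disc coordinate the stabilizer acts by all rotations of order dividing
  \<open>stab_order\<close>; an invariant function is therefore a function of that power of the
  coordinate which serves as local parameter.\<close>

lemma expansion_inner_exists:
  assumes pos: "Im \<tau>0 > 0" and f: "f meromorphic_on upper_half"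
    and inv: "\<And>\<gamma> \<tau>. \<gamma> \<in> Gamma0 M \<Longrightarrow> \<tau> \<in> upper_half \<Longrightarrow> f (moebius_act \<gamma> \<tau>) = f \<tau>"
  obtains F where "F meromorphic_on {0}" "expands_at M f (Inner \<tau>0) F"
    "\<And>s. 0 < norm s \<Longrightarrow> norm s < 1 \<Longrightarrow> f (inner_mu \<tau>0 s) = F (s ^ stab_order M \<tau>0)"
proof -
  interpret stabilizer M \<tau>0 by unfold_locales (rule pos)
  define \<phi> where "\<phi> = (\<lambda>s. f (inner_mu \<tau>0 s))"
  have "inner_mu \<tau>0 analytic_on {0}" unfolding inner_mu_def by (intro analytic_intros) auto
  then have mero: "\<phi> meromorphic_on {0}" unfolding \<phi>_def
    by (rule meromorphic_on_compose[OF f]) (use pos in \<open>auto simp: inner_mu_def upper_half_iff\<close>)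
  have rot: "\<phi> (\<zeta> * s) = \<phi> s" if s: "0 < norm s" "norm s < 1" and \<zeta>: "\<zeta> ^ stab_order M \<tau>0 = 1" for s \<zeta>
  proof -
    obtain x where x: "x \<in> Gamma0 M" "\<And>\<tau>. Im \<tau> > 0 \<Longrightarrow> inner_s \<tau>0 (moebius_act x \<tau>) = \<zeta> * inner_s \<tau>0 \<tau>"
      using rotation_exists[OF \<zeta>] by blast
    define \<tau> where "\<tau> = inner_mu \<tau>0 s"
    have \<tau>: "Im \<tau> > 0" unfolding \<tau>_def by (rule inner_mu_Im[OF pos s(2)])
    have "s \<noteq> 1" using s(2) by auto
    then have st: "inner_s \<tau>0 \<tau> = s" unfolding \<tau>_def by (rule inner_s_mu[OF pos])
    obtain a b c d where xx: "x = (a, b, c, d)" "a * d - b * c = 1" using x(1) by (cases x) (auto simp: Gamma0_def)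
    have "Im (moebius_act x \<tau>) > 0" unfolding xx(1) by (rule moebius_Im(2)[OF xx(2) \<tau>])
    then have "inner_mu \<tau>0 (\<zeta> * s) = moebius_act x \<tau>"
      using inner_mu_s(1)[OF pos, of "moebius_act x \<tau>"] x(2)[OF \<tau>] st by simp
    then show ?thesis using inv[OF x(1), of \<tau>] \<tau> by (simp add: \<phi>_def \<tau>_def upper_half_iff)
  qed
  obtain F where F: "F meromorphic_on {0}" "\<And>s. 0 < norm s \<Longrightarrow> norm s < 1 \<Longrightarrow> \<phi> s = F (s ^ stab_order M \<tau>0)"
    using meromorphic_of_power[OF mero stab_order_pos zero_less_one rot] by blast
  have "expands_at M f (Inner \<tau>0) F"
    unfolding expands_at_def local_param_inner
  proof (intro exI[of _ 1] conjI ballI impI)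
    fix \<tau> assume t: "\<tau> \<in> upper_half" "0 < norm (inner_s \<tau>0 \<tau> ^ stab_order M \<tau>0) \<and> norm (inner_s \<tau>0 \<tau> ^ stab_order M \<tau>0) < 1"
    then have t': "Im \<tau> > 0" by (simp add: upper_half_iff)
    have "inner_s \<tau>0 \<tau> \<noteq> 0" using t(2) stab_order_pos by (auto simp: zero_power)
    then show "f \<tau> = F (inner_s \<tau>0 \<tau> ^ stab_order M \<tau>0)"
      using F(2)[of "inner_s \<tau>0 \<tau>"] inner_mu_s[OF pos t'] by (simp add: \<phi>_def)
  qed simp
  then show ?thesis using that F by (simp add: \<phi>_def)
qed

lemma eventually_deriv_cong:
  fixes f g :: "complex \<Rightarrow> complex"
  assumes "eventually (\<lambda>z. f z = g z) (at 0)"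
  shows "eventually (\<lambda>z. deriv f z = deriv g z) (at 0)"
proof -
  obtain d where d: "d > 0" "\<And>z. z \<noteq> 0 \<Longrightarrow> dist z 0 < d \<Longrightarrow> f z = g z" using assms unfolding eventually_at by auto
  show ?thesis unfolding eventually_at
  proof (intro exI[of _ d] conjI ballI impI)
    fix z :: complex assume z: "z \<noteq> 0 \<and> dist z 0 < d"
    show "deriv f z = deriv g z"
      by (rule deriv_cong_open[of "ball 0 d - {0}"]) (use z d in \<open>auto simp: dist_norm\<close>)
  qed (use d in auto)
qed

lemma eventually_zcoeff_cong:
  assumes "eventually (\<lambda>z. X z = X' z) (at 0)" "eventually (\<lambda>z. A z = A' z) (at 0)" "eventually (\<lambda>z. B z = B' z) (at 0)"
  shows "eventually (\<lambda>z. zcoeff1 (DiffOp X A B) z = zcoeff1 (DiffOp X' A' B') z) (at 0)"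
    "eventually (\<lambda>z. zcoeff0 (DiffOp X A B) z = zcoeff0 (DiffOp X' A' B') z) (at 0)"
proof -
  note d1 = eventually_deriv_cong[OF assms(1)] 
  note d2 = eventually_deriv_cong[OF d1]
  show "eventually (\<lambda>z. zcoeff1 (DiffOp X A B) z = zcoeff1 (DiffOp X' A' B') z) (at 0)"
    using d1 d2 assms(2) by eventually_elim (simp add: zcoeff1_def)
  show "eventually (\<lambda>z. zcoeff0 (DiffOp X A B) z = zcoeff0 (DiffOp X' A' B') z) (at 0)"
    using d1 assms(3) by eventually_elim (simp add: zcoeff0_def)
qed

lemma moebius_tendsto:
  assumes g: "a * d - b * c = 1" and t: "Im \<tau> > 0"
  shows "filterlim (moebius_act (a, b, c, d)) (at (moebius_act (a, b, c, d) \<tau>)) (at \<tau>)"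
proof -
  have "isCont (moebius_act (a, b, c, d)) \<tau>"
    unfolding moebius_act.simps[abs_def] using moebius_Im(1)[OF g t] by (intro continuous_intros) auto
  moreover have "eventually (\<lambda>z. moebius_act (a, b, c, d) z \<noteq> moebius_act (a, b, c, d) \<tau>) (at \<tau>)"
  proof -
    have "eventually (\<lambda>z. z \<in> upper_half) (at \<tau>)"
      by (rule eventually_at_in_open'[OF open_upper_half]) (simp add: upper_half_iff t)
    moreover have "eventually (\<lambda>z. z \<noteq> \<tau>) (at \<tau>)" by (simp add: eventually_at_filter)
    ultimately show ?thesis
      by eventually_elim (metis moebius_comp_inv(1)[OF g] t upper_half_iff)
  qed
  ultimately show ?thesis unfolding filterlim_at isCont_def by (auto elim: eventually_mono)
qed

text \<open>Equality of filters, and not only a limit, is what allows \<open>remove_sings\<close> to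
  be moved through the transformation.\<close>

lemma moebius_filtermap:
  assumes g: "a * d - b * c = 1" and t: "Im \<tau> > 0"
  shows "filtermap (moebius_act (a, b, c, d)) (at \<tau>) = at (moebius_act (a, b, c, d) \<tau>)"
proof (rule filtermap_fun_inverse[where g = "moebius_act (d, - b, - c, a)"])
  have g': "d * a - - b * - c = 1" using g by (simp add: mult.commute)
  note i = moebius_Im(2)[OF g t]
  show "filterlim (moebius_act (d, - b, - c, a)) (at \<tau>) (at (moebius_act (a, b, c, d) \<tau>))"
    using moebius_tendsto[OF g' i] moebius_comp_inv(1)[OF g t] by simp
  show "filterlim (moebius_act (a, b, c, d)) (at (moebius_act (a, b, c, d) \<tau>)) (at \<tau>)"
    by (rule moebius_tendsto[OF g t])
  have "eventually (\<lambda>z. z \<in> upper_half) (at (moebius_act (a, b, c, d) \<tau>))"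
    by (rule eventually_at_in_open'[OF open_upper_half]) (use i in \<open>simp only: upper_half_iff\<close>)
  then show "eventually (\<lambda>x. moebius_act (a, b, c, d) (moebius_act (d, - b, - c, a) x) = x) (at (moebius_act (a, b, c, d) \<tau>))"
    by eventually_elim (rule moebius_comp_inv(2)[OF g], simp only: upper_half_iff)
qed

lemma pole_from_limit:
  fixes f :: "complex \<Rightarrow> complex"
  assumes "((\<lambda>z. z ^ n * f z) \<longlongrightarrow> c) (at 0)" "c \<noteq> 0" "n > 0"
  shows "is_pole f 0"
proof -
  have "((\<lambda>z::complex. z ^ n) \<longlongrightarrow> 0 ^ n) (at 0)" by (intro tendsto_intros)
  then have "filterlim (\<lambda>z::complex. z ^ n) (at 0) (at 0)"
    using assms(3) by (auto simp: filterlim_at eventually_at_filter zero_power)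
  from filterlim_divide_at_infinity[OF assms(1) this assms(2)]
  have lim: "filterlim (\<lambda>z. z ^ n * f z / z ^ n) at_infinity (at 0)" .
  have ev: "eventually (\<lambda>z. z ^ n * f z / z ^ n = f z) (at 0)"
    by (auto simp: eventually_at_filter)
  show ?thesis unfolding is_pole_def using lim unfolding filterlim_cong[OF refl refl ev] .
qed

lemma j_q_pole: "is_pole j_q 0"
proof (rule pole_from_limit[of 1])
  have "(\<lambda>q. e4 q ^ 3 / d1 q) holomorphic_on ball 0 1" by (intro holomorphic_intros d1_nonzero)
  then have "isCont (\<lambda>q. e4 q ^ 3 / d1 q) 0"
    by (metis centre_in_ball continuous_on_eq_continuous_at holomorphic_on_imp_continuous_on open_ball zero_less_one)
  then have "((\<lambda>q. e4 q ^ 3 / d1 q) \<longlongrightarrow> 1) (at 0)" by (simp add: isCont_def)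
  moreover have "eventually (\<lambda>q. e4 q ^ 3 / d1 q = q ^ 1 * j_q q) (at 0)"
    by (auto simp: eventually_at_filter j_q_def delta_def)
  ultimately show "((\<lambda>z. z ^ 1 * j_q z) \<longlongrightarrow> 1) (at 0)" by (rule Lim_transform_eventually)
qed auto

lemma klein_j_not_constant: "\<not> klein_j constant_on upper_half"
proof
  assume "klein_j constant_on upper_half"
  then obtain c where c: "\<And>\<tau>. \<tau> \<in> upper_half \<Longrightarrow> klein_j \<tau> = c" unfolding constant_on_def by blast
  have "j_q z = c" if "z \<noteq> 0" "norm z < 1" for z
    using to_q_surj[OF that] c klein_j_q by (metis upper_half_iff)
  then have "eventually (\<lambda>z. j_q z = c) (at 0)"
    unfolding eventually_at by (intro exI[of _ 1]) auto
  then have "j_q \<midarrow>0\<rightarrow> c" by (rule tendsto_eventually)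
  then show False using j_q_pole not_tendsto_and_filterlim_at_infinity[of "at 0" j_q c] unfolding is_pole_def by simp
qed

lemma deriv_klein_j_holo: "deriv klein_j holomorphic_on upper_half"
  by (rule holomorphic_deriv[OF klein_j_holo open_upper_half])

text \<open>\<open>j\<close> is not constant, so the zeros of its derivative are isolated.\<close>

lemma deriv_klein_j_nonzero:
  assumes "\<tau> \<in> upper_half"
  shows "eventually (\<lambda>z. deriv klein_j z \<noteq> 0) (at \<tau>)"
proof -
  have "\<exists>\<beta>\<in>upper_half. deriv klein_j \<beta> \<noteq> 0"
  proof (rule ccontr)
    assume *: "\<not> ?thesis"
    have "(klein_j has_field_derivative 0) (at z)" if "z \<in> upper_half" for z
      using holomorphic_derivI[OF klein_j_holo open_upper_half that, of UNIV] * that by auto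
    then have "klein_j constant_on upper_half"
      using has_field_derivative_0_imp_constant_on[OF _ connected_upper_half open_upper_half] by blast
    then show False using klein_j_not_constant by blast
  qed
  then obtain \<beta> where \<beta>: "\<beta> \<in> upper_half" "deriv klein_j \<beta> \<noteq> 0" by blast
  show ?thesis
  proof (cases "deriv klein_j \<tau> = 0")
    case True
    obtain r where "0 < r" "ball \<tau> r \<subseteq> upper_half" "\<And>z. z \<in> ball \<tau> r - {\<tau>} \<Longrightarrow> deriv klein_j z \<noteq> 0"
      by (rule isolated_zeros[OF deriv_klein_j_holo open_upper_half connected_upper_half assms True \<beta>]) (rule that, assumption+)
    then show ?thesis unfolding eventually_at by (intro exI[of _ r]) (auto simp: dist_commute)
  next
    case False
    have "isCont (deriv klein_j) \<tau>"
      using holomorphic_on_imp_continuous_on[OF deriv_klein_j_holo] open_upper_half assms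
      by (simp add: continuous_on_eq_continuous_at)
    then show ?thesis using False unfolding isCont_def by (rule tendsto_imp_eventually_ne)
  qed
qed

section \<open>Forms of weight 12 and uniformizing operators\<close>

definition autf :: "mat2 \<Rightarrow> complex \<Rightarrow> complex" where
  "autf \<gamma> \<tau> = (case \<gamma> of (a, b, c, d) \<Rightarrow> of_int c * \<tau> + of_int d)"

text \<open>
  \<open>K\<close> plays the role of the twelfth power of the weight-one form \<open>h\<close>; \<open>ordc a c\<close> is its order at
  the cusp \<open>a/c\<close> in the local parameter of level \<open>M\<close>.
\<close>

locale weight12 =
  fixes M :: nat and K :: "complex \<Rightarrow> complex" and ordc :: "int \<Rightarrow> int \<Rightarrow> int"
  assumes M: "M > 0"
    and K_holo: "K holomorphic_on upper_half"
    and K_nz: "\<And>\<tau>. Im \<tau> > 0 \<Longrightarrow> K \<tau> \<noteq> 0"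
    and K_mod: "\<And>\<gamma> \<tau>. \<gamma> \<in> Gamma0 M \<Longrightarrow> Im \<tau> > 0 \<Longrightarrow> K (moebius_act \<gamma> \<tau>) = autf \<gamma> \<tau> ^ 12 * K \<tau>"
    and K_cusp: "\<And>a c. coprime a c \<Longrightarrow> \<exists>\<Phi>. \<Phi> meromorphic_on {0} \<and> zorder \<Phi> 0 = ordc a c \<and>
      (\<exists>r>0. \<forall>\<tau>. Im \<tau> > 0 \<and> norm (cusp_q (cusp_width M a c) \<tau>) < r \<longrightarrow>
         K (moebius_act (cusp_mat a c) \<tau>) / autf (cusp_mat a c) \<tau> ^ 12 = \<Phi> (cusp_q (cusp_width M a c) \<tau>))"
begin

text \<open>Where \<open>deriv klein_j\<close> vanishes, the raw quotient has only the value
  dictated by division by zero. \<open>remove_sings\<close> repairs this, since the function field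
  asks for nicely meromorphic functions.\<close>

definition "A = remove_sings (opA klein_j K)"
definition "B = remove_sings (opB klein_j K)"
definition "L = DiffOp klein_j A B"

lemma K_nz': "\<tau> \<in> upper_half \<Longrightarrow> K \<tau> \<noteq> 0" using K_nz by (simp add: upper_half_iff)

lemma logd_K_holo: "logd K holomorphic_on upper_half"
  by (rule logd_holo[OF open_upper_half K_holo K_nz'])

lemma holo_mero: "h holomorphic_on upper_half \<Longrightarrow> h meromorphic_on upper_half"
  by (intro analytic_on_imp_meromorphic_on) (simp add: analytic_on_open open_upper_half)

lemma op_mero: "opA klein_j K meromorphic_on upper_half" "opB klein_j K meromorphic_on upper_half"
  unfolding opA_def opB_def
  by (intro meromorphic_intros holo_mero logd_K_holo klein_j_holo)+

lemma op_analytic: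
  assumes "\<tau> \<in> upper_half" "deriv klein_j \<tau> \<noteq> 0"
  shows "opA klein_j K analytic_on {\<tau>}" "opB klein_j K analytic_on {\<tau>}"
proof -
  have an: "h analytic_on {\<tau>}" if "h holomorphic_on upper_half" for h
    using that assms(1) open_upper_half by (metis analytic_at)
  note hs = an[OF deriv_klein_j_holo] an[OF holomorphic_deriv[OF deriv_klein_j_holo open_upper_half]]
     an[OF logd_K_holo] an[OF holomorphic_deriv[OF logd_K_holo open_upper_half]]
  show "opA klein_j K analytic_on {\<tau>}" "opB klein_j K analytic_on {\<tau>}"
    unfolding opA_def opB_def using assms(2) by (auto intro!: analytic_intros hs)
qed

lemma AB_eq:
  assumes "\<tau> \<in> upper_half" "deriv klein_j \<tau> \<noteq> 0"
  shows "A \<tau> = opA klein_j K \<tau>" "B \<tau> = opB klein_j K \<tau>"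
  unfolding A_def B_def using op_analytic[OF assms] by simp_all

text \<open>As \<open>j\<close> is invariant, the operator of \<open>K\<close> at the transformed
  point is that of the transformed form at \<open>\<tau>\<close>. The whole modular group is covered
  because the matrices that carry infinity to the cusps need not lie in
  \<open>Gamma0 M\<close>.\<close>

lemma op_SL2:
  assumes g: "a * d - b * c = 1" and t: "Im \<tau> > 0"
  shows "opA klein_j K (moebius_act (a, b, c, d) \<tau>) = opA klein_j (\<lambda>s. K (moebius_act (a, b, c, d) s) / autf (a, b, c, d) s ^ 12) \<tau>"
    "opB klein_j K (moebius_act (a, b, c, d) \<tau>) = opB klein_j (\<lambda>s. K (moebius_act (a, b, c, d) s) / autf (a, b, c, d) s ^ 12) \<tau>"
    "deriv klein_j \<tau> = deriv klein_j (moebius_act (a, b, c, d) \<tau>) / autf (a, b, c, d) \<tau> ^ 2"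
proof -
  have e: "of_int a * of_int d - of_int b * of_int c = (1 :: complex)"
    using g by (metis of_int_1 of_int_diff of_int_mult)
  have m: "moebius_act (a, b, c, d) = (\<lambda>s. (of_int a * s + of_int b) / (of_int c * s + of_int d))" by (rule ext) simp
  have D: "of_int a * of_int d - of_int b * of_int c \<noteq> (0 :: complex)" using e by simp
  have u3: "of_int c * z + of_int d \<noteq> 0" if "z \<in> upper_half" for z :: complex
    using moebius_Im(1)[OF g] that by (simp add: upper_half_iff)
  have u4: "(of_int a * z + of_int b) / (of_int c * z + of_int d) \<in> upper_half" if "z \<in> upper_half" for z
    using moebius_Im(2)[OF g, of z] that by (simp add: upper_half_iff)
  have tU: "\<tau> \<in> upper_half" using t by (simp add: upper_half_iff)
  note om0 = op_moebius[OF open_upper_half klein_j_holo K_holo _ D open_upper_half tU]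
  have om1: "opA (\<lambda>s. klein_j ((of_int a * s + of_int b) / (of_int c * s + of_int d)))
      (\<lambda>s. K ((of_int a * s + of_int b) / (of_int c * s + of_int d)) / (of_int c * s + of_int d) ^ 12) \<tau>
      = opA klein_j K ((of_int a * \<tau> + of_int b) / (of_int c * \<tau> + of_int d))"
    using K_nz' u3 u4 by (rule om0(1))
  have om2: "opB (\<lambda>s. klein_j ((of_int a * s + of_int b) / (of_int c * s + of_int d)))
      (\<lambda>s. K ((of_int a * s + of_int b) / (of_int c * s + of_int d)) / (of_int c * s + of_int d) ^ 12) \<tau>
      = opB klein_j K ((of_int a * \<tau> + of_int b) / (of_int c * \<tau> + of_int d))"
    using K_nz' u3 u4 by (rule om0(2))
  have om3: "deriv (\<lambda>s. klein_j ((of_int a * s + of_int b) / (of_int c * s + of_int d))) \<tau>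
      = deriv klein_j ((of_int a * \<tau> + of_int b) / (of_int c * \<tau> + of_int d))
         * ((of_int a * of_int d - of_int b * of_int c) / (of_int c * \<tau> + of_int d) ^ 2)"
    using K_nz' u3 u4 by (rule om0(3))
  note om = om1 om2 om3
  have jinv: "klein_j ((of_int a * s + of_int b) / (of_int c * s + of_int d)) = klein_j s" if "s \<in> upper_half" for s
    using klein_j_invariant[OF g, of s] that by (simp add: upper_half_iff)
  have oc1: "opA (\<lambda>s. klein_j ((of_int a * s + of_int b) / (of_int c * s + of_int d))) K' \<tau> = opA klein_j K' \<tau>" for K'
    by (rule op_cong(1)[OF open_upper_half tU]) (auto simp: jinv)
  have oc2: "opB (\<lambda>s. klein_j ((of_int a * s + of_int b) / (of_int c * s + of_int d))) K' \<tau> = opB klein_j K' \<tau>" for K'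
    by (rule op_cong(2)[OF open_upper_half tU]) (auto simp: jinv)
  show "opA klein_j K (moebius_act (a, b, c, d) \<tau>) = opA klein_j (\<lambda>s. K (moebius_act (a, b, c, d) s) / autf (a, b, c, d) s ^ 12) \<tau>"
    unfolding m autf_def case_prod_conv using om(1) unfolding oc1 by (rule sym)
  show "opB klein_j K (moebius_act (a, b, c, d) \<tau>) = opB klein_j (\<lambda>s. K (moebius_act (a, b, c, d) s) / autf (a, b, c, d) s ^ 12) \<tau>"
    unfolding m autf_def case_prod_conv using om(2) unfolding oc2 by (rule sym)
  show "deriv klein_j \<tau> = deriv klein_j (moebius_act (a, b, c, d) \<tau>) / autf (a, b, c, d) \<tau> ^ 2"
    using om(3) deriv_cong_open[OF open_upper_half tU jinv] e by (simp add: autf_def)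
qed

lemma op_inv:
  assumes g: "(a, b, c, d) \<in> Gamma0 M" and t: "Im \<tau> > 0"
  shows "opA klein_j K (moebius_act (a, b, c, d) \<tau>) = opA klein_j K \<tau>"
    "opB klein_j K (moebius_act (a, b, c, d) \<tau>) = opB klein_j K \<tau>"
proof -
  have g': "a * d - b * c = 1" using g by (simp add: Gamma0_def)
  have tU: "\<tau> \<in> upper_half" using t by (simp add: upper_half_iff)
  have Kinv: "K (moebius_act (a, b, c, d) s) / autf (a, b, c, d) s ^ 12 = K s" if "s \<in> upper_half" for s
  proof -
    have "autf (a, b, c, d) s \<noteq> 0" using moebius_Im(1)[OF g', of s] that by (simp add: autf_def upper_half_iff)
    then show ?thesis using K_mod[OF g, of s] that by (simp add: upper_half_iff del: moebius_act.simps)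
  qed
  have oc1: "opA klein_j (\<lambda>s. K (moebius_act (a, b, c, d) s) / autf (a, b, c, d) s ^ 12) \<tau> = opA klein_j K \<tau>"
    using Kinv by (rule op_cong(1)[OF open_upper_half tU refl])
  have oc2: "opB klein_j (\<lambda>s. K (moebius_act (a, b, c, d) s) / autf (a, b, c, d) s ^ 12) \<tau> = opB klein_j K \<tau>"
    using Kinv by (rule op_cong(2)[OF open_upper_half tU refl])
  show "opA klein_j K (moebius_act (a, b, c, d) \<tau>) = opA klein_j K \<tau>"
    "opB klein_j K (moebius_act (a, b, c, d) \<tau>) = opB klein_j K \<tau>"
    unfolding op_SL2(1,2)[OF g' t] by (rule oc1 oc2)+
qed

lemma AB_inv:
  assumes g: "\<gamma> \<in> Gamma0 M" and t: "\<tau> \<in> upper_half"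
  shows "A (moebius_act \<gamma> \<tau>) = A \<tau>" "B (moebius_act \<gamma> \<tau>) = B \<tau>"
proof -
  obtain a b c d where \<gamma>: "\<gamma> = (a, b, c, d)" by (cases \<gamma>)
  have g': "a * d - b * c = 1" using g by (simp add: Gamma0_def \<gamma>)
  have t': "Im \<tau> > 0" using t by (simp add: upper_half_iff)
  have ev: "eventually (\<lambda>z. z \<in> upper_half) (at \<tau>)" by (rule eventually_at_in_open'[OF open_upper_half t])
  have 1: "remove_sings (f \<circ> moebius_act (a, b, c, d)) \<tau> = remove_sings f (moebius_act (a, b, c, d) \<tau>)" for f
    by (rule remove_sings_compose[OF moebius_filtermap[OF g' t']])
  have 2: "remove_sings (f \<circ> moebius_act (a, b, c, d)) \<tau> = remove_sings f \<tau>"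
    if "\<And>z. Im z > 0 \<Longrightarrow> f (moebius_act (a, b, c, d) z) = f z" for f
    by (rule remove_sings_cong[OF eventually_mono[OF ev] refl]) (use that in \<open>auto simp: upper_half_iff simp del: moebius_act.simps\<close>)
  show "A (moebius_act \<gamma> \<tau>) = A \<tau>" "B (moebius_act \<gamma> \<tau>) = B \<tau>"
    unfolding A_def B_def \<gamma>
    using 1[of "opA klein_j K"] 2[of "opA klein_j K", OF op_inv(1)[OF g[unfolded \<gamma>]]] 1[of "opB klein_j K"] 2[of "opB klein_j K", OF op_inv(2)[OF g[unfolded \<gamma>]]]
    by simp_all
qed

end

text \<open>A chart with derivative \<open>\<kappa> * l\<close> is of exponential type, like the
  parameter at a cusp. Written with \<open>x d/dx\<close>, the coefficients no longer contain
  \<open>\<kappa>\<close>.\<close>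

lemma op_exp_chart:
  assumes U: "open U" "\<tau> \<in> U" and l: "\<And>z. z \<in> U \<Longrightarrow> (l has_field_derivative \<kappa> * l z) (at z)" and \<kappa>: "\<kappa> \<noteq> 0" and l0: "l \<tau> \<noteq> 0"
    and W: "open W" "X holomorphic_on W" "\<Phi> holomorphic_on W" "\<And>z. z \<in> W \<Longrightarrow> \<Phi> z \<noteq> 0" "\<And>z. z \<in> U \<Longrightarrow> l z \<in> W"
    and X0: "deriv X (l \<tau>) \<noteq> 0"
    and J: "\<And>z. z \<in> U \<Longrightarrow> J z = X (l z)" and K: "\<And>z. z \<in> U \<Longrightarrow> K z = \<Phi> (l z)"
  defines "H \<equiv> \<lambda>z. z * logd \<Phi> z"
  shows "opA J K \<tau> = (deriv (deriv X) (l \<tau>) * l \<tau> / deriv X (l \<tau>) + 1 - 2 * H (l \<tau>)) / (deriv X (l \<tau>) * l \<tau>)"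
    "opB J K \<tau> = (H (l \<tau>) ^ 2 - l \<tau> * deriv H (l \<tau>)) / (deriv X (l \<tau>) * l \<tau>) ^ 2"
    "deriv J \<tau> \<noteq> 0"
proof -
  have dX: "(X has_field_derivative deriv X z) (at z)" "(deriv X has_field_derivative deriv (deriv X) z) (at z)"
    "(\<Phi> has_field_derivative deriv \<Phi> z) (at z)" "(H has_field_derivative deriv H z) (at z)" if "z \<in> W" for z
  proof -
    have "H holomorphic_on W" unfolding H_def by (intro holomorphic_intros logd_holo W)
    then show "(X has_field_derivative deriv X z) (at z)" "(deriv X has_field_derivative deriv (deriv X) z) (at z)"
      "(\<Phi> has_field_derivative deriv \<Phi> z) (at z)" "(H has_field_derivative deriv H z) (at z)"
      using holomorphic_derivI[OF W(2,1) that] holomorphic_derivI[OF holomorphic_deriv[OF W(2,1)] W(1) that]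
        holomorphic_derivI[OF W(3,1) that] holomorphic_derivI[OF _ W(1) that] by auto
  qed
  have J1: "deriv J z = deriv X (l z) * (\<kappa> * l z)" if z: "z \<in> U" for z
    using deriv_cong_open[OF U(1) z J] DERIV_imp_deriv[OF DERIV_chain2[OF dX(1)[OF W(5)[OF z]] l[OF z]]] by simp
  have l2: "((\<lambda>z. \<kappa> * l z) has_field_derivative \<kappa> * (\<kappa> * l z)) (at z)" if z: "z \<in> U" for z
    by (rule DERIV_cmult[OF l[OF z]])
  have J2: "deriv (deriv J) \<tau> = deriv (deriv X) (l \<tau>) * (\<kappa> * l \<tau>) * (\<kappa> * l \<tau>) + \<kappa> * (\<kappa> * l \<tau>) * deriv X (l \<tau>)"
    using deriv_cong_open[OF U J1] DERIV_imp_deriv[OF DERIV_mult[OF DERIV_chain2[OF dX(2)[OF W(5)[OF U(2)]] l[OF U(2)]] l2[OF U(2)]]] by simp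
  have K1: "logd K z = \<kappa> * H (l z)" if z: "z \<in> U" for z
  proof -
    have "deriv K z = deriv \<Phi> (l z) * (\<kappa> * l z)"
      using deriv_cong_open[OF U(1) z K] DERIV_imp_deriv[OF DERIV_chain2[OF dX(3)[OF W(5)[OF z]] l[OF z]]] by simp
    then show ?thesis using K[OF z] by (simp add: logd_def H_def)
  qed
  have K2: "deriv (logd K) \<tau> = \<kappa> * (deriv H (l \<tau>) * (\<kappa> * l \<tau>))"
    using deriv_cong_open[OF U K1] DERIV_imp_deriv[OF DERIV_cmult[OF DERIV_chain2[OF dX(4)[OF W(5)[OF U(2)]] l[OF U(2)]], of \<kappa>]] by simp
  define x x1 x2 h h' where "x = l \<tau>" and "x1 = deriv X x" and "x2 = deriv (deriv X) x" and "h = H x" and "h' = deriv H x"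
  note fld = x_def[symmetric] x1_def[symmetric] x2_def[symmetric] h_def[symmetric] h'_def[symmetric]
  have nz: "x \<noteq> 0" "x1 \<noteq> 0" using l0 X0 by (auto simp: x_def x1_def)
  show "opA J K \<tau> = (deriv (deriv X) (l \<tau>) * l \<tau> / deriv X (l \<tau>) + 1 - 2 * H (l \<tau>)) / (deriv X (l \<tau>) * l \<tau>)"
    unfolding opA_def J2 J1[OF U(2)] K1[OF U(2)] fld using nz \<kappa> by (simp add: field_simps)
  have "(\<kappa> * h) ^ 2 - \<kappa> * (h' * (\<kappa> * x)) = \<kappa> ^ 2 * (h ^ 2 - x * h')" by (simp add: power2_eq_square algebra_simps)
  then show "opB J K \<tau> = (H (l \<tau>) ^ 2 - l \<tau> * deriv H (l \<tau>)) / (deriv X (l \<tau>) * l \<tau>) ^ 2"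
    unfolding opB_def J1[OF U(2)] K1[OF U(2)] K2 fld using nz \<kappa> by (simp add: power_mult_distrib)
  show "deriv J \<tau> \<noteq> 0" unfolding J1[OF U(2)] fld using nz \<kappa> by simp
qed

text \<open>Up to the factor 1/12, \<open>H\<close> is \<open>z\<close> times a logarithmic
  derivative, whose limit is the order. It extends analytically to 0, so its \<open>z d/dz\<close>
  tends to 0.\<close>

lemma logd_times_limit:
  assumes mero: "\<Phi> meromorphic_on {0}" and nz: "eventually (\<lambda>z. \<Phi> z \<noteq> 0) (at 0)"
  defines "H \<equiv> \<lambda>z. z * logd \<Phi> z"
  shows "(H \<longlongrightarrow> of_int (zorder \<Phi> 0) / 12) (at 0)" "((\<lambda>z. z * deriv H z) \<longlongrightarrow> 0) (at 0)"
proof -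
  define n where "n = zorder \<Phi> 0"
  define g where "g = zor_poly \<Phi> 0"
  have fr: "\<exists>\<^sub>F w in at 0. \<Phi> w \<noteq> 0" using nz eventually_frequently[of "at (0::complex)"] by simp
  have "g 0 \<noteq> 0 \<and> (\<exists>r. r > 0 \<and> g holomorphic_on cball 0 r \<and> (\<forall>w\<in>cball 0 r - {0}. \<Phi> w = g w * (w - 0) powi n \<and> g w \<noteq> 0))"
    unfolding g_def n_def using mero fr unfolding meromorphic_at_iff by (intro zorder_exist) auto
  then obtain r where r: "r > 0" "g holomorphic_on cball 0 r" "\<And>w. w \<in> cball 0 r - {0} \<Longrightarrow> \<Phi> w = g w * w powi n"
    "\<And>w. w \<in> cball 0 r \<Longrightarrow> g w \<noteq> 0" by fastforce
  have gh: "g holomorphic_on ball 0 r" by (rule holomorphic_on_subset[OF r(2)]) auto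
  define k where "k = (\<lambda>w. logd g w)"
  have kh: "k holomorphic_on ball 0 r" unfolding k_def
    using logd_holo[OF open_ball gh] r(4) by auto
  have H: "H w = of_int n / 12 + w * k w" if w: "w \<in> ball 0 r - {0}" for w
  proof -
    have "((\<lambda>w. g w * w powi n) has_field_derivative deriv g w * w powi n + (of_int n * w powi (n - 1) * 1) * g w) (at w)"
      by (rule DERIV_mult[OF holomorphic_derivI[OF gh open_ball]]) (use w in \<open>auto intro!: derivative_eq_intros\<close>)
    from DERIV_imp_deriv[OF this] have "deriv \<Phi> w = deriv g w * w powi n + (of_int n * w powi (n - 1) * 1) * g w"
      by (subst deriv_cong_open[of "ball 0 r - {0}" w \<Phi> "\<lambda>w. g w * w powi n"]) (use w r(3) in auto)
    moreover have "w powi n = w powi (n - 1) * w" using w by (simp add: power_int_diff)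
    moreover have "w powi (n - 1) \<noteq> 0" "g w \<noteq> 0" "w \<noteq> 0" using w r(4) by auto
    ultimately show ?thesis unfolding H_def logd_def k_def using r(3)[of w] w
      by (simp add: field_simps)
  qed
  have ev: "eventually (\<lambda>w. w \<in> ball 0 r - {0}) (at (0 :: complex))"
    by (rule eventually_at_in_open) (use r in auto)
  have kc: "(k \<longlongrightarrow> k 0) (at 0)" and kc': "(deriv k \<longlongrightarrow> deriv k 0) (at 0)"
    using holomorphic_on_imp_continuous_on[OF kh] holomorphic_on_imp_continuous_on[OF holomorphic_deriv[OF kh open_ball]] r(1)
    by (auto simp: continuous_on_eq_continuous_at isCont_def)
  have "((\<lambda>w. of_int n / 12 + w * k w) \<longlongrightarrow> of_int n / 12 + 0 * k 0) (at 0)" by (intro tendsto_intros kc)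
  moreover have "eventually (\<lambda>w. of_int n / 12 + w * k w = H w) (at 0)" using ev by eventually_elim (simp add: H)
  ultimately show "(H \<longlongrightarrow> of_int (zorder \<Phi> 0) / 12) (at 0)"
    using Lim_transform_eventually by (fastforce simp: n_def)
  have dH: "deriv H w = k w + w * deriv k w" if w: "w \<in> ball 0 r - {0}" for w
  proof -
    have "((\<lambda>w. of_int n / 12 + w * k w) has_field_derivative 0 + (1 * k w + deriv k w * w)) (at w)"
      by (intro DERIV_add DERIV_const DERIV_mult DERIV_ident holomorphic_derivI[OF kh open_ball]) (use w in auto)
    from DERIV_imp_deriv[OF this] show ?thesis
      by (subst deriv_cong_open[of "ball 0 r - {0}" w H "\<lambda>w. of_int n / 12 + w * k w"]) (use w H in auto)
  qed
  have "((\<lambda>w. w * (k w + w * deriv k w)) \<longlongrightarrow> 0 * (k 0 + 0 * deriv k 0)) (at 0)" by (intro tendsto_intros kc kc')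
  moreover have "eventually (\<lambda>w. w * (k w + w * deriv k w) = w * deriv H w) (at 0)" using ev by eventually_elim (simp add: dH)
  ultimately show "((\<lambda>z. z * deriv H z) \<longlongrightarrow> 0) (at 0)" using Lim_transform_eventually by fastforce
qed

lemma meromorphic_punctured:
  assumes "f meromorphic_on {0}"
  shows "eventually (\<lambda>r. f holomorphic_on ball 0 r - {0}) (at_right 0)"
proof -
  obtain r where r: "r > 0" "f analytic_on ball 0 r - {0}"
    using assms unfolding meromorphic_at_iff isolated_singularity_at_def by blast
  have "f holomorphic_on ball 0 s - {0}" if "s < r" for s
    by (rule analytic_imp_holomorphic[OF analytic_on_subset[OF r(2)]]) (use that in auto)
  then show ?thesis unfolding eventually_at_right[OF r(1)] using r(1) by blast
qed

context weight12
begin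

lemma A_B_mero: "A nicely_meromorphic_on upper_half" "B nicely_meromorphic_on upper_half"
  unfolding A_def B_def by (rule remove_sings_nicely_meromorphic[OF op_mero(1)], rule remove_sings_nicely_meromorphic[OF op_mero(2)])

lemma klein_j_cusp:
  assumes "coprime a c"
  shows "expands_at M klein_j (Cusp a c) (\<lambda>z. j_q (z ^ cusp_width M a c))"
proof -
  obtain b d where bd: "a * d - b * c = 1" "cusp_mat a c = (a, b, c, d)" using cusp_mat[OF assms] by blast
  show ?thesis unfolding expands_at_cusp_iff[OF assms] bd(2)
  proof (intro exI[of _ 1] conjI allI impI)
    fix \<tau> assume t: "Im \<tau> > 0 \<and> norm (cusp_q (cusp_width M a c) \<tau>) < 1"
    then show "klein_j (moebius_act (a, b, c, d) \<tau>) = j_q (cusp_q (cusp_width M a c) \<tau> ^ cusp_width M a c)"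
      using klein_j_invariant[OF bd(1), of \<tau>] klein_j_q[of \<tau>] cusp_q_power'[OF cusp_width_pos[OF M]] by (simp del: moebius_act.simps)
  qed simp
qed

lemma j_pow_mero: "w > 0 \<Longrightarrow> (\<lambda>z. j_q (z ^ w)) meromorphic_on {0}"
  by (rule meromorphic_on_compose[OF j_q_meromorphic]) (auto intro!: analytic_intros)

lemma j_pow_pole: "w > 0 \<Longrightarrow> is_pole (\<lambda>z. j_q (z ^ w)) 0"
proof -
  assume w: "w > 0"
  have "((\<lambda>z::complex. z ^ w) \<longlongrightarrow> 0 ^ w) (at 0)" by (intro tendsto_intros)
  then have "filterlim (\<lambda>z::complex. z ^ w) (at 0) (at 0)"
    using w by (auto simp: filterlim_at eventually_at_filter zero_power)
  then show ?thesis unfolding is_pole_def by (rule filterlim_compose[OF j_q_pole[unfolded is_pole_def]])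
qed

text \<open>After pulling back to infinity, \<open>\<tau>\<close> is a multiple of
  \<open>log z\<close>, so the local solutions are \<open>\<Phi>^(1/12)\<close> and
  \<open>\<Phi>^(1/12) * log z\<close>; the two coefficients are those of the operator annihilating
  this pair.\<close>

lemma cusp_summary:
  assumes co: "coprime a c"
  obtains X Ah Bh \<Phi> r where
    "X meromorphic_on {0}" "Ah meromorphic_on {0}" "Bh meromorphic_on {0}"
    "expands_at M klein_j (Cusp a c) X" "expands_at M A (Cusp a c) Ah" "expands_at M B (Cusp a c) Bh"
    "\<Phi> meromorphic_on {0}" "zorder \<Phi> 0 = ordc a c" "eventually (\<lambda>z. \<Phi> z \<noteq> 0) (at 0)"
    "r > 0" "\<And>\<tau>. Im \<tau> > 0 \<Longrightarrow> norm (cusp_q (cusp_width M a c) \<tau>) < r \<Longrightarrow>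
         K (moebius_act (cusp_mat a c) \<tau>) / autf (cusp_mat a c) \<tau> ^ 12 = \<Phi> (cusp_q (cusp_width M a c) \<tau>)"
    "eventually (\<lambda>z. zcoeff1 (DiffOp X Ah Bh) z = (1 - 2 * (z * logd \<Phi> z)) / z) (at 0)"
    "eventually (\<lambda>z. zcoeff0 (DiffOp X Ah Bh) z = ((z * logd \<Phi> z) ^ 2 - z * deriv (\<lambda>z. z * logd \<Phi> z) z) / z ^ 2) (at 0)"
proof -
  define w where "w = cusp_width M a c"
  have w: "w > 0" unfolding w_def by (rule cusp_width_pos[OF M])
  obtain b d where bd: "a * d - b * c = 1" "cusp_mat a c = (a, b, c, d)" using cusp_mat[OF co] by blast
  obtain \<Phi> r0 where \<Phi>: "\<Phi> meromorphic_on {0}" "zorder \<Phi> 0 = ordc a c" and r0: "r0 > 0"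
    "\<And>\<tau>. Im \<tau> > 0 \<Longrightarrow> norm (cusp_q w \<tau>) < r0 \<Longrightarrow>
         K (moebius_act (cusp_mat a c) \<tau>) / autf (cusp_mat a c) \<tau> ^ 12 = \<Phi> (cusp_q w \<tau>)"
    using K_cusp[OF co] unfolding w_def by blast
  define X where "X = (\<lambda>z. j_q (z ^ w))"
  define H where "H = (\<lambda>z. z * logd \<Phi> z)"
  define Ah where "Ah = (\<lambda>z. (deriv (deriv X) z * z / deriv X z + 1 - 2 * H z) / (deriv X z * z))"
  define Bh where "Bh = (\<lambda>z. (H z ^ 2 - z * deriv H z) / (deriv X z * z) ^ 2)"
  have Xm: "X meromorphic_on {0}" unfolding X_def by (rule j_pow_mero[OF w])
  have Hm: "H meromorphic_on {0}" unfolding H_def logd_def by (intro meromorphic_intros \<Phi>)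
  have Am: "Ah meromorphic_on {0}" "Bh meromorphic_on {0}"
    unfolding Ah_def Bh_def by (intro meromorphic_intros Xm Hm)+
  \<comment> \<open>The pole of \<open>X\<close> makes its derivative nonzero nearby, so close to
    the cusp \<open>A\<close> and \<open>B\<close> coincide with the raw quotients.\<close>
  have X'0: "eventually (\<lambda>z. deriv X z \<noteq> 0) (at 0)"
    by (rule non_zero_neighbour_pole) (use is_pole_deriv_iff[OF Xm] j_pow_pole[OF w] in \<open>simp add: X_def\<close>)
  have \<Phi>nz: "\<Phi> z \<noteq> 0" if z: "z \<noteq> 0" "norm z < min 1 r0" for z
  proof -
    obtain \<tau> where t: "Im \<tau> > 0" "cusp_q w \<tau> = z" using cusp_q_surj[OF z(1) _ w] z(2) by auto
    have "autf (cusp_mat a c) \<tau> \<noteq> 0" unfolding bd(2) autf_def using moebius_Im(1)[OF bd(1) t(1)] by simp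
    moreover have "K (moebius_act (cusp_mat a c) \<tau>) \<noteq> 0" unfolding bd(2) by (intro K_nz moebius_Im(2)[OF bd(1) t(1)])
    ultimately show ?thesis using r0(2)[OF t(1)] t(2) z(2) by auto
  qed
  have \<Phi>nz': "eventually (\<lambda>z. \<Phi> z \<noteq> 0) (at 0)"
    unfolding eventually_at using r0(1) \<Phi>nz by (intro exI[of _ "min 1 r0"]) auto
  obtain r1 where r1: "r1 > 0" "\<And>z. z \<noteq> 0 \<Longrightarrow> norm z < r1 \<Longrightarrow> deriv X z \<noteq> 0"
    using X'0 unfolding eventually_at by auto
  have "min 1 (min r0 r1) > 0" using r0(1) r1(1) by simp
  from eventually_at_right_real[OF this]
  have "eventually (\<lambda>r. X holomorphic_on ball 0 r - {0} \<and> \<Phi> holomorphic_on ball 0 r - {0} \<and> r \<in> {0<..<min 1 (min r0 r1)}) (at_right 0)"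
    using meromorphic_punctured[OF Xm] meromorphic_punctured[OF \<Phi>(1)] by eventually_elim auto
  from eventually_happens'[OF _ this] obtain r where r: "X holomorphic_on ball 0 r - {0}" "\<Phi> holomorphic_on ball 0 r - {0}" "r < 1" "r < r0" "r < r1" "r > 0"
    by auto
  define W where "W = ball 0 r - {0 :: complex}"
  have W: "open W" "X holomorphic_on W" "\<Phi> holomorphic_on W" "\<And>z. z \<in> W \<Longrightarrow> \<Phi> z \<noteq> 0"
    using r \<Phi>nz by (auto simp: W_def)
  define U where "U = {\<tau>. Im \<tau> > 0} \<inter> cusp_q w -` ball 0 r"
  have lder: "(cusp_q w has_field_derivative (2 * pi * \<i> / of_nat w) * cusp_q w z) (at z)" for z
    unfolding cusp_q_def using w by (auto intro!: derivative_eq_intros)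
  have "open U" unfolding U_def
    by (intro open_Int open_halfspace_Im_gt open_vimage open_ball continuous_at_imp_continuous_on ballI DERIV_isCont[OF lder])
  have key: "A (moebius_act (cusp_mat a c) \<tau>) = Ah (cusp_q w \<tau>) \<and> B (moebius_act (cusp_mat a c) \<tau>) = Bh (cusp_q w \<tau>)"
    if t: "Im \<tau> > 0" "norm (cusp_q w \<tau>) < r" for \<tau>
  proof -
    have tU: "\<tau> \<in> U" using t by (simp add: U_def)
    have X0: "deriv X (cusp_q w \<tau>) \<noteq> 0" using r1(2)[of "cusp_q w \<tau>"] t r by simp
    have J: "klein_j z = X (cusp_q w z)" if "z \<in> U" for z
      using klein_j_q[of z] cusp_q_power'[OF w] that by (simp add: X_def U_def)
    have KK: "K (moebius_act (a, b, c, d) z) / autf (a, b, c, d) z ^ 12 = \<Phi> (cusp_q w z)" if "z \<in> U" for z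
      using r0(2)[of z] that r unfolding bd(2) U_def by auto
    have lW: "cusp_q w z \<in> W" if "z \<in> U" for z using that by (simp add: U_def W_def)
    have kap: "2 * pi * \<i> / of_nat w \<noteq> 0" using w by simp
    note oc = op_exp_chart[OF \<open>open U\<close> tU lder kap _ W lW X0 J KK]
    have dj: "deriv klein_j \<tau> \<noteq> 0" by (rule oc(3)) auto
    have mU: "moebius_act (a, b, c, d) \<tau> \<in> upper_half" unfolding upper_half_iff by (rule moebius_Im(2)[OF bd(1) t(1)])
    have "deriv klein_j (moebius_act (a, b, c, d) \<tau>) \<noteq> 0" using op_SL2(3)[OF bd(1) t(1)] dj by auto
    note AB = AB_eq[OF mU this, unfolded op_SL2(1,2)[OF bd(1) t(1)]]
    have "opA klein_j (\<lambda>s. K (moebius_act (a, b, c, d) s) / autf (a, b, c, d) s ^ 12) \<tau> = Ah (cusp_q w \<tau>)"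
      unfolding Ah_def H_def by (rule oc(1)) auto
    moreover have "opB klein_j (\<lambda>s. K (moebius_act (a, b, c, d) s) / autf (a, b, c, d) s ^ 12) \<tau> = Bh (cusp_q w \<tau>)"
      unfolding Bh_def H_def by (rule oc(2)) auto
    ultimately show ?thesis unfolding bd(2) AB by simp
  qed
  have eA: "expands_at M A (Cusp a c) Ah" and eB: "expands_at M B (Cusp a c) Bh"
    unfolding expands_at_cusp_iff[OF co] w_def[symmetric] using r(6) key by blast+
  have ev: "eventually (\<lambda>z. z \<noteq> 0 \<and> deriv X z \<noteq> 0) (at 0)"
    using X'0 by (auto simp: eventually_at_filter elim: eventually_mono)
  show ?thesis
  proof (rule that[OF Xm Am _ eA eB \<Phi> \<Phi>nz' r0(1)])
    show "expands_at M klein_j (Cusp a c) X" unfolding X_def w_def by (rule klein_j_cusp[OF co])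
    show "K (moebius_act (cusp_mat a c) \<tau>) / autf (cusp_mat a c) \<tau> ^ 12 = \<Phi> (cusp_q (cusp_width M a c) \<tau>)"
      if "Im \<tau> > 0" "norm (cusp_q (cusp_width M a c) \<tau>) < r0" for \<tau>
      using r0(2) that unfolding w_def by blast
    show "eventually (\<lambda>z. zcoeff1 (DiffOp X Ah Bh) z = (1 - 2 * (z * logd \<Phi> z)) / z) (at 0)"
      using ev by eventually_elim (simp add: zcoeff1_def Ah_def H_def field_simps)
    show "eventually (\<lambda>z. zcoeff0 (DiffOp X Ah Bh) z = ((z * logd \<Phi> z) ^ 2 - z * deriv (\<lambda>z. z * logd \<Phi> z) z) / z ^ 2) (at 0)"
      using ev by eventually_elim (simp add: zcoeff0_def Bh_def H_def power_mult_distrib)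
  qed
qed

lemma cusp_localize:
  assumes co: "coprime a c"
  obtains \<Phi> r where
    "\<Phi> meromorphic_on {0}" "zorder \<Phi> 0 = ordc a c" "eventually (\<lambda>z. \<Phi> z \<noteq> 0) (at 0)"
    "r > 0" "\<And>\<tau>. Im \<tau> > 0 \<Longrightarrow> norm (cusp_q (cusp_width M a c) \<tau>) < r \<Longrightarrow>
         K (moebius_act (cusp_mat a c) \<tau>) / autf (cusp_mat a c) \<tau> ^ 12 = \<Phi> (cusp_q (cusp_width M a c) \<tau>)"
    "eventually (\<lambda>z. zcoeff1 (localize M (Cusp a c) L) z = (1 - 2 * (z * logd \<Phi> z)) / z) (at 0)"
    "eventually (\<lambda>z. zcoeff0 (localize M (Cusp a c) L) z = ((z * logd \<Phi> z) ^ 2 - z * deriv (\<lambda>z. z * logd \<Phi> z) z) / z ^ 2) (at 0)"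
proof -
  have p: "Cusp a c \<in> ext_upper_half" using co by (auto simp: ext_upper_half_def)
  show ?thesis
  proof (rule cusp_summary[OF co], goal_cases)
    case (1 X Ah Bh \<Phi> r)
    note e = expansion_props(3)[OF p M 1(1,4)] expansion_props(3)[OF p M 1(2,5)] expansion_props(3)[OF p M 1(3,6)]
    note z = eventually_zcoeff_cong[OF e]
    have l: "localize M (Cusp a c) L = DiffOp (expansion M (Cusp a c) klein_j) (expansion M (Cusp a c) A) (expansion M (Cusp a c) B)"
      by (simp add: localize_def L_def)
    show ?case
    proof (rule that[OF 1(7-11)])
      show "eventually (\<lambda>z. zcoeff1 (localize M (Cusp a c) L) z = (1 - 2 * (z * logd \<Phi> z)) / z) (at 0)"
        using z(1) 1(12) unfolding l by eventually_elim simp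
      show "eventually (\<lambda>z. zcoeff0 (localize M (Cusp a c) L) z = ((z * logd \<Phi> z) ^ 2 - z * deriv (\<lambda>z. z * logd \<Phi> z) z) / z ^ 2) (at 0)"
        using z(2) 1(13) unfolding l by eventually_elim simp
    qed
  qed
qed

end

section \<open>Local form at the points of the upper half-plane\<close>

lemma tendsto_of_power:
  fixes \<phi> :: "complex \<Rightarrow> complex"
  assumes "((\<lambda>s. \<phi> (s ^ k)) \<longlongrightarrow> c) (at 0)" "k > 0"
  shows "(\<phi> \<longlongrightarrow> c) (at 0)"
proof -
  have "((\<lambda>z. \<phi> (exp (Ln z / of_nat k) ^ k)) \<longlongrightarrow> c) (at 0)"
    by (rule filterlim_compose[OF assms(1) root_tends_to_0[OF assms(2)]])
  moreover have "eventually (\<lambda>z. \<phi> (exp (Ln z / of_nat k) ^ k) = \<phi> z) (at 0)"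
    using root_power[OF assms(2)] by (auto simp: eventually_at_filter)
  ultimately show ?thesis by (rule Lim_transform_eventually)
qed

text \<open>Passing from \<open>s\<close> to \<open>s ^ k\<close>, with \<open>k = Suc m\<close>,
  divides exponents by \<open>k\<close>: the exponents 0 and 1 of a regular equation become 0 and
  \<open>1/k\<close>, whence the leading term \<open>m / Suc m = 1 - 1/k\<close>.\<close>

lemma op_power_chart:
  assumes "s \<noteq> 0"
  shows "s ^ Suc m * opA (\<lambda>z. z ^ Suc m) K s = (of_nat m - 2 * s * logd K s) / of_nat (Suc m)"
    "(s ^ Suc m) ^ 2 * opB (\<lambda>z. z ^ Suc m) K s = s ^ 2 * (logd K s ^ 2 - deriv (logd K) s) / of_nat (Suc m) ^ 2"
proof -
  have 1: "deriv (\<lambda>z::complex. z ^ Suc m) z = of_nat (Suc m) * z ^ m" for z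
    by (rule DERIV_imp_deriv) (auto intro!: derivative_eq_intros simp del: of_nat_Suc power_Suc)
  then have dpow: "deriv (\<lambda>z::complex. z ^ Suc m) = (\<lambda>z. of_nat (Suc m) * z ^ m)" by blast
  have 2: "s * deriv (\<lambda>z::complex. of_nat (Suc m) * z ^ m) s = of_nat (Suc m) * of_nat m * s ^ m"
  proof -
    have "((\<lambda>z. of_nat (Suc m) * z ^ m) has_field_derivative of_nat (Suc m) * (of_nat m * s ^ (m - 1))) (at s)"
      by (rule DERIV_cmult) (auto intro!: derivative_eq_intros)
    from DERIV_imp_deriv[OF this] show ?thesis by (cases m) (auto simp del: of_nat_Suc)
  qed
  have n0: "of_nat (Suc m) \<noteq> (0 :: complex)" by (simp only: of_nat_neq_0 not_False_eq_True)
  define n :: complex where "n = of_nat (Suc m)"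
  have nz: "n \<noteq> 0" "s ^ m \<noteq> 0" using n0 assms by (auto simp: n_def)
  define d where "d = deriv (\<lambda>z::complex. of_nat (Suc m) * z ^ m) s"
  have sd: "s * d = n * of_nat m * s ^ m" using 2 by (simp only: d_def n_def)
  have "s * s ^ m * ((d / (n * s ^ m) - 2 * g) / (n * s ^ m)) = (of_nat m - 2 * s * g) / n" for g
  proof -
    have "s * s ^ m * ((d / (n * s ^ m) - 2 * g) / (n * s ^ m)) = (s * d / (n * s ^ m) - 2 * s * g) / n"
      using nz by (simp add: field_simps)
    then show ?thesis unfolding sd using nz by simp
  qed
  then show "s ^ Suc m * opA (\<lambda>z. z ^ Suc m) K s = (of_nat m - 2 * s * logd K s) / of_nat (Suc m)"
    unfolding opA_def dpow d_def[symmetric] n_def by (simp only: power_Suc)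
  show "(s ^ Suc m) ^ 2 * opB (\<lambda>z. z ^ Suc m) K s = s ^ 2 * (logd K s ^ 2 - deriv (logd K) s) / of_nat (Suc m) ^ 2"
    unfolding opB_def dpow n_def[symmetric] using nz by (simp add: power_mult_distrib)
qed

context weight12
begin

text \<open>In the disc coordinate the transformed form is holomorphic without zeros, so its
  logarithmic derivative is regular and contributes nothing to the first two limits. These are
  computed in \<open>s\<close> and transferred to \<open>z = s ^ k\<close>; for \<open>k = 1\<close>
  the coefficients themselves are regular.\<close>

lemma inner_limits:
  assumes pos: "Im \<tau>0 > 0"
  defines "k \<equiv> stab_order M \<tau>0"
  shows "((\<lambda>z. z * zcoeff1 (localize M (Inner \<tau>0) L) z) \<longlongrightarrow> (of_nat k - 1) / of_nat k) (at 0)"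
    "((\<lambda>z. z ^ 2 * zcoeff0 (localize M (Inner \<tau>0) L) z) \<longlongrightarrow> 0) (at 0)"
    "k = 1 \<Longrightarrow> \<exists>c. (zcoeff1 (localize M (Inner \<tau>0) L) \<longlongrightarrow> c) (at 0)"
    "k = 1 \<Longrightarrow> \<exists>c. (zcoeff0 (localize M (Inner \<tau>0) L) \<longlongrightarrow> c) (at 0)"
proof -
  interpret stabilizer M \<tau>0 by unfold_locales (rule pos)
  have k0: "k > 0" unfolding k_def by (rule stab_order_pos)
  obtain m where km: "k = Suc m" using k0 by (cases k) auto
  have p: "Inner \<tau>0 \<in> ext_upper_half" using pos by (auto simp: ext_upper_half_def upper_half_iff)
  have jinv: "klein_j (moebius_act \<gamma> \<tau>) = klein_j \<tau>" if g: "\<gamma> \<in> Gamma0 M" and t: "\<tau> \<in> upper_half" for \<gamma> \<tau>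
  proof -
    obtain a b c d where \<gamma>: "\<gamma> = (a, b, c, d)" by (cases \<gamma>)
    show ?thesis unfolding \<gamma> by (rule klein_j_invariant) (use g t \<gamma> in \<open>auto simp: Gamma0_def upper_half_iff\<close>)
  qed
  obtain X where X: "X meromorphic_on {0}" "expands_at M klein_j (Inner \<tau>0) X"
    "\<And>s. 0 < norm s \<Longrightarrow> norm s < 1 \<Longrightarrow> klein_j (inner_mu \<tau>0 s) = X (s ^ k)"
    using jinv that by (rule expansion_inner_exists[OF pos holo_mero[OF klein_j_holo], where M = M, folded k_def])
  have ABm: "A meromorphic_on upper_half" "B meromorphic_on upper_half"
    using A_B_mero by (simp_all add: nicely_meromorphic_on_def)
  obtain Ah where Ah: "Ah meromorphic_on {0}" "expands_at M A (Inner \<tau>0) Ah"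
    "\<And>s. 0 < norm s \<Longrightarrow> norm s < 1 \<Longrightarrow> A (inner_mu \<tau>0 s) = Ah (s ^ k)"
    using AB_inv(1) that by (rule expansion_inner_exists[OF pos ABm(1), where M = M, folded k_def])
  obtain Bh where Bh: "Bh meromorphic_on {0}" "expands_at M B (Inner \<tau>0) Bh"
    "\<And>s. 0 < norm s \<Longrightarrow> norm s < 1 \<Longrightarrow> B (inner_mu \<tau>0 s) = Bh (s ^ k)"
    using AB_inv(2) that by (rule expansion_inner_exists[OF pos ABm(2), where M = M, folded k_def])
  have l: "localize M (Inner \<tau>0) L = DiffOp (expansion M (Inner \<tau>0) klein_j) (expansion M (Inner \<tau>0) A) (expansion M (Inner \<tau>0) B)"
    by (simp add: localize_def L_def)
  note zc = eventually_zcoeff_cong[OF expansion_props(3)[OF p M X(1,2)] expansion_props(3)[OF p M Ah(1,2)] expansion_props(3)[OF p M Bh(1,2)], folded l]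
  let ?\<mu> = "inner_mu \<tau>0"
  define Kt where "Kt = (\<lambda>s. K (?\<mu> s) / (- 1 * s + 1) ^ 12)"
  have D: "- cnj \<tau>0 * 1 - \<tau>0 * - 1 \<noteq> 0" using pos by (auto simp: complex_eq_iff)
  have u3: "- 1 * z + 1 \<noteq> 0" if "z \<in> ball 0 1" for z :: complex using that by auto
  have u4: "(- cnj \<tau>0 * z + \<tau>0) / (- 1 * z + 1) \<in> upper_half" if "z \<in> ball 0 1" for z
    using inner_mu_Im[OF pos, of z] that unfolding inner_mu_def by (simp add: upper_half_iff)
  have om: "opA (\<lambda>s. klein_j (?\<mu> s)) Kt s = opA klein_j K (?\<mu> s)" "opB (\<lambda>s. klein_j (?\<mu> s)) Kt s = opB klein_j K (?\<mu> s)"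
    "deriv (\<lambda>s. klein_j (?\<mu> s)) s = deriv klein_j (?\<mu> s) * ((- cnj \<tau>0 * 1 - \<tau>0 * - 1) / (- 1 * s + 1) ^ 2)"
    if s: "s \<in> ball 0 1" for s
  proof -
    show "opA (\<lambda>s. klein_j (?\<mu> s)) Kt s = opA klein_j K (?\<mu> s)" unfolding Kt_def inner_mu_def
      using K_nz' u3 u4 by (rule op_moebius(1)[OF open_upper_half klein_j_holo K_holo _ D open_ball s])
    show "opB (\<lambda>s. klein_j (?\<mu> s)) Kt s = opB klein_j K (?\<mu> s)" unfolding Kt_def inner_mu_def
      using K_nz' u3 u4 by (rule op_moebius(2)[OF open_upper_half klein_j_holo K_holo _ D open_ball s])
    show "deriv (\<lambda>s. klein_j (?\<mu> s)) s = deriv klein_j (?\<mu> s) * ((- cnj \<tau>0 * 1 - \<tau>0 * - 1) / (- 1 * s + 1) ^ 2)"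
      unfolding inner_mu_def
      using K_nz' u3 u4 by (rule op_moebius(3)[OF open_upper_half klein_j_holo K_holo _ D open_ball s])
  qed
  have mu_holo: "?\<mu> holomorphic_on ball 0 1" unfolding inner_mu_def using u3 by (intro holomorphic_intros) auto
  have mu_H: "?\<mu> ` ball 0 1 \<subseteq> upper_half" using u4 unfolding inner_mu_def by blast
  have Kt_holo: "Kt holomorphic_on ball 0 1"
    unfolding Kt_def using holomorphic_on_compose_gen[OF mu_holo K_holo mu_H] u3
    by (intro holomorphic_intros) (auto simp: o_def)
  have Kt_nz: "Kt z \<noteq> 0" if "z \<in> ball 0 1" for z
  proof -
    have "?\<mu> z \<in> upper_half" using mu_H that by blast
    from K_nz'[OF this] show ?thesis unfolding Kt_def using u3[OF that] by simp
  qed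
  define \<gamma> where "\<gamma> = logd Kt"
  have \<gamma>h: "\<gamma> holomorphic_on ball 0 1" unfolding \<gamma>_def by (rule logd_holo[OF open_ball Kt_holo Kt_nz])
  have \<gamma>c: "(\<gamma> \<longlongrightarrow> \<gamma> 0) (at 0)" "(deriv \<gamma> \<longlongrightarrow> deriv \<gamma> 0) (at 0)"
    using holomorphic_on_imp_continuous_on[OF \<gamma>h] holomorphic_on_imp_continuous_on[OF holomorphic_deriv[OF \<gamma>h open_ball]]
    by (auto simp: continuous_on_eq_continuous_at isCont_def)
  obtain r1 where r1: "r1 > 0" "X holomorphic_on ball 0 r1 - {0}"
    using eventually_happens'[OF _ eventually_conj[OF meromorphic_punctured[OF X(1)] eventually_at_right_less[of 0]]] by auto
  have mu_lim: "filterlim ?\<mu> (at \<tau>0) (at 0)"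
  proof -
    have "isCont ?\<mu> 0" using holomorphic_on_imp_continuous_on[OF mu_holo] by (simp add: continuous_on_eq_continuous_at)
    then have "(?\<mu> \<longlongrightarrow> \<tau>0) (at 0)" by (simp add: isCont_def inner_mu_def)
    moreover have "eventually (\<lambda>s. ?\<mu> s \<noteq> \<tau>0) (at 0)"
    proof -
      have "eventually (\<lambda>s::complex. s \<in> ball 0 1 - {0}) (at 0)" by (rule eventually_at_in_open) auto
      then show ?thesis
      proof eventually_elim
        case (elim s)
        then have "s \<noteq> 1" by auto
        from inner_s_mu[OF pos this] show ?case using elim by (auto simp: inner_s_def)
      qed
    qed
    ultimately show ?thesis by (auto simp: filterlim_at elim: eventually_mono)
  qed
  have pw: "filterlim (\<lambda>s::complex. s ^ k) (at 0) (at 0)"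
  proof -
    have "((\<lambda>s::complex. s ^ k) \<longlongrightarrow> 0 ^ k) (at 0)" by (intro tendsto_intros)
    then show ?thesis using k0 by (auto simp: filterlim_at eventually_at_filter zero_power)
  qed
  \<comment> \<open>The derivative of \<open>j\<close> may vanish at \<open>\<tau>0\<close> itself,
    for example at an elliptic point, but not at nearby points; so everything is compared on a
    punctured neighbourhood.\<close>
  have "eventually (\<lambda>s. deriv klein_j (?\<mu> s) \<noteq> 0) (at 0)"
    using deriv_klein_j_nonzero[of \<tau>0] pos mu_lim by (auto simp: upper_half_iff dest: eventually_compose_filterlim)
  moreover have "eventually (\<lambda>s. s ^ k \<in> ball 0 r1 - {0}) (at (0 :: complex))"
    by (rule eventually_compose_filterlim[OF eventually_at_in_open pw]) (use r1 in auto)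
  moreover have "eventually (\<lambda>s::complex. s \<in> ball 0 1 - {0}) (at 0)" by (rule eventually_at_in_open) auto
  ultimately have key: "eventually (\<lambda>s. s \<noteq> 0 \<and> zcoeff1 (DiffOp X Ah Bh) (s ^ k) = opA (\<lambda>z. z ^ k) Kt s \<and> zcoeff0 (DiffOp X Ah Bh) (s ^ k) = opB (\<lambda>z. z ^ k) Kt s) (at 0)"
  proof eventually_elim
    case (elim s)
    define U where "U = (ball 0 1 - {0}) \<inter> (\<lambda>s::complex. s ^ k) -` (ball 0 r1 - {0})"
    have U: "open U" "s \<in> U" unfolding U_def using elim by (auto intro!: open_Int open_vimage continuous_intros)
    have sb: "s \<in> ball 0 1" "s \<noteq> 0" using elim by auto
    have lh: "(\<lambda>s::complex. s ^ k) holomorphic_on U" by (intro holomorphic_intros)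
    have l0: "deriv (\<lambda>z::complex. z ^ k) s \<noteq> 0"
    proof -
      have "((\<lambda>z::complex. z ^ k) has_field_derivative of_nat k * s ^ (k - 1)) (at s)" by (auto intro!: derivative_eq_intros)
      from DERIV_imp_deriv[OF this] show ?thesis using elim k0 by simp
    qed
    have lW: "z ^ k \<in> ball 0 r1 - {0}" if "z \<in> U" for z using that by (simp add: U_def)
    have J: "klein_j (?\<mu> z) = X (z ^ k)" if "z \<in> U" for z using X(3)[of z] that by (auto simp: U_def)
    have J0: "deriv (\<lambda>s. klein_j (?\<mu> s)) s \<noteq> 0" unfolding om(3)[OF sb(1)] using elim D u3[OF sb(1)] by auto
    have muU: "?\<mu> s \<in> upper_half" using mu_H sb by blast
    note AB = AB_eq[OF muU elim(1)]
    have A1: "Ah (s ^ k) = opA (\<lambda>s. klein_j (?\<mu> s)) Kt s" using Ah(3)[of s] sb AB(1) om(1)[OF sb(1)] by simp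
    have B1: "Bh (s ^ k) = opB (\<lambda>s. klein_j (?\<mu> s)) Kt s" using Bh(3)[of s] sb AB(2) om(2)[OF sb(1)] by simp
    have oW: "open (ball 0 r1 - {0 :: complex})" by (simp add: open_delete)
    show ?case
      using zcoeff_change[of U s "\<lambda>z. z ^ k" "ball 0 r1 - {0}" X "\<lambda>s. klein_j (?\<mu> s)" Ah Kt Bh, OF U lh l0 oW r1(2) lW J J0 A1 B1] sb by simp
  qed
  have "((\<lambda>s. (of_nat m - 2 * s * \<gamma> s) / of_nat (Suc m)) \<longlongrightarrow> (of_nat m - 2 * 0 * \<gamma> 0) / of_nat (Suc m)) (at 0)"
    by (intro tendsto_intros \<gamma>c) (simp only: of_nat_neq_0 not_False_eq_True)
  moreover have "eventually (\<lambda>s. (of_nat m - 2 * s * \<gamma> s) / of_nat (Suc m) = s ^ k * zcoeff1 (DiffOp X Ah Bh) (s ^ k)) (at 0)"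
    using key
  proof eventually_elim
    case (elim s)
    then have s: "s \<noteq> 0" and z: "zcoeff1 (DiffOp X Ah Bh) (s ^ k) = opA (\<lambda>z. z ^ k) Kt s" by auto
    show ?case unfolding z unfolding km \<gamma>_def by (rule op_power_chart(1)[OF s, symmetric])
  qed
  ultimately have "((\<lambda>s. s ^ k * zcoeff1 (DiffOp X Ah Bh) (s ^ k)) \<longlongrightarrow> (of_nat m - 2 * 0 * \<gamma> 0) / of_nat (Suc m)) (at 0)"
    by (rule Lim_transform_eventually)
  from tendsto_of_power[OF this k0] have "((\<lambda>z. z * zcoeff1 (DiffOp X Ah Bh) z) \<longlongrightarrow> (of_nat k - 1) / of_nat k) (at 0)"
    by (simp add: km)
  moreover have "eventually (\<lambda>z. z * zcoeff1 (DiffOp X Ah Bh) z = z * zcoeff1 (localize M (Inner \<tau>0) L) z) (at 0)"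
    using zc(1) by eventually_elim simp
  ultimately show "((\<lambda>z. z * zcoeff1 (localize M (Inner \<tau>0) L) z) \<longlongrightarrow> (of_nat k - 1) / of_nat k) (at 0)"
    by (rule Lim_transform_eventually)
  have "((\<lambda>s. s ^ 2 * (\<gamma> s ^ 2 - deriv \<gamma> s) / of_nat (Suc m) ^ 2) \<longlongrightarrow> 0 ^ 2 * (\<gamma> 0 ^ 2 - deriv \<gamma> 0) / of_nat (Suc m) ^ 2) (at 0)"
    by (intro tendsto_intros \<gamma>c) (simp only: of_nat_neq_0 not_False_eq_True power_not_zero)
  moreover have "eventually (\<lambda>s. s ^ 2 * (\<gamma> s ^ 2 - deriv \<gamma> s) / of_nat (Suc m) ^ 2 = (s ^ k) ^ 2 * zcoeff0 (DiffOp X Ah Bh) (s ^ k)) (at 0)"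
    using key
  proof eventually_elim
    case (elim s)
    then have s: "s \<noteq> 0" and z: "zcoeff0 (DiffOp X Ah Bh) (s ^ k) = opB (\<lambda>z. z ^ k) Kt s" by auto
    show ?case unfolding z unfolding km \<gamma>_def by (rule op_power_chart(2)[OF s, symmetric])
  qed
  ultimately have "((\<lambda>s. (s ^ k) ^ 2 * zcoeff0 (DiffOp X Ah Bh) (s ^ k)) \<longlongrightarrow> 0 ^ 2 * (\<gamma> 0 ^ 2 - deriv \<gamma> 0) / of_nat (Suc m) ^ 2) (at 0)"
    by (rule Lim_transform_eventually)
  from tendsto_of_power[OF this k0] have "((\<lambda>z. z ^ 2 * zcoeff0 (DiffOp X Ah Bh) z) \<longlongrightarrow> 0) (at 0)" by simp
  moreover have "eventually (\<lambda>z. z ^ 2 * zcoeff0 (DiffOp X Ah Bh) z = z ^ 2 * zcoeff0 (localize M (Inner \<tau>0) L) z) (at 0)"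
    using zc(2) by eventually_elim simp
  ultimately show "((\<lambda>z. z ^ 2 * zcoeff0 (localize M (Inner \<tau>0) L) z) \<longlongrightarrow> 0) (at 0)"
    by (rule Lim_transform_eventually)
  show "\<exists>c. (zcoeff1 (localize M (Inner \<tau>0) L) \<longlongrightarrow> c) (at 0)" "\<exists>c. (zcoeff0 (localize M (Inner \<tau>0) L) \<longlongrightarrow> c) (at 0)" if k1: "k = 1"
  proof -
    have d: "deriv (\<lambda>z::complex. z) = (\<lambda>z. 1)" by (rule ext) simp
    have oA: "opA (\<lambda>z. z) Kt s = - 2 * \<gamma> s" and oB: "opB (\<lambda>z. z) Kt s = \<gamma> s ^ 2 - deriv \<gamma> s" for s
      unfolding opA_def opB_def \<gamma>_def d by simp_all
    have e1: "eventually (\<lambda>s. - 2 * \<gamma> s = zcoeff1 (localize M (Inner \<tau>0) L) s) (at 0)"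
      using key zc(1) unfolding k1 power_one_right oA by eventually_elim simp
    have e0: "eventually (\<lambda>s. \<gamma> s ^ 2 - deriv \<gamma> s = zcoeff0 (localize M (Inner \<tau>0) L) s) (at 0)"
      using key zc(2) unfolding k1 power_one_right oB by eventually_elim simp
    have "((\<lambda>s. - 2 * \<gamma> s) \<longlongrightarrow> - 2 * \<gamma> 0) (at 0)" "((\<lambda>s. \<gamma> s ^ 2 - deriv \<gamma> s) \<longlongrightarrow> \<gamma> 0 ^ 2 - deriv \<gamma> 0) (at 0)"
      by (intro tendsto_intros \<gamma>c)+
    with e1 e0 show "\<exists>c. (zcoeff1 (localize M (Inner \<tau>0) L) \<longlongrightarrow> c) (at 0)" "\<exists>c. (zcoeff0 (localize M (Inner \<tau>0) L) \<longlongrightarrow> c) (at 0)"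
      using Lim_transform_eventually by blast+
  qed
qed

end

lemma limit_not_pole: "(f \<longlongrightarrow> c) (at 0) \<Longrightarrow> \<not> is_pole f (0 :: complex)"
  for f :: "complex \<Rightarrow> complex"
  unfolding is_pole_def using not_tendsto_and_filterlim_at_infinity[of "at (0 :: complex)" f c] by auto

context weight12
begin

lemma cusp_limits:
  assumes co: "coprime a c"
  defines "\<rho> \<equiv> of_int (ordc a c) / 12 :: complex"
  shows "((\<lambda>z. z * zcoeff1 (localize M (Cusp a c) L) z) \<longlongrightarrow> 1 - 2 * \<rho>) (at 0)"
    "((\<lambda>z. z ^ 2 * zcoeff0 (localize M (Cusp a c) L) z) \<longlongrightarrow> \<rho> ^ 2) (at 0)"
proof -
  obtain \<Phi> where \<Phi>: "\<Phi> meromorphic_on {0}" "zorder \<Phi> 0 = ordc a c" "eventually (\<lambda>z. \<Phi> z \<noteq> 0) (at 0)"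
    and z: "eventually (\<lambda>z. zcoeff1 (localize M (Cusp a c) L) z = (1 - 2 * (z * logd \<Phi> z)) / z) (at 0)"
    "eventually (\<lambda>z. zcoeff0 (localize M (Cusp a c) L) z = ((z * logd \<Phi> z) ^ 2 - z * deriv (\<lambda>z. z * logd \<Phi> z) z) / z ^ 2) (at 0)"
    by (rule cusp_localize[OF co]) (rule that, assumption+)
  note lim = logd_times_limit[OF \<Phi>(1,3), unfolded \<Phi>(2), folded \<rho>_def]
  have n0: "eventually (\<lambda>z::complex. z \<noteq> 0) (at 0)" by (simp add: eventually_at_filter)
  have "((\<lambda>z. 1 - 2 * (z * logd \<Phi> z)) \<longlongrightarrow> 1 - 2 * \<rho>) (at 0)" by (intro tendsto_intros lim)
  moreover have "eventually (\<lambda>z. 1 - 2 * (z * logd \<Phi> z) = z * zcoeff1 (localize M (Cusp a c) L) z) (at 0)"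
    using z(1) n0 by eventually_elim simp
  ultimately show "((\<lambda>z. z * zcoeff1 (localize M (Cusp a c) L) z) \<longlongrightarrow> 1 - 2 * \<rho>) (at 0)"
    by (rule Lim_transform_eventually)
  have "((\<lambda>z. (z * logd \<Phi> z) ^ 2 - z * deriv (\<lambda>z. z * logd \<Phi> z) z) \<longlongrightarrow> \<rho> ^ 2 - 0) (at 0)" by (intro tendsto_intros lim)
  moreover have "eventually (\<lambda>z. (z * logd \<Phi> z) ^ 2 - z * deriv (\<lambda>z. z * logd \<Phi> z) z = z ^ 2 * zcoeff0 (localize M (Cusp a c) L) z) (at 0)"
    using z(2) n0 by eventually_elim simp
  ultimately have "((\<lambda>z. z ^ 2 * zcoeff0 (localize M (Cusp a c) L) z) \<longlongrightarrow> \<rho> ^ 2 - 0) (at 0)"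
    by (rule Lim_transform_eventually)
  then show "((\<lambda>z. z ^ 2 * zcoeff0 (localize M (Cusp a c) L) z) \<longlongrightarrow> \<rho> ^ 2) (at 0)" by simp
qed

text \<open>With the limits of \<open>cusp_limits\<close> the indicial polynomial is
  \<open>(X - \<rho>) ^ 2\<close>, in accordance with the logarithmic second solution.\<close>

lemma exponents_cusp:
  assumes co: "coprime a c"
  shows "exponents M L (Cusp a c) = {# of_int (ordc a c) / 12, of_int (ordc a c) / 12 #}"
proof -
  define \<rho> :: complex where "\<rho> = of_int (ordc a c) / 12"
  note lim = cusp_limits[OF co, folded \<rho>_def]
  have "indicial_poly M L (Cusp a c) = [:- \<rho>, 1:] * [:- \<rho>, 1:]"
    unfolding indicial_poly_def tendsto_Lim[OF at_neq_bot lim(1)] tendsto_Lim[OF at_neq_bot lim(2)]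
    by (simp add: power2_eq_square algebra_simps)
  then show ?thesis unfolding exponents_def \<rho>_def[symmetric] by (simp add: proots_mult del: mult_pCons_left mult_pCons_right)
qed

lemma exponents_inner:
  assumes pos: "Im \<tau>0 > 0"
  shows "exponents M L (Inner \<tau>0) = {# 0, 1 / of_nat (stab_order M \<tau>0) #}"
proof -
  interpret stabilizer M \<tau>0 by unfold_locales (rule pos)
  define k where "k = stab_order M \<tau>0"
  have k0: "of_nat k \<noteq> (0 :: complex)" using stab_order_pos by (simp add: k_def)
  note lim = inner_limits(1,2)[OF pos, folded k_def]
  have "indicial_poly M L (Inner \<tau>0) = [:0, 1:] * [:- (1 / of_nat k), 1:]"
    unfolding indicial_poly_def tendsto_Lim[OF at_neq_bot lim(1)] tendsto_Lim[OF at_neq_bot lim(2)]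
    using k0 by (simp add: field_simps)
  then show ?thesis unfolding exponents_def k_def[symmetric] by (simp add: proots_mult del: mult_pCons_left mult_pCons_right)
qed

lemma function_field_AB: "klein_j \<in> function_field M" "A \<in> function_field M" "B \<in> function_field M"
proof -
  have jn: "klein_j nicely_meromorphic_on upper_half"
    by (rule analytic_on_imp_nicely_meromorphic_on) (simp add: analytic_on_open open_upper_half klein_j_holo)
  have jinv: "klein_j (moebius_act \<gamma> \<tau>) = klein_j \<tau>" if g: "\<gamma> \<in> Gamma0 M" and t: "\<tau> \<in> upper_half" for \<gamma> \<tau>
  proof -
    obtain a b c d where \<gamma>: "\<gamma> = (a, b, c, d)" by (cases \<gamma>)
    show ?thesis unfolding \<gamma> by (rule klein_j_invariant) (use g t \<gamma> in \<open>auto simp: Gamma0_def upper_half_iff\<close>)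
  qed
  have c: "(\<exists>F. F meromorphic_on {0} \<and> expands_at M klein_j (Cusp a c) F) \<and> (\<exists>F. F meromorphic_on {0} \<and> expands_at M A (Cusp a c) F)
      \<and> (\<exists>F. F meromorphic_on {0} \<and> expands_at M B (Cusp a c) F)" if "coprime a c" for a c
  proof (rule cusp_summary[OF that], goal_cases)
    case (1 X Ah Bh \<Phi> r)
    then show ?case by blast
  qed
  show "klein_j \<in> function_field M" "A \<in> function_field M" "B \<in> function_field M"
    unfolding function_field_def using jn A_B_mero jinv AB_inv c by auto
qed

text \<open>With \<open>h\<close> the exponential of a primitive of \<open>logd K\<close> on the
  convex half-plane, the equation says that \<open>y / h\<close> has second derivative 0. So every
  solution is \<open>h\<close> times a linear function of \<open>\<tau>\<close>, and
  \<open>h\<close> cancels in ratios.\<close>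

lemma ratios: "moebius_ratios L"
  unfolding moebius_ratios_def
proof (intro allI impI, elim conjE)
  fix U u v
  assume U: "open U" "connected U" "U \<noteq> {}" "U \<subseteq> upper_half" and d0: "\<forall>\<tau>\<in>U. deriv (dvar L) \<tau> \<noteq> 0"
    and su: "solution_on L U u" and sv: "solution_on L U v" and ind: "independent_on U u v"
  define g where "g = logd K"
  obtain p where p: "\<And>x. x \<in> upper_half \<Longrightarrow> (p has_field_derivative g x) (at x within upper_half)"
    using holomorphic_convex_primitive'[OF convex_upper_half open_upper_half logd_K_holo] unfolding g_def by blast
  define h where "h = (\<lambda>z. exp (p z))"
  have hd: "(h has_field_derivative h z * g z) (at z)" if "z \<in> upper_half" for z
    unfolding h_def using p[OF that] at_within_open[OF that open_upper_half] by (auto intro!: derivative_eq_intros)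
  have h0: "h z \<noteq> 0" for z by (simp add: h_def)
  have gd: "(g has_field_derivative deriv g z) (at z)" if "z \<in> upper_half" for z
    unfolding g_def by (rule holomorphic_derivI[OF logd_K_holo open_upper_half that])
  have zc: "zcoeff1 L z = - 2 * g z" "zcoeff0 L z = g z ^ 2 - deriv g z" if z: "z \<in> U" for z
  proof -
    have zu: "z \<in> upper_half" using z U by auto
    have dj: "deriv klein_j z \<noteq> 0" using d0 z by (auto simp: L_def)
    have d: "deriv (\<lambda>z::complex. z) = (\<lambda>z. 1)" by (rule ext) simp
    have 1: "zcoeff1 (DiffOp klein_j A B) z = opA (\<lambda>z. z) K z" "zcoeff0 (DiffOp klein_j A B) z = opB (\<lambda>z. z) K z"
      using zcoeff_change[of upper_half z "\<lambda>z. z" upper_half klein_j klein_j A K B] zu dj open_upper_half klein_j_holo AB_eq[OF zu dj]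
      by (auto simp: holomorphic_on_ident)
    show "zcoeff1 L z = - 2 * g z" "zcoeff0 L z = g z ^ 2 - deriv g z"
      unfolding L_def 1 opA_def opB_def d g_def by simp_all
  qed
  have lin: "\<exists>\<alpha> \<beta>. \<forall>z\<in>U. y z = h z * (\<alpha> * z + \<beta>)" if sy: "solution_on L U y" for y
  proof -
    have yh: "y holomorphic_on U" and ye: "\<And>z. z \<in> U \<Longrightarrow> solves_at L y z" using sy by (auto simp: solution_on_def)
    have yd: "(y has_field_derivative deriv y z) (at z)" "(deriv y has_field_derivative deriv (deriv y) z) (at z)" if "z \<in> U" for z
      using holomorphic_derivI[OF yh U(1) that] holomorphic_derivI[OF holomorphic_deriv[OF yh U(1)] U(1) that] by auto
    \<comment> \<open>This is the derivative of \<open>y / h\<close>.\<close>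
    define q where "q = (\<lambda>z. (deriv y z - g z * y z) / h z)"
    have qd: "(q has_field_derivative 0) (at z)" if z: "z \<in> U" for z
    proof -
      have zu: "z \<in> upper_half" using z U by auto
      have f1: "(q has_field_derivative ((deriv (deriv y) z - (deriv g z * y z + deriv y z * g z)) * h z - (deriv y z - g z * y z) * (h z * g z)) / (h z * h z)) (at z)"
        unfolding q_def by (intro DERIV_divide DERIV_diff DERIV_mult yd[OF z] gd[OF zu] hd[OF zu] h0)
      have f2: "(deriv (deriv y) z - (deriv g z * y z + deriv y z * g z)) * h z - (deriv y z - g z * y z) * (h z * g z)
         = h z * (deriv (deriv y) z + (- 2 * g z) * deriv y z + (g z ^ 2 - deriv g z) * y z)"
        by (simp add: power2_eq_square algebra_simps)
      have f3: "deriv (deriv y) z + (- 2 * g z) * deriv y z + (g z ^ 2 - deriv g z) * y z = 0"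
        using ye[OF z] unfolding solves_at_def zc[OF z] .
      show ?thesis using f1 unfolding f2 f3 by simp
    qed
    have "q constant_on U"
      by (rule has_field_derivative_0_imp_constant_on[OF _ U(2,1)]) (rule qd)
    then obtain \<alpha> where \<alpha>: "\<And>z. z \<in> U \<Longrightarrow> q z = \<alpha>" unfolding constant_on_def by blast
    have wd: "((\<lambda>z. y z / h z - \<alpha> * z) has_field_derivative 0) (at z)" if z: "z \<in> U" for z
    proof -
      have zu: "z \<in> upper_half" using z U by auto
      have "((\<lambda>z. y z / h z - \<alpha> * z) has_field_derivative (deriv y z * h z - y z * (h z * g z)) / (h z * h z) - \<alpha> * 1) (at z)"
        by (intro DERIV_diff DERIV_divide DERIV_cmult DERIV_ident yd[OF z] hd[OF zu] h0)
      moreover have "(deriv y z * h z - y z * (h z * g z)) / (h z * h z) = q z" unfolding q_def using h0[of z] by (simp add: field_simps)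
      ultimately show ?thesis using \<alpha>[OF z] by simp
    qed
    have "(\<lambda>z. y z / h z - \<alpha> * z) constant_on U"
      by (rule has_field_derivative_0_imp_constant_on[OF _ U(2,1)]) (rule wd)
    then obtain \<beta> where "\<And>z. z \<in> U \<Longrightarrow> y z / h z - \<alpha> * z = \<beta>" unfolding constant_on_def by blast
    then have "\<forall>z\<in>U. y z = h z * (\<alpha> * z + \<beta>)" using h0 by (auto simp: field_simps)
    then show ?thesis by blast
  qed
  obtain a b where ab: "\<And>z. z \<in> U \<Longrightarrow> u z = h z * (a * z + b)" using lin[OF su] by blast
  obtain c d where cd: "\<And>z. z \<in> U \<Longrightarrow> v z = h z * (c * z + d)" using lin[OF sv] by blast
  have "a * d \<noteq> b * c"
  proof
    assume e: "a * d = b * c"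
    have "c * u z + (- a) * v z = 0" "d * u z + (- b) * v z = 0" if "z \<in> U" for z
    proof -
      have "c * u z + (- a) * v z = h z * (b * c - a * d)" "d * u z + (- b) * v z = h z * (a * d - b * c) * z"
        unfolding ab[OF that] cd[OF that] by (simp_all add: algebra_simps)
      then show "c * u z + (- a) * v z = 0" "d * u z + (- b) * v z = 0" using e by simp_all
    qed
    then have "c = 0 \<and> - a = 0" "d = 0 \<and> - b = 0" using ind unfolding independent_on_def by blast+
    then have "\<forall>z\<in>U. 1 * u z + 0 * v z = 0" using ab by simp
    then have "(1 :: complex) = 0" using ind unfolding independent_on_def by blast
    then show False by simp
  qed
  moreover have "\<forall>\<tau>\<in>U. v \<tau> \<noteq> 0 \<longrightarrow> u \<tau> / v \<tau> = (a * \<tau> + b) / (c * \<tau> + d)"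
    using ab cd h0 by simp
  ultimately show "\<exists>a b c d. a * d \<noteq> b * c \<and> (\<forall>\<tau>\<in>U. v \<tau> \<noteq> 0 \<longrightarrow> u \<tau> / v \<tau> = (a * \<tau> + b) / (c * \<tau> + d))" by blast
qed

theorem uniformizing_L: "uniformizing M L"
proof -
  have do: "diff_op_on M L" unfolding diff_op_on_def L_def using function_field_AB klein_j_not_constant by simp
  have fu: "fuchsian M L" unfolding fuchsian_def
  proof
    fix p assume p: "p \<in> ext_upper_half"
    show "\<not> is_pole (\<lambda>z. z * zcoeff1 (localize M p L) z) 0 \<and> \<not> is_pole (\<lambda>z. z\<^sup>2 * zcoeff0 (localize M p L) z) 0"
    proof (cases p)
      case (Inner \<tau>)
      then show ?thesis using p inner_limits(1,2)[of \<tau>] limit_not_pole by (auto simp: ext_upper_half_def upper_half_iff)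
    next
      case (Cusp a c)
      then show ?thesis using p cusp_limits[of a c] limit_not_pole by (auto simp: ext_upper_half_def)
    qed
  qed
  have si: "singular_point M L p \<longleftrightarrow> fixed_point M p" if p: "p \<in> ext_upper_half" for p
  proof (cases p)
    case (Inner \<tau>)
    then have pos: "Im \<tau> > 0" using p by (auto simp: ext_upper_half_def upper_half_iff)
    interpret stabilizer M \<tau> by unfold_locales (rule pos)
    show ?thesis
    proof (cases "stab_order M \<tau> = 1")
      case True
      then show ?thesis using inner_limits(3,4)[OF pos True] limit_not_pole unfolding singular_point_def Inner by auto
    next
      case False
      then have k: "stab_order M \<tau> > 1" using stab_order_pos by simp
      have "((of_nat (stab_order M \<tau>) - 1) / of_nat (stab_order M \<tau>) :: complex) \<noteq> 0" using k by simp
      then have "is_pole (zcoeff1 (localize M p L)) 0"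
        using pole_from_limit[of 1 "zcoeff1 (localize M p L)"] inner_limits(1)[OF pos] unfolding Inner by simp
      then show ?thesis using k unfolding singular_point_def Inner by simp
    qed
  next
    case (Cusp a c)
    then have co: "coprime a c" using p by (auto simp: ext_upper_half_def)
    define \<rho> :: complex where "\<rho> = of_int (ordc a c) / 12"
    note lim = cusp_limits[OF co, folded \<rho>_def]
    \<comment> \<open>If \<open>\<rho> = 0\<close>, the first coefficient has a simple pole of
      residue 1; otherwise the second has a double pole with coefficient
      \<open>\<rho> ^ 2\<close>.\<close>
    have "is_pole (zcoeff1 (localize M p L)) 0 \<or> is_pole (zcoeff0 (localize M p L)) 0"
    proof (cases "\<rho> = 0")
      case True
      then show ?thesis using pole_from_limit[of 1 "zcoeff1 (localize M p L)" "1 - 2 * \<rho>"] lim(1) unfolding Cusp by simp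
    next
      case False
      then show ?thesis using pole_from_limit[OF lim(2)] unfolding Cusp by simp
    qed
    then show ?thesis unfolding singular_point_def Cusp by simp
  qed
  show ?thesis unfolding uniformizing_def exponent_difference_def
  proof (intro conjI do fu ratios ballI si impI allI)
    fix \<tau> assume "\<tau> \<in> upper_half"
    then show "\<exists>\<rho>. exponents M L (Inner \<tau>) = {#\<rho>, \<rho> + 1 / of_nat (stab_order M \<tau>)#}"
      using exponents_inner[of \<tau>] by (intro exI[of _ 0]) (simp add: upper_half_iff)
  next
    fix a c :: int assume "coprime a c"
    then show "\<exists>\<rho>. exponents M L (Cusp a c) = {#\<rho>, \<rho> + 0#}"
      using exponents_cusp[of a c] by (intro exI[of _ "of_int (ordc a c) / 12"]) simp
  qed
qed

end

section \<open>The normalized solution at infinity\<close>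

lemma cusp_width_infinity: "M > 0 \<Longrightarrow> cusp_width M 1 0 = 1"
  by (simp add: cusp_width_eq)

text \<open>The choice operator leaves the upper right entry open; it is an integral translation,
  which \<open>to_q\<close> does not see.\<close>

lemma cusp_mat_infinity:
  obtains b where "cusp_mat 1 0 = (1, b, 0, 1)"
proof -
  have co: "coprime (1 :: int) 0" by simp
  obtain b d where "1 * d - b * 0 = (1 :: int)" "cusp_mat 1 0 = (1, b, 0, d)"
    by (rule cusp_mat[OF co]) (rule that, assumption+)
  then show ?thesis using that[of b] by simp
qed

lemma cusp_q_1: "cusp_q 1 \<tau> = to_q \<tau>" by (simp add: cusp_q_def)

context weight12
begin

text \<open>Near 0, \<open>u\<close> is a constant times a twelfth root of \<open>K\<close>, so it
  solves the equation. The other solutions contain \<open>u * log z\<close>, and analyticity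
  excludes the logarithm.\<close>

theorem unique_normalized:
  assumes u: "u analytic_on {0}" "u 0 = 1" and C: "C \<noteq> 0" and r: "r > 0"
    and h: "\<And>\<tau>. Im \<tau> > 0 \<Longrightarrow> norm (to_q \<tau>) < r \<Longrightarrow> h \<tau> = u (to_q \<tau>) \<and> u (to_q \<tau>) ^ 12 = C * K \<tau>"
  shows "unique_normalized_solution M L h"
proof -
  obtain b where b: "cusp_mat 1 0 = (1, b, 0, 1)" by (rule cusp_mat_infinity)
  note w1 = cusp_width_infinity[OF M]
  have co: "coprime (1 :: int) 0" by simp
  obtain \<Phi> r1 where \<Phi>1: "r1 > 0" and \<Phi>2: "\<And>\<tau>. Im \<tau> > 0 \<Longrightarrow> norm (cusp_q (cusp_width M 1 0) \<tau>) < r1 \<Longrightarrow>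
         K (moebius_act (cusp_mat 1 0) \<tau>) / autf (cusp_mat 1 0) \<tau> ^ 12 = \<Phi> (cusp_q (cusp_width M 1 0) \<tau>)"
    and zc: "eventually (\<lambda>z. zcoeff1 (localize M (Cusp 1 0) L) z = (1 - 2 * (z * logd \<Phi> z)) / z) (at 0)"
    "eventually (\<lambda>z. zcoeff0 (localize M (Cusp 1 0) L) z = ((z * logd \<Phi> z) ^ 2 - z * deriv (\<lambda>z. z * logd \<Phi> z) z) / z ^ 2) (at 0)"
    by (rule cusp_localize[OF co]) (rule that, assumption+)
  note \<Phi> = \<Phi>1 \<Phi>2[unfolded w1 cusp_q_1 b]
  have gb: "(1, b, 0, 1) \<in> Gamma0 M" by (simp add: Gamma0_def)
  have K\<Phi>: "K \<tau> = \<Phi> (to_q \<tau>)" if "Im \<tau> > 0" "norm (to_q \<tau>) < r1" for \<tau>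
    using \<Phi>(2)[OF that] K_mod[OF gb that(1)] by (simp add: autf_def)
  obtain r2 where r2: "r2 > 0" "u holomorphic_on ball 0 r2" using u(1) unfolding analytic_at by (meson openE holomorphic_on_subset singletonI)
  have "isCont u 0" using u(1) by (simp add: analytic_at_imp_isCont)
  then have "(u \<longlongrightarrow> u 0) (nhds 0)" unfolding isCont_def tendsto_at_iff_tendsto_nhds .
  then have "eventually (\<lambda>z. u z \<noteq> 0) (nhds 0)"
    using u(2) by (intro tendsto_imp_eventually_ne[of u "u 0"]) auto
  then obtain r3 where r3: "r3 > 0" "\<And>z. norm z < r3 \<Longrightarrow> u z \<noteq> 0" unfolding eventually_nhds_metric by auto
  obtain r4 where r4: "r4 > 0" "\<And>z. z \<noteq> 0 \<Longrightarrow> norm z < r4 \<Longrightarrow> zcoeff1 (localize M (Cusp 1 0) L) z = (1 - 2 * (z * logd \<Phi> z)) / z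
     \<and> zcoeff0 (localize M (Cusp 1 0) L) z = ((z * logd \<Phi> z) ^ 2 - z * deriv (\<lambda>z. z * logd \<Phi> z) z) / z ^ 2"
    using eventually_conj[OF zc] unfolding eventually_at by auto
  define R where "R = min 1 (min r (min r1 (min r2 (min r3 r4))))"
  have R: "R > 0" using r \<Phi>(1) r2 r3 r4 by (simp add: R_def)
  define W where "W = ball (0 :: complex) R - {0}"
  have oW: "open W" by (simp add: W_def open_delete)
  have uh: "u holomorphic_on ball 0 R" by (rule holomorphic_on_subset[OF r2(2)]) (auto simp: R_def)
  have u0: "u z \<noteq> 0" if "z \<in> ball 0 R" for z using r3(2) that by (simp add: R_def)
  have u\<Phi>: "u z ^ 12 = C * \<Phi> z" if z: "z \<in> W" for z
  proof -
    have "z \<noteq> 0" "norm z < 1" using z by (auto simp: W_def R_def)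
    then obtain \<tau> where t: "Im \<tau> > 0" "to_q \<tau> = z" using to_q_surj by blast
    then show ?thesis using h[OF t(1)] K\<Phi>[OF t(1)] z by (auto simp: W_def R_def)
  qed
  define g where "g = (\<lambda>z. deriv u z / u z)"
  have gh: "g holomorphic_on ball 0 R" unfolding g_def using u0 by (intro holomorphic_intros holomorphic_deriv uh open_ball) auto
  have ud: "(u has_field_derivative g z * u z) (at z)" if "z \<in> ball 0 R" for z
    using holomorphic_derivI[OF uh open_ball that] u0[OF that] by (simp add: g_def)
  have gd: "(g has_field_derivative deriv g z) (at z)" if "z \<in> ball 0 R" for z
    by (rule holomorphic_derivI[OF gh open_ball that])
  have WR: "z \<in> ball 0 R" "z \<noteq> 0" if "z \<in> W" for z using that by (auto simp: W_def)
  have lg: "logd \<Phi> z = g z" if z: "z \<in> W" for z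
  proof -
    have "\<Phi> y = u y ^ 12 / C" if "y \<in> W" for y using u\<Phi>[OF that] C by simp
    then have "deriv \<Phi> z = deriv (\<lambda>z. u z ^ 12 / C) z" by (rule deriv_cong_open[OF oW z])
    also have "\<dots> = 12 * u z ^ 11 * (g z * u z) / C"
      by (rule DERIV_imp_deriv) (use ud[OF WR(1)[OF z]] C in \<open>auto intro!: derivative_eq_intros\<close>)
    also have "\<dots> = 12 * g z * (u z ^ 12 / C)" by (simp add: eval_nat_numeral)
    finally have "deriv \<Phi> z = 12 * g z * \<Phi> z" using \<open>\<And>y. y \<in> W \<Longrightarrow> \<Phi> y = u y ^ 12 / C\<close>[OF z] by simp
    moreover have "\<Phi> z \<noteq> 0" using u\<Phi>[OF z] u0[OF WR(1)[OF z]] by auto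
    ultimately show ?thesis by (simp add: logd_def)
  qed
  have zz: "zcoeff1 (localize M (Cusp 1 0) L) z = 1 / z - 2 * g z"
    "zcoeff0 (localize M (Cusp 1 0) L) z = g z ^ 2 - g z / z - deriv g z" if z: "z \<in> W" for z
  proof -
    have "norm z < r4" using z by (simp add: W_def R_def)
    note r = r4(2)[OF WR(2)[OF z] this]
    have "deriv (\<lambda>z. z * logd \<Phi> z) z = deriv (\<lambda>z. z * g z) z" by (rule deriv_cong_open[OF oW z]) (simp add: lg)
    also have "\<dots> = g z + z * deriv g z"
      by (rule DERIV_imp_deriv) (use gd[OF WR(1)[OF z]] in \<open>auto intro!: derivative_eq_intros\<close>)
    finally have d: "deriv (\<lambda>z. z * logd \<Phi> z) z = g z + z * deriv g z" .
    show "zcoeff1 (localize M (Cusp 1 0) L) z = 1 / z - 2 * g z"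
      using r WR(2)[OF z] lg[OF z] by (simp add: field_simps)
    show "zcoeff0 (localize M (Cusp 1 0) L) z = g z ^ 2 - g z / z - deriv g z"
      unfolding conjunct2[OF r] d lg[OF z] using WR(2)[OF z] by (simp add: field_simps power2_eq_square)
  qed
  have ev: "eventually (\<lambda>z. z \<in> W) (at 0)" unfolding W_def by (rule eventually_at_in_open) (use R in auto)
  have du: "deriv u z = g z * u z" if "z \<in> ball 0 R" for z by (rule DERIV_imp_deriv[OF ud[OF that]])
  have ddu: "deriv (deriv u) z = deriv g z * u z + g z * u z * g z" if z: "z \<in> ball 0 R" for z
  proof -
    have "deriv (deriv u) z = deriv (\<lambda>z. g z * u z) z" by (rule deriv_cong_open[OF open_ball z du])
    also have "\<dots> = deriv g z * u z + g z * u z * g z" by (rule DERIV_imp_deriv[OF DERIV_mult[OF gd[OF z] ud[OF z]]])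
    finally show ?thesis .
  qed
  have sol: "solves_at (localize M (Cusp 1 0) L) u z" if z: "z \<in> W" for z
    unfolding solves_at_def zz[OF z] ddu[OF WR(1)[OF z]] du[OF WR(1)[OF z]]
    by (simp add: power2_eq_square algebra_simps)
  have ns: "normalized_solution M L u"
    unfolding normalized_solution_def using u ev sol by (auto elim: eventually_mono)
  have ex: "expands_at M h (Cusp 1 0) u"
  proof -
    have "h (moebius_act (1, b, 0, 1) \<tau>) = u (cusp_q 1 \<tau>)" if "Im \<tau> > 0" "norm (cusp_q 1 \<tau>) < r" for \<tau>
      using h[of "\<tau> + of_int b"] that unfolding cusp_q_1 by (simp add: to_q_add_int)
    then show ?thesis using expands_at_cusp_iff[of 1 0 M h u] r unfolding w1 b by auto
  qed
  have uniq: "eventually (\<lambda>z. v z = u z) (nhds 0)" if v: "normalized_solution M L v" for v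
  proof -
    have va: "v analytic_on {0}" "v 0 = 1" "eventually (\<lambda>z. solves_at (localize M (Cusp 1 0) L) v z) (at 0)"
      using v by (auto simp: normalized_solution_def)
    obtain s1 where s1: "s1 > 0" "v holomorphic_on ball 0 s1" using va(1) unfolding analytic_at by (meson openE holomorphic_on_subset singletonI)
    obtain s2 where s2: "s2 > 0" "\<And>z. z \<noteq> 0 \<Longrightarrow> norm z < s2 \<Longrightarrow> solves_at (localize M (Cusp 1 0) L) v z"
      using va(3) unfolding eventually_at by auto
    define S where "S = min R (min s1 s2)"
    have S: "S > 0" using R s1 s2 by (simp add: S_def)
    have inR: "z \<in> ball 0 R" if "z \<in> ball 0 S" for z :: complex using that by (simp add: S_def)
    have vh: "v holomorphic_on ball 0 S" by (rule holomorphic_on_subset[OF s1(2)]) (auto simp: S_def)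
    have vd: "(v has_field_derivative deriv v z) (at z)" "(deriv v has_field_derivative deriv (deriv v) z) (at z)" if "z \<in> ball 0 S" for z
      using holomorphic_derivI[OF vh open_ball that] holomorphic_derivI[OF holomorphic_deriv[OF vh open_ball] open_ball that] by auto
    \<comment> \<open>\<open>p\<close> is the derivative of \<open>v / u\<close>. The equation makes
      \<open>z * p z\<close> constant; a nonzero constant would be the coefficient of a logarithm,
      and analyticity at 0 forces it to be 0.\<close>
    define p where "p = (\<lambda>z. (deriv v z - g z * v z) / u z)"
    have ph: "p holomorphic_on ball 0 S" unfolding p_def
      using u0 inR by (intro holomorphic_intros holomorphic_deriv vh open_ball holomorphic_on_subset[OF gh] holomorphic_on_subset[OF uh]) auto
    have pd: "((\<lambda>z. z * p z) has_field_derivative 0) (at z)" if z: "z \<in> ball 0 S - {0}" for z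
    proof -
      have zS: "z \<in> ball 0 S" and z0: "z \<noteq> 0" using z by auto
      note zR = inR[OF zS]
      have zW: "z \<in> W" using zR z0 by (simp add: W_def)
      have f1: "((\<lambda>z. z * p z) has_field_derivative 1 * p z + ((deriv (deriv v) z - (deriv g z * v z + deriv v z * g z)) * u z - (deriv v z - g z * v z) * (g z * u z)) / (u z * u z) * z) (at z)"
        unfolding p_def by (intro DERIV_divide DERIV_diff DERIV_mult DERIV_ident vd[OF zS] gd[OF zR] ud[OF zR] u0[OF zR])
      have sv: "deriv (deriv v) z + (1 / z - 2 * g z) * deriv v z + (g z ^ 2 - g z / z - deriv g z) * v z = 0"
        using s2(2)[of z] z unfolding solves_at_def zz[OF zW] by (simp add: S_def)
      have "(deriv (deriv v) z - (deriv g z * v z + deriv v z * g z)) * u z - (deriv v z - g z * v z) * (g z * u z)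
         = u z * (deriv (deriv v) z + (1 / z - 2 * g z) * deriv v z + (g z ^ 2 - g z / z - deriv g z) * v z) - u z * ((deriv v z - g z * v z) / z)"
        by (simp add: power2_eq_square algebra_simps diff_divide_distrib)
      then have "(deriv (deriv v) z - (deriv g z * v z + deriv v z * g z)) * u z - (deriv v z - g z * v z) * (g z * u z) = - (u z * ((deriv v z - g z * v z) / z))"
        unfolding sv by simp
      then show ?thesis using f1 u0[OF zR] z0 by (simp add: p_def)
    qed
    obtain c where c: "\<And>z. z \<in> ball 0 S \<Longrightarrow> z * p z = c"
    proof (rule DERIV_zero_connected_constant[of "ball 0 S" "{0}" "\<lambda>z. z * p z"])
      show "continuous_on (ball 0 S) (\<lambda>z. z * p z)" by (intro continuous_intros holomorphic_on_imp_continuous_on ph)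
    qed (use pd in auto)
    have "c = 0" using c[of 0] S by simp
    then have p0: "p z = 0" if "z \<in> ball 0 S - {0}" for z using c[of z] that by auto
    have wd: "((\<lambda>z. v z / u z) has_field_derivative 0) (at z)" if z: "z \<in> ball 0 S - {0}" for z
    proof -
      have zS: "z \<in> ball 0 S" using z by auto
      have "((\<lambda>z. v z / u z) has_field_derivative (deriv v z * u z - v z * (g z * u z)) / (u z * u z)) (at z)"
        by (intro DERIV_divide vd[OF zS] ud[OF inR[OF zS]] u0[OF inR[OF zS]])
      moreover have "(deriv v z * u z - v z * (g z * u z)) / (u z * u z) = p z" unfolding p_def using u0[OF inR[OF zS]] by (simp add: field_simps)
      ultimately show ?thesis using p0[OF z] by simp
    qed
    obtain c' where c': "\<And>z. z \<in> ball 0 S \<Longrightarrow> v z / u z = c'"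
    proof (rule DERIV_zero_connected_constant[of "ball 0 S" "{0}" "\<lambda>z. v z / u z"])
      show "continuous_on (ball 0 S) (\<lambda>z. v z / u z)"
        using u0 inR by (intro continuous_intros holomorphic_on_imp_continuous_on vh holomorphic_on_subset[OF uh]) auto
    qed (use wd in auto)
    have "c' = 1" using c'[of 0] S va(2) u(2) by simp
    then have "v z = u z" if "norm z < S" for z using c'[of z] u0[of z] inR[of z] that by simp
    then show ?thesis unfolding eventually_nhds_metric using S by (intro exI[of _ S]) auto
  qed
  show ?thesis unfolding unique_normalized_solution_def using ex ns uniq by blast
qed

end

section \<open>The Hauptmodul at the cusps\<close>

lemma eventually_imp_frequently: "eventually P (at (0 :: complex)) \<Longrightarrow> frequently P (at 0)"
  using eventually_frequently[of "at (0::complex)" P] by simp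

lemma zorder_0_limit:
  assumes "F meromorphic_on {0}" "(F \<longlongrightarrow> c) (at 0)" "c \<noteq> 0"
  shows "zorder F 0 = 0"
proof (rule not_pole_not_isolated_zero_imp_zorder_eq_0[OF assms(1)])
  show "\<not> is_pole F 0" by (rule limit_not_pole[OF assms(2)])
  show "\<not> isolated_zero F 0"
    using tendsto_unique[OF at_neq_bot assms(2)] assms(3) by (auto simp: isolated_zero_def)
  show "frequently (\<lambda>z. F z \<noteq> 0) (at 0)"
    by (rule eventually_imp_frequently[OF tendsto_imp_eventually_ne[OF assms(2,3)]])
qed

lemma zorder_cong_at:
  assumes "eventually (\<lambda>z. f z = g z) (at (0 :: complex))"
  shows "zorder f 0 = zorder g 0"
  using assms by (rule zorder_cong) simp

text \<open>The effect on orders of ramification of index \<open>e\<close>, seen after splitting off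
  the leading power of \<open>\<Phi>\<close>.\<close>

lemma zorder_pow_arg:
  assumes mero: "\<Phi> meromorphic_on {0}" and nz: "eventually (\<lambda>z. \<Phi> z \<noteq> 0) (at 0)" and e: "e > 0"
  shows "zorder (\<lambda>z. \<Phi> (z ^ e)) 0 = int e * zorder \<Phi> 0"
proof -
  define n where "n = zorder \<Phi> 0"
  define g where "g = zor_poly \<Phi> 0"
  have "g 0 \<noteq> 0 \<and> (\<exists>r. r > 0 \<and> g holomorphic_on cball 0 r \<and> (\<forall>w\<in>cball 0 r - {0}. \<Phi> w = g w * (w - 0) powi n \<and> g w \<noteq> 0))"
    unfolding g_def n_def using mero eventually_imp_frequently[OF nz] unfolding meromorphic_at_iff by (intro zorder_exist) auto
  then obtain r where g0: "g 0 \<noteq> 0" and r: "r > 0" "g holomorphic_on cball 0 r" "\<And>w. w \<in> cball 0 r - {0} \<Longrightarrow> \<Phi> w = g w * w powi n" by auto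
  have gh: "g holomorphic_on ball 0 r" by (rule holomorphic_on_subset[OF r(2)]) auto
  define S where "S = (\<lambda>z::complex. z ^ e) -` ball 0 r"
  have "open S" unfolding S_def by (intro open_vimage open_ball continuous_intros)
  have pw: "(\<lambda>z::complex. z ^ e) holomorphic_on S" by (intro holomorphic_intros)
  have sub: "(\<lambda>z::complex. z ^ e) ` S \<subseteq> ball 0 r" by (auto simp: S_def)
  show ?thesis unfolding n_def[symmetric]
  proof (rule zorder_eqI[of S _ "\<lambda>z. g (z ^ e)"])
    show "0 \<in> S" using r e by (simp add: S_def zero_power)
    show "(\<lambda>z. g (z ^ e)) holomorphic_on S"
      using holomorphic_on_compose_gen[OF pw gh sub] by (simp only: o_def)
    show "g (0 ^ e) \<noteq> 0" using e g0 by (simp add: zero_power)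
    show "\<Phi> (w ^ e) = g (w ^ e) * (w - 0) powi (int e * n)" if "w \<in> S" "w \<noteq> 0" for w
      using r(3)[of "w ^ e"] that by (simp add: S_def power_int_mult)
  qed fact
qed

text \<open>In terms of \<open>1 / F\<close> the quotient is the reflected polynomial, whose value
  at 0 is the leading coefficient.\<close>

lemma poly_at_infinity:
  fixes p :: "complex poly"
  assumes "filterlim F at_infinity A"
  shows "((\<lambda>z. poly p (F z) / F z ^ degree p) \<longlongrightarrow> lead_coeff p) A"
proof -
  have i: "((\<lambda>z. inverse (F z)) \<longlongrightarrow> 0) A"
    using filterlim_compose[OF tendsto_inverse_0 assms] .
  have "((\<lambda>z. poly (reflect_poly p) (inverse (F z))) \<longlongrightarrow> poly (reflect_poly p) 0) A"
    by (intro tendsto_intros i)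
  moreover have "poly (reflect_poly p) 0 = lead_coeff p" by (simp add: poly_0_coeff_0)
  moreover have "eventually (\<lambda>z. poly (reflect_poly p) (inverse (F z)) = poly p (F z) / F z ^ degree p) A"
    using filterlim_at_infinity_imp_eventually_ne[OF assms, of 0]
    by eventually_elim (simp add: poly_reflect_poly_nz field_simps)
  ultimately show ?thesis using Lim_transform_eventually by fastforce
qed

lemma poly_mero: "F meromorphic_on {0} \<Longrightarrow> (\<lambda>z. poly p (F z)) meromorphic_on {0}"
  by (induction p) (auto intro!: meromorphic_intros)

lemma zorder_poly_pole:
  fixes p :: "complex poly"
  assumes F: "F meromorphic_on {0}" "is_pole F 0" and p: "p \<noteq> 0"
  shows "zorder (\<lambda>z. poly p (F z)) 0 = int (degree p) * zorder F 0"
proof -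
  have nz: "eventually (\<lambda>z. F z \<noteq> 0) (at 0)" by (rule non_zero_neighbour_pole[OF F(2)])
  have lim: "((\<lambda>z. poly p (F z) / F z ^ degree p) \<longlongrightarrow> lead_coeff p) (at 0)"
    by (rule poly_at_infinity) (use F(2) in \<open>simp add: is_pole_def\<close>)
  have l0: "lead_coeff p \<noteq> 0" using p by simp
  have m: "(\<lambda>z. poly p (F z) / F z ^ degree p) meromorphic_on {0}" by (intro meromorphic_intros poly_mero F)
  have "zorder (\<lambda>z. (poly p (F z) / F z ^ degree p) * F z ^ degree p) 0 = 0 + int (degree p) * zorder F 0"
    unfolding zorder_0_limit[OF m lim l0, symmetric] zorder_power[OF F(1) eventually_imp_frequently[OF nz], symmetric]
    by (rule zorder_mult[OF m eventually_imp_frequently[OF tendsto_imp_eventually_ne[OF lim l0]]])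
      (use F nz in \<open>auto intro!: meromorphic_intros eventually_imp_frequently elim: eventually_mono\<close>)
  moreover have "eventually (\<lambda>z. (poly p (F z) / F z ^ degree p) * F z ^ degree p = poly p (F z)) (at 0)"
    using nz by eventually_elim simp
  ultimately show ?thesis using zorder_cong_at by fastforce
qed

lemma zorder_j_pow: "w > 0 \<Longrightarrow> zorder (\<lambda>z. j_q (z ^ w)) 0 = - int w"
  using zorder_pow_arg[OF j_q_meromorphic non_zero_neighbour_pole[OF j_q_pole]] zorder_j_q by simp

lemma delta_mero: "delta meromorphic_on {0}"
  by (intro analytic_on_imp_meromorphic_on analytic_at_0 delta_holo)

lemma delta_nz: "eventually (\<lambda>z. delta z \<noteq> 0) (at 0)"
  unfolding eventually_at by (intro exI[of _ 1]) (auto simp: delta_def d1_nonzero)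

lemma zorder_delta_pow: "w > 0 \<Longrightarrow> zorder (\<lambda>z. delta (z ^ w)) 0 = int w"
  using zorder_pow_arg[OF delta_mero delta_nz] zorder_delta by simp

lemma pow_at_0: "w > 0 \<Longrightarrow> filterlim (\<lambda>z::complex. z ^ w) (at 0) (at 0)"
proof -
  assume w: "w > 0"
  have "((\<lambda>z::complex. z ^ w) \<longlongrightarrow> 0 ^ w) (at 0)" by (intro tendsto_intros)
  then show ?thesis using w by (auto simp: filterlim_at eventually_at_filter zero_power)
qed

lemma scale_at_0: "\<zeta> \<noteq> 0 \<Longrightarrow> filterlim (\<lambda>z::complex. \<zeta> * z) (at 0) (at 0)"
proof -
  assume w: "\<zeta> \<noteq> 0"
  have "((\<lambda>z::complex. \<zeta> * z) \<longlongrightarrow> \<zeta> * 0) (at 0)" by (intro tendsto_intros)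
  then show ?thesis using w by (auto simp: filterlim_at eventually_at_filter)
qed

lemma function_field_cusp:
  assumes f: "f \<in> function_field M" and M: "M > 0" and co: "coprime a c"
  shows "expansion M (Cusp a c) f meromorphic_on {0}"
    "\<exists>r>0. \<forall>\<tau>. Im \<tau> > 0 \<and> norm (cusp_q (cusp_width M a c) \<tau>) < r \<longrightarrow>
       f (moebius_act (cusp_mat a c) \<tau>) = expansion M (Cusp a c) f (cusp_q (cusp_width M a c) \<tau>)"
proof -
  have p: "Cusp a c \<in> ext_upper_half" using co by (auto simp: ext_upper_half_def)
  obtain F where F: "F meromorphic_on {0}" "expands_at M f (Cusp a c) F"
    using f co unfolding function_field_def by blast
  note e = expansion_props[OF p M F]
  show "expansion M (Cusp a c) f meromorphic_on {0}" by (rule e(1))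
  show "\<exists>r>0. \<forall>\<tau>. Im \<tau> > 0 \<and> norm (cusp_q (cusp_width M a c) \<tau>) < r \<longrightarrow>
       f (moebius_act (cusp_mat a c) \<tau>) = expansion M (Cusp a c) f (cusp_q (cusp_width M a c) \<tau>)"
    using e(2) unfolding expands_at_cusp_iff[OF co] .
qed

lemma cusp_eventually:
  assumes w: "w > 0" and r: "r > 0" and P: "\<And>\<tau>. Im \<tau> > 0 \<Longrightarrow> norm (cusp_q w \<tau>) < r \<Longrightarrow> P (cusp_q w \<tau>)"
  shows "eventually P (at 0)"
proof -
  have "P z" if z: "z \<noteq> 0" "norm z < min 1 r" for z
    using cusp_q_surj[OF z(1) _ w] z(2) P by (metis min_less_iff_conj)
  then show ?thesis unfolding eventually_at using r by (intro exI[of _ "min 1 r"]) auto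
qed

locale hauptmodul_data =
  fixes N :: nat and x :: "complex \<Rightarrow> complex" and P Q :: "complex poly"
  assumes N: "N > 1"
    and x: "x \<in> function_field N"
    and x_inf: "ord_at N x (Cusp 1 0) = 1"
    and x_zero: "ord_at N x (Cusp 0 1) = - 1"
    and PQ: "coprime P Q" and P0: "P \<noteq> 0" and Q0: "Q \<noteq> 0" and dvd: "[:0, 1:] dvd Q"
    and j: "\<And>\<tau>. Im \<tau> > 0 \<Longrightarrow> klein_j \<tau> = poly P (x \<tau>) / poly Q (x \<tau>)"
begin

lemma Q_0: "poly Q 0 = 0" using dvd by (simp add: poly_eq_0_iff_dvd)

lemma no_common_root: "poly Q z = 0 \<Longrightarrow> poly P z \<noteq> 0"
  using coprime_poly_0[OF PQ, of z] by auto

lemma x_inv: "(a, b, c, d) \<in> Gamma0 N \<Longrightarrow> Im \<tau> > 0 \<Longrightarrow> x (moebius_act (a, b, c, d) \<tau>) = x \<tau>"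
  using x unfolding function_field_def by (auto simp: upper_half_iff simp del: moebius_act.simps)

abbreviation "w a c \<equiv> cusp_width N a c"
abbreviation "Xe a c \<equiv> expansion N (Cusp a c) x"

lemma w_pos: "w a c > 0" using cusp_width_pos N by simp

lemma Xe_mero: "coprime a c \<Longrightarrow> Xe a c meromorphic_on {0}"
  by (rule function_field_cusp(1)[OF x]) (use N in auto)

lemma Xe_eq:
  assumes "coprime a c"
  obtains r where "r > 0" "\<And>\<tau>. Im \<tau> > 0 \<Longrightarrow> norm (cusp_q (w a c) \<tau>) < r \<Longrightarrow> x (moebius_act (cusp_mat a c) \<tau>) = Xe a c (cusp_q (w a c) \<tau>)"
proof -
  have N0: "N > 0" using N by simp
  show ?thesis using function_field_cusp(2)[OF x N0 assms] that by blast
qed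

lemma Xe_j:
  assumes co: "coprime a c"
  shows "eventually (\<lambda>z. j_q (z ^ w a c) = poly P (Xe a c z) / poly Q (Xe a c z)) (at 0)"
proof -
  obtain b d where bd: "a * d - b * c = 1" "cusp_mat a c = (a, b, c, d)" using cusp_mat[OF co] by blast
  obtain r where r: "r > 0" "\<And>\<tau>. Im \<tau> > 0 \<Longrightarrow> norm (cusp_q (w a c) \<tau>) < r \<Longrightarrow> x (moebius_act (cusp_mat a c) \<tau>) = Xe a c (cusp_q (w a c) \<tau>)"
    using Xe_eq[OF co] by blast
  show ?thesis
  proof (rule cusp_eventually[OF w_pos r(1)])
    fix \<tau> assume t: "Im \<tau> > 0" "norm (cusp_q (w a c) \<tau>) < r"
    have "j_q (cusp_q (w a c) \<tau> ^ w a c) = klein_j \<tau>" unfolding cusp_q_power'[OF w_pos] using klein_j_q[OF t(1)] by simp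
    also have "\<dots> = klein_j (moebius_act (a, b, c, d) \<tau>)" using klein_j_invariant[OF bd(1) t(1)] by simp
    also have "\<dots> = poly P (Xe a c (cusp_q (w a c) \<tau>)) / poly Q (Xe a c (cusp_q (w a c) \<tau>))"
      using j[OF moebius_Im(2)[OF bd(1) t(1)]] r(2)[OF t] bd(2) by (simp del: moebius_act.simps)
    finally show "j_q (cusp_q (w a c) \<tau> ^ w a c) = poly P (Xe a c (cusp_q (w a c) \<tau>)) / poly Q (Xe a c (cusp_q (w a c) \<tau>))" .
  qed
qed

lemma j_pow_infinity: "n > 0 \<Longrightarrow> filterlim (\<lambda>z. j_q (z ^ n)) at_infinity (at 0)"
  by (rule filterlim_compose[OF j_q_pole[unfolded is_pole_def] pow_at_0])

lemma Xe_nz: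
  assumes co: "coprime a c"
  shows "eventually (\<lambda>z. poly P (Xe a c z) \<noteq> 0 \<and> poly Q (Xe a c z) \<noteq> 0 \<and> Xe a c z \<noteq> 0) (at 0)"
  using Xe_j[OF co] filterlim_at_infinity_imp_eventually_ne[OF j_pow_infinity[OF w_pos, of a c], of 0]
proof eventually_elim
  case (elim z)
  then have "poly P (Xe a c z) \<noteq> 0 \<and> poly Q (Xe a c z) \<noteq> 0" by auto
  then show ?case using Q_0 by metis
qed

text \<open>The pole of \<open>j\<close> forces the finite limit of \<open>x\<close> to be a root of
  \<open>Q\<close>; there \<open>P\<close> is nonzero by coprimality, so \<open>Q\<close> alone
  carries the pole order \<open>w a c\<close> of \<open>j\<close>. \<open>Delta\<close> has the same
  order, whence \<open>K1\<close> has order 0 at such a cusp.\<close>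

lemma Xe_not_pole:
  assumes co: "coprime a c" and np: "\<not> is_pole (Xe a c) 0"
  shows "zorder (\<lambda>z. poly Q (Xe a c z)) 0 = int (w a c)"
proof -
  obtain x0 where x0: "(Xe a c \<longlongrightarrow> x0) (at 0)"
    using Xe_mero[OF co] np unfolding meromorphic_at_iff not_essential_def by blast
  have limP: "((\<lambda>z. poly P (Xe a c z)) \<longlongrightarrow> poly P x0) (at 0)" and limQ: "((\<lambda>z. poly Q (Xe a c z)) \<longlongrightarrow> poly Q x0) (at 0)"
    by (intro tendsto_intros x0)+
  have Qx0: "poly Q x0 = 0"
  proof (rule ccontr)
    assume q: "poly Q x0 \<noteq> 0"
    have "((\<lambda>z. poly P (Xe a c z) / poly Q (Xe a c z)) \<longlongrightarrow> poly P x0 / poly Q x0) (at 0)"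
      by (intro tendsto_intros limP limQ q)
    moreover have "eventually (\<lambda>z. poly P (Xe a c z) / poly Q (Xe a c z) = j_q (z ^ w a c)) (at 0)"
      using Xe_j[OF co] by eventually_elim simp
    ultimately have "((\<lambda>z. j_q (z ^ w a c)) \<longlongrightarrow> poly P x0 / poly Q x0) (at 0)" by (rule Lim_transform_eventually)
    then show False using j_pow_infinity[OF w_pos] not_tendsto_and_filterlim_at_infinity[OF at_neq_bot] by blast
  qed
  have zP: "zorder (\<lambda>z. poly P (Xe a c z)) 0 = 0"
    by (rule zorder_0_limit[OF poly_mero[OF Xe_mero[OF co]] limP no_common_root[OF Qx0]])
  have jm: "(\<lambda>z. j_q (z ^ w a c)) meromorphic_on {0}"
    by (rule meromorphic_on_compose[OF j_q_meromorphic]) (use w_pos in \<open>auto intro!: analytic_intros simp: zero_power\<close>)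
  have jnz: "eventually (\<lambda>z. j_q (z ^ w a c) \<noteq> 0) (at 0)"
    by (rule filterlim_at_infinity_imp_eventually_ne[OF j_pow_infinity[OF w_pos]])
  have Pnz: "eventually (\<lambda>z. poly P (Xe a c z) \<noteq> 0) (at 0)" using Xe_nz[OF co] by eventually_elim simp
  have "zorder (\<lambda>z. poly Q (Xe a c z)) 0 = zorder (\<lambda>z. poly P (Xe a c z) / j_q (z ^ w a c)) 0"
    by (rule zorder_cong_at) (use Xe_j[OF co] Xe_nz[OF co] in \<open>eventually_elim, simp\<close>)
  also have "\<dots> = 0 - (- int (w a c))"
    unfolding zP[symmetric] zorder_j_pow[OF w_pos, symmetric]
    by (rule zorder_divide[OF poly_mero[OF Xe_mero[OF co]] eventually_imp_frequently[OF Pnz] jm eventually_imp_frequently[OF jnz]])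
  finally show ?thesis by simp
qed

text \<open>At a pole of \<open>x\<close> a polynomial in \<open>x\<close> behaves like its leading
  term, and the order of \<open>j = P (x) / Q (x)\<close> is known to be
  \<open>- w a c\<close>.\<close>

lemma Xe_pole:
  assumes co: "coprime a c" and p: "is_pole (Xe a c) 0"
  shows "int (w a c) = - zorder (Xe a c) 0 * (int (degree P) - int (degree Q))"
    "zorder (\<lambda>z. poly Q (Xe a c z)) 0 = int (degree Q) * zorder (Xe a c) 0"
proof -
  show zQ: "zorder (\<lambda>z. poly Q (Xe a c z)) 0 = int (degree Q) * zorder (Xe a c) 0"
    by (rule zorder_poly_pole[OF Xe_mero[OF co] p Q0])
  have zP: "zorder (\<lambda>z. poly P (Xe a c z)) 0 = int (degree P) * zorder (Xe a c) 0"
    by (rule zorder_poly_pole[OF Xe_mero[OF co] p P0])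
  have Pnz: "eventually (\<lambda>z. poly P (Xe a c z) \<noteq> 0) (at 0)" and Qnz: "eventually (\<lambda>z. poly Q (Xe a c z) \<noteq> 0) (at 0)"
    using Xe_nz[OF co] by (eventually_elim, simp)+
  have "- int (w a c) = zorder (\<lambda>z. poly P (Xe a c z) / poly Q (Xe a c z)) 0"
    unfolding zorder_j_pow[OF w_pos, symmetric] by (rule zorder_cong_at[OF Xe_j[OF co]])
  also have "\<dots> = int (degree P) * zorder (Xe a c) 0 - int (degree Q) * zorder (Xe a c) 0"
    unfolding zP[symmetric] zQ[symmetric]
    by (rule zorder_divide[OF poly_mero[OF Xe_mero[OF co]] eventually_imp_frequently[OF Pnz] poly_mero[OF Xe_mero[OF co]] eventually_imp_frequently[OF Qnz]])
  finally show "int (w a c) = - zorder (Xe a c) 0 * (int (degree P) - int (degree Q))" by (simp add: algebra_simps)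
qed

lemma co01: "coprime (0 :: int) 1" by simp

lemma Xe01_pole: "is_pole (Xe 0 1) 0"
proof (rule zorder_neg_imp_is_pole[OF Xe_mero[OF co01]])
  show "eventually (\<lambda>z. Xe 0 1 z \<noteq> 0) (at 0)" using Xe_nz[OF co01] by eventually_elim simp
  show "zorder (Xe 0 1) 0 < 0" using x_zero by (simp add: ord_at_def)
qed

lemma w01: "w 0 1 = N" using N by (simp add: cusp_width_eq)

text \<open>The cusp 0 has width \<open>N\<close>, and \<open>x\<close> has a simple pole
  there.\<close>

lemma degree_diff: "int (degree P) - int (degree Q) = int N"
  using Xe_pole(1)[OF co01 Xe01_pole] x_zero w01 by (simp add: ord_at_def)

end

text \<open>Matrix and width are arbitrary here, in contrast to the condition in
  \<open>weight12\<close>, so that orders can be transported between different matrices and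
  levels.\<close>

definition has_cusp_order :: "(complex \<Rightarrow> complex) \<Rightarrow> mat2 \<Rightarrow> nat \<Rightarrow> int \<Rightarrow> bool" where
  "has_cusp_order K \<sigma> w n \<longleftrightarrow> (\<exists>\<Phi>. \<Phi> meromorphic_on {0} \<and> eventually (\<lambda>z. \<Phi> z \<noteq> 0) (at 0) \<and> zorder \<Phi> 0 = n \<and>
     (\<exists>r>0. \<forall>\<tau>. Im \<tau> > 0 \<and> norm (cusp_q w \<tau>) < r \<longrightarrow> K (moebius_act \<sigma> \<tau>) / autf \<sigma> \<tau> ^ 12 = \<Phi> (cusp_q w \<tau>)))"

text \<open>The substitution \<open>(g * \<tau> + B) / h\<close> replaces the parameter of width
  \<open>w\<close> by a constant of norm 1 times the \<open>e\<close>-th power of the parameter of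
  width \<open>w'\<close>. It serves for a change of the second column, for the passage to a higher
  level and for the argument \<open>N * \<tau>\<close>.\<close>

lemma has_cusp_order_subst:
  fixes g h e w w' :: nat and B :: int
  assumes ord: "has_cusp_order K \<sigma> w n" and pos: "g > 0" "h > 0" "w > 0" "w' > 0" "e > 0"
    and e: "g * w' = e * h * w" and C: "C \<noteq> 0"
    and eq: "\<And>\<tau>. Im \<tau> > 0 \<Longrightarrow> K' (moebius_act \<sigma>' \<tau>) / autf \<sigma>' \<tau> ^ 12 =
       C * (K (moebius_act \<sigma> ((of_nat g * \<tau> + of_int B) / of_nat h)) / autf \<sigma> ((of_nat g * \<tau> + of_int B) / of_nat h) ^ 12)"
  shows "has_cusp_order K' \<sigma>' w' (int e * n)"
proof -
  obtain \<Phi> r where \<Phi>: "\<Phi> meromorphic_on {0}" "eventually (\<lambda>z. \<Phi> z \<noteq> 0) (at 0)" "zorder \<Phi> 0 = n"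
    and r: "r > 0" "\<And>\<tau>. Im \<tau> > 0 \<Longrightarrow> norm (cusp_q w \<tau>) < r \<Longrightarrow> K (moebius_act \<sigma> \<tau>) / autf \<sigma> \<tau> ^ 12 = \<Phi> (cusp_q w \<tau>)"
    using ord unfolding has_cusp_order_def by blast
  define \<zeta> where "\<zeta> = to_q (of_int B / (of_nat h * of_nat w))"
  have \<zeta>: "\<zeta> \<noteq> 0" "norm \<zeta> = 1" by (simp_all add: \<zeta>_def to_q_norm Im_divide)
  define \<Psi> where "\<Psi> = (\<lambda>z. \<Phi> (\<zeta> * z))"
  have \<Psi>m: "\<Psi> meromorphic_on {0}" unfolding \<Psi>_def by (rule meromorphic_on_compose[OF \<Phi>(1)]) (auto intro!: analytic_intros)
  have \<Psi>nz: "eventually (\<lambda>z. \<Psi> z \<noteq> 0) (at 0)" unfolding \<Psi>_def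
    by (rule eventually_compose_filterlim[OF \<Phi>(2) scale_at_0[OF \<zeta>(1)]])
  have \<Psi>z: "zorder \<Psi> 0 = n" unfolding \<Psi>_def using Meromorphic.zorder_scale[of \<Phi> \<zeta> 0] \<Phi> \<zeta> by simp
  have q: "cusp_q w ((of_nat g * \<tau> + of_int B) / of_nat h) = \<zeta> * cusp_q w' \<tau> ^ e" for \<tau>
  proof -
    have "of_nat g * of_nat w' = (of_nat e * of_nat h * of_nat w :: complex)"
      unfolding of_nat_mult[symmetric] e ..
    then have e': "of_nat g / (of_nat h * of_nat w) = (of_nat e / of_nat w' :: complex)"
      using pos by (simp add: frac_eq_eq mult.assoc)
    have "(of_nat g * \<tau> + of_int B) / of_nat h / of_nat w = of_int B / (of_nat h * of_nat w) + of_nat g / (of_nat h * of_nat w) * \<tau>"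
      by (simp add: add_divide_distrib)
    then have "(of_nat g * \<tau> + of_int B) / of_nat h / of_nat w = of_int B / (of_nat h * of_nat w) + of_nat e * (\<tau> / of_nat w')"
      unfolding e' by simp
    moreover have "to_q (s + t) = to_q s * to_q t" for s t by (simp add: to_q_def distrib_left exp_add)
    ultimately show ?thesis unfolding cusp_q_def \<zeta>_def by (simp only: to_q_mult_nat)
  qed
  define X where "X = (\<lambda>z. C * \<Psi> (z ^ e))"
  have "X meromorphic_on {0}" unfolding X_def
    by (intro meromorphic_intros meromorphic_on_compose[OF \<Psi>m]) (use pos in \<open>auto intro!: analytic_intros simp: zero_power\<close>)
  moreover have "eventually (\<lambda>z. X z \<noteq> 0) (at 0)" unfolding X_def
    using eventually_compose_filterlim[OF \<Psi>nz pow_at_0[OF pos(5)]] by eventually_elim (simp add: C)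
  moreover have "zorder X 0 = int e * n" unfolding X_def zorder_cmult[OF C] zorder_pow_arg[OF \<Psi>m \<Psi>nz pos(5)] \<Psi>z ..
  moreover have "\<exists>r>0. \<forall>\<tau>. Im \<tau> > 0 \<and> norm (cusp_q w' \<tau>) < r \<longrightarrow> K' (moebius_act \<sigma>' \<tau>) / autf \<sigma>' \<tau> ^ 12 = X (cusp_q w' \<tau>)"
  proof (intro exI[of _ "min 1 r"] conjI allI impI; (elim conjE)?)
    show "min 1 r > 0" using r by simp
    fix \<tau> assume t: "Im \<tau> > 0" "norm (cusp_q w' \<tau>) < min 1 r"
    let ?t = "(of_nat g * \<tau> + of_int B) / of_nat h"
    have "Im ?t > 0" using t pos by simp
    moreover have "norm (cusp_q w ?t) < r"
    proof -
      have "norm (cusp_q w ?t) = norm (cusp_q w' \<tau>) ^ e" unfolding q using \<zeta> by (simp add: norm_mult norm_power)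
      also have "\<dots> \<le> norm (cusp_q w' \<tau>) ^ 1" by (rule power_decreasing) (use pos t in auto)
      finally show ?thesis using t by simp
    qed
    ultimately show "K' (moebius_act \<sigma>' \<tau>) / autf \<sigma>' \<tau> ^ 12 = X (cusp_q w' \<tau>)"
      unfolding eq[OF t(1)] X_def \<Psi>_def q[symmetric] using r(2) by simp
  qed
  ultimately show ?thesis unfolding has_cusp_order_def by blast
qed

section \<open>Values of \<open>x\<close> in the upper half-plane and cusp orders of
  \<open>K1\<close>\<close>

lemma moebius_translate: "moebius_act (a, b + t * a, c, d + t * c) \<tau> = moebius_act (a, b, c, d) (\<tau> + of_int t)"
  "autf (a, b + t * a, c, d + t * c) \<tau> = autf (a, b, c, d) (\<tau> + of_int t)"
  by (simp_all add: autf_def algebra_simps)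

lemma coprime_column:
  assumes "a * d - b * c = (1 :: int)"
  shows "coprime a c"
proof (rule coprimeI)
  fix l assume "l dvd a" "l dvd c"
  then have "l dvd a * d - b * c" by (intro dvd_diff) auto
  then show "is_unit l" using assms by simp
qed

lemma same_column:
  fixes a b c d b' d' :: int
  assumes "a * d - b * c = 1" "a * d' - b' * c = 1"
  obtains t where "b' = b + t * a" "d' = d + t * c"
proof
  let ?t = "d * b' - b * d'"
  show "b' = b + ?t * a" using assms by algebra
  show "d' = d + ?t * c" using assms by algebra
qed

lemma moebius_mult:
  assumes "a' * d' - b' * c' = 1" "a * d - b * c = 1" "Im \<tau> > 0"
  shows "moebius_act (a, b, c, d) (moebius_act (a', b', c', d') \<tau>) =
      moebius_act (a * a' + b * c', a * b' + b * d', c * a' + d * c', c * b' + d * d') \<tau>" (is ?A)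
    "autf (a * a' + b * c', a * b' + b * d', c * a' + d * c', c * b' + d * d') \<tau> =
      autf (a, b, c, d) (moebius_act (a', b', c', d') \<tau>) * autf (a', b', c', d') \<tau>" (is ?B)
proof -
  have n: "of_int c' * \<tau> + of_int d' \<noteq> 0" by (rule moebius_Im(1)[OF assms(1,3)])
  show ?B using n by (simp add: autf_def field_simps)
  have "of_int a * ((of_int a' * \<tau> + of_int b') / w) + of_int b = (of_int a * (of_int a' * \<tau> + of_int b') + of_int b * w) / w"
    "of_int c * ((of_int a' * \<tau> + of_int b') / w) + of_int d = (of_int c * (of_int a' * \<tau> + of_int b') + of_int d * w) / w"
    if "w \<noteq> 0" for w :: complex using that by (simp_all add: field_simps)
  note * = this[OF n]
  have "(U / w) / (V / w) = U / V" if "w \<noteq> 0" for U V w :: complex using that by simp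
  then show ?A unfolding moebius_act.simps * using n by (simp only: algebra_simps of_int_add of_int_mult)
qed

context hauptmodul_data
begin

text \<open>As \<open>deg P - deg Q = N > 0\<close>, a pole of \<open>x\<close> would be a pole of
  \<open>j\<close>, which is holomorphic. \<open>R\<close> below is \<open>1 / j\<close>, written so
  that its limit 0 is visible.\<close>

lemma x_not_pole:
  assumes pos: "Im \<tau>0 > 0"
  shows "\<not> is_pole x \<tau>0"
proof
  assume "is_pole x \<tau>0"
  then have inf: "filterlim x at_infinity (at \<tau>0)" by (simp add: is_pole_def)
  have limP: "((\<lambda>z. poly P (x z) / x z ^ degree P) \<longlongrightarrow> lead_coeff P) (at \<tau>0)"
    and limQ: "((\<lambda>z. poly Q (x z) / x z ^ degree Q) \<longlongrightarrow> lead_coeff Q) (at \<tau>0)"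
    by (intro poly_at_infinity inf)+
  have lP: "lead_coeff P \<noteq> 0" and lQ: "lead_coeff Q \<noteq> 0" using P0 Q0 by auto
  have inv: "((\<lambda>z. inverse (x z)) \<longlongrightarrow> 0) (at \<tau>0)" using filterlim_compose[OF tendsto_inverse_0 inf] .
  have kj: "(klein_j \<longlongrightarrow> klein_j \<tau>0) (at \<tau>0)"
    using klein_j_holo pos open_upper_half
    by (metis continuous_on_eq_continuous_at holomorphic_on_imp_continuous_on isCont_def upper_half_iff)
  define R where "R = (\<lambda>z. (poly Q (x z) / x z ^ degree Q) / (poly P (x z) / x z ^ degree P) * inverse (x z) ^ N)"
  have "(R \<longlongrightarrow> lead_coeff Q / lead_coeff P * 0 ^ N) (at \<tau>0)"
    unfolding R_def by (intro tendsto_intros limP limQ inv lP)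
  then have "((\<lambda>z. klein_j z * R z) \<longlongrightarrow> klein_j \<tau>0 * (lead_coeff Q / lead_coeff P * 0 ^ N)) (at \<tau>0)"
    by (intro tendsto_intros kj)
  then have l0: "((\<lambda>z. klein_j z * R z) \<longlongrightarrow> 0) (at \<tau>0)" using N by (simp add: zero_power)
  have deg: "degree P = degree Q + N" using degree_diff by linarith
  have "eventually (\<lambda>z. z \<in> upper_half) (at \<tau>0)"
    using open_upper_half pos by (intro eventually_at_in_open') (auto simp: upper_half_iff)
  then have "eventually (\<lambda>z. klein_j z * R z = 1) (at \<tau>0)"
    using filterlim_at_infinity_imp_eventually_ne[OF inf, of 0] tendsto_imp_eventually_ne[OF limP lP] tendsto_imp_eventually_ne[OF limQ lQ]
  proof eventually_elim
    case (elim z)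
    then show ?case using j[of z] by (auto simp: R_def upper_half_iff deg power_add field_simps)
  qed
  from tendsto_eventually[OF this] l0 show False
    using tendsto_unique[OF at_neq_bot] by (metis zero_neq_one)
qed

lemma x_holo: "x holomorphic_on upper_half"
proof -
  have nm: "x nicely_meromorphic_on upper_half" using x by (simp add: function_field_def)
  have "x analytic_on upper_half"
    unfolding analytic_on_analytic_at[of _ upper_half]
    using nicely_meromorphic_on_imp_analytic_at[OF nm _ x_not_pole] by (auto simp: upper_half_iff)
  then show ?thesis by (rule analytic_imp_holomorphic)
qed

lemma Qx_holo: "(\<lambda>\<tau>. poly Q (x \<tau>)) holomorphic_on upper_half"
  by (intro holomorphic_intros x_holo)

lemma isCont_upper:
  assumes "g holomorphic_on upper_half" "Im \<tau> > 0"
  shows "(g \<longlongrightarrow> g \<tau>) (at \<tau>)"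
  using assms open_upper_half
  by (metis continuous_on_eq_continuous_at holomorphic_on_imp_continuous_on isCont_def upper_half_iff)

text \<open>At a zero of \<open>Q (x)\<close> the formula for \<open>j\<close> only yields the value
  of a division by zero. Therefore \<open>j * Q (x) = P (x)\<close> is extended to
  \<open>\<tau>0\<close> by continuity from nearby points, and \<open>P\<close> and \<open>Q\<close>
  would have a common root.\<close>

lemma Qx_nz:
  assumes pos: "Im \<tau>0 > 0"
  shows "poly Q (x \<tau>0) \<noteq> 0"
proof
  assume q0: "poly Q (x \<tau>0) = 0"
  have "\<exists>\<beta>\<in>upper_half. poly Q (x \<beta>) \<noteq> 0"
  proof (rule ccontr)
    assume "\<not> ?thesis"
    then have "klein_j \<tau> = 0" if "\<tau> \<in> upper_half" for \<tau> using j[of \<tau>] that by (simp add: upper_half_iff)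
    then show False using klein_j_not_constant unfolding constant_on_def by blast
  qed
  then obtain \<beta> where \<beta>: "\<beta> \<in> upper_half" "poly Q (x \<beta>) \<noteq> 0" by blast
  have t0: "\<tau>0 \<in> upper_half" using pos by (simp add: upper_half_iff)
  obtain r where r: "r > 0" "ball \<tau>0 r \<subseteq> upper_half" "\<And>z. z \<in> ball \<tau>0 r - {\<tau>0} \<Longrightarrow> poly Q (x z) \<noteq> 0"
    by (rule isolated_zeros[OF Qx_holo open_upper_half connected_upper_half t0 q0 \<beta>]) blast
  have "eventually (\<lambda>z. z \<in> ball \<tau>0 r - {\<tau>0}) (at \<tau>0)"
    using eventually_at_in_open[of "ball \<tau>0 r" \<tau>0] r by simp
  then have ev: "eventually (\<lambda>z. klein_j z * poly Q (x z) = poly P (x z)) (at \<tau>0)"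
  proof eventually_elim
    case (elim z)
    then have "poly Q (x z) \<noteq> 0" "Im z > 0" using r by (auto simp: upper_half_iff[symmetric])
    then show ?case using j[of z] by simp
  qed
  have Px: "(\<lambda>\<tau>. poly P (x \<tau>)) holomorphic_on upper_half" by (intro holomorphic_intros x_holo)
  have "((\<lambda>z. klein_j z * poly Q (x z)) \<longlongrightarrow> klein_j \<tau>0 * poly Q (x \<tau>0)) (at \<tau>0)"
    by (intro tendsto_intros isCont_upper[OF klein_j_holo pos] isCont_upper[OF Qx_holo pos])
  from Lim_transform_eventually[OF this ev] isCont_upper[OF Px pos]
  have "klein_j \<tau>0 * poly Q (x \<tau>0) = poly P (x \<tau>0)" by (rule tendsto_unique[OF at_neq_bot])
  then show False using no_common_root[OF q0] q0 by simp
qed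

definition K1 :: "complex \<Rightarrow> complex" where "K1 \<tau> = Delta \<tau> / poly Q (x \<tau>)"

lemma K1_holo: "K1 holomorphic_on upper_half"
  unfolding K1_def by (intro holomorphic_intros Delta_holo x_holo) (simp add: Qx_nz upper_half_iff)

lemma K1_nz: "Im \<tau> > 0 \<Longrightarrow> K1 \<tau> \<noteq> 0"
  unfolding K1_def using Delta_nonzero Qx_nz by simp

lemma K1_mod:
  assumes "\<gamma> \<in> Gamma0 N" "Im \<tau> > 0"
  shows "K1 (moebius_act \<gamma> \<tau>) = autf \<gamma> \<tau> ^ 12 * K1 \<tau>"
proof -
  obtain a b c d where g: "\<gamma> = (a, b, c, d)" by (cases \<gamma>)
  then have "a * d - b * c = 1" using assms by (simp add: Gamma0_def)
  from Delta_modular[OF this assms(2)] x_inv[of a b c d \<tau>] assms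
  show ?thesis unfolding K1_def g autf_def by (simp del: moebius_act.simps)
qed

lemma K1_expand:
  assumes co: "coprime a c"
  shows "has_cusp_order K1 (cusp_mat a c) (w a c) (int (w a c) - zorder (\<lambda>z. poly Q (Xe a c z)) 0)"
proof -
  obtain b d where bd: "a * d - b * c = 1" "cusp_mat a c = (a, b, c, d)" using cusp_mat[OF co] by blast
  obtain r where r: "r > 0" "\<And>\<tau>. Im \<tau> > 0 \<Longrightarrow> norm (cusp_q (w a c) \<tau>) < r \<Longrightarrow> x (moebius_act (cusp_mat a c) \<tau>) = Xe a c (cusp_q (w a c) \<tau>)"
    using Xe_eq[OF co] by blast
  define \<Phi> where "\<Phi> = (\<lambda>z. delta (z ^ w a c) / poly Q (Xe a c z))"
  have dm: "(\<lambda>z. delta (z ^ w a c)) meromorphic_on {0}"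
    by (rule meromorphic_on_compose[OF delta_mero]) (use w_pos in \<open>auto intro!: analytic_intros simp: zero_power\<close>)
  have dnz: "eventually (\<lambda>z. delta (z ^ w a c) \<noteq> 0) (at 0)"
    by (rule eventually_compose_filterlim[OF delta_nz pow_at_0[OF w_pos]])
  have qm: "(\<lambda>z. poly Q (Xe a c z)) meromorphic_on {0}" by (rule poly_mero[OF Xe_mero[OF co]])
  have qnz: "eventually (\<lambda>z. poly Q (Xe a c z) \<noteq> 0) (at 0)" using Xe_nz[OF co] by eventually_elim simp
  have "\<Phi> meromorphic_on {0}" unfolding \<Phi>_def by (intro meromorphic_intros dm qm)
  moreover have "eventually (\<lambda>z. \<Phi> z \<noteq> 0) (at 0)" unfolding \<Phi>_def using dnz qnz by eventually_elim simp
  moreover have "zorder \<Phi> 0 = int (w a c) - zorder (\<lambda>z. poly Q (Xe a c z)) 0"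
    unfolding \<Phi>_def zorder_delta_pow[OF w_pos, symmetric]
    by (rule zorder_divide[OF dm eventually_imp_frequently[OF dnz] qm eventually_imp_frequently[OF qnz]])
  moreover have "\<exists>r>0. \<forall>\<tau>. Im \<tau> > 0 \<and> norm (cusp_q (w a c) \<tau>) < r \<longrightarrow>
      K1 (moebius_act (cusp_mat a c) \<tau>) / autf (cusp_mat a c) \<tau> ^ 12 = \<Phi> (cusp_q (w a c) \<tau>)"
  proof (intro exI[of _ r] conjI allI impI; (elim conjE)?)
    show "r > 0" by fact
    fix \<tau> assume t: "Im \<tau> > 0" "norm (cusp_q (w a c) \<tau>) < r"
    have "autf (cusp_mat a c) \<tau> \<noteq> 0" using moebius_Im(1)[OF bd(1) t(1)] by (simp add: bd(2) autf_def)
    moreover have "Delta (moebius_act (cusp_mat a c) \<tau>) = autf (cusp_mat a c) \<tau> ^ 12 * Delta \<tau>"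
      using Delta_modular[OF bd(1) t(1)] by (simp add: bd(2) autf_def del: moebius_act.simps)
    moreover have "Delta \<tau> = delta (cusp_q (w a c) \<tau> ^ w a c)" by (simp add: Delta_def cusp_q_power'[OF w_pos])
    ultimately show "K1 (moebius_act (cusp_mat a c) \<tau>) / autf (cusp_mat a c) \<tau> ^ 12 = \<Phi> (cusp_q (w a c) \<tau>)"
      using r(2)[OF t] by (simp add: K1_def \<Phi>_def)
  qed
  ultimately show ?thesis unfolding has_cusp_order_def by blast
qed

lemma w_eq: "int (w a c) = int N div gcd (int N) (c\<^sup>2)"
  using N by (simp add: cusp_width_eq pos_imp_zdiv_nonneg_iff)

lemma w_coprime: "coprime c (int N) \<Longrightarrow> w a c = N"
proof -
  assume "coprime c (int N)"
  then have "coprime (int N) (c\<^sup>2)" by (simp add: coprime_commute)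
  then have "int (w a c) = int N" unfolding w_eq by simp
  then show ?thesis by simp
qed

text \<open>Comparing pole orders gives \<open>N dvd w a c\<close>, while
  \<open>w a c * gcd N (c^2) = N\<close>; so this gcd is 1. Thus among the cusps \<open>x\<close>
  has poles only in the class of 0.\<close>

lemma pole_coprime:
  assumes co: "coprime a c" and p: "is_pole (Xe a c) 0"
  shows "coprime c (int N)"
proof -
  have "int (w a c) = - zorder (Xe a c) 0 * int N" using Xe_pole(1)[OF co p] degree_diff by simp
  then have "int N dvd int (w a c)" by simp
  then have ge: "int N \<le> int (w a c)" using w_pos[of a c] by (intro zdvd_imp_le) auto
  let ?g = "gcd (int N) (c\<^sup>2)"
  have gp: "?g > 0" and gd: "?g dvd int N" using N by auto
  have wg: "int (w a c) * ?g = int N" unfolding w_eq using gd by simp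
  have "int N * ?g \<le> int N * 1" using mult_right_mono[OF ge, of ?g] wg gp by simp
  then have "?g \<le> 1" using N by (subst (asm) mult_le_cancel_left_pos) auto
  with gp have "?g = 1" by linarith
  then have "coprime (int N) (c\<^sup>2)" by (simp only: coprime_iff_gcd_eq_1)
  then show ?thesis by (simp add: coprime_commute)
qed

lemma K1_cusp_order:
  assumes det: "a * d - b * c = 1"
  shows "has_cusp_order K1 (a, b, c, d) (w a c) (if coprime c (int N) then int (degree P) else 0)"
proof -
  have co: "coprime a c" by (rule coprime_column[OF det])
  show ?thesis
  proof (cases "coprime c (int N)")
    case False
    then have "\<not> is_pole (Xe a c) 0" using pole_coprime[OF co] by blast
    from K1_expand[OF co] Xe_not_pole[OF co this]
    have o: "has_cusp_order K1 (cusp_mat a c) (w a c) 0" by simp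
    obtain b0 d0 where bd: "a * d0 - b0 * c = 1" "cusp_mat a c = (a, b0, c, d0)" using cusp_mat[OF co] by blast
    obtain t where t: "b = b0 + t * a" "d = d0 + t * c" using same_column[OF bd(1) det] by blast
    have "has_cusp_order K1 (a, b, c, d) (w a c) (int 1 * 0)"
      by (rule has_cusp_order_subst[OF o, where g = 1 and h = 1 and B = t and C = 1])
        (use w_pos in \<open>auto simp: t bd(2) moebius_translate simp del: moebius_act.simps\<close>)
    then show ?thesis using False by simp
  next
    case True
    obtain b0 d0 where bd: "0 * d0 - b0 * 1 = (1 :: int)" "cusp_mat 0 1 = (0, b0, 1, d0)" using cusp_mat[OF co01] by blast
    then have bd: "cusp_mat 0 1 = (0, - 1, 1, d0)" by (simp add: minus_equation_iff)
    have z1: "zorder (Xe 0 1) 0 = - 1" using x_zero by (simp add: ord_at_def)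
    have "has_cusp_order K1 (cusp_mat 0 1) (w 0 1) (int N + int (degree Q))"
      using K1_expand[OF co01] unfolding Xe_pole(2)[OF co01 Xe01_pole] z1 w01 by simp
    then have o: "has_cusp_order K1 (0, - 1, 1, d0) N (int (degree P))" using degree_diff w01 bd by (simp add: algebra_simps)
    obtain u v where uv: "u * c + v * int N = 1" using True by (metis bezout_int coprime_iff_gcd_eq_1)
    \<comment> \<open>\<open>D\<close> is \<open>d / c\<close> modulo \<open>N\<close>. With it the
      matrix becomes an element of \<open>Gamma0 N\<close> times a matrix with first column
      \<open>(0, 1)\<close>, which exhibits the cusp as equivalent to 0.\<close>
    define D where "D = u * d"
    have cD: "int N dvd c * D - d"
    proof
      have "c * D - d = (u * c + v * int N) * d - d - int N * (v * d)" by (simp add: D_def algebra_simps)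
      then show "c * D - d = int N * (- v * d)" unfolding uv by simp
    qed
    define t where "t = D - d0"
    have g: "(a * D - b, a, c * D - d, c) \<in> Gamma0 N" (is "?g \<in> _") unfolding Gamma0_def using cD det by (simp add: algebra_simps)
    have dS: "0 * D - (- 1) * 1 = (1 :: int)" by simp
    have dg: "(a * D - b) * c - a * (c * D - d) = 1" using det by (simp add: algebra_simps)
    have "has_cusp_order K1 (a, b, c, d) N (int 1 * int (degree P))"
    proof (rule has_cusp_order_subst[OF o, where g = 1 and h = 1 and B = t and C = 1])
      fix \<tau> :: complex assume pos: "Im \<tau> > 0"
      let ?S = "(0, - 1, 1, D) :: mat2"
      have S: "moebius_act ?S \<tau> = moebius_act (0, - 1, 1, d0) (\<tau> + of_int t)" "autf ?S \<tau> = autf (0, - 1, 1, d0) (\<tau> + of_int t)"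
        by (simp_all add: t_def autf_def add.assoc)
      have Sp: "Im (moebius_act ?S \<tau>) > 0" by (rule moebius_Im(2)[OF dS pos])
      have m: "moebius_act ?g (moebius_act ?S \<tau>) = moebius_act (a, b, c, d) \<tau>" "autf (a, b, c, d) \<tau> = autf ?g (moebius_act ?S \<tau>) * autf ?S \<tau>"
        using moebius_mult[OF dS dg pos] by (simp_all add: algebra_simps del: moebius_act.simps)
      have nz: "autf ?g (moebius_act ?S \<tau>) \<noteq> 0" using moebius_Im(1)[OF dg Sp] by (simp add: autf_def del: moebius_act.simps)
      have "K1 (moebius_act (a, b, c, d) \<tau>) / autf (a, b, c, d) \<tau> ^ 12 = K1 (moebius_act ?S \<tau>) / autf ?S \<tau> ^ 12"
        unfolding m(1)[symmetric] m(2) K1_mod[OF g Sp] using nz by (simp add: power_mult_distrib)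
      then show "K1 (moebius_act (a, b, c, d) \<tau>) / autf (a, b, c, d) \<tau> ^ 12 =
        1 * (K1 (moebius_act (0, - 1, 1, d0) ((of_nat 1 * \<tau> + of_int t) / of_nat 1)) / autf (0, - 1, 1, d0) ((of_nat 1 * \<tau> + of_int t) / of_nat 1) ^ 12)"
        unfolding S by simp
    qed (use N in auto)
    then show ?thesis using True w_coprime[OF True] by simp
  qed
qed

end

section \<open>Cusps of \<open>X\<^sub>0(N\<^sup>2)\<close>\<close>

lemma act_cusp_mult:
  "act (a, b, c, d) (act (a', b', c', d') (Cusp p q)) = act (a * a' + b * c', a * b' + b * d', c * a' + d * c', c * b' + d * d') (Cusp p q)"
  by (simp add: algebra_simps)

lemma Gamma0_mult:
  assumes "(a, b, c, d) \<in> Gamma0 M" "(a', b', c', d') \<in> Gamma0 M"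
  shows "(a * a' + b * c', a * b' + b * d', c * a' + d * c', c * b' + d * d') \<in> Gamma0 M"
proof -
  have "a * d - b * c = 1" "a' * d' - b' * c' = 1" using assms by (auto simp: Gamma0_def)
  then have "(a * a' + b * c') * (c * b' + d * d') - (a * b' + b * d') * (c * a' + d * c') = 1" by algebra
  moreover have "int M dvd c * a' + d * c'" using assms by (auto simp: Gamma0_def)
  ultimately show ?thesis unfolding Gamma0_def by simp
qed

lemma X0_class_cusp_eq_iff:
  "X0_class M (Cusp p q) = X0_class M (Cusp p' q') \<longleftrightarrow> (\<exists>\<gamma>\<in>Gamma0 M. Cusp p' q' = act \<gamma> (Cusp p q))"
proof
  assume eq: "X0_class M (Cusp p q) = X0_class M (Cusp p' q')"
  have "(1, 0, 0, 1) \<in> Gamma0 M" "act (1, 0, 0, 1) (Cusp p' q') = Cusp p' q'" by (auto simp: Gamma0_def)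
  then have "Cusp p' q' \<in> X0_class M (Cusp p' q')" unfolding X0_class_def by force
  then show "\<exists>\<gamma>\<in>Gamma0 M. Cusp p' q' = act \<gamma> (Cusp p q)" using eq unfolding X0_class_def by blast
next
  assume "\<exists>\<gamma>\<in>Gamma0 M. Cusp p' q' = act \<gamma> (Cusp p q)"
  then obtain a b c d where g: "(a, b, c, d) \<in> Gamma0 M" "Cusp p' q' = act (a, b, c, d) (Cusp p q)" by auto
  have det: "a * d - b * c = 1" using g by (simp add: Gamma0_def)
  have g': "(d, - b, - c, a) \<in> Gamma0 M" using g by (auto simp: Gamma0_def algebra_simps)
  have "d * p' + - b * q' = (a * d - b * c) * p" and "(- c) * p' + a * q' = (a * d - b * c) * q" using g(2)
    by (simp_all add: algebra_simps)
  then have inv: "Cusp p q = act (d, - b, - c, a) (Cusp p' q')" using det by simp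
  have sub: "X0_class M (Cusp r s) \<subseteq> X0_class M (Cusp r' s')"
    if h: "h \<in> Gamma0 M" "Cusp r s = act h (Cusp r' s')" for r s r' s' h
  proof
    fix y assume "y \<in> X0_class M (Cusp r s)"
    then obtain k where k: "k \<in> Gamma0 M" "y = act k (Cusp r s)" by (auto simp: X0_class_def)
    obtain a1 b1 c1 d1 where k1: "k = (a1, b1, c1, d1)" by (cases k)
    obtain a2 b2 c2 d2 where h1: "h = (a2, b2, c2, d2)" by (cases h)
    have "y = act (a1 * a2 + b1 * c2, a1 * b2 + b1 * d2, c1 * a2 + d1 * c2, c1 * b2 + d1 * d2) (Cusp r' s')"
      unfolding k h(2) k1 h1 by (rule act_cusp_mult)
    then show "y \<in> X0_class M (Cusp r' s')" unfolding X0_class_def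
      using Gamma0_mult[OF k(1)[unfolded k1] h(1)[unfolded h1]] by blast
  qed
  show "X0_class M (Cusp p q) = X0_class M (Cusp p' q')"
    using sub[OF g' inv] sub[OF g] by blast
qed

text \<open>Modulo \<open>M\<close> the lower row of a matrix in \<open>Gamma0 M\<close> is
  \<open>(0, d)\<close> with \<open>d\<close> a unit, so \<open>q\<close> only changes by a
  unit.\<close>

lemma X0_class_gcd:
  assumes "X0_class M (Cusp p q) = X0_class M (Cusp p' q')"
  shows "gcd q (int M) = gcd q' (int M)"
proof -
  obtain a b c d where g: "(a, b, c, d) \<in> Gamma0 M" "q' = c * p + d * q"
    using assms unfolding X0_class_cusp_eq_iff by auto
  obtain k where k: "c = int M * k" using g by (auto simp: Gamma0_def)
  have "d * a + int M * (- b * k) = 1" using g by (simp add: Gamma0_def k algebra_simps)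
  then have "coprime d (int M)" using coprime_column[of d a "b * k" "int M"] by (simp add: algebra_simps)
  then have "gcd (d * q) (int M) = gcd q (int M)" by (simp add: gcd_mult_left_left_cancel coprime_commute)
  moreover have "gcd (d * q + (k * p) * int M) (int M) = gcd (d * q) (int M)" 
    using gcd_add_mult[of "int M" "k * p" "d * q"] by (simp add: gcd.commute add.commute)
  moreover have "q' = d * q + (k * p) * int M" using g k by simp
  ultimately show ?thesis by simp
qed

text \<open>For a divisor \<open>d\<close> of \<open>N\<close> the cofactor \<open>N^2 / d\<close>
  is again a multiple of \<open>d\<close>. Hence \<open>gcd d (N^2 / d) = d\<close>, and the cusps
  of denominator \<open>d\<close> correspond to the units modulo \<open>d\<close>.\<close>

lemma dvd_cofactor:
  fixes d N :: nat
  assumes "d dvd N"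
  obtains n where "int (N\<^sup>2) = int d * n" "int d dvd n"
proof -
  obtain m where "N = d * m" using assms by blast
  then show ?thesis using that[of "int d * int m ^ 2"] by (simp add: power2_eq_square)
qed

lemma cusps_with_denom_iff:
  assumes N: "N > 0" and d: "d dvd N" and co: "coprime a c"
  shows "X0_class (N\<^sup>2) (Cusp a c) \<in> cusps_with_denom (N\<^sup>2) d \<longleftrightarrow> gcd c (int (N\<^sup>2)) = int d"
proof
  obtain n where n: "int (N\<^sup>2) = int d * n" "int d dvd n" by (rule dvd_cofactor[OF d])
  {
    assume "X0_class (N\<^sup>2) (Cusp a c) \<in> cusps_with_denom (N\<^sup>2) d"
    then obtain a' where "X0_class (N\<^sup>2) (Cusp a c) = X0_class (N\<^sup>2) (Cusp a' (int d))" unfolding cusps_with_denom_def by blast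
    from X0_class_gcd[OF this] show "gcd c (int (N\<^sup>2)) = int d" unfolding n(1) by (simp add: gcd_proj1_if_dvd)
  }
  assume g: "gcd c (int (N\<^sup>2)) = int d"
  have d0: "int d > 0" using N d by (auto intro: Nat.gr0I)
  have "int d dvd c" using g by (metis gcd_dvd1)
  then obtain c1 where c1: "c = int d * c1" by blast
  have "gcd (int d * c1) (int d * n) = int d * 1" using g unfolding c1 n(1) by simp
  then have "int d * gcd c1 n = int d * 1" by (simp add: gcd_mult_left)
  then have "gcd c1 n = 1" using d0 by simp
  then have "coprime c1 n" by (simp add: coprime_iff_gcd_eq_1)
  moreover have "coprime c1 a" using co by (simp add: c1 coprime_commute)
  ultimately have "coprime (n * a) c1" by (simp add: coprime_commute)
  then have "gcd (n * a) c1 = 1" by simp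
  \<comment> \<open>The Bezout coefficients yield a lower row \<open>(N^2 * k, \<delta>)\<close>
    that sends \<open>(a, c)\<close> to \<open>d\<close>; a second application completes it to
    determinant 1.\<close>
  moreover obtain k \<delta> where "k * (n * a) + \<delta> * c1 = gcd (n * a) c1" using bezout_int[of "n * a" c1] by blast
  ultimately have kd: "k * (n * a) + \<delta> * c1 = 1" by simp
  have cop: "coprime \<delta> (n * k)"
  proof (rule coprimeI)
    fix l assume "l dvd \<delta>" "l dvd n * k"
    then have "l dvd (n * k) * a + \<delta> * c1" by (intro dvd_add) auto
    then show "is_unit l" using kd by (simp add: algebra_simps)
  qed
  then have "coprime \<delta> n" "coprime \<delta> k" by auto
  moreover have "coprime \<delta> (int d)" by (rule coprime_divisors[OF dvd_refl n(2) \<open>coprime \<delta> n\<close>])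
  ultimately have "coprime \<delta> (int (N\<^sup>2) * k)" unfolding n(1) by simp
  then have "gcd \<delta> (int (N\<^sup>2) * k) = 1" by simp
  moreover obtain \<alpha> \<beta> where "\<alpha> * \<delta> + \<beta> * (int (N\<^sup>2) * k) = gcd \<delta> (int (N\<^sup>2) * k)"
    using bezout_int[of \<delta> "int (N\<^sup>2) * k"] by blast
  ultimately have ab: "\<alpha> * \<delta> + \<beta> * (int (N\<^sup>2) * k) = 1" by simp
  let ?M = "int (N\<^sup>2)"
  have G: "(\<alpha>, - \<beta>, ?M * k, \<delta>) \<in> Gamma0 (N\<^sup>2)" using ab by (simp add: Gamma0_def)
  define a' where "a' = \<alpha> * a - \<beta> * c"
  have c': "?M * k * a + \<delta> * c = int d"
  proof -
    have "?M * k * a + \<delta> * c = int d * (k * (n * a) + \<delta> * c1)" unfolding n(1) c1 by (simp add: algebra_simps)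
    then show ?thesis using kd by simp
  qed
  have "coprime a' (int d)"
  proof (rule coprimeI)
    fix l assume l: "l dvd a'" "l dvd int d"
    have "\<delta> * a' + \<beta> * int d = (\<alpha> * \<delta> + \<beta> * (?M * k)) * a" "\<alpha> * int d - (?M * k) * a' = (\<alpha> * \<delta> + \<beta> * (?M * k)) * c"
      unfolding a'_def c'[symmetric] by algebra+
    then have *: "a = \<delta> * a' + \<beta> * int d" "c = \<alpha> * int d - (?M * k) * a'" unfolding ab by auto
    have "l dvd a" by (subst *(1), intro dvd_add dvd_mult l)
    moreover have "l dvd c" by (subst *(2), intro dvd_diff dvd_mult l)
    ultimately show "is_unit l" using co by (meson coprime_common_divisor)
  qed
  moreover have "X0_class (N\<^sup>2) (Cusp a c) = X0_class (N\<^sup>2) (Cusp a' (int d))"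
    unfolding X0_class_cusp_eq_iff by (rule bexI[OF _ G]) (use c' in \<open>simp add: a'_def\<close>)
  ultimately show "X0_class (N\<^sup>2) (Cusp a c) \<in> cusps_with_denom (N\<^sup>2) d" unfolding cusps_with_denom_def by blast
qed

lemma X0_class_same_denom:
  assumes N: "N > 0" and d: "d dvd N"
  shows "X0_class (N\<^sup>2) (Cusp a (int d)) = X0_class (N\<^sup>2) (Cusp a' (int d)) \<longleftrightarrow> int d dvd a' - a"
proof
  obtain n where n: "int (N\<^sup>2) = int d * n" "int d dvd n" by (rule dvd_cofactor[OF d])
  have d0: "int d > 0" using N d by (auto intro: Nat.gr0I)
  assume "X0_class (N\<^sup>2) (Cusp a (int d)) = X0_class (N\<^sup>2) (Cusp a' (int d))"
  then obtain \<alpha> \<beta> \<kappa> \<delta> where g: "(\<alpha>, \<beta>, \<kappa>, \<delta>) \<in> Gamma0 (N\<^sup>2)" "a' = \<alpha> * a + \<beta> * int d" "int d = \<kappa> * a + \<delta> * int d"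
    unfolding X0_class_cusp_eq_iff by auto
  obtain k where k: "\<kappa> = int (N\<^sup>2) * k" using g by (auto simp: Gamma0_def)
  obtain m where m: "n = int d * m" using n by blast
  have "int d * 1 = int d * (n * k * a + \<delta>)" using g(3) unfolding k n(1) by (simp add: algebra_simps)
  then have "n * k * a + \<delta> = 1" using d0 by simp
  then have \<delta>: "\<delta> = 1 - int d * (m * k * a)" by (simp add: m)
  have "\<alpha> * \<delta> - \<beta> * \<kappa> = 1" using g by (simp add: Gamma0_def)
  then have "\<alpha> = 1 + int d * (\<beta> * n * k + \<alpha> * m * k * a)" unfolding \<delta> k n(1) by (simp add: algebra_simps)
  then have "a' - a = int d * ((\<beta> * n * k + \<alpha> * m * k * a) * a + \<beta>)" using g(2) by algebra
  then show "int d dvd a' - a" by simp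
next
  assume "int d dvd a' - a"
  then obtain t where "a' - a = int d * t" by blast
  then have t: "a' = a + int d * t" by simp
  have "(1, t, 0, 1) \<in> Gamma0 (N\<^sup>2)" by (simp add: Gamma0_def)
  then show "X0_class (N\<^sup>2) (Cusp a (int d)) = X0_class (N\<^sup>2) (Cusp a' (int d))"
    unfolding X0_class_cusp_eq_iff by (rule bexI[rotated]) (simp add: t algebra_simps)
qed

lemma card_cusps_with_denom:
  assumes N: "N > 0" and d: "d dvd N"
  shows "finite (cusps_with_denom (N\<^sup>2) d)" "card (cusps_with_denom (N\<^sup>2) d) = totient d"
proof -
  let ?f = "\<lambda>k. X0_class (N\<^sup>2) (Cusp (int k) (int d))"
  have d0: "d > 0" using N d by (auto intro: Nat.gr0I)
  have "cusps_with_denom (N\<^sup>2) d \<subseteq> ?f ` totatives d"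
  proof
    fix C assume "C \<in> cusps_with_denom (N\<^sup>2) d"
    then obtain a where a: "C = X0_class (N\<^sup>2) (Cusp a (int d))" "coprime a (int d)" unfolding cusps_with_denom_def by blast
    \<comment> \<open>The representative is taken in \<open>1..d\<close>, the range of
      \<open>totatives\<close>; the shift by 1 matters for \<open>d = 1\<close>.\<close>
    define k where "k = nat ((a - 1) mod int d + 1)"
    have k1: "int k = (a - 1) mod int d + 1" using d0 by (simp add: k_def)
    have "int k - a = int d * (- ((a - 1) div int d))" unfolding k1 minus_div_mult_eq_mod[symmetric] by (simp add: algebra_simps)
    then have kd: "int d dvd int k - a" by simp
    have "(a - 1) mod int d < int d" "(a - 1) mod int d \<ge> 0" using d0 by auto
    then have k2: "0 < k" "k \<le> d" using k1 by linarith+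
    have "coprime (int k) (int d)"
    proof (rule coprimeI)
      fix l assume l: "l dvd int k" "l dvd int d"
      have "l dvd int k - (int k - a)" by (rule dvd_diff[OF l(1) dvd_trans[OF l(2) kd]])
      then have "l dvd a" by simp
      then show "is_unit l" using a(2) l by (meson coprime_common_divisor)
    qed
    then have "k \<in> totatives d" using k2 by (simp add: totatives_def)
    moreover have "C = ?f k" unfolding a(1) X0_class_same_denom[OF N d] by (rule kd)
    ultimately show "C \<in> ?f ` totatives d" by blast
  qed
  moreover have "?f ` totatives d \<subseteq> cusps_with_denom (N\<^sup>2) d"
    unfolding cusps_with_denom_def totatives_def by auto
  ultimately have eq: "cusps_with_denom (N\<^sup>2) d = ?f ` totatives d" by blast
  have "inj_on ?f (totatives d)"
  proof (rule inj_onI)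
    fix k l assume kl: "k \<in> totatives d" "l \<in> totatives d" "?f k = ?f l"
    then have dv: "int d dvd int l - int k" unfolding X0_class_same_denom[OF N d] by simp
    have "0 < k" "k \<le> d" "0 < l" "l \<le> d" using kl by (auto simp: totatives_def)
    then have lt: "\<bar>int l - int k\<bar> < int d" by linarith
    show "k = l"
    proof (rule ccontr)
      assume "k \<noteq> l"
      then have "int l - int k \<noteq> 0" by simp
      from dvd_imp_le_int[OF this dv] lt show False by simp
    qed
  qed
  then show "card (cusps_with_denom (N\<^sup>2) d) = totient d"
    unfolding eq totient_def by (rule card_image)
  show "finite (cusps_with_denom (N\<^sup>2) d)" unfolding eq by simp
qed

text \<open>Write \<open>c = g * c'\<close> and \<open>n = g * m\<close> with \<open>c'\<close>
  prime to \<open>m\<close>. Then \<open>gcd c (n^2) = g * gcd c' g\<close>, which divides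
  \<open>n\<close> only if \<open>c'\<close> is prime to \<open>g\<close> as well. The left side is
  how the divisor of \<open>f\<close> selects cusps, the right side how the order of
  \<open>K1 (N * \<tau>)\<close> does.\<close>

lemma gcd_square_dvd_iff:
  fixes c n :: int
  assumes "n > 0"
  shows "gcd c (n\<^sup>2) dvd n \<longleftrightarrow> coprime (c div gcd c n) n"
proof -
  define g where "g = gcd c n"
  have g: "g > 0" using assms by (simp add: g_def)
  have "g dvd c" "g dvd n" by (simp_all add: g_def)
  then obtain c' m where c': "c = g * c'" and m: "n = g * m" by (auto elim!: dvdE)
  have "gcd (g * c') (g * m) = g" unfolding c'[symmetric] m[symmetric] by (rule g_def[symmetric])
  then have "g * gcd c' m = g" using g by (simp add: gcd_mult_left)
  then have cm: "coprime c' m" using g by (simp add: coprime_iff_gcd_eq_1)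
  have "gcd c (n\<^sup>2) = g * gcd c' (g * m\<^sup>2)"
  proof -
    have n2: "n\<^sup>2 = g * (g * m\<^sup>2)" by (simp add: m power2_eq_square)
    show ?thesis unfolding n2 c' using g by (simp add: gcd_mult_left)
  qed
  also have "gcd c' (g * m\<^sup>2) = gcd c' g" using cm by (simp add: gcd_mult_right_right_cancel)
  finally have e: "gcd c (n\<^sup>2) dvd n \<longleftrightarrow> gcd c' g dvd m" using g by (simp add: m)
  have "gcd c' g dvd m \<longleftrightarrow> coprime c' g"
  proof
    assume "gcd c' g dvd m"
    then have "is_unit (gcd c' g)" using cm by (meson coprime_common_divisor gcd_dvd1)
    then show "coprime c' g" by (simp only: is_unit_gcd)
  qed simp
  also have "\<dots> \<longleftrightarrow> coprime c' n" using cm by (simp add: m)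
  finally have f: "gcd c' g dvd m \<longleftrightarrow> coprime c' n" .
  have q: "c div gcd c n = c'" unfolding g_def[symmetric] using g c' by simp
  show ?thesis unfolding e f q ..
qed

text \<open>At most one \<open>d\<close> matches the invariant \<open>gcd c (N^2)\<close>, which
  gives the first term. The point \<open>[1/1]\<close> is subtracted once for every cusp in the sum,
  and the totients of the divisors of \<open>N\<close> add up to \<open>N\<close>.\<close>

lemma divisor_cusp:
  assumes N: "N > 0" and co: "coprime a c"
  shows "(\<Sum>d | d dvd N. \<Sum>C\<in>cusps_with_denom (N\<^sup>2) d. point_divisor C (X0_class (N\<^sup>2) (Cusp a c))
      - point_divisor (X0_class (N\<^sup>2) (Cusp 1 1)) (X0_class (N\<^sup>2) (Cusp a c))) =
    (if coprime (c div gcd c (int N)) (int N) then 1 else 0) - (if coprime c (int N) then int N else 0)"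
proof -
  define p where "p = X0_class (N\<^sup>2) (Cusp a c)"
  let ?D = "\<lambda>d. cusps_with_denom (N\<^sup>2) d"
  define q where "q = point_divisor (X0_class (N\<^sup>2) (Cusp 1 1)) p"
  have fin: "finite {d. d dvd N}" using N by simp
  have q: "q = (if coprime c (int N) then 1 else 0)"
  proof -
    have "p = X0_class (N\<^sup>2) (Cusp 1 1) \<longleftrightarrow> p \<in> ?D 1"
      using X0_class_same_denom[OF N, of 1] unfolding cusps_with_denom_def by auto
    also have "\<dots> \<longleftrightarrow> gcd c (int (N\<^sup>2)) = 1" unfolding p_def using cusps_with_denom_iff[OF N, of 1 a c] co by simp
    also have "\<dots> \<longleftrightarrow> coprime c (int N)" by (simp add: coprime_iff_gcd_eq_1[symmetric])
    finally show ?thesis by (simp add: q_def point_divisor_def)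
  qed
  have inner: "(\<Sum>C\<in>?D d. point_divisor C p - q) = (if gcd c (int (N\<^sup>2)) = int d then 1 else 0) - int (totient d) * q" if d: "d dvd N" for d
  proof -
    have "(\<Sum>C\<in>?D d. point_divisor C p) = (if p \<in> ?D d then 1 else 0)"
      unfolding point_divisor_def using card_cusps_with_denom(1)[OF N d] by (rule sum.delta')
    then show ?thesis unfolding sum_subtractf sum_constant card_cusps_with_denom(2)[OF N d]
      p_def cusps_with_denom_iff[OF N d co] by simp
  qed
  have "(\<Sum>d | d dvd N. \<Sum>C\<in>?D d. point_divisor C p - q) =
      (\<Sum>d | d dvd N. if gcd c (int (N\<^sup>2)) = int d then 1 else 0) - int (\<Sum>d | d dvd N. totient d) * q"
    using inner by (simp add: sum_subtractf sum_distrib_right)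
  also have "(\<Sum>d | d dvd N. totient d) = N" by (rule totient_divisor_sum)
  also have "(\<Sum>d | d dvd N. if gcd c (int (N\<^sup>2)) = int d then 1 else 0) = (if gcd c (int (N\<^sup>2)) dvd int N then 1 else (0 :: int))"
  proof -
    have "(\<Sum>d | d dvd N. if gcd c (int (N\<^sup>2)) = int d then 1 else (0::int)) = (\<Sum>d | d dvd N. if d = nat (gcd c (int (N\<^sup>2))) then 1 else 0)"
      by (intro sum.cong refl) auto
    also have "\<dots> = (if nat (gcd c (int (N\<^sup>2))) dvd N then 1 else 0)" using fin by (simp add: sum.delta')
    also have "nat (gcd c (int (N\<^sup>2))) dvd N \<longleftrightarrow> gcd c (int (N\<^sup>2)) dvd int N" by (simp add: nat_dvd_iff)
    finally show ?thesis .
  qed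
  also have "gcd c (int (N\<^sup>2)) dvd int N \<longleftrightarrow> coprime (c div gcd c (int N)) (int N)"
    using gcd_square_dvd_iff[of "int N" c] N by simp
  finally show ?thesis unfolding p_def[symmetric] q_def[symmetric] using q by simp
qed

lemma divisor_inner:
  "(\<Sum>d | d dvd N. \<Sum>C\<in>cusps_with_denom (N\<^sup>2) d. point_divisor C (X0_class (N\<^sup>2) (Inner \<tau>))
      - point_divisor (X0_class (N\<^sup>2) (Cusp 1 1)) (X0_class (N\<^sup>2) (Inner \<tau>))) = 0"
proof -
  have "(1, 0, 0, 1) \<in> Gamma0 (N\<^sup>2)" by (simp add: Gamma0_def)
  then have "act (1, 0, 0, 1) (Inner \<tau>) \<in> X0_class (N\<^sup>2) (Inner \<tau>)" unfolding X0_class_def by blast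
  moreover have "act (1, 0, 0, 1) (Inner \<tau>) \<notin> X0_class (N\<^sup>2) (Cusp a c)" for a c unfolding X0_class_def by auto
  ultimately have "X0_class (N\<^sup>2) (Inner \<tau>) \<noteq> X0_class (N\<^sup>2) (Cusp a c)" for a c by blast
  then show ?thesis unfolding cusps_with_denom_def point_divisor_def by (intro sum.neutral ballI) auto
qed

section \<open>Comparison of the two forms\<close>

lemma zorder_0_tendsto:
  assumes mero: "\<Phi> meromorphic_on {0}" and nz: "eventually (\<lambda>z. \<Phi> z \<noteq> 0) (at 0)" and z: "zorder \<Phi> 0 = 0"
  obtains l where "l \<noteq> 0" "(\<Phi> \<longlongrightarrow> l) (at 0)"
proof -
  define g where "g = zor_poly \<Phi> 0"
  have "g 0 \<noteq> 0 \<and> (\<exists>r. r > 0 \<and> g holomorphic_on cball 0 r \<and> (\<forall>w\<in>cball 0 r - {0}. \<Phi> w = g w * (w - 0) powi zorder \<Phi> 0 \<and> g w \<noteq> 0))"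
    unfolding g_def using mero eventually_imp_frequently[OF nz] unfolding meromorphic_at_iff by (intro zorder_exist) auto
  then obtain r where g0: "g 0 \<noteq> 0" and r: "r > 0" "g holomorphic_on cball 0 r" "\<And>w. w \<in> cball 0 r - {0} \<Longrightarrow> \<Phi> w = g w" using z by auto
  have "g holomorphic_on ball 0 r" by (rule holomorphic_on_subset[OF r(2)]) auto
  then have "continuous_on (ball 0 r) g" by (rule holomorphic_on_imp_continuous_on)
  then have "isCont g 0" using continuous_on_eq_continuous_at[of "ball 0 r" g] r(1) by simp
  then have "(g \<longlongrightarrow> g 0) (at 0)" by (simp add: isCont_def)
  moreover have "eventually (\<lambda>z. g z = \<Phi> z) (at 0)"
    unfolding eventually_at using r by (intro exI[of _ r]) auto
  ultimately have "(\<Phi> \<longlongrightarrow> g 0) (at 0)" by (rule Lim_transform_eventually)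
  then show ?thesis using that g0 by blast
qed

lemma cusp_width_dvd:
  assumes "M > 0" "int M dvd c\<^sup>2 * int v"
  shows "cusp_width M a c dvd v"
proof -
  define g where "g = gcd (int M) (c\<^sup>2)"
  have g: "g > 0" using assms by (simp add: g_def)
  have "g dvd int M" "g dvd c\<^sup>2" by (simp_all add: g_def)
  then obtain m k where m: "int M = g * m" and k: "c\<^sup>2 = g * k" by (auto elim!: dvdE)
  have "gcd (g * m) (g * k) = g" unfolding m[symmetric] k[symmetric] by (rule g_def[symmetric])
  then have "g * gcd m k = g" using g by (simp add: gcd_mult_left)
  then have mk: "coprime m k" using g by (simp add: coprime_iff_gcd_eq_1)
  have "g * m dvd g * (k * int v)" using assms(2) unfolding m k by (simp add: mult.assoc)
  then have "m dvd k * int v" using g by simp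
  then have "m dvd int v" using mk by (simp add: coprime_dvd_mult_right_iff)
  moreover have "int M div g = m" using m g by simp
  moreover have "m > 0" using m g assms(1) by (metis of_nat_0_less_iff zero_less_mult_pos)
  ultimately show ?thesis unfolding cusp_width_eq[OF assms(1)] g_def[symmetric]
    by (simp add: nat_dvd_iff)
qed

lemma cusp_width_square:
  assumes N: "N > 0"
  shows "int (cusp_width (N\<^sup>2) a c) = (int N div gcd c (int N))\<^sup>2"
proof -
  have "int (cusp_width (N\<^sup>2) a c) = (int N)\<^sup>2 div gcd ((int N)\<^sup>2) (c\<^sup>2)"
    using N by (simp add: cusp_width_eq pos_imp_zdiv_nonneg_iff)
  also have "gcd ((int N)\<^sup>2) (c\<^sup>2) = (gcd c (int N))\<^sup>2" by (simp add: gcd_exp gcd.commute)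
  finally show ?thesis by (simp add: div_power)
qed

lemma weight12I:
  assumes "M > 0" "K holomorphic_on upper_half" "\<And>\<tau>. Im \<tau> > 0 \<Longrightarrow> K \<tau> \<noteq> 0"
    "\<And>\<gamma> \<tau>. \<gamma> \<in> Gamma0 M \<Longrightarrow> Im \<tau> > 0 \<Longrightarrow> K (moebius_act \<gamma> \<tau>) = autf \<gamma> \<tau> ^ 12 * K \<tau>"
    "\<And>a c. coprime a c \<Longrightarrow> has_cusp_order K (cusp_mat a c) (cusp_width M a c) (ordc a c)"
  shows "weight12 M K ordc"
proof (unfold_locales, goal_cases)
  case (5 a c)
  then show ?case using assms(5)[of a c] unfolding has_cusp_order_def by blast
qed (use assms in auto)

locale divisor_data = hauptmodul_data +
  fixes f :: "complex \<Rightarrow> complex"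
  assumes f: "f \<in> function_field (N\<^sup>2)"
    and f_nonzero: "\<exists>\<tau>\<in>upper_half. f \<tau> \<noteq> 0"
    and f_inner: "\<And>\<tau>. Im \<tau> > 0 \<Longrightarrow> ord_at (N\<^sup>2) f (Inner \<tau>) = 0"
    and f_cusp: "\<And>a c. coprime a c \<Longrightarrow> ord_at (N\<^sup>2) f (Cusp a c) =
      int (degree P) * ((if coprime (c div gcd c (int N)) (int N) then 1 else 0) - (if coprime c (int N) then int N else 0))"
begin

lemma N2: "N\<^sup>2 > 0" using N by simp

lemma f_mero: "f nicely_meromorphic_on upper_half" using f by (simp add: function_field_def)

lemma f_inv: "\<gamma> \<in> Gamma0 (N\<^sup>2) \<Longrightarrow> \<tau> \<in> upper_half \<Longrightarrow> f (moebius_act \<gamma> \<tau>) = f \<tau>"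
  using f unfolding function_field_def by blast

lemma f_limit:
  assumes pos: "Im \<tau>0 > 0"
  obtains l where "l \<noteq> 0" "(f \<longlongrightarrow> l) (at \<tau>0)"
proof -
  interpret stabilizer "N\<^sup>2" \<tau>0 by unfold_locales (rule pos)
  have t0: "\<tau>0 \<in> upper_half" using pos by (simp add: upper_half_iff)
  have p: "Inner \<tau>0 \<in> ext_upper_half" using t0 by (auto simp: ext_upper_half_def)
  let ?k = "stab_order (N\<^sup>2) \<tau>0"
  have fm: "f meromorphic_on upper_half" using f_mero by (simp add: nicely_meromorphic_on_def)
  obtain F where F: "F meromorphic_on {0}" "expands_at (N\<^sup>2) f (Inner \<tau>0) F"
    by (rule expansion_inner_exists[OF pos fm f_inv])
  obtain r where r: "r > 0" "\<And>\<tau>. \<tau> \<in> upper_half \<Longrightarrow> 0 < norm (inner_s \<tau>0 \<tau> ^ ?k) \<Longrightarrow> norm (inner_s \<tau>0 \<tau> ^ ?k) < r \<Longrightarrow> f \<tau> = F (inner_s \<tau>0 \<tau> ^ ?k)"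
    using F(2) unfolding expands_at_def local_param_inner by blast
  have z: "zorder F 0 = 0"
    using zorder_cong_at[OF expansion_props(3)[OF p N2 F]] f_inner[OF pos] by (simp add: ord_at_def)
  have ne: "\<tau>0 - cnj \<tau>0 \<noteq> 0" using pos by (auto simp: complex_eq_iff)
  have "(inner_s \<tau>0 \<longlongrightarrow> (\<tau>0 - \<tau>0) / (\<tau>0 - cnj \<tau>0)) (at \<tau>0)"
    unfolding inner_s_def by (intro tendsto_intros ne)
  moreover have up: "eventually (\<lambda>z. z \<in> upper_half) (at \<tau>0)" by (rule eventually_at_in_open'[OF open_upper_half t0])
  moreover have "eventually (\<lambda>z. inner_s \<tau>0 z \<noteq> 0) (at \<tau>0)"
    using up eventually_neq_at_within[of \<tau>0 \<tau>0 UNIV]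
  proof eventually_elim
    case (elim z)
    then have "z - cnj \<tau>0 \<noteq> 0" using pos by (auto simp: complex_eq_iff upper_half_iff)
    then show ?case using elim by (simp add: inner_s_def)
  qed
  ultimately have "filterlim (inner_s \<tau>0) (at 0) (at \<tau>0)" by (simp add: filterlim_at)
  then have lim: "filterlim (\<lambda>z. inner_s \<tau>0 z ^ ?k) (at 0) (at \<tau>0)"
    by (rule filterlim_compose[OF pow_at_0[OF stab_order_pos]])
  have "eventually (\<lambda>z. z \<noteq> 0 \<and> norm z < r) (at (0 :: complex))"
    unfolding eventually_at using r by (intro exI[of _ r]) auto
  from up eventually_compose_filterlim[OF this lim]
  have eq: "eventually (\<lambda>z. F (inner_s \<tau>0 z ^ ?k) = f z) (at \<tau>0)"
    by eventually_elim (use r(2) in auto)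
  \<comment> \<open>\<open>zorder\<close> says nothing about a function that vanishes near 0, so
    this case is excluded separately: by the identity theorem \<open>f\<close> would vanish on the
    whole half-plane.\<close>
  have "eventually (\<lambda>z. F z \<noteq> 0) (at 0)"
  proof (rule ccontr)
    assume "\<not> ?thesis"
    then have "frequently (\<lambda>z. F z = 0) (at 0)" by (simp add: frequently_def)
    then have "eventually (\<lambda>z. F z = 0) (at 0)"
      using F(1) unfolding meromorphic_at_iff by (intro not_essential_frequently_0_imp_eventually_0) auto
    from eventually_compose_filterlim[OF this lim] eq have "eventually (\<lambda>z. f z = 0) (at \<tau>0)"
      by eventually_elim simp
    then have "frequently (\<lambda>z. f z = 0) (at \<tau>0)" using eventually_frequently[OF at_neq_bot] by blast
    from frequently_eq_meromorphic_imp_constant[OF this f_mero open_upper_half connected_upper_half t0]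
    show False using f_nonzero by blast
  qed
  then obtain l where l: "l \<noteq> 0" "(F \<longlongrightarrow> l) (at 0)" using zorder_0_tendsto[OF F(1) _ z] by blast
  have "(f \<longlongrightarrow> l) (at \<tau>0)" by (rule Lim_transform_eventually[OF filterlim_compose[OF l(2) lim] eq])
  then show ?thesis using that l(1) by blast
qed

text \<open>A nicely meromorphic function takes its limit as value wherever it has no pole, so the
  nonzero limit of \<open>f_limit\<close> is the value.\<close>

lemma f_regular:
  assumes pos: "Im \<tau>0 > 0"
  shows "f analytic_on {\<tau>0}" "f \<tau>0 \<noteq> 0"
proof -
  have t0: "\<tau>0 \<in> upper_half" using pos by (simp add: upper_half_iff)
  obtain l where l: "l \<noteq> 0" "(f \<longlongrightarrow> l) (at \<tau>0)" by (rule f_limit[OF pos])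
  then have np: "\<not> is_pole f \<tau>0"
    unfolding is_pole_def using not_tendsto_and_filterlim_at_infinity[of "at \<tau>0" f l] by auto
  show "f analytic_on {\<tau>0}" by (rule nicely_meromorphic_on_imp_analytic_at[OF f_mero t0 np])
  have "(f \<longlongrightarrow> f \<tau>0) (at \<tau>0)" using f_mero t0 np unfolding nicely_meromorphic_on_def by blast
  then have "f \<tau>0 = l" using l(2) by (rule tendsto_unique[OF at_neq_bot])
  then show "f \<tau>0 \<noteq> 0" using l by simp
qed

lemma f_holo: "f holomorphic_on upper_half"
  by (rule analytic_imp_holomorphic) (use f_regular(1) in \<open>auto simp: analytic_on_analytic_at[of _ upper_half] upper_half_iff\<close>)

abbreviation "Fe a c \<equiv> expansion (N\<^sup>2) (Cusp a c) f"
abbreviation "v a c \<equiv> cusp_width (N\<^sup>2) a c"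

lemma v_pos: "v a c > 0" by (rule cusp_width_pos[OF N2])

lemma Fe_nz:
  assumes co: "coprime a c"
  shows "eventually (\<lambda>z. Fe a c z \<noteq> 0) (at 0)"
proof -
  obtain b d where bd: "a * d - b * c = 1" "cusp_mat a c = (a, b, c, d)" using cusp_mat[OF co] by blast
  obtain r where r: "r > 0" "\<And>\<tau>. Im \<tau> > 0 \<Longrightarrow> norm (cusp_q (v a c) \<tau>) < r \<Longrightarrow> f (moebius_act (cusp_mat a c) \<tau>) = Fe a c (cusp_q (v a c) \<tau>)"
    using function_field_cusp(2)[OF f N2 co] by blast
  show ?thesis
  proof (rule cusp_eventually[OF v_pos r(1)])
    fix \<tau> assume t: "Im \<tau> > 0" "norm (cusp_q (v a c) \<tau>) < r"
    show "Fe a c (cusp_q (v a c) \<tau>) \<noteq> 0"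
      using r(2)[OF t] f_regular(2)[OF moebius_Im(2)[OF bd(1) t(1)]] by (simp add: bd(2) del: moebius_act.simps)
  qed
qed

text \<open>The common order of \<open>K1\<close> and \<open>K2\<close>. The factor \<open>N\<close>
  is the ratio of the widths \<open>N^2\<close> and \<open>N\<close> that the cusp 1/1 has in the
  two levels.\<close>

definition ordc :: "int \<Rightarrow> int \<Rightarrow> int" where "ordc a c = (if coprime c (int N) then int N * int (degree P) else 0)"

lemma K1_level_square:
  assumes co: "coprime a c"
  shows "has_cusp_order K1 (cusp_mat a c) (v a c) (ordc a c)"
proof -
  obtain b d where bd: "a * d - b * c = 1" "cusp_mat a c = (a, b, c, d)" using cusp_mat[OF co] by blast
  have N0: "N > 0" using N by simp
  have "int (N\<^sup>2) dvd c\<^sup>2 * int (v a c)"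
  proof -
    have "gcd (int (N\<^sup>2)) (c\<^sup>2) * int (v a c) = int (N\<^sup>2)"
      unfolding cusp_width_eq[OF N2] using N by (simp add: pos_imp_zdiv_nonneg_iff)
    moreover have "gcd (int (N\<^sup>2)) (c\<^sup>2) * int (v a c) dvd c\<^sup>2 * int (v a c)" by (intro mult_dvd_mono) auto
    ultimately show ?thesis by simp
  qed
  then have "int N dvd c\<^sup>2 * int (v a c)" by (rule dvd_trans[rotated]) (simp add: power2_eq_square)
  from cusp_width_dvd[OF N0 this, of a] obtain e where e: "v a c = w a c * e" by blast
  have e0: "e > 0" using v_pos[of a c] e by (auto intro: Nat.gr0I)
  have *: "has_cusp_order K1 (a, b, c, d) (v a c) (int e * (if coprime c (int N) then int (degree P) else 0))"
    by (rule has_cusp_order_subst[OF K1_cusp_order[OF bd(1)], where g = 1 and h = 1 and B = 0 and C = 1])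
      (use w_pos v_pos e e0 in auto)
  have "e = N" if cN: "coprime c (int N)"
  proof -
    have "int (v a c) = (int N)\<^sup>2" using cusp_width_square[OF N0, of a c] cN by simp
    then have "v a c = N * N" by (simp add: power2_eq_square flip: of_nat_mult)
    then show ?thesis using e N0 unfolding w_coprime[OF cN] by simp
  qed
  then show ?thesis using * unfolding bd(2) ordc_def by (auto split: if_splits)
qed

text \<open>The diagonal matrix with entries \<open>N\<close> and 1, times the given matrix, is
  factored into a matrix of determinant 1 and the upper triangular one with rows
  \<open>(g, B)\<close> and \<open>(0, h)\<close>, where \<open>g * h = N\<close>. So the order of
  \<open>K1 (N * \<tau>)\<close> at \<open>a/c\<close> is read off from \<open>K1\<close> at
  \<open>a'/c'\<close> with argument \<open>(g * \<tau> + B) / h\<close>.\<close>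

lemma K1_multiple_order:
  assumes co: "coprime a c"
  shows "has_cusp_order (\<lambda>\<tau>. K1 (of_nat N * \<tau>)) (cusp_mat a c) (v a c)
     (if coprime (c div gcd c (int N)) (int N) then int (degree P) else 0)"
proof -
  obtain b d where bd: "a * d - b * c = 1" "cusp_mat a c = (a, b, c, d)" using cusp_mat[OF co] by blast
  have N0: "N > 0" using N by simp
  define g where "g = gcd c (int N)"
  have g: "g > 0" using N by (simp add: g_def)
  have "g dvd c" "g dvd int N" by (simp_all add: g_def)
  then obtain c' h where c': "c = g * c'" and h: "int N = g * h" by (auto elim!: dvdE)
  have h0: "h > 0" using h g N0 by (metis of_nat_0_less_iff zero_less_mult_pos)
  have "gcd (g * c') (g * h) = g" unfolding c'[symmetric] h[symmetric] by (rule g_def[symmetric])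
  then have "g * gcd c' h = g" using g by (simp add: gcd_mult_left)
  then have ch: "coprime c' h" using g by (simp add: coprime_iff_gcd_eq_1)
  define a' where "a' = a * h"
  have "coprime a c'" using co by (simp add: c')
  then have "coprime a' c'" using ch by (simp add: a'_def coprime_commute)
  then obtain b' d' where bd': "a' * d' - b' * c' = 1" by (rule cusp_mat)
  \<comment> \<open>The upper right entry of the triangular factor, found by multiplying with the
    inverse of the factor of determinant 1.\<close>
  define B where "B = d' * int N * b - b' * d"
  \<comment> \<open>The ramification index that results from comparing widths. It is 1 when
    \<open>c'\<close> is prime to \<open>N\<close>; in the other case it multiplies the order
    0.\<close>
  define e where "e = nat (gcd (int N) (c'\<^sup>2))"
  have e: "int e = gcd (int N) (c'\<^sup>2)" by (simp add: e_def)
  have e0: "e > 0" using N0 by (simp add: e_def)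
  have ew: "int e * int (w a' c') = int N" unfolding e w_eq by simp
  have gh: "int (nat g) = g" "int (nat h) = h" using g h0 by auto
  have vv: "int (v a c) = h\<^sup>2" 
  proof -
    have "int N div g = h" using h g by simp
    then show ?thesis using cusp_width_square[OF N0, of a c] unfolding g_def[symmetric] by simp
  qed
  have width: "nat g * v a c = e * nat h * w a' c'"
  proof -
    have "int (nat g * v a c) = g * h * h" using vv gh by (simp add: power2_eq_square)
    also have "\<dots> = h * (int e * int (w a' c'))" unfolding ew h by simp
    also have "\<dots> = int (e * nat h * w a' c')" using gh by simp
    finally show ?thesis by (simp only: of_nat_eq_iff)
  qed
  have ord: "has_cusp_order (\<lambda>\<tau>. K1 (of_nat N * \<tau>)) (a, b, c, d) (v a c) (int e * (if coprime c' (int N) then int (degree P) else 0))"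
  proof (rule has_cusp_order_subst[OF K1_cusp_order[OF bd'], where g = "nat g" and h = "nat h" and B = B and C = "1 / of_int h ^ 12"])
    fix \<tau> :: complex assume pos: "Im \<tau> > 0"
    define t where "t = (of_nat (nat g) * \<tau> + of_int B) / of_nat (nat h)"
    have hn: "(of_int h :: complex) \<noteq> 0" using h0 by simp
    have "(of_nat (nat g) :: complex) = of_int g" "(of_nat (nat h) :: complex) = of_int h" using gh by (metis of_int_of_nat_eq)+
    then have ht: "of_int h * t = of_int g * \<tau> + of_int B" unfolding t_def using hn by simp
    have i1: "c' * B + d' * h = d" and i2: "a' * B + b' * h = int N * b"
      using bd(1) bd' unfolding B_def h a'_def c' by algebra+
    have s: "of_int h * autf (a', b', c', d') t = autf (a, b, c, d) \<tau>"
    proof -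
      have "of_int h * autf (a', b', c', d') t = of_int c' * (of_int h * t) + of_int (d' * h)" by (simp add: autf_def algebra_simps)
      also have "\<dots> = of_int (g * c') * \<tau> + of_int (c' * B + d' * h)" unfolding ht by (simp add: algebra_simps)
      finally show ?thesis unfolding i1 c'[symmetric] by (simp add: autf_def)
    qed
    have s2: "of_int h * (of_int a' * t + of_int b') = of_nat N * (of_int a * \<tau> + of_int b)"
    proof -
      have "of_int h * (of_int a' * t + of_int b') = of_int a' * (of_int h * t) + of_int (b' * h)" by (simp add: algebra_simps)
      also have "\<dots> = of_int (a' * g) * \<tau> + of_int (a' * B + b' * h)" unfolding ht by (simp add: algebra_simps)
      also have "a' * g = a * int N" unfolding a'_def h by simp
      also have "of_int (a * int N) * \<tau> + of_int (a' * B + b' * h) = of_int a * of_int (int N) * \<tau> + of_int (int N) * of_int b"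
        unfolding i2 by simp
      finally show ?thesis by (simp add: algebra_simps)
    qed
    have m: "moebius_act (a', b', c', d') t = of_nat N * moebius_act (a, b, c, d) \<tau>"
    proof -
      have "moebius_act (a', b', c', d') t = (of_int h * (of_int a' * t + of_int b')) / (of_int h * autf (a', b', c', d') t)"
        using hn by (simp add: autf_def)
      also have "\<dots> = of_nat N * moebius_act (a, b, c, d) \<tau>" unfolding s2 s by (simp add: autf_def)
      finally show ?thesis .
    qed
    show "K1 (of_nat N * moebius_act (a, b, c, d) \<tau>) / autf (a, b, c, d) \<tau> ^ 12 =
        1 / of_int h ^ 12 * (K1 (moebius_act (a', b', c', d') ((of_nat (nat g) * \<tau> + of_int B) / of_nat (nat h))) /
          autf (a', b', c', d') ((of_nat (nat g) * \<tau> + of_int B) / of_nat (nat h)) ^ 12)"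
      unfolding t_def[symmetric] m s[symmetric] by (simp add: power_mult_distrib)
  qed (use g h0 w_pos v_pos e0 width in auto)
  have "c div gcd c (int N) = c'" unfolding g_def[symmetric] using g c' by simp
  moreover have "e = 1" if "coprime c' (int N)"
  proof -
    have "coprime (int N) (c'\<^sup>2)" using that by (simp add: coprime_commute)
    then show ?thesis by (simp add: e_def)
  qed
  ultimately show ?thesis using ord unfolding bd(2) by (auto split: if_splits)
qed

definition K2 :: "complex \<Rightarrow> complex" where "K2 \<tau> = K1 (of_nat N * \<tau>) / f \<tau>"

text \<open>The positive part of the divisor of \<open>f\<close> cancels the order of
  \<open>K1 (N * \<tau>)\<close>; its negative part leaves \<open>N\<close> times the degree of
  \<open>P\<close> at the class of 1/1.\<close>

lemma K2_cusp_order: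
  assumes co: "coprime a c"
  shows "has_cusp_order K2 (cusp_mat a c) (v a c) (ordc a c)"
proof -
  obtain b d where bd: "a * d - b * c = 1" "cusp_mat a c = (a, b, c, d)" using cusp_mat[OF co] by blast
  define n where "n = (if coprime (c div gcd c (int N)) (int N) then int (degree P) else 0)"
  obtain \<Phi> r where \<Phi>: "\<Phi> meromorphic_on {0}" "eventually (\<lambda>z. \<Phi> z \<noteq> 0) (at 0)" "zorder \<Phi> 0 = n"
    and r: "r > 0" "\<And>\<tau>. Im \<tau> > 0 \<Longrightarrow> norm (cusp_q (v a c) \<tau>) < r \<Longrightarrow>
      K1 (of_nat N * moebius_act (cusp_mat a c) \<tau>) / autf (cusp_mat a c) \<tau> ^ 12 = \<Phi> (cusp_q (v a c) \<tau>)"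
    using K1_multiple_order[OF co] unfolding has_cusp_order_def n_def[symmetric] by blast
  obtain r' where r': "r' > 0" "\<And>\<tau>. Im \<tau> > 0 \<Longrightarrow> norm (cusp_q (v a c) \<tau>) < r' \<Longrightarrow> f (moebius_act (cusp_mat a c) \<tau>) = Fe a c (cusp_q (v a c) \<tau>)"
    using function_field_cusp(2)[OF f N2 co] by blast
  have fm: "Fe a c meromorphic_on {0}" by (rule function_field_cusp(1)[OF f N2 co])
  define X where "X = (\<lambda>z. \<Phi> z / Fe a c z)"
  have "X meromorphic_on {0}" unfolding X_def by (intro meromorphic_intros fm \<Phi>)
  moreover have "eventually (\<lambda>z. X z \<noteq> 0) (at 0)" unfolding X_def using \<Phi>(2) Fe_nz[OF co] by eventually_elim simp
  moreover have "zorder X 0 = ordc a c"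
  proof -
    have "zorder X 0 = n - zorder (Fe a c) 0" unfolding X_def \<Phi>(3)[symmetric]
      by (rule zorder_divide[OF \<Phi>(1) eventually_imp_frequently[OF \<Phi>(2)] fm eventually_imp_frequently[OF Fe_nz[OF co]]])
    also have "zorder (Fe a c) 0 = ord_at (N\<^sup>2) f (Cusp a c)" by (simp add: ord_at_def)
    finally show ?thesis unfolding f_cusp[OF co] n_def ordc_def by (auto simp: algebra_simps split: if_splits)
  qed
  moreover have "\<exists>r>0. \<forall>\<tau>. Im \<tau> > 0 \<and> norm (cusp_q (v a c) \<tau>) < r \<longrightarrow>
      K2 (moebius_act (cusp_mat a c) \<tau>) / autf (cusp_mat a c) \<tau> ^ 12 = X (cusp_q (v a c) \<tau>)"
  proof (intro exI[of _ "min r r'"] conjI allI impI; (elim conjE)?)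
    show "min r r' > 0" using r r' by simp
    fix \<tau> assume t: "Im \<tau> > 0" "norm (cusp_q (v a c) \<tau>) < min r r'"
    have lt: "norm (cusp_q (v a c) \<tau>) < r" "norm (cusp_q (v a c) \<tau>) < r'" using t by auto
    show "K2 (moebius_act (cusp_mat a c) \<tau>) / autf (cusp_mat a c) \<tau> ^ 12 = X (cusp_q (v a c) \<tau>)"
      unfolding K2_def X_def r'(2)[OF t(1) lt(2)] r(2)[OF t(1) lt(1), symmetric] by (simp add: mult.commute)
  qed
  ultimately show ?thesis unfolding has_cusp_order_def by blast
qed

lemma multiple_upper_half: "Im \<tau> > 0 \<Longrightarrow> Im (of_nat N * \<tau>) > 0"
  using N by simp

lemma K1_weight12: "weight12 (N\<^sup>2) K1 ordc"
proof (rule weight12I[OF N2 K1_holo K1_nz _ K1_level_square])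
  fix \<gamma> \<tau> assume g: "\<gamma> \<in> Gamma0 (N\<^sup>2)" and pos: "Im \<tau> > 0"
  have "int N dvd int (N\<^sup>2)" by simp
  then have "\<gamma> \<in> Gamma0 N" using g unfolding Gamma0_def by (auto intro: dvd_trans)
  then show "K1 (moebius_act \<gamma> \<tau>) = autf \<gamma> \<tau> ^ 12 * K1 \<tau>" using pos by (rule K1_mod)
qed

lemma K2_weight12: "weight12 (N\<^sup>2) K2 ordc"
proof (rule weight12I[OF N2 _ _ _ K2_cusp_order])
  have "(\<lambda>\<tau>. K1 (of_nat N * \<tau>)) holomorphic_on upper_half"
  proof -
    have "(\<lambda>\<tau>. of_nat N * \<tau>) holomorphic_on upper_half" by (intro holomorphic_intros)
    moreover have "(\<lambda>\<tau>. of_nat N * \<tau>) ` upper_half \<subseteq> upper_half" using multiple_upper_half by (auto simp: upper_half_iff)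
    ultimately show ?thesis using holomorphic_on_compose_gen[OF _ K1_holo] by (simp add: o_def)
  qed
  then show "K2 holomorphic_on upper_half" unfolding K2_def
    by (rule holomorphic_on_divide[OF _ f_holo]) (simp add: upper_half_iff f_regular)
  show "K2 \<tau> \<noteq> 0" if "Im \<tau> > 0" for \<tau>
    unfolding K2_def using K1_nz[OF multiple_upper_half[OF that]] f_regular(2)[OF that] by simp
  fix \<gamma> \<tau> assume g: "\<gamma> \<in> Gamma0 (N\<^sup>2)" and pos: "Im \<tau> > 0"
  obtain a b c d where abcd: "\<gamma> = (a, b, c, d)" by (cases \<gamma>)
  obtain k where k: "c = (int N)\<^sup>2 * k" using g unfolding abcd Gamma0_def by auto
  have det: "a * d - b * c = 1" using g by (simp add: abcd Gamma0_def)
  \<comment> \<open>Conjugation by the diagonal matrix with entries \<open>N\<close> and 1 carries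
    \<open>Gamma0 (N^2)\<close> into \<open>Gamma0 N\<close> and keeps the automorphy
    factor.\<close>
  have g': "(a, b * int N, int N * k, d) \<in> Gamma0 N" using det by (simp add: Gamma0_def k power2_eq_square mult_ac)
  have m: "of_nat N * moebius_act \<gamma> \<tau> = moebius_act (a, b * int N, int N * k, d) (of_nat N * \<tau>)"
    by (simp add: abcd k power2_eq_square algebra_simps)
  have "autf (a, b * int N, int N * k, d) (of_nat N * \<tau>) = autf \<gamma> \<tau>"
    by (simp add: abcd k power2_eq_square autf_def)
  then show "K2 (moebius_act \<gamma> \<tau>) = autf \<gamma> \<tau> ^ 12 * K2 \<tau>"
    unfolding K2_def m K1_mod[OF g' multiple_upper_half[OF pos]] using f_inv[OF g, of \<tau>] pos by (simp add: upper_half_iff)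
qed

end

section \<open>The two functions near infinity\<close>

lemma expansion_infinity:
  assumes f: "f \<in> function_field M" and M: "M > 0" and nz: "eventually (\<lambda>z. expansion M (Cusp 1 0) f z \<noteq> 0) (at 0)"
    and ord: "ord_at M f (Cusp 1 0) = int n"
  shows "\<exists>G r. r > 0 \<and> G holomorphic_on ball 0 r \<and> G 0 \<noteq> 0 \<and>
    (\<forall>\<tau>. Im \<tau> > 0 \<and> norm (to_q \<tau>) < r \<longrightarrow> f \<tau> = G (to_q \<tau>) * to_q \<tau> ^ n)"
proof -
  have co: "coprime (1 :: int) 0" by simp
  define \<Phi> where "\<Phi> = expansion M (Cusp 1 0) f"
  have mero: "\<Phi> meromorphic_on {0}" unfolding \<Phi>_def by (rule function_field_cusp(1)[OF f M co])
  define g where "g = zor_poly \<Phi> 0"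
  have z: "zorder \<Phi> 0 = int n" using ord by (simp add: ord_at_def \<Phi>_def)
  have "g 0 \<noteq> 0 \<and> (\<exists>r. r > 0 \<and> g holomorphic_on cball 0 r \<and> (\<forall>w\<in>cball 0 r - {0}. \<Phi> w = g w * (w - 0) powi zorder \<Phi> 0 \<and> g w \<noteq> 0))"
    unfolding g_def using mero eventually_imp_frequently[OF nz] unfolding meromorphic_at_iff \<Phi>_def by (intro zorder_exist) auto
  then obtain r where g0: "g 0 \<noteq> 0" and r: "r > 0" "g holomorphic_on cball 0 r" "\<And>w. w \<in> cball 0 r - {0} \<Longrightarrow> \<Phi> w = g w * w ^ n"
    using z by auto
  obtain r' where r': "r' > 0" "\<And>\<tau>. Im \<tau> > 0 \<Longrightarrow> norm (to_q \<tau>) < r' \<Longrightarrow> f (moebius_act (cusp_mat 1 0) \<tau>) = \<Phi> (to_q \<tau>)"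
    using function_field_cusp(2)[OF f M co] unfolding cusp_width_infinity[OF M] cusp_q_1 \<Phi>_def by blast
  obtain b where b: "cusp_mat 1 0 = (1, b, 0, 1)" by (rule cusp_mat_infinity)
  have "(1, b, 0, 1) \<in> Gamma0 M" by (simp add: Gamma0_def)
  then have inv: "f (moebius_act (cusp_mat 1 0) \<tau>) = f \<tau>" if "Im \<tau> > 0" for \<tau>
    using f that unfolding function_field_def b by (auto simp: upper_half_iff simp del: moebius_act.simps)
  show ?thesis
  proof (intro exI[of _ g] exI[of _ "min r r'"] conjI allI impI; (elim conjE)?)
    show "min r r' > 0" using r r' by simp
    show "g holomorphic_on ball 0 (min r r')" by (rule holomorphic_on_subset[OF r(2)]) auto
    show "g 0 \<noteq> 0" by fact
    fix \<tau> assume t: "Im \<tau> > 0" "norm (to_q \<tau>) < min r r'"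
    then show "f \<tau> = g (to_q \<tau>) * to_q \<tau> ^ n"
      using r'(2)[of \<tau>] inv[of \<tau>] r(3)[of "to_q \<tau>"] by simp
  qed
qed

lemma powr_inverse_12: "a \<noteq> 0 \<Longrightarrow> (a powr (- 1 / 12)) ^ 12 = 1 / (a :: complex)"
proof -
  assume a: "a \<noteq> 0"
  have "(a powr (- 1 / 12)) ^ 12 = exp (of_nat 12 * (- 1 / 12 * Ln a))" using a unfolding powr_def exp_of_nat_mult by simp
  also have "\<dots> = 1 / a" using a by (simp add: exp_minus inverse_eq_divide)
  finally show ?thesis .
qed

lemma analytic_powr_near_1:
  assumes "g analytic_on {0}" "g 0 = 1"
  shows "(\<lambda>z. g z powr a) analytic_on {0 :: complex}"
  using assms by (intro analytic_intros) auto

context hauptmodul_data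
begin

lemma P_at_0: "poly P 0 \<noteq> 0" by (rule no_common_root[OF Q_0])

text \<open>In the twelfth power the root becomes \<open>P 0 / P (x)\<close> and the hypergeometric
  factor becomes \<open>E4 ^ 3 = j * \<Delta>\<close>; with \<open>j = P (x) / Q (x)\<close> the
  factor \<open>P (x)\<close> cancels. Roots are only taken near 1, where the principal branch is
  analytic.\<close>

lemma h_expansion:
  "\<exists>u r. u analytic_on {0} \<and> u 0 = 1 \<and> r > 0 \<and> (\<forall>\<tau>. Im \<tau> > 0 \<and> norm (to_q \<tau>) < r \<longrightarrow>
     h_fun P Q (x \<tau>) = u (to_q \<tau>) \<and> u (to_q \<tau>) ^ 12 = poly P 0 * K1 \<tau>)"
proof -
  have N0: "N > 0" using N by simp
  have co: "coprime (1 :: int) 0" by simp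
  have nz: "eventually (\<lambda>z. Xe 1 0 z \<noteq> 0) (at 0)" using Xe_nz[OF co] by eventually_elim simp
  have o1: "ord_at N x (Cusp 1 0) = int 1" using x_inf by simp
  obtain G r1 where G: "r1 > 0" "G holomorphic_on ball 0 r1"
    "\<And>\<tau>. Im \<tau> > 0 \<Longrightarrow> norm (to_q \<tau>) < r1 \<Longrightarrow> x \<tau> = G (to_q \<tau>) * to_q \<tau> ^ 1"
    using expansion_infinity[OF x N0 nz o1] by blast
  define X where "X = (\<lambda>z. G z * z)"
  have "G analytic_on {0}" by (rule analytic_on_subset[of _ "ball 0 r1"]) (use G(1,2) in \<open>auto simp: analytic_on_open\<close>)
  then have Xa: "X analytic_on {0}" unfolding X_def by (intro analytic_intros)
  have X0: "X 0 = 0" by (simp add: X_def)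
  have pa: "(\<lambda>z. poly p (X z)) analytic_on {0}" for p by (induction p) (auto intro!: analytic_intros Xa)
  define u where "u = (\<lambda>z. h_fun P Q (X z))"
  have Ba: "(\<lambda>z. 1728 * poly Q (X z) / poly P (X z)) analytic_on {0}"
    by (intro analytic_intros pa) (simp add: X0 P_at_0)
  have "hypF analytic_on {1728 * poly Q (X 0) / poly P (X 0)}"
    unfolding X0 Q_0 using analytic_at_0[OF hypF_holo(1)] by simp
  then have "(\<lambda>z. hypF (1728 * poly Q (X z) / poly P (X z))) analytic_on {0}"
    using analytic_on_compose_gen[OF Ba, of hypF "{1728 * poly Q (X 0) / poly P (X 0)}"] by (simp add: o_def)
  moreover have "(\<lambda>z. (poly P (X z) / poly P 0) powr (- 1 / 12)) analytic_on {0}"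
    by (rule analytic_powr_near_1) (auto intro!: analytic_intros pa simp: P_at_0 X0)
  ultimately have ua: "u analytic_on {0}" unfolding u_def h_fun_def hyp2F1_eq by (intro analytic_on_mult)
  have u0: "u 0 = 1" by (simp add: u_def h_fun_def hyp2F1_eq X0 P_at_0 Q_0 hypF_0)
  obtain r2 where r2: "0 < r2" "r2 < 1" "\<And>q. norm q < r2 \<Longrightarrow> e4 q \<noteq> 0 \<and> norm (jinv_q q) < 1 \<and> hypF (jinv_q q) ^ 4 = e4 q"
    using hypF_e4 by blast
  show ?thesis
  proof (intro exI[of _ u] exI[of _ "min r1 r2"] conjI allI impI ua u0; (elim conjE)?)
    show "min r1 r2 > 0" using G r2 by simp
    fix \<tau> assume t: "Im \<tau> > 0" "norm (to_q \<tau>) < min r1 r2"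
    define q where "q = to_q \<tau>"
    have xq: "x \<tau> = X q" using G(3)[of \<tau>] t by (simp add: X_def q_def)
    then show "h_fun P Q (x \<tau>) = u (to_q \<tau>)" by (simp add: u_def q_def)
    have e4q: "e4 q \<noteq> 0" "hypF (jinv_q q) ^ 4 = e4 q" using r2(3)[of q] t by (auto simp: q_def)
    have d: "delta q \<noteq> 0" using Delta_nonzero[OF t(1)] by (simp add: Delta_def q_def)
    have Qn: "poly Q (X q) \<noteq> 0" using Qx_nz[OF t(1)] xq by simp
    have jq: "e4 q ^ 3 / delta q = poly P (X q) / poly Q (X q)"
      using klein_j_q[OF t(1)] j[OF t(1)] by (simp add: j_q_def q_def[symmetric] xq)
    then have Pn: "poly P (X q) \<noteq> 0" using e4q d by auto
    have e3: "e4 q ^ 3 = poly P (X q) / poly Q (X q) * delta q" using jq d by (simp add: field_simps)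
    have arg: "1728 * poly Q (X q) / poly P (X q) = jinv_q q" unfolding jinv_q_def e3 using d Pn Qn by simp
    have "u q ^ 12 = ((poly P (X q) / poly P 0) powr (- 1 / 12)) ^ 12 * (hypF (jinv_q q) ^ 4) ^ 3"
      unfolding u_def h_fun_def hyp2F1_eq arg power_mult_distrib power_mult[symmetric] by simp
    also have "\<dots> = poly P 0 / poly P (X q) * (poly P (X q) / poly Q (X q) * delta q)"
      unfolding e4q(2) e3 using powr_inverse_12[of "poly P (X q) / poly P 0"] Pn P_at_0 by simp
    also have "\<dots> = poly P 0 * K1 \<tau>" using Pn unfolding K1_def Delta_def xq q_def[symmetric] by simp
    finally show "u (to_q \<tau>) ^ 12 = poly P 0 * K1 \<tau>" by (simp add: q_def)
  qed
qed

end

context divisor_data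
begin

text \<open>The value is taken at \<open>1/N^2\<close>, the expansion at infinity. The matrix
  belonging to \<open>1/N^2\<close> lies in \<open>Gamma0 (N^2)\<close> and the width there is 1, so
  the same series in \<open>to_q\<close> serves both.\<close>

lemma f_expansion:
  "\<exists>G r. r > 0 \<and> G holomorphic_on ball 0 r \<and> G 0 \<noteq> 0 \<and>
    (\<forall>\<tau>. Im \<tau> > 0 \<and> norm (to_q \<tau>) < r \<longrightarrow> f \<tau> = G (to_q \<tau>)) \<and>
    value_at (N\<^sup>2) f (Cusp 1 (int (N\<^sup>2))) = G 0"
proof -
  have co: "coprime (1 :: int) 0" by simp
  have "ord_at (N\<^sup>2) f (Cusp 1 0) = int 0" unfolding f_cusp[OF co] using N by simp
  from expansion_infinity[OF f N2 Fe_nz[OF co] this]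
  obtain G r where G: "r > 0" "G holomorphic_on ball 0 r" "G 0 \<noteq> 0"
    "\<And>\<tau>. Im \<tau> > 0 \<Longrightarrow> norm (to_q \<tau>) < r \<Longrightarrow> f \<tau> = G (to_q \<tau>) * to_q \<tau> ^ 0" by blast
  have fG: "f \<tau> = G (to_q \<tau>)" if "Im \<tau> > 0" "norm (to_q \<tau>) < r" for \<tau> using G(4)[OF that] by simp
  have Ga: "G analytic_on {0}" by (rule analytic_on_subset[of _ "ball 0 r"]) (use G(1,2) in \<open>auto simp: analytic_on_open\<close>)
  let ?c = "int (N\<^sup>2)"
  have co': "coprime 1 ?c" by simp
  obtain b d where bd: "1 * d - b * ?c = 1" "cusp_mat 1 ?c = (1, b, ?c, d)" using cusp_mat[OF co'] by blast
  have g: "cusp_mat 1 ?c \<in> Gamma0 (N\<^sup>2)" unfolding bd(2) Gamma0_def using bd(1) by simp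
  have "gcd ?c (?c\<^sup>2) = ?c" by (simp add: gcd_proj1_if_dvd power2_eq_square)
  then have w1: "cusp_width (N\<^sup>2) 1 ?c = 1" unfolding cusp_width_eq[OF N2] using N by simp
  have "expands_at (N\<^sup>2) f (Cusp 1 ?c) G"
    unfolding expands_at_cusp_iff[OF co'] w1 cusp_q_1
    by (intro exI[of _ r]) (use G(1) fG f_inv[OF g] in \<open>simp add: upper_half_iff\<close>)
  moreover have "Cusp 1 ?c \<in> ext_upper_half" using co' unfolding ext_upper_half_def by blast
  ultimately have "eventually (\<lambda>z. expansion (N\<^sup>2) (Cusp 1 ?c) f z = G z) (at 0)"
    using expansion_props(3)[OF _ N2 analytic_on_imp_meromorphic_on[OF Ga]] by blast
  then have ev: "eventually (\<lambda>z. G z = expansion (N\<^sup>2) (Cusp 1 ?c) f z) (at 0)" by eventually_elim simp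
  have "(G \<longlongrightarrow> G 0) (at 0)" using analytic_at_imp_isCont[OF Ga] by (simp add: isCont_def)
  then have "(expansion (N\<^sup>2) (Cusp 1 ?c) f \<longlongrightarrow> G 0) (at 0)" by (rule Lim_transform_eventually[OF _ ev])
  then have "value_at (N\<^sup>2) f (Cusp 1 ?c) = G 0" unfolding value_at_def by (rule tendsto_Lim[OF at_neq_bot])
  then show ?thesis using G(1-3) fG by blast
qed

theorem cusp_equivalence:
  "cusp_equiv (N\<^sup>2) (\<lambda>\<tau>. h_fun P Q (x \<tau>))
     (\<lambda>\<tau>. (f \<tau> / value_at (N\<^sup>2) f (Cusp 1 (int (N\<^sup>2)))) powr (- 1 / 12) * h_fun P Q (x (of_nat N * \<tau>)))"
proof -
  interpret A: weight12 "N\<^sup>2" K1 ordc by (rule K1_weight12)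
  interpret B: weight12 "N\<^sup>2" K2 ordc by (rule K2_weight12)
  obtain u r where u: "u analytic_on {0}" "u 0 = 1" "r > 0"
    and ur: "\<And>\<tau>. Im \<tau> > 0 \<Longrightarrow> norm (to_q \<tau>) < r \<Longrightarrow> h_fun P Q (x \<tau>) = u (to_q \<tau>) \<and> u (to_q \<tau>) ^ 12 = poly P 0 * K1 \<tau>"
    using h_expansion by blast
  obtain G r' where G: "r' > 0" "G holomorphic_on ball 0 r'" "G 0 \<noteq> 0"
    "\<And>\<tau>. Im \<tau> > 0 \<Longrightarrow> norm (to_q \<tau>) < r' \<Longrightarrow> f \<tau> = G (to_q \<tau>)"
    and val: "value_at (N\<^sup>2) f (Cusp 1 (int (N\<^sup>2))) = G 0"
    using f_expansion by blast
  have Ga: "G analytic_on {0}" by (rule analytic_on_subset[of _ "ball 0 r'"]) (use G(1,2) in \<open>auto simp: analytic_on_open\<close>)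
  \<comment> \<open>The expansion of the second function: replacing \<open>\<tau>\<close> by
    \<open>N * \<tau>\<close> raises \<open>to_q\<close> to the power \<open>N\<close>.\<close>
  define v2 where "v2 = (\<lambda>z. (G z / G 0) powr (- 1 / 12) * u (z ^ N))"
  have N0: "N > 0" using N by simp
  have "(\<lambda>z. u (z ^ N)) analytic_on {0}"
  proof -
    have "(\<lambda>z::complex. z ^ N) analytic_on {0}" by (intro analytic_intros)
    from analytic_on_compose_gen[OF this u(1)] show ?thesis using N0 by (simp add: o_def zero_power)
  qed
  moreover have "(\<lambda>z. (G z / G 0) powr (- 1 / 12)) analytic_on {0}"
    by (rule analytic_powr_near_1) (auto intro!: analytic_intros Ga simp: G(3))
  ultimately have v2a: "v2 analytic_on {0}" unfolding v2_def by (intro analytic_on_mult)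
  have v20: "v2 0 = 1" using N0 G(3) u(2) by (simp add: v2_def zero_power)
  have v2: "(f \<tau> / G 0) powr (- 1 / 12) * h_fun P Q (x (of_nat N * \<tau>)) = v2 (to_q \<tau>) \<and> v2 (to_q \<tau>) ^ 12 = (G 0 * poly P 0) * K2 \<tau>"
    if t: "Im \<tau> > 0" "norm (to_q \<tau>) < min r r'" for \<tau>
  proof -
    have "norm (to_q (of_nat N * \<tau>)) = norm (to_q \<tau>) ^ N" by (simp add: to_q_mult_nat norm_power)
    also have "\<dots> \<le> norm (to_q \<tau>) ^ 1" by (rule power_decreasing) (use N0 to_q_in_ball[OF t(1)] in auto)
    finally have "norm (to_q (of_nat N * \<tau>)) < r" using t by simp
    from ur[OF multiple_upper_half[OF t(1)] this]
    have h: "h_fun P Q (x (of_nat N * \<tau>)) = u (to_q \<tau> ^ N)" "u (to_q \<tau> ^ N) ^ 12 = poly P 0 * K1 (of_nat N * \<tau>)"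
      by (simp_all add: to_q_mult_nat)
    have fG: "f \<tau> = G (to_q \<tau>)" using G(4) t by simp
    have fn: "f \<tau> \<noteq> 0" by (rule f_regular(2)[OF t(1)])
    have "v2 (to_q \<tau>) ^ 12 = 1 / (f \<tau> / G 0) * (poly P 0 * K1 (of_nat N * \<tau>))"
      unfolding v2_def power_mult_distrib h(2) fG[symmetric] using powr_inverse_12[of "f \<tau> / G 0"] fn G(3) by simp
    then show ?thesis using h(1) by (simp add: v2_def fG[symmetric] K2_def)
  qed
  have "unique_normalized_solution (N\<^sup>2) A.L (\<lambda>\<tau>. h_fun P Q (x \<tau>))"
    using ur by (rule A.unique_normalized[OF u(1,2) P_at_0 u(3)])
  moreover have "unique_normalized_solution (N\<^sup>2) B.L (\<lambda>\<tau>. (f \<tau> / G 0) powr (- 1 / 12) * h_fun P Q (x (of_nat N * \<tau>)))"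
  proof -
    have C: "G 0 * poly P 0 \<noteq> 0" and rr: "min r r' > 0" using G P_at_0 u by auto
    show ?thesis using v2 by (rule B.unique_normalized[OF v2a v20 C rr])
  qed
  moreover have "exponents (N\<^sup>2) A.L p = exponents (N\<^sup>2) B.L p" if p: "p \<in> ext_upper_half" for p
  proof (cases p)
    case (Inner \<tau>)
    then have "Im \<tau> > 0" using p by (auto simp: ext_upper_half_def upper_half_iff)
    then show ?thesis unfolding Inner using A.exponents_inner B.exponents_inner by simp
  next
    case (Cusp a c)
    then have "coprime a c" using p by (auto simp: ext_upper_half_def)
    then show ?thesis unfolding Cusp using A.exponents_cusp B.exponents_cusp by simp
  qed
  ultimately show ?thesis unfolding cusp_equiv_def val using A.uniformizing_L B.uniformizing_L by blast
qed

end

theorem theorem5p3: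
  fixes N :: nat and x f :: "complex \<Rightarrow> complex" and P Q :: "complex poly"
  assumes "N > 1"
    and "genus_X0 N = 0"
    and "is_hauptmodul N x"
    and "ord_at N x (Cusp 1 0) = 1"
    and "ord_at N x (Cusp 0 1) = - 1"
    and "coprime P Q" and "lead_coeff P = 1" and "lead_coeff Q = 1"
    and "degree P = dedekind_psi N"
    and "[:0, 1:] dvd Q"
    and "\<forall>\<tau>\<in>upper_half. klein_j \<tau> = poly P (x \<tau>) / poly Q (x \<tau>)"
    and "f \<in> function_field (N\<^sup>2)"
    and "has_divisor (N\<^sup>2) f (\<lambda>p. int (dedekind_psi N) *
           (\<Sum>d | d dvd N. \<Sum>C\<in>cusps_with_denom (N\<^sup>2) d.
              point_divisor C p - point_divisor (X0_class (N\<^sup>2) (Cusp 1 1)) p))"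
  shows "cusp_equiv (N\<^sup>2)
           (\<lambda>\<tau>. h_fun P Q (x \<tau>))
           (\<lambda>\<tau>. (f \<tau> / value_at (N\<^sup>2) f (Cusp 1 (int (N\<^sup>2)))) powr (- 1 / 12) *
                h_fun P Q (x (of_nat N * \<tau>)))"
proof -
  have N0: "N > 0" using assms(1) by simp
  note dv = assms(13)[unfolded has_divisor_def]
  interpret divisor_data N x P Q f
  proof (unfold_locales, goal_cases)
    case 2 show ?case using assms(3) by (simp add: is_hauptmodul_def)
  next
    case (9 \<tau>) then show ?case using assms(11) by (simp add: upper_half_iff)
  next
    case 11 then show ?case using dv by simp
  next
    case (12 \<tau>)
    then have "Inner \<tau> \<in> ext_upper_half" by (auto simp: ext_upper_half_def upper_half_iff)
    then show ?case using dv divisor_inner[of N \<tau>] by simp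
  next
    case (13 a c)
    then have "Cusp a c \<in> ext_upper_half" by (auto simp: ext_upper_half_def)
    \<comment> \<open>Here \<open>dedekind_psi N\<close> is exchanged for the degree of
      \<open>P\<close>, in which the orders of \<open>K1\<close> are expressed.\<close>
    then show ?case using dv divisor_cusp[OF N0 13] assms(9) by simp
  qed (use assms in auto)
  show ?thesis by (rule cusp_equivalence)
qed

end
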